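(* Let $N\ge 1$ be an integer, let $v,w$ be submultiplicative weights on $\mathbb{R}^{2d}$ and assume: (H1) Weights: $m\in\mathcal{M}_v$, $\mu\in\mathcal{M}_w$. (H2) Windows: $\varphi_1,\varphi_4\in M^1_{vw(\langle\cdot\rangle^N\otimes\langle\cdot\rangle^N)}(\mathbb{R}^d)$ and $\varphi_2,\varphi_3\in M^1_w(\mathbb{R}^d)$. (H3) Symbols: $a\in L^\infty_{1/m}(\mathbb{R}^{2d})$ and $\partial^\alpha b\in L^\infty_m(\mathbb{R}^{2d})$ for all multi-indices $\alpha\in\mathbb{Z}_{\ge0}^{2d}$ with $|\alpha|\le N$. For $\alpha=(\alpha_1,\alpha_2)$ with $\alpha_1,\alpha_2\in\mathbb{Z}_{\ge 0}^d$ define $$\Phi_\alpha=\frac{1}{(2\pi i)^{|\alpha_2|}}\sum_{\beta=(\beta_1,\beta_2)\le\alpha}\binom{\alpha}{\beta}(-1)^{|\beta_1|}\,\langle\varphi_3,X^{\alpha_1-\beta_1}\partial^{\alpha_2-\beta_2}\varphi_4\rangle\,X^{\beta_1}\partial^{\beta_2}\varphi_1 ,$$ and let $$E_Nf=\int_{\mathbb{R}^{2d}}\int_{\mathbb{R}^{2d}}a(y)\,b_N(y,z)\,V_{\varphi_3}f(z)\,\langle\pi(z)\varphi_4,\pi(y)\varphi_1\rangle\,\pi(y)\varphi_2\,dz\,dy,$$ $$b_N(y,z)=N\sum_{|\alpha|=N}\int_0^1(1-t)^{N-1}\,\partial^\alpha b(y+t(z-y))\,dt\;\frac{(z-y)^\alpha}{\alpha!}.$$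 Then: (i) For $|\alpha|<N$ the window $\Phi_\alpha$ belongs to $M^1_{vw}(\mathbb{R}^d)$. (ii) For all $1\le p,q\le\infty$, the operator $A_a^{\varphi_1,\varphi_2}A_b^{\varphi_3,\varphi_4}$, the operators $A^{\Phi_\alpha,\varphi_2}_{a\,\partial^\alpha b}$ ($|\alpha|<N$) and $E_N$ are all bounded from $M^{p,q}_\mu(\mathbb{R}^d)$ to $M^{p,q}_\mu(\mathbb{R}^d)$, and $$A_a^{\varphi_1,\varphi_2}A_b^{\varphi_3,\varphi_4}=\sum_{|\alpha|=0}^{N-1}\frac{(-1)^{|\alpha|}}{\alpha!}\,A^{\Phi_\alpha,\varphi_2}_{a\,\partial^\alpha b}+E_N$$ is valid as an identity of operators on $M^{p,q}_\mu(\mathbb{R}^d)$. (iii) If, in addition, $(\partial^\alpha b)\,m\in L^0(\mathbb{R}^{2d})$ for all $\alpha$ with $|\alpha|=N$, then the remainder $E_N$ is compact on $M^{p,q}_\mu(\mathbb{R}^d)$.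
   Context: Weights. A submultiplicative weight is a continuous, positive, even function $v$ on $\mathbb{R}^{2d}$ with $v(0)=1$, $v(z_1+z_2)\le v(z_1)v(z_2)$, which moreover satisfies the GRS-condition $\lim_{n\to\infty}v(nz)^{1/n}=1$ for all $z$, and $\int_0^1v(tz)\,dt\le C\,v(z)$ for a constant $C$. For such $v$, $\mathcal{M}_v$ is the set of positive even weight functions $m$ on $\mathbb{R}^{2d}$ such that $m(z_1+z_2)\le C\,v(z_1)m(z_2)$ for all $z_1,z_2$ and some constant $C$. Put $\langle z\rangle=(1+|z|^2)^{1/2}$; $\langle\cdot\rangle^N\otimes\langle\cdot\rangle^N$ is the weight $(x,\omega)\mapsto\langle x\rangle^N\langle\omega\rangle^N$ on $\mathbb{R}^{2d}$. Time-frequency notation. For $z=(x,\omega)\in\mathbb{R}^{2d}$, $\pi(z)f(t)=M_\omega T_xf(t)=e^{2\pi i\omega t}f(t-x)$. The short-time Fourier transform is $V_gf(z)=\langle f,\pi(z)g\rangle$, where $\langle\cdot,\cdot\rangle$ is the bracket extending the inner product $\int f\bar g$ (linear in the first argument) by duality. $X^\beta$ denotes multiplication by $t^\beta$. Function spaces. $\|F\|_{L^{p,q}_m}=\big(\int_{\mathbb{R}^d}(\int_{\mathbb{R}^d}|F(x,\omega)|^pm(x,\omega)^p\,dx)^{q/p}d\omega\big)^{1/q}$ (usual modification if $p$ or $q$ is $\infty$); $L^\infty_m=\{F: Fm\in L^\infty(\mathbb{R}^{2d})\}$. $L^0(\mathbb{R}^{2d})$ is the space of $F\in L^\infty(\mathbb{R}^{2d})$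 vanishing at infinity: for every $\varepsilon>0$ there is $R>0$ with $|F(z)|<\varepsilon$ for a.a. $|z|>R$. Partial derivatives of symbols are in the sense of distributions; $\partial^\alpha b\in L^\infty_m$ means that $\partial^\alpha b$ is a function in that space. Modulation spaces: let $\varphi_0(t)=e^{-\pi t^2}$ and $\mathcal{S}_{\mathcal{C}}=\mathrm{span}\{\pi(z)\varphi_0:z\in\mathbb{R}^{2d}\}$. For $m\in\mathcal{M}_v$ and $1\le p,q\le\infty$ put $\|f\|_{M^{p,q}_m}=\|V_{\varphi_0}f\|_{L^{p,q}_m}$; $M^{p,q}_m(\mathbb{R}^d)$ is the completion of $\mathcal{S}_{\mathcal{C}}$ in this norm if $p,q<\infty$, and the completion of $\mathcal{S}_{\mathcal{C}}$ in the $\sigma(\mathcal{S}_{\mathcal{C}},\mathcal{S}_{\mathcal{C}})$-topology if $p=\infty$ or $q=\infty$. (Equivalently, $M^\infty_{1/v}$ is the antidual of $M^1_v$, and $M^{p,q}_m$ consists of the $f\in M^\infty_{1/v}$ with $V_{\varphi_0}f\in L^{p,q}_m$.) $M^p_m=M^{p,p}_m$. Localization operators. For a symbol $a$ on $\mathbb{R}^{2d}$ and windows $\varphi,\psi$ on $\mathbb{R}^d$, $A_a^{\varphi,\psi}f=\int_{\mathbb{R}^{2d}}a(z)\,V_\varphi f(z)\,\pi(z)\psi\,dz$, understood weakly: $\langle A_a^{\varphi,\psi}f,g\rangle=\langle a\,V_\varphi f,V_\psi g\rangle$. The vector-valued integral defining $E_N$ is likewise understood weakly.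
   Formalization: The prefactor of Φ_α is taken as 1/(-2πi)^{|α_2|} instead of the printed 1/(2πi)^{|α_2|}; with the printed sign the identity in (ii) fails for N≥2, e.g. d=1, N=2, b(x,ω)=ω, a(z)=e^{-|z|^2} and Gaussian windows. *)

theory Defs
  imports "HOL-Probability.Essential_Supremum"
begin

text \<open>
  \<open>\<real>\<^sup>d\<close> is an arbitrary type \<open>'a\<close> of class euclidean space, and phase space \<open>\<real>\<^sup>2\<^sup>d\<close> is
  \<open>'a \<times> 'a\<close>, whose points are \<open>z = (x, \<omega>)\<close>.  ``Measurable'' always means Lebesgue measurable.
\<close>

subsection \<open>Multi-indices and partial derivatives\<close>

text \<open>
  A multi-index is a function on the standard basis, extended by 0.  A multi-index on \<open>'a \<times> 'a\<close> is
  therefore a pair \<open>(\<alpha>\<^sub>1, \<alpha>\<^sub>2)\<close> of multi-indices on \<open>'a\<close>, recovered by \<open>mi_fst\<close> and \<open>mi_snd\<close>.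
\<close>

definition multi_index :: "('a::euclidean_space \<Rightarrow> nat) \<Rightarrow> bool" where
  "multi_index \<alpha> \<longleftrightarrow> (\<forall>b. b \<notin> Basis \<longrightarrow> \<alpha> b = 0)"

definition mi_deg :: "('a::euclidean_space \<Rightarrow> nat) \<Rightarrow> nat" where
  "mi_deg \<alpha> = (\<Sum>b\<in>Basis. \<alpha> b)"

definition mi_fact :: "('a::euclidean_space \<Rightarrow> nat) \<Rightarrow> nat" where
  "mi_fact \<alpha> = (\<Prod>b\<in>Basis. fact (\<alpha> b))"

definition mi_choose :: "('a::euclidean_space \<Rightarrow> nat) \<Rightarrow> ('a \<Rightarrow> nat) \<Rightarrow> nat" where
  "mi_choose \<alpha> \<beta> = (\<Prod>b\<in>Basis. \<alpha> b choose \<beta> b)"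

definition monomial :: "('a::euclidean_space \<Rightarrow> nat) \<Rightarrow> 'a \<Rightarrow> real" where
  "monomial \<alpha> x = (\<Prod>b\<in>Basis. (x \<bullet> b) ^ \<alpha> b)"

definition mi_fst :: "('a::euclidean_space \<times> 'a \<Rightarrow> nat) \<Rightarrow> 'a \<Rightarrow> nat" where
  "mi_fst \<alpha> b = \<alpha> (b, 0)"

definition mi_snd :: "('a::euclidean_space \<times> 'a \<Rightarrow> nat) \<Rightarrow> 'a \<Rightarrow> nat" where
  "mi_snd \<alpha> b = \<alpha> (0, b)"

definition partial_deriv :: "'a::euclidean_space \<Rightarrow> ('a \<Rightarrow> complex) \<Rightarrow> 'a \<Rightarrow> complex" where
  "partial_deriv b f x = frechet_derivative f (at x) b"

text \<open>
  The classical derivative \<open>\<partial>\<^sup>\<alpha> f\<close>.  It is only used for functions of class \<open>C\<^sup>|\<^sup>\<alpha>\<^sup>|\<close>, for which the order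
  in which the partial derivatives are taken is immaterial; an arbitrary enumeration of the basis
  fixes it.
\<close>

definition basis_list :: "'a::euclidean_space list" where
  "basis_list = (SOME bs. distinct bs \<and> set bs = Basis)"

definition mi_deriv :: "('a::euclidean_space \<Rightarrow> nat) \<Rightarrow> ('a \<Rightarrow> complex) \<Rightarrow> 'a \<Rightarrow> complex" where
  "mi_deriv \<alpha> f = foldr (\<lambda>b. partial_deriv b ^^ \<alpha> b) basis_list f"

primrec C_class :: "nat \<Rightarrow> ('a::euclidean_space \<Rightarrow> complex) \<Rightarrow> bool" where
  "C_class 0 f \<longleftrightarrow> continuous_on UNIV f"
| "C_class (Suc k) f \<longleftrightarrow>
     (\<forall>x. f differentiable (at x)) \<and> (\<forall>b\<in>Basis. C_class k (partial_deriv b f))"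

definition test_function :: "('a::euclidean_space \<Rightarrow> complex) \<Rightarrow> bool" where
  "test_function \<eta> \<longleftrightarrow> (\<forall>k. C_class k \<eta>) \<and> (\<exists>K. compact K \<and> (\<forall>x. x \<notin> K \<longrightarrow> \<eta> x = 0))"

definition locally_integrable :: "('a::euclidean_space \<Rightarrow> complex) \<Rightarrow> bool" where
  "locally_integrable f \<longleftrightarrow> (\<forall>K. compact K \<longrightarrow> set_integrable lebesgue K f)"

text \<open>\<open>h\<close> is a function representing the distributional derivative \<open>\<partial>\<^sup>\<alpha> f\<close>.\<close>

definition distr_deriv ::
  "('a::euclidean_space \<Rightarrow> nat) \<Rightarrow> ('a \<Rightarrow> complex) \<Rightarrow> ('a \<Rightarrow> complex) \<Rightarrow> bool" where
  "distr_deriv \<alpha> f h \<longleftrightarrow> locally_integrable f \<and> locally_integrable h \<and>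
     (\<forall>\<eta>. test_function \<eta> \<longrightarrow>
        (LINT x|lebesgue. h x * \<eta> x) = (-1) ^ mi_deg \<alpha> * (LINT x|lebesgue. f x * mi_deriv \<alpha> \<eta> x))"

subsection \<open>Weights\<close>

definition submult_weight :: "('a::euclidean_space \<times> 'a \<Rightarrow> real) \<Rightarrow> bool" where
  "submult_weight v \<longleftrightarrow>
     continuous_on UNIV v \<and> (\<forall>z. 0 < v z) \<and> (\<forall>z. v (- z) = v z) \<and> v 0 = 1 \<and>
     (\<forall>z1 z2. v (z1 + z2) \<le> v z1 * v z2) \<and>
     (\<forall>z. (\<lambda>n::nat. v (real n *\<^sub>R z) powr (1 / real n)) \<longlonglongrightarrow> 1) \<and>
     (\<exists>C. \<forall>z. integral {0..1} (\<lambda>t. v (t *\<^sub>R z)) \<le> C * v z)"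

definition moderate_weights ::
  "('a::euclidean_space \<times> 'a \<Rightarrow> real) \<Rightarrow> ('a \<times> 'a \<Rightarrow> real) set" where
  "moderate_weights v =
     {m. m \<in> borel_measurable lebesgue \<and> (\<forall>z. 0 < m z) \<and> (\<forall>z. m (- z) = m z) \<and>
         (\<exists>C. \<forall>z1 z2. m (z1 + z2) \<le> C * v z1 * m z2)}"

definition jbracket :: "'a::euclidean_space \<Rightarrow> real" where
  "jbracket x = sqrt (1 + (norm x)\<^sup>2)"

subsection \<open>Weighted mixed-norm spaces\<close>

definition ennreal_powr :: "ennreal \<Rightarrow> real \<Rightarrow> ennreal" where
  "ennreal_powr x r = (if x = \<infinity> then \<infinity> else ennreal (enn2real x powr r))"

text \<open>The \<open>L\<^sup>p\<close>-norm of a nonnegative function, for \<open>1 \<le> p \<le> \<infinity>\<close>.\<close>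

definition Lp_norm :: "ennreal \<Rightarrow> ('a::euclidean_space \<Rightarrow> ennreal) \<Rightarrow> ennreal" where
  "Lp_norm p f =
     (if p = \<infinity> then esssup lebesgue f
      else ennreal_powr (\<integral>\<^sup>+ x. ennreal_powr (f x) (enn2real p) \<partial>lebesgue) (1 / enn2real p))"

definition Lpq_norm ::
  "ennreal \<Rightarrow> ennreal \<Rightarrow> ('a::euclidean_space \<times> 'a \<Rightarrow> real) \<Rightarrow> ('a \<times> 'a \<Rightarrow> complex) \<Rightarrow> ennreal" where
  "Lpq_norm p q m F =
     Lp_norm q (\<lambda>\<omega>. Lp_norm p (\<lambda>x. ennreal (cmod (F (x, \<omega>)) * m (x, \<omega>))))"

definition Lpq ::
  "ennreal \<Rightarrow> ennreal \<Rightarrow> ('a::euclidean_space \<times> 'a \<Rightarrow> real) \<Rightarrow> ('a \<times> 'a \<Rightarrow> complex) set" where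
  "Lpq p q m = {F. F \<in> borel_measurable lebesgue \<and> Lpq_norm p q m F < \<infinity>}"

definition Linf :: "('a::euclidean_space \<times> 'a \<Rightarrow> real) \<Rightarrow> ('a \<times> 'a \<Rightarrow> complex) set" where
  "Linf m = {F. F \<in> borel_measurable lebesgue \<and>
                (\<exists>C. AE z in lebesgue. cmod (F z * of_real (m z)) \<le> C)}"

definition L0 :: "('a::euclidean_space \<times> 'a \<Rightarrow> complex) set" where
  "L0 = {F \<in> Linf (\<lambda>_. 1).
           \<forall>\<epsilon>>0. \<exists>R>0. AE z in lebesgue. norm z > R \<longrightarrow> cmod (F z) < \<epsilon>}"

subsection \<open>Time-frequency shifts and the short-time Fourier transform\<close>

definition tf_shift :: "'a::euclidean_space \<times> 'a \<Rightarrow> ('a \<Rightarrow> complex) \<Rightarrow> 'a \<Rightarrow> complex" where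
  "tf_shift z f t = exp (2 * of_real pi * \<i> * of_real (snd z \<bullet> t)) * f (t - fst z)"

definition bracket :: "('a::euclidean_space \<Rightarrow> complex) \<Rightarrow> ('a \<Rightarrow> complex) \<Rightarrow> complex" where
  "bracket f g = (LINT t|lebesgue. f t * cnj (g t))"

text \<open>
  A generalized function is represented by the antilinear functional \<open>g \<mapsto> \<langle>f, g\<rangle>\<close>; a function \<open>f\<close>
  is identified with \<open>bracket f\<close>.
\<close>

type_synonym 'a functional = "('a \<Rightarrow> complex) \<Rightarrow> complex"

definition stft ::
  "('a::euclidean_space \<Rightarrow> complex) \<Rightarrow> 'a functional \<Rightarrow> 'a \<times> 'a \<Rightarrow> complex" where
  "stft g f z = f (tf_shift z g)"

subsection \<open>Modulation spaces\<close>

definition gaussian :: "'a::euclidean_space \<Rightarrow> complex" where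
  "gaussian t = of_real (exp (- pi * (norm t)\<^sup>2))"

definition gauss_span :: "('a::euclidean_space \<Rightarrow> complex) set" where
  "gauss_span = {\<lambda>t. \<Sum>z\<in>Z. c z * tf_shift z gaussian t | Z c. finite Z}"

definition mod_norm ::
  "ennreal \<Rightarrow> ennreal \<Rightarrow> ('a::euclidean_space \<times> 'a \<Rightarrow> real) \<Rightarrow> 'a functional \<Rightarrow> ennreal" where
  "mod_norm p q m f = Lpq_norm p q m (stft gaussian f)"

text \<open>
  The completion \<open>M\<^sup>1\<^sub>v\<close> of the Gaussian span, realized as a space of continuous square-integrable
  functions.  This realization is the completion as soon as \<open>v\<close> is bounded away from 0, since then
  the \<open>M\<^sup>1\<^sub>v\<close>-norm dominates the \<open>L\<^sup>2\<close>-norm and the supremum norm.  Square-integrability guarantees that the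
  brackets with Gaussians are convergent integrals; continuity selects one representative.
\<close>

definition M1 :: "('a::euclidean_space \<times> 'a \<Rightarrow> real) \<Rightarrow> ('a \<Rightarrow> complex) set" where
  "M1 v = {f. continuous_on UNIV f \<and> integrable lebesgue (\<lambda>t. (cmod (f t))\<^sup>2) \<and>
              (\<exists>s. (\<forall>n::nat. s n \<in> gauss_span) \<and>
                   (\<lambda>n. mod_norm 1 1 v (bracket (\<lambda>t. f t - s n t))) \<longlonglongrightarrow> 0)}"

text \<open>
  \<open>M\<^sup>\<infinity>\<^bsub>1/v\<^esub>\<close>, the antidual of \<open>M\<^sup>1\<^sub>v\<close>.  Only the values of a functional on \<open>M1 v\<close> are meaningful:
  two functionals are the same element if they agree there.
\<close>

definition M1_antidual :: "('a::euclidean_space \<times> 'a \<Rightarrow> real) \<Rightarrow> 'a functional set" where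
  "M1_antidual v =
     {F. (\<forall>f\<in>M1 v. \<forall>g\<in>M1 v. \<forall>c. F (\<lambda>t. c * f t + g t) = cnj c * F f + F g) \<and>
         (\<exists>C::real. \<forall>g\<in>M1 v. ennreal (cmod (F g)) \<le> ennreal C * mod_norm 1 1 v (bracket g))}"

text \<open>\<open>M\<^sup>p\<^sup>,\<^sup>q\<^sub>m\<close> for \<open>m \<in> moderate_weights v\<close>.\<close>

definition Mpq ::
  "('a::euclidean_space \<times> 'a \<Rightarrow> real) \<Rightarrow> ennreal \<Rightarrow> ennreal \<Rightarrow> ('a \<times> 'a \<Rightarrow> real) \<Rightarrow> 'a functional set" where
  "Mpq v p q m = {f \<in> M1_antidual v. stft gaussian f \<in> Lpq p q m}"

definition bounded_on_Mpq ::
  "('a::euclidean_space \<times> 'a \<Rightarrow> real) \<Rightarrow> ennreal \<Rightarrow> ennreal \<Rightarrow> ('a \<times> 'a \<Rightarrow> real) \<Rightarrow>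
   ('a functional \<Rightarrow> 'a functional) \<Rightarrow> bool" where
  "bounded_on_Mpq v p q m A \<longleftrightarrow>
     (\<forall>f\<in>Mpq v p q m. \<forall>g\<in>Mpq v p q m. \<forall>c. \<forall>h\<in>M1 v.
        A (\<lambda>k. c * f k + g k) h = c * A f h + A g h) \<and>
     (\<exists>C::real. \<forall>f\<in>Mpq v p q m.
        A f \<in> Mpq v p q m \<and> mod_norm p q m (A f) \<le> ennreal C * mod_norm p q m f)"

definition compact_on_Mpq ::
  "('a::euclidean_space \<times> 'a \<Rightarrow> real) \<Rightarrow> ennreal \<Rightarrow> ennreal \<Rightarrow> ('a \<times> 'a \<Rightarrow> real) \<Rightarrow>
   ('a functional \<Rightarrow> 'a functional) \<Rightarrow> bool" where
  "compact_on_Mpq v p q m A \<longleftrightarrow>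
     bounded_on_Mpq v p q m A \<and>
     (\<forall>f. (\<forall>n::nat. f n \<in> Mpq v p q m \<and> mod_norm p q m (f n) \<le> 1) \<longrightarrow>
        (\<exists>r g. strict_mono r \<and> g \<in> Mpq v p q m \<and>
               (\<lambda>n. mod_norm p q m (\<lambda>h. A (f (r n)) h - g h)) \<longlonglongrightarrow> 0))"

subsection \<open>Localization operators\<close>

definition loc_op ::
  "('a::euclidean_space \<times> 'a \<Rightarrow> complex) \<Rightarrow> ('a \<Rightarrow> complex) \<Rightarrow> ('a \<Rightarrow> complex) \<Rightarrow>
   'a functional \<Rightarrow> 'a functional" where
  "loc_op a \<phi> \<psi> f =
     (\<lambda>g. LINT z|lebesgue. a z * stft \<phi> f z * cnj (stft \<psi> (bracket g) z))"

definition mono_deriv ::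
  "('a::euclidean_space \<Rightarrow> nat) \<Rightarrow> ('a \<Rightarrow> nat) \<Rightarrow> ('a \<Rightarrow> complex) \<Rightarrow> 'a \<Rightarrow> complex" where
  "mono_deriv \<gamma> \<delta> \<phi> t = of_real (monomial \<gamma> t) * mi_deriv \<delta> \<phi> t"

text \<open>
  The windows \<open>\<Phi>\<^sub>\<alpha>\<close>, for which
  \<open>(-1)\<^sup>|\<^sup>\<alpha>\<^sup>| \<Phi>\<^sub>\<alpha> = \<integral> z\<^sup>\<alpha> \<langle>\<phi>\<^sub>1, \<pi>(z)\<phi>\<^sub>4\<rangle> \<pi>(z)\<phi>\<^sub>3 dz\<close>.
  The prefactor is \<open>(-2\<pi>i)\<close> to the power \<open>-|\<alpha>\<^sub>2|\<close>.  With \<open>2\<pi>i\<close> in place of \<open>-2\<pi>i\<close> this identity, and with it the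
  expansion of the product of two localization operators, has the wrong sign for odd \<open>|\<alpha>\<^sub>2|\<close>: for
  \<open>d = 1\<close>, \<open>\<alpha> = (0, 1)\<close> and Gaussian windows the integral is \<open>(2\<pi>i)\<^sup>-\<^sup>1 \<parallel>\<phi>\<^sub>0\<parallel>\<^sup>2 \<phi>\<^sub>0'\<close>.
\<close>

definition Phi ::
  "('a::euclidean_space \<Rightarrow> complex) \<Rightarrow> ('a \<Rightarrow> complex) \<Rightarrow> ('a \<Rightarrow> complex) \<Rightarrow>
   ('a \<times> 'a \<Rightarrow> nat) \<Rightarrow> 'a \<Rightarrow> complex" where
  "Phi \<phi>1 \<phi>3 \<phi>4 \<alpha> t =
     1 / (- 2 * of_real pi * \<i>) ^ mi_deg (mi_snd \<alpha>) *
     (\<Sum>\<beta> | multi_index \<beta> \<and> \<beta> \<le> \<alpha>.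
        of_nat (mi_choose \<alpha> \<beta>) * (-1) ^ mi_deg (mi_fst \<beta>) *
        bracket \<phi>3 (mono_deriv (\<lambda>b. mi_fst \<alpha> b - mi_fst \<beta> b) (\<lambda>b. mi_snd \<alpha> b - mi_snd \<beta> b) \<phi>4) *
        mono_deriv (mi_fst \<beta>) (mi_snd \<beta>) \<phi>1 t)"

text \<open>In the next two definitions \<open>Db \<alpha>\<close> stands for \<open>\<partial>\<^sup>\<alpha> b\<close>.\<close>

definition taylor_kernel ::
  "nat \<Rightarrow> (('a::euclidean_space \<times> 'a \<Rightarrow> nat) \<Rightarrow> 'a \<times> 'a \<Rightarrow> complex) \<Rightarrow>
   'a \<times> 'a \<Rightarrow> 'a \<times> 'a \<Rightarrow> complex" where
  "taylor_kernel N Db y z =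
     of_nat N *
     (\<Sum>\<alpha> | multi_index \<alpha> \<and> mi_deg \<alpha> = N.
        (LINT t:{0..1}|lebesgue. of_real ((1 - t) ^ (N - 1)) * Db \<alpha> (y + t *\<^sub>R (z - y))) *
        of_real (monomial \<alpha> (z - y) / of_nat (mi_fact \<alpha>)))"

definition remainder_op ::
  "nat \<Rightarrow> ('a::euclidean_space \<times> 'a \<Rightarrow> complex) \<Rightarrow>
   (('a \<times> 'a \<Rightarrow> nat) \<Rightarrow> 'a \<times> 'a \<Rightarrow> complex) \<Rightarrow>
   ('a \<Rightarrow> complex) \<Rightarrow> ('a \<Rightarrow> complex) \<Rightarrow> ('a \<Rightarrow> complex) \<Rightarrow> ('a \<Rightarrow> complex) \<Rightarrow>
   'a functional \<Rightarrow> 'a functional" where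
  "remainder_op N a Db \<phi>1 \<phi>2 \<phi>3 \<phi>4 f =
     (\<lambda>g. LINT y|lebesgue. LINT z|lebesgue.
        a y * taylor_kernel N Db y z * stft \<phi>3 f z *
        bracket (tf_shift z \<phi>4) (tf_shift y \<phi>1) * bracket (tf_shift y \<phi>2) g)"

end

theory Submission
 imports Defs "HOL-Probability.Probability" "HOL-Complex_Analysis.Great_Picard"
begin

text \<open>Every functional in the antidual of \<open>M\<^sup>1\<^sub>w\<close> is recovered from its short-time Fourier transform with
 Gaussian window, and changing the window costs a convolution with a function in \<open>L\<^sup>1\<^sub>w\<close>. All operators
 in the theorem have the form \<open>f \<mapsto> \<integral> Q f (y) \<pi>(y)\<phi>\<^sub>2 dy\<close>, where \<open>Q f (y)\<close> is the integral over \<open>u\<close> of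
 \<open>\<sigma>(y, u) \<langle>\<pi>(y + u)\<phi>\<^sub>4, \<pi>(y)\<phi>\<^sub>1\<rangle> V f (y + u)\<close>, with window \<open>\<phi>\<^sub>3\<close> for \<open>V\<close>, and \<open>\<sigma>\<close> is bounded by \<open>v\<close> times
 a polynomial in \<open>u\<close>. The hypotheses on \<open>\<phi>\<^sub>1\<close> and \<open>\<phi>\<^sub>4\<close> absorb that growth, so boundedness is Young's inequality in
 mixed-norm spaces; compactness follows from equicontinuity of the transforms of a bounded sequence.
 The kernel of the product has \<open>\<sigma>(y, u) = a(y) b(y + u)\<close>. Taylor's formula in \<open>u\<close>, proved weakly by testing with products
 of one-dimensional bump functions, splits it, and \<open>u\<^sup>\<alpha> V\<phi>\<^sub>1\<close> is a sum of transforms of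
 derivatives by a Leibniz rule; the orthogonality relations then identify the windows \<open>\<Phi>\<^sub>\<alpha>\<close>.\<close>

text \<open>The growth of a is that of m and the growth of the derivatives of b that of 1/m; by
  moderation the product of a(y) with a derivative of b at y + s is bounded by a multiple of v(s),
  uniformly in y. This is why every operator is dominated by a correlation on phase space. In the
  remainder s runs over t u with t in [0,1], and the integral condition on v brings the average of
  v(t u) back to v(u). Only distributional derivatives of b exist, so Taylor's formula is reached
  for almost every base point with a null set depending on the increment; both variables are
  integrated, and Tonelli absorbs this. Since weights and symbols are merely Lebesgue measurable,
  they are exchanged for Borel representatives whose bounds hold at every point. The factor -2 pi i
  in \<Phi>\<alpha> is the conjugate of the factor 2 pi i of the differentiation rule, because the
  conjugated transform enters the kernel. For compactness, if y is far out and u short, the whole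
  segment from y to y + u is far out, where the top derivatives are small against 1/m; long u
  contribute little because the kernel is integrable.\<close>

abbreviation BM :: "('a::topological_space => 'b::topological_space) set" where
 "BM \<equiv> borel_measurable borel"

abbreviation nn_lborel :: "('a::euclidean_space => ennreal) => ennreal" (binder "NNINT " 10) where
 "nn_lborel f \<equiv> integral\<^sup>N lborel f"

lemmas BM_contI = borel_measurable_continuous_onI

abbreviation intg :: "('a::euclidean_space => 'b::{banach, second_countable_topology}) => bool" where
 "intg == integrable lborel"

abbreviation AE_lborel :: "('a::euclidean_space => bool) => bool" (binder "AEL " 10) where
 "AE_lborel P == almost_everywhere lborel P"

abbreviation seq_lim :: "(nat => 'a::topological_space) => 'a => bool" ("(_/ ---> _)" [60, 60] 60) where
 "X ---> l == filterlim X (nhds l) sequentially"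

abbreviation en :: "real => ennreal" where
 "en == ennreal"

lemmas int_bound = Bochner_Integration.integrable_bound

lemma int_dom:
 fixes f :: "'a => 'b::{banach, second_countable_topology}"
 assumes "integrable M g" "f \<in> borel_measurable M" "!!x. norm (f x) <= g x"
 shows "integrable M f"
 using order_trans[OF assms(3) abs_ge_self] by (intro int_bound[OF assms(1,2)] AE_I2) (simp only: real_norm_def)

section \<open>Invariance of Lebesgue measure under translations, reflections and dilations\<close>

lemma nn_integral_lborel_shift:
 assumes [measurable]: "f \<in> BM"
 shows "(NNINT x. f (c + x)) = (NNINT x. f x)"
 by (subst (2) lborel_distr_plus[symmetric, of c]) (simp add: nn_integral_distr)

lemma integral_lborel_shift:
 fixes f :: "'a::euclidean_space => 'b::{banach, second_countable_topology}"
 assumes [measurable]: "f \<in> BM"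
 shows "(LBINT x. f (c + x)) = (LBINT x. f x)"
 by (subst (2) lborel_distr_plus[symmetric, of c]) (simp add: integral_distr)

lemma integrable_lborel_shift:
 fixes f :: "'a::euclidean_space => 'b::{banach, second_countable_topology}"
 assumes f: "intg f"
 shows "intg (%x. f (c + x))"
 using f by (subst (asm) lborel_distr_plus[symmetric, of c]) (rule integrable_distr[of _ _ borel, rotated], auto)

lemma lborel_distr_reflect:
 shows "distr lborel borel (%x. c - x) = lborel"
 by (subst lborel_affine[of "-1" c]) (auto simp: density_1 one_ennreal_def[symmetric])

lemma nn_integral_lborel_reflect:
 assumes [measurable]: "f \<in> BM"
 shows "(NNINT x. f (c - x)) = (NNINT x. f x)"
 by (subst (2) lborel_distr_reflect[symmetric, of c]) (simp add: nn_integral_distr)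

lemma integral_lborel_reflect:
 fixes f :: "'a::euclidean_space => 'b::{banach, second_countable_topology}"
 assumes [measurable]: "f \<in> BM"
 shows "(LBINT x. f (c - x)) = (LBINT x. f x)"
 by (subst (2) lborel_distr_reflect[symmetric, of c]) (simp add: integral_distr)

lemma integrable_lborel_reflect:
 fixes f :: "'a::euclidean_space => 'b::{banach, second_countable_topology}"
 assumes f: "intg f"
 shows "intg (%x. f (c - x))"
 using f by (subst (asm) lborel_distr_reflect[symmetric, of c]) (rule integrable_distr[of _ _ borel, rotated], auto)

lemma nn_integral_lborel_scale:
 fixes f :: "'a::euclidean_space => ennreal"
 assumes [measurable]: "f \<in> BM" and c: "c ~= 0"
 shows "(NNINT x. f x) = en (\<bar>c\<bar>^DIM('a))*(NNINT x. f (t + c *\<^sub>R x))"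
 by (subst lborel_affine[OF c, of t]) (simp add: nn_integral_density nn_integral_distr nn_integral_cmult)

lemma integral_lborel_scale:
 fixes f :: "'a::euclidean_space => 'b::{banach, second_countable_topology}"
 assumes [measurable]: "f \<in> BM" and c: "c ~= 0"
 shows "(LBINT x. f x) = (\<bar>c\<bar>^DIM('a)) *\<^sub>R (LBINT x. f (t + c *\<^sub>R x))"
 by (subst lborel_affine[OF c, of t]) (simp add: integral_density integral_distr)

lemma borel_measurable_if_continuous [measurable_dest]:
 "continuous_on UNIV f ==> f \<in> BM"
 by (rule BM_contI)

section \<open>Time-frequency shifts and the short-time Fourier transform\<close>

definition ph :: "real => complex" where
 "ph s = cis (2*pi * s)"

lemma ph_add: "ph (a + b) = ph a*ph b"
 by (simp add: ph_def cis_mult algebra_simps)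

lemma ph_0 [simp]: "ph 0 = 1"
 by (simp add: ph_def)

lemma norm_ph [simp]: "cmod (ph a) = 1"
 by (simp add: ph_def)

lemma cnj_ph [simp]: "cnj (ph a) = ph (- a)"
 by (simp add: ph_def cis_cnj)

lemma ph_cancel [simp]: "ph a*ph (- a) = 1" "ph (- a)*ph a = 1"
 by (simp_all flip: ph_add)

lemma ph_cancel' [simp]: "ph a*(ph (- a)*x) = x" "ph (- a)*(ph a*x) = x"
 by (simp_all flip: ph_add mult.assoc)

lemma ph_diff: "ph (a - b) = ph a*ph (- b)"
 by (simp flip: ph_add)

lemma continuous_on_ph [continuous_intros]:
 "continuous_on S f ==> continuous_on S (%x. ph (f x))"
 unfolding ph_def by (intro continuous_intros)

lemma measurable_ph [measurable]: "ph \<in> BM"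
 by (intro BM_contI continuous_intros)

lemma tf_shift_eq: "tf_shift z f t = ph (snd z \<bullet> t)*f (t - fst z)"
 by (simp add: tf_shift_def ph_def cis_conv_exp algebra_simps)

lemma norm_tf_shift [simp]: "cmod (tf_shift z f t) = cmod (f (t - fst z))"
 by (simp add: tf_shift_eq norm_mult)

section \<open>Fourier transforms of Gaussians\<close>

lemma gaussian_FT_real:
 assumes c: "0 < c"
 shows "(LBINT x. of_real (exp (- pi*c*x^2))*ph (- (s*x)))
      = of_real (1 / sqrt c*exp (- pi * s^2/c))"
proof -
 \<comment> \<open>Substituting \<open>k\<close>*x turns pi c x^2 into half the square of the normal
   variable, so the transform is the characteristic function of the standard normal law at
   \<open>t\<close>; the sign of \<open>t\<close> fits the phase.\<close>
 define k where "k = sqrt (2*pi*c)"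
 have k: "k > 0" "k^2 = 2*pi*c" using c by (auto simp: k_def)
 define t where "t = - (2*pi * s)/k"
 have [measurable]: "ph \<in> BM" by simp
 let ?A = "%x. of_real (exp (- pi*c*x^2))"
 let ?B = "%x. std_normal_density (k*x)"
 have "of_real (exp (- (t^2)/2)) = char std_normal_distribution t"
  by (simp add: char_std_normal_distribution)
 also have "... = (LBINT x. std_normal_density x *\<^sub>R iexp (t*x))"
  unfolding char_def by (subst integral_density) (auto simp: normal_density_nonneg)
 also have "... = k *\<^sub>R (LBINT x. ?B x *\<^sub>R iexp (t*(k*x)))"
  using k by (subst lborel_integral_real_affine[where c=k and t=0]) auto
 also have "(%x. ?B x *\<^sub>R iexp (t*(k*x)))
   = (%x. of_real (1 / sqrt (2*pi))*(?A x*ph (- (s*x))))"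
 proof
  fix x
  have "t*(k*x) = 2*pi*(- (s*x))" using k by (simp add: t_def)
  hence 1: "iexp (t*(k*x)) = ph (- (s*x))"
   unfolding ph_def cis_conv_exp by simp
  have 2: "?B x = 1 / sqrt (2*pi)*exp (- pi*c*x^2)"
   unfolding std_normal_density_def power_mult_distrib k(2) by simp
  show "?B x *\<^sub>R iexp (t*(k*x))
    = of_real (1 / sqrt (2*pi))*(?A x*ph (- (s*x)))"
   unfolding 1 2 by (simp add: scaleR_conv_of_real)
 qed
 finally have "of_real (exp (- (t^2)/2)) = of_real (k / sqrt (2*pi)) *
   (LBINT x. ?A x*ph (- (s*x)))"
  by (simp add: scaleR_conv_of_real)
 moreover have "k / sqrt (2*pi) = sqrt c" by (simp add: k_def real_sqrt_mult)
 moreover have "t^2/2 = pi * s^2/c"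
  using c by (simp add: t_def power_divide k(2) power_mult_distrib) (simp add: power2_eq_square)
 ultimately have "complex_of_real (exp (- (pi * s^2/c))) = of_real (sqrt c) *
   (LBINT x. ?A x*ph (- (s*x)))"
  by simp
 thus ?thesis using c by (simp add: field_simps)
qed

text \<open>A function that is not integrable has Bochner integral 0, whereas the transform at
  frequency 0 is 1/sqrt c.\<close>

lemma gaussian_integrable_real:
 assumes c: "0 < c"
 shows "intg (%x. exp (- pi*c*x^2))"
proof (rule ccontr)
 assume "\<not> ?thesis"
 hence "(LBINT x. exp (- pi*c*x^2)) = 0" by (rule not_integrable_integral_eq)
 moreover have "complex_of_real (LBINT x. exp (- pi*c*x^2)) = of_real (1 / sqrt c)"
  using gaussian_FT_real[OF c, of 0] by simp
 ultimately show False using c by simp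
qed

lemma norm_sq_Basis: "(norm (t::'a::euclidean_space))^2 = (\<Sum>b\<in>Basis. (t \<bullet> b)^2)"
 by (subst power2_norm_eq_inner, subst euclidean_inner) (simp add: power2_eq_square)

text \<open>\<open>lborel\<close> on a Euclidean space is the image of the product measure under the
  coordinate map, so Fubini for finite products applies to functions that factor over the
  basis.\<close>

lemma integral_lborel_prod_Basis:
 fixes f :: "'a::euclidean_space => real => complex"
 assumes int: "!!b. b \<in> Basis ==> intg (f b)"
 shows "intg (%x::'a. \<Prod>b\<in>Basis. f b (x \<bullet> b))"
  and "(\<integral>x. (\<Prod>b\<in>Basis. f b (x \<bullet> b)) \<partial>(lborel :: 'a measure)) = (\<Prod>b\<in>Basis. integral\<^sup>L lborel (f b))"
proof -
 interpret finite_product_sigma_finite "%_. lborel" "Basis :: 'a set"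
  by unfold_locales simp
 have [measurable]: "!!b. b \<in> Basis ==> f b \<in> BM"
  using int by auto
 have eq: "(\<Prod>b\<in>Basis. f b ((\<Sum>c\<in>Basis. x c *\<^sub>R c) \<bullet> b)) = (\<Prod>b\<in>Basis. f b (x b))" for x :: "'a => real"
  by (intro prod.cong refl) simp
 have m: "(%x::'a. \<Prod>b\<in>Basis. f b (x \<bullet> b)) \<in> BM" by measurable
 have m2: "(%x. \<Sum>b\<in>Basis. x b *\<^sub>R b) \<in> measurable (Pi\<^sub>M Basis (%_. lborel)) (borel :: 'a measure)"
  by measurable
 show "intg (%x::'a. \<Prod>b\<in>Basis. f b (x \<bullet> b))"
  using product_integrable_prod[OF _ int] by (subst lborel_eq) (simp add: integrable_distr_eq[OF m2 m] eq)
 show "(\<integral>x. (\<Prod>b\<in>Basis. f b (x \<bullet> b)) \<partial>(lborel :: 'a measure)) = (\<Prod>b\<in>Basis. integral\<^sup>L lborel (f b))"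
  using product_integral_prod[OF _ int] by (subst lborel_eq) (simp add: integral_distr[OF m2 m] eq)
qed

lemma gaussian_FT:
 fixes s :: "'a::euclidean_space" and c :: real
 assumes c: "0 < c"
 shows "intg (%x::'a. exp (- pi*c*(norm x)^2))"
  and "(LBINT x. of_real (exp (- pi*c*(norm x)^2))*ph (- (s \<bullet> x)))
      = of_real ((1 / sqrt c)^DIM('a)*exp (- pi*(norm s)^2/c))"
proof -
 define f where "f b x = of_real (exp (- pi*c*x^2))*ph (- ((s \<bullet> b)*x))" for b :: 'a and x
 have int: "intg (f b)" for b
  unfolding f_def using gaussian_integrable_real[OF c]
  by (rule int_bound) (auto simp: norm_mult)
 have prod_ph: "(\<Prod>b\<in>B. ph (g b)) = ph (\<Sum>b\<in>B. g b)" if "finite B" for B :: "'a set" and g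
  using that by induction (auto simp: ph_add)
 let ?A = "%x. of_real (exp (- pi*c*(norm x)^2))"
 let ?C = "%x. ph (- (s \<bullet> x))"
 have eq: "(\<Prod>b\<in>Basis. f b (x \<bullet> b)) = ?A x*?C x" for x :: 'a
 proof -
  have "- pi*c*(norm x)^2 = (\<Sum>b\<in>Basis. - pi*c*(x \<bullet> b)^2)"
   by (simp add: norm_sq_Basis sum_distrib_left)
  moreover have "- (s \<bullet> x) = (\<Sum>b\<in>Basis. - ((s \<bullet> b)*(x \<bullet> b)))"
   by (simp add: sum_negf euclidean_inner[of s x])
  ultimately show ?thesis
   by (simp add: f_def prod.distrib prod_ph exp_sum)
 qed
 have "intg (%x::'a. ?A x*?C x)"
  using integral_lborel_prod_Basis(1)[of f, OF int] by (simp add: eq)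
 hence "intg (%x::'a. cmod (?A x*?C x))"
  by (rule integrable_norm)
 thus "intg (%x::'a. exp (- pi*c*(norm x)^2))"
  by (simp add: norm_mult)
 let ?B = "of_real ((1 / sqrt c)^DIM('a)*exp (- pi*(norm s)^2/c))"
 have "(LBINT x. ?A x*?C x)
   = (\<Prod>b\<in>Basis. integral\<^sup>L lborel (f b))"
  using integral_lborel_prod_Basis(2)[of f, OF int] by (simp add: eq)
 also have "... = (\<Prod>b\<in>Basis. of_real (1 / sqrt c*exp (- pi*(s \<bullet> b)^2/c)))"
  unfolding f_def gaussian_FT_real[OF c] ..
 also have "... = ?B"
  by (simp add: prod.distrib norm_sq_Basis sum_distrib_left sum_divide_distrib flip: exp_sum)
    (simp add: prod_constant power_one_over  prod_dividef flip: exp_sum of_real_prod)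
 finally show "(LBINT x. ?A x*?C x)
      = ?B" .
qed

lemma borel_measurable_fst' [measurable]: "fst \<in> borel_measurable (borel :: ('a::euclidean_space \<times> 'b::euclidean_space) measure)"
 by (intro BM_contI continuous_intros)

lemma borel_measurable_snd' [measurable]: "snd \<in> borel_measurable (borel :: ('a::euclidean_space \<times> 'b::euclidean_space) measure)"
 by (intro BM_contI continuous_intros)

lemma sets_lborel_pair [measurable_cong]:
 "sets (lborel \<Otimes>\<^sub>M lborel) = sets (borel :: ('a::euclidean_space \<times> 'b::euclidean_space) measure)"
 by (simp add: borel_prod[symmetric] cong: sets_pair_measure_cong)

lemma cnj_measurable [measurable]: "cnj \<in> BM"
 by (intro BM_contI continuous_intros)

section \<open>Square-integrable functions and the bracket\<close>

definition L2 :: "('a::euclidean_space => complex) => bool" where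
 "L2 f \<longleftrightarrow> f \<in> BM & intg (%t. (cmod (f t))^2)"

definition sq_norm :: "('a::euclidean_space => complex) => real" where
 "sq_norm f = (LBINT t. (cmod (f t))^2)"

lemma L2_measurable [measurable_dest]: "L2 f ==> f \<in> BM"
 by (simp add: L2_def)

lemma L2_sq_integrable: "L2 f ==> intg (%t. (cmod (f t))^2)"
 by (simp add: L2_def)

text \<open>The arithmetic-geometric mean stands in for Cauchy-Schwarz: from brackets and transforms
  only a finite bound in terms of the two square norms is asked.\<close>

lemma norm_mult_le_half_sq: "cmod (a*b) <= ((cmod a)^2 + (cmod b)^2)/2"
 using sum_squares_bound[of "cmod a" "cmod b"] by (simp add: norm_mult)

lemma L2_mult_integrable:
 assumes "L2 f" "L2 g"
 shows "intg (%t. f t*cnj (g t))"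
proof (rule int_bound)
 show "intg (%t. ((cmod (f t))^2 + (cmod (g t))^2)/2)"
  using assms by (auto simp: L2_def)
 show "(%t. f t*cnj (g t)) \<in> borel_measurable lborel"
  using assms by measurable
 show "AEL t. norm (f t*cnj (g t)) <= norm (((cmod (f t))^2 + (cmod (g t))^2)/2)"
  using norm_mult_le_half_sq[of "f _" "cnj (g _)"] by auto
qed

lemma integral_norm_L2_mult:
 assumes "L2 f" "L2 g"
 shows "(LBINT t. cmod (f t*cnj (g t))) <= (sq_norm f + sq_norm g)/2"
proof -
 have "(LBINT t. cmod (f t*cnj (g t))) <= (LBINT t. ((cmod (f t))^2 + (cmod (g t))^2)/2)"
  using assms norm_mult_le_half_sq[of "f _" "cnj (g _)"]
  by (intro integral_mono integrable_norm L2_mult_integrable) (auto simp: L2_def)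
 also have "... = (sq_norm f + sq_norm g)/2"
  using assms by (simp add: L2_def sq_norm_def)
 finally show ?thesis .
qed

lemma tf_shift_measurable [measurable (raw)]:
 assumes [measurable]: "f \<in> BM"
  "(%x. t x) \<in> borel_measurable M" "(%x. z x) \<in> borel_measurable M"
 shows "(%x. tf_shift (z x) f (t x :: 'a::euclidean_space)) \<in> borel_measurable M"
 unfolding tf_shift_eq by measurable

lemma tf_shift_measurable' [measurable]:
 assumes [measurable]: "f \<in> BM"
 shows "tf_shift z f \<in> BM"
 by measurable

lemma L2_tf_shift [simp]:
 assumes "L2 f"
 shows "L2 (tf_shift z f)"
 unfolding L2_def
proof
 have [measurable]: "f \<in> BM" using assms by measurable
 show "tf_shift z f \<in> BM" by measurable
 show "intg (%t. (cmod (tf_shift z f t))^2)"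
  using integrable_lborel_shift[OF L2_sq_integrable[OF assms], of "- fst z"] by simp
qed

lemma sq_norm_tf_shift [simp]:
 assumes "L2 f"
 shows "sq_norm (tf_shift z f) = sq_norm f"
proof -
 have [measurable]: "f \<in> BM" using assms by measurable
 show ?thesis
  using integral_lborel_shift[of "%t. (cmod (f t))^2" "- fst z"] by (simp add: sq_norm_def)
qed

lemma L2_cmult [intro]:
 assumes "L2 f" shows "L2 (%t. c*f t)"
 using assms by (auto simp: L2_def norm_mult power_mult_distrib)

lemma L2_add [intro]:
 assumes "L2 f" "L2 g" shows "L2 (%t. f t + g t)"
 unfolding L2_def
proof
 have [measurable]: "f \<in> BM" "g \<in> BM" using assms by measurable
 show "(%t. f t + g t) \<in> BM" by measurable
 show "intg (%t. (cmod (f t + g t))^2)"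
 proof (rule int_bound)
  show "intg (%t. 2*(cmod (f t))^2 + 2*(cmod (g t))^2)"
   using assms by (auto simp: L2_def)
  have "(cmod (a + b))^2 <= 2*(cmod a)^2 + 2*(cmod b)^2" for a b
  proof -
   have "(cmod (a + b))^2 <= (cmod a + cmod b)^2"
    by (intro power_mono norm_triangle_ineq) auto
   also have "... <= 2*(cmod a)^2 + 2*(cmod b)^2"
    using sum_squares_bound[of "cmod a" "cmod b"] by (simp add: power2_sum)
   finally show ?thesis .
  qed
  thus "AEL t. norm ((cmod (f t + g t))^2) <= norm (2*(cmod (f t))^2 + 2*(cmod (g t))^2)"
   by auto
 qed measurable
qed

lemma L2_zero [simp]: "L2 (%t. 0)"
 by (simp add: L2_def)

lemma L2_diff [intro]: "L2 f ==> L2 g ==> L2 (%t. f t - g t)"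
 using L2_add[of f "%t. (-1)*g t"] L2_cmult[of g "-1"] by simp

lemma L2_sum: "finite A ==> (!!i. i \<in> A ==> L2 (f i)) ==> L2 (%t. \<Sum>i\<in>A. f i t)"
 by (induction A rule: finite_induct) auto

lemma bracket_lborel:
 assumes [measurable]: "f \<in> BM" "g \<in> BM"
 shows "bracket f g = (LBINT t. f t*cnj (g t))"
 unfolding bracket_def by (rule integral_completion) measurable

lemma bracket_L2: "L2 f ==> L2 g ==> bracket f g = (LBINT t. f t*cnj (g t))"
 by (intro bracket_lborel L2_measurable)

lemma bracket_sym: "cnj (bracket f g) = bracket g f"
 unfolding bracket_def by (simp add: mult.commute flip: Bochner_Integration.integral_cnj)

lemma bracket_scale_left: "bracket (%t. c*f t) g = c*bracket f g"
 unfolding bracket_def by (simp add: mult.assoc)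

lemma bracket_add_left:
 assumes "L2 f" "L2 g" "L2 h"
 shows "bracket (%t. f t + g t) h = bracket f h + bracket g h"
 using assms by (simp add: bracket_L2 L2_add distrib_right L2_mult_integrable)

lemma bracket_diff_left:
 assumes "L2 f" "L2 g" "L2 h"
 shows "bracket (%t. f t - g t) h = bracket f h - bracket g h"
 using assms by (simp add: bracket_L2 L2_diff left_diff_distrib L2_mult_integrable)

lemma bracket_sum_left:
 assumes "finite A" "!!i. i \<in> A ==> L2 (f i)" "L2 h"
 shows "bracket (%t. \<Sum>i\<in>A. f i t) h = (\<Sum>i\<in>A. bracket (f i) h)"
 using assms(1,2)
proof (induction A rule: finite_induct)
 case empty thus ?case by (simp add: bracket_def)
next
 case (insert x F)
 thus ?case using assms(3) by (simp add: bracket_add_left L2_sum)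
qed

lemma bracket_bound:
 assumes "L2 f" "L2 g"
 shows "cmod (bracket f g) <= (sq_norm f + sq_norm g)/2"
 unfolding bracket_L2[OF assms]
 by (rule order_trans[OF integral_norm_bound integral_norm_L2_mult[OF assms]])

section \<open>The transform of functions and its covariance under time-frequency shifts\<close>

definition STFT :: "('a::euclidean_space => complex) => ('a => complex) => 'a*'a => complex" where
 "STFT g f z = bracket f (tf_shift z g)"

abbreviation VG :: "('a::euclidean_space => complex) => 'a*'a => complex" where
 "VG \<equiv> STFT gaussian"

lemma stft_bracket: "stft g (bracket f) = STFT g f"
 by (simp add: fun_eq_iff stft_def STFT_def)

lemma STFT_eq:
 assumes [measurable]: "f \<in> BM" "g \<in> BM"
 shows "STFT g f z = (LBINT t. f t*cnj (g (t - fst z))*ph (- (snd z \<bullet> t)))"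
 unfolding STFT_def by (subst bracket_lborel) (auto simp: tf_shift_eq mult_ac)

lemma STFT_measurable [measurable (raw)]:
 assumes [measurable]: "f \<in> BM" "g \<in> BM" "z \<in> borel_measurable M"
 shows "(%x. STFT g f (z x)) \<in> borel_measurable M"
proof -
 have "STFT g f \<in> BM"
  unfolding STFT_eq[OF assms(1,2), abs_def] by measurable
 thus ?thesis by measurable
qed

lemma STFT_bound:
 assumes "L2 f" "L2 g"
 shows "cmod (STFT g f z) <= (sq_norm f + sq_norm g)/2"
 using bracket_bound[of f "tf_shift z g"] assms by (simp add: STFT_def)

lemma tf_shift_tf_shift: "tf_shift y (tf_shift z f) = (%t. ph (- (snd z \<bullet> fst y))*tf_shift (y + z) f t)"
 by (auto simp: fun_eq_iff tf_shift_eq inner_add_left inner_diff_right ph_add ph_diff algebra_simps)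

lemma tf_shift_scale: "tf_shift y (%t. c*f t) = (%t. c*tf_shift y f t)"
 by (auto simp: fun_eq_iff tf_shift_eq)

lemma tf_shift_add_fun: "tf_shift y (%t. f t + g t) = (%t. tf_shift y f t + tf_shift y g t)"
 by (auto simp: fun_eq_iff tf_shift_eq algebra_simps)

lemma tf_shift_add: "tf_shift (y + z) f = (%t. ph (snd z \<bullet> fst y)*tf_shift y (tf_shift z f) t)"
 by (simp add: tf_shift_tf_shift)

lemma tf_shift_0 [simp]: "tf_shift 0 f = f"
 by (simp add: fun_eq_iff tf_shift_eq)

lemma bracket_tf_shift [simp]:
 assumes [measurable]: "f \<in> BM" "g \<in> BM"
 shows "bracket (tf_shift y f) (tf_shift y g) = bracket f g"
proof -
 have "bracket (tf_shift y f) (tf_shift y g) = (LBINT t. f (- fst y + t)*cnj (g (- fst y + t)))"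
  by (subst bracket_lborel) (auto simp: tf_shift_eq mult_ac mult.left_commute[of "ph _"])
 also have "... = bracket f g"
  by (subst integral_lborel_shift[where f="%t. f t*cnj (g t)"]) (auto simp: bracket_lborel)
 finally show ?thesis .
qed

text \<open>Time-frequency shifts preserve the bracket, so one shift cancels against the other; the
  phase is the cocycle of \<open>tf_shift_add\<close>.\<close>

lemma STFT_tf_shift:
 assumes [measurable]: "f \<in> BM" "g \<in> BM"
 shows "STFT g (tf_shift y f) z = ph ((snd y - snd z) \<bullet> fst y)*STFT g f (z - y)"
proof -
 let ?A = "(%t. ph ((snd z - snd y) \<bullet> fst y)*tf_shift y (tf_shift (z - y) g) t)"
 have "tf_shift z g = ?A"
  using tf_shift_add[of y "z - y" g] by simp
 hence "STFT g (tf_shift y f) z = cnj (bracket ?A (tf_shift y f))"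
  by (simp add: STFT_def bracket_sym)
 also have "... = ph (- ((snd z - snd y) \<bullet> fst y))*STFT g f (z - y)"
  by (simp add: bracket_scale_left bracket_sym STFT_def)
 finally show ?thesis by (simp add: inner_diff_left)
qed

lemma norm_STFT_tf_shift:
 assumes [measurable]: "f \<in> BM" "g \<in> BM"
 shows "cmod (STFT g (tf_shift y f) z) = cmod (STFT g f (z - y))"
 by (simp add: STFT_tf_shift norm_mult)

lemma STFT_swap:
 assumes [measurable]: "f \<in> BM" "g \<in> BM"
 shows "STFT f g (- z) = ph (- (snd z \<bullet> fst z))*cnj (STFT g f z)"
proof -
 have "cnj (STFT g f z) = bracket (tf_shift z g) f" by (simp add: STFT_def bracket_sym)
 also have "... = STFT f (tf_shift z g) 0" by (simp add: STFT_def)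
 also have "... = ph (snd z \<bullet> fst z)*STFT f g (- z)" by (simp add: STFT_tf_shift)
 finally show ?thesis by simp
qed

lemma norm_STFT_swap:
 assumes [measurable]: "f \<in> BM" "g \<in> BM"
 shows "cmod (STFT f g (- z)) = cmod (STFT g f z)"
 by (simp add: STFT_swap norm_mult)

text \<open>The class in which the regularization arguments run: continuity gives pointwise limits,
  boundedness and integrability give majorants. All windows of the theorem turn out to belong to it
  (\<open>MM_nice\<close>).\<close>

definition nice :: "('a::euclidean_space => complex) => bool" where
 "nice f \<longleftrightarrow> continuous_on UNIV f & bounded (range f) & intg f"

lemma nice_L2: assumes "nice f" shows "L2 f"
proof -
 have [measurable]: "f \<in> BM"
  using assms by (intro BM_contI) (simp add: nice_def)
 obtain B where B: "!!t. cmod (f t) <= B" using assms by (auto simp: nice_def bounded_iff)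
 have "intg (%t. (cmod (f t))^2)"
 proof (rule int_dom)
  show "intg (%t. B*cmod (f t))" using assms by (auto simp: nice_def)
  show "norm ((cmod (f t))^2) <= B*cmod (f t)" for t
   using mult_right_mono[OF B[of t] norm_ge_zero[of "f t"]] by (simp add: power2_eq_square)
 qed measurable
 thus ?thesis by (simp add: L2_def)
qed

lemma continuous_gaussian: "continuous_on UNIV gaussian"
 unfolding gaussian_def[abs_def] by (intro continuous_intros)

lemma norm_gaussian_le_1: "cmod (gaussian t) <= 1"
 by (simp add: gaussian_def)

lemma nice_gaussian: "nice (gaussian :: 'a::euclidean_space => complex)"
proof -
 have "intg (gaussian :: 'a => complex)"
  unfolding gaussian_def[abs_def] using gaussian_FT(1)[of 1, where 'a='a] by simp
 thus ?thesis
  using norm_gaussian_le_1 by (auto simp: nice_def continuous_gaussian bounded_iff)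
qed

lemma L2_gaussian [simp]: "L2 gaussian"
 by (rule nice_L2[OF nice_gaussian])

lemma gaussian_measurable [measurable]: "gaussian \<in> BM"
 by (rule BM_contI[OF continuous_gaussian])

text \<open>Centring the integral at x/2 and using the parallelogram law splits the product of the
  two Gaussians into a constant and a Gaussian of exponent 2 pi, whose Fourier transform is
  known.\<close>

lemma STFT_gaussian:
 fixes z :: "'a::euclidean_space \<times> 'a"
 shows "VG gaussian z = of_real ((1 / sqrt 2)^DIM('a)*exp (- (pi/2)*(norm z)^2))*ph (- (snd z \<bullet> fst z)/2)"
proof -
 define x w where "x = fst z" and "w = snd z"
 let ?B = "%t. (1/2) *\<^sub>R x + t"
 have sq: "(norm (?B t))^2 + (norm (t - (1/2) *\<^sub>R x))^2 = 2*(norm t)^2 + (norm x)^2/2" for t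
  by (simp add: power2_norm_eq_inner inner_add_left inner_add_right inner_diff_left inner_diff_right inner_commute)
 let ?F = "%t. t - (1/2) *\<^sub>R x"
 have shift: "(1/2) *\<^sub>R x + t - x = ?F t" "t + (1/2) *\<^sub>R x - x = ?F t" for t
 proof -
  have "x = (1/2) *\<^sub>R x + (1/2) *\<^sub>R x" by (simp flip: scaleR_left_distrib)
  thus "(1/2) *\<^sub>R x + t - x = ?F t" "t + (1/2) *\<^sub>R x - x = ?F t"
   by (metis add_diff_cancel_left add.commute)+
 qed
 let ?A = "of_real (exp (- (pi/2)*(norm x)^2))"
 let ?C = "%t. of_real (exp (- pi*2*(norm t)^2))*ph (- (w \<bullet> t))"
 let ?D = "%t. cnj (gaussian ((1/2) *\<^sub>R x + t - x))"
 let ?E = "ph (- (w \<bullet> x)/2)"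
 have "VG gaussian z = (LBINT t. gaussian t*cnj (gaussian (t - x))*ph (- (w \<bullet> t)))"
  by (simp add: STFT_eq x_def w_def)
 also have "... = (LBINT t. gaussian (?B t)*?D t*ph (- (w \<bullet> (?B t))))"
  by (subst integral_lborel_shift) auto
 also have "(%t. gaussian (?B t)*?D t*ph (- (w \<bullet> (?B t))))
   = (%t. (?A*?E)*(?C t))"
 proof
  fix t
  have "gaussian (?B t)*?D t
    = of_real (exp (- pi*((norm (?B t))^2 + (norm (t - (1/2) *\<^sub>R x))^2)))"
   by (simp add: gaussian_def shift algebra_simps flip: exp_add of_real_mult)
  also have "... = ?A * of_real (exp (- pi*2*(norm t)^2))"
   unfolding sq by (simp add: algebra_simps flip: exp_add of_real_mult)
  finally show "gaussian (?B t)*?D t*ph (- (w \<bullet> (?B t)))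
   = (?A*?E)*(?C t)"
   by (simp add: inner_add_right ph_add ph_diff mult_ac)
 qed
 also have "(LBINT t. (?A*?E)*(?C t))
   = ?A*?E * of_real ((1 / sqrt 2)^DIM('a)*exp (- pi*(norm w)^2/2))"
  by (subst integral_mult_right_zero) (simp only: gaussian_FT(2)[of 2])
 also have "... = of_real ((1 / sqrt 2)^DIM('a)*exp (- (pi/2)*((norm x)^2 + (norm w)^2)))*?E"
  by (simp add: algebra_simps exp_add flip: exp_add of_real_mult)
 also have "(norm x)^2 + (norm w)^2 = (norm z)^2"
  by (simp add: x_def w_def norm_prod_def)
 finally show ?thesis by (simp add: x_def w_def)
qed

lemma norm_STFT_gaussian:
 fixes z :: "'a::euclidean_space \<times> 'a"
 shows "cmod (VG gaussian z) = (1 / sqrt 2)^DIM('a)*exp (- (pi/2)*(norm z)^2)"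
 by (simp add: STFT_gaussian norm_mult norm_power norm_divide)

text \<open>\<open>cg = 1 / \<parallel>\<phi>\<^sub>0\<parallel>\<^sup>2\<close>\<close>

definition cg :: "'a::euclidean_space itself => real" where
 "cg _ = (sqrt 2)^DIM('a)"

lemma cg_pos [simp]: "0 < cg TYPE('a::euclidean_space)"
 by (simp add: cg_def)

lemma bracket_gaussian: "bracket gaussian (gaussian :: 'a::euclidean_space => complex) = of_real (1/cg TYPE('a))"
 using STFT_gaussian[of "0 :: 'a*'a"] by (simp add: STFT_def cg_def power_one_over flip: of_real_power)

section \<open>Tonelli and Fubini on products of Euclidean spaces\<close>

lemma nn_integral_fst_lborel:
 assumes "f \<in> BM"
 shows "(NNINT x. (NNINT y. f (x, y))) = (NNINT z. f z)"
 using assms by (subst lborel_prod[symmetric]) (simp add: lborel.nn_integral_fst lborel_prod)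

lemma nn_integral_snd_lborel:
 assumes "f \<in> BM"
 shows "(NNINT y. (NNINT x. f (x, y))) = (NNINT z. f z)"
 using assms by (subst lborel_prod[symmetric]) (simp add: lborel_pair.nn_integral_snd lborel_prod)

lemma integrable_lborel_prodI:
 fixes f :: "'b::euclidean_space \<times> 'c::euclidean_space => 'd::{banach, second_countable_topology}"
 assumes "f \<in> BM" "(NNINT x. (NNINT y. en (norm (f (x, y))))) < \<infinity>"
 shows "intg f"
proof -
 have [measurable]: "f \<in> BM" by fact
 show ?thesis using assms
  by (subst (asm) nn_integral_fst_lborel[of "%z. en (norm (f z))"]) (auto simp: integrable_iff_bounded)
qed

lemma integrable_lborel_prodI':
 fixes f :: "'b::euclidean_space \<times> 'c::euclidean_space => 'd::{banach, second_countable_topology}"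
 assumes "f \<in> BM" "(NNINT y. (NNINT x. en (norm (f (x, y))))) < \<infinity>"
 shows "intg f"
proof -
 have [measurable]: "f \<in> BM" by fact
 show ?thesis using assms
  by (subst (asm) nn_integral_snd_lborel[of "%z. en (norm (f z))"]) (auto simp: integrable_iff_bounded)
qed

lemma Fubini_lborel:
 fixes f :: "'b::euclidean_space \<times> 'c::euclidean_space => 'd::{banach, second_countable_topology}"
 assumes "intg f"
 shows "(LBINT x. (LBINT y. f (x, y))) = (LBINT z. f z)"
  and "(LBINT y. (LBINT x. f (x, y))) = (LBINT z. f z)"
  and "AEL x. intg (%y. f (x, y))"
  and "AEL y. intg (%x. f (x, y))"
  and "intg (%x. (LBINT y. f (x, y)))"
  and "intg (%y. (LBINT x. f (x, y)))"
proof -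
 let ?A = "integrable (lborel \<Otimes>\<^sub>M lborel)"
 have i: "?A f" using assms by (simp add: lborel_prod)
 have i': "?A (%(x, y). f (x, y))" using i by simp
 show "(LBINT x. (LBINT y. f (x, y))) = (LBINT z. f z)"
  using lborel_pair.integral_fst'[OF i] by (simp add: lborel_prod)
 show "(LBINT y. (LBINT x. f (x, y))) = (LBINT z. f z)"
  using lborel_pair.integral_snd[OF i'] by (simp add: lborel_prod)
 show "AEL x. intg (%y. f (x, y))"
  using lborel_pair.AE_integrable_fst'[OF i] .
 show "AEL y. intg (%x. f (x, y))"
  using lborel_pair.AE_integrable_snd[OF i'] by simp
 show "intg (%x. (LBINT y. f (x, y)))"
  using lborel_pair.integrable_fst'[OF i] .
 show "intg (%y. (LBINT x. f (x, y)))"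
  using lborel_pair.integrable_snd[OF i'] by simp
qed

lemma Fubini_swap_lborel:
 fixes f :: "'b::euclidean_space \<times> 'c::euclidean_space => 'd::{banach, second_countable_topology}"
 assumes "intg f"
 shows "(LBINT x. (LBINT y. f (x, y))) = (LBINT y. (LBINT x. f (x, y)))"
 using Fubini_lborel(1,2)[OF assms] by simp

lemma integrable_nn_less_top:
 fixes f :: "'a => 'b::{banach, second_countable_topology}"
 shows "integrable M f ==> (\<integral>\<^sup>+x. en (norm (f x)) \<partial>M) < \<infinity>"
 by (simp add: integrable_iff_bounded)

lemma integrable_tensor:
 fixes f :: "'b::euclidean_space => 'd::{banach, second_countable_topology, real_normed_field}"
  and g :: "'c::euclidean_space => 'd"
 assumes "intg f" "intg g"
 shows "intg (%z. f (fst z)*g (snd z))"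
proof (rule integrable_lborel_prodI)
 have [measurable]: "f \<in> BM" "g \<in> BM" using assms by auto
 show "(%z. f (fst z)*g (snd z)) \<in> BM" by measurable
 show "(NNINT x. (NNINT y. en (norm (f (fst (x, y))*g (snd (x, y)))))) < \<infinity>"
  using assms[THEN integrable_nn_less_top]
  by (simp add: norm_mult ennreal_mult nn_integral_cmult nn_integral_multc ennreal_mult_less_top)
qed

section \<open>Correlations, regularized Parseval formula and orthogonality relations\<close>

lemma integrable_conv:
 fixes u v :: "'b::euclidean_space => 'd::{banach, second_countable_topology, real_normed_field}"
 assumes u: "intg u" and v: "intg v"
 shows "intg (%z. u (snd z) * v (snd z - fst z))"
  and "(LBINT x. (LBINT s. u s * v (s - x))) = (LBINT s. u s)*(LBINT s. v s)"
proof -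
 have [measurable]: "u \<in> BM" "v \<in> BM" using assms by auto
 show i: "intg (%z. u (snd z) * v (snd z - fst z))"
 proof (rule integrable_lborel_prodI')
  have "(NNINT x. en (norm (v (s - x)))) = (NNINT x. en (norm (v x)))" for s
   by (rule nn_integral_lborel_reflect) measurable
  thus "(NNINT s. (NNINT x. en (norm (u (snd (x, s)) * v (snd (x, s) - fst (x, s)))))) < \<infinity>"
   using assms[THEN integrable_nn_less_top]
   by (simp add: norm_mult ennreal_mult nn_integral_cmult nn_integral_multc ennreal_mult_less_top)
 qed measurable
 have "(LBINT x. (LBINT s. u s * v (s - x))) = (LBINT s. (LBINT x. u s * v (s - x)))"
  using Fubini_swap_lborel[OF i] by simp
 also have "... = (LBINT s. u s*(LBINT x. v x))"
  using integral_lborel_reflect[of v] by simp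
 finally show "(LBINT x. (LBINT s. u s * v (s - x))) = (LBINT s. u s)*(LBINT s. v s)"
  by simp
qed

text \<open>The damping factor makes the frequency integral absolutely convergent, so that Fubini
  applies; its Fourier transform is a Gaussian of width 1/sqrt n, an approximate identity that
  smears the argument of q.\<close>

lemma parseval_damped:
 fixes p q :: "'a::euclidean_space => complex" and n :: nat
 assumes p: "intg p" and q: "intg q" and n: "0 < n"
  and qB: "!!s. cmod (q s) <= B"
 defines "P \<equiv> %w. (LBINT s. p s*ph (- (w \<bullet> s)))" and "Q \<equiv> %w. (LBINT s. q s*ph (- (w \<bullet> s)))"
  and "F \<equiv> %z. p (fst z)*cnj (q (fst z - (1 / sqrt n) *\<^sub>R snd z))*gaussian (snd z)"
 shows "intg F"
  and "(LBINT w. of_real (exp (- pi*(norm w)^2/n))*(P w*cnj (Q w))) = (LBINT z. F z)"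
proof -
 have [measurable]: "p \<in> BM" "q \<in> BM" using p q by auto
 define e where "e w = exp (- pi*(norm w)^2/n)" for w :: 'a
 have e: "intg e" unfolding e_def using gaussian_FT(1)[of "1/real n", where 'a='a] n by simp
 let ?B = "%s w. ph (- (s \<bullet> w))"
 let ?H = "%s. of_real (sqrt n^DIM('a)*exp (- pi*(norm s)^2*n))"
 have eFT: "(LBINT w. of_real (e w)*?B s w) = ?H s" for s
  using gaussian_FT(2)[of "1/real n" s] n by (simp add: e_def real_sqrt_divide)
 have [measurable]: "e \<in> BM" using e by auto
 show F: "intg F"
 proof (rule int_bound)
  show "intg (%z. (of_real B*p (fst z))*gaussian (snd z :: 'a))"
   using nice_gaussian p by (intro integrable_tensor) (auto simp: nice_def)
  show "F \<in> borel_measurable lborel" unfolding F_def by measurable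
  show "AEL z. cmod (F z) <= cmod (of_real B*p (fst z)*gaussian (snd z))"
   using qB order_trans[OF norm_ge_zero qB] unfolding F_def norm_mult
   by (intro AE_I2 mult_right_mono) (auto simp: norm_mult mult.commute[of "cmod (p _)"] intro!: mult_right_mono)
 qed
 have [measurable]: "P \<in> BM" "Q \<in> BM"
  unfolding P_def Q_def by measurable
 let ?J = "LBINT s. cmod (q s)"
 have Qb: "cmod (Q w) <= ?J" for w
  unfolding Q_def using integral_norm_bound[of lborel "%s. q s*?B w s"] by (simp add: norm_mult)
 have cq: "intg (%s. cnj (q s))" using q by simp
 let ?C = "%t s. LBINT w. of_real (e w)*cnj (q t)*ph (w \<bullet> t - w \<bullet> s)"
 let ?D = "%t. of_real (sqrt n^DIM('a)*exp (- pi*(norm (0 + (1 / sqrt n) *\<^sub>R t))^2*n))"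
 let ?E = "%z. of_real (e (fst z))"
 let ?F = "%s t. cnj (q (s - (1 / sqrt n) *\<^sub>R t))"
 let ?G = "%w s. LBINT t. of_real (e w)*cnj (q t)*ph (w \<bullet> t - w \<bullet> s)"
 let ?I = "%s t. of_real (sqrt n^DIM('a)*exp (- pi*(norm (s - t))^2*n))"
 have inner: "(LBINT w. of_real (e w)*cnj (Q w)*?B w s)
   = (LBINT t. ?F s t*gaussian t)" for s
 proof -
  have i: "intg (%z. ?E z*cnj (q (snd z))*ph (fst z \<bullet> snd z - fst z \<bullet> s))"
  proof (rule int_bound)
   show "intg (%z. ?E z*cnj (q (snd z)))"
    using e cq by (intro integrable_tensor) auto
  qed (auto simp: norm_mult)
  have "(LBINT w. of_real (e w)*cnj (Q w)*?B w s)
   = (LBINT w. ?G w s)"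
  proof (intro Bochner_Integration.integral_cong refl)
   fix w
   have "cnj (Q w) = (LBINT t. cnj (q t)*ph (w \<bullet> t))"
    unfolding Q_def by (simp flip: Bochner_Integration.integral_cnj)
   hence "of_real (e w)*cnj (Q w)*?B w s = of_real (e w)*?B w s*(LBINT t. cnj (q t)*ph (w \<bullet> t))"
    by simp
   also have "... = (LBINT t. of_real (e w)*?B w s*(cnj (q t)*ph (w \<bullet> t)))"
    by simp
   finally show "of_real (e w)*cnj (Q w)*?B w s = ?G w s"
    by (simp add: ph_diff mult_ac)
  qed
  also have "... = (LBINT t. ?C t s)"
   using Fubini_swap_lborel[OF i] by simp
  also have "... = (LBINT t. cnj (q t)*?I s t)"
  proof (intro Bochner_Integration.integral_cong refl)
   fix t
   have "(?C t s)
    = (LBINT w. cnj (q t)*(of_real (e w)*ph (- ((s - t) \<bullet> w))))"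
    unfolding inner_diff_left by (simp add: inner_commute[of _ t] inner_commute[of _ s] mult_ac)
   thus "(?C t s)
     = cnj (q t)*?I s t"
    by (simp add: eFT del: of_real_mult)
  qed
  also have "... = (LBINT t. cnj (q (s - t))*?H t)"
   by (subst integral_lborel_reflect[where c=s, symmetric]) auto
  \<comment> \<open>Dilation by 1/sqrt n cancels the factor n^(d/2) and leaves the standard
    Gaussian, while the scale moves into the argument of q.\<close>
  also have "... = (\<bar>1 / sqrt n\<bar>^DIM('a)) *\<^sub>R (LBINT t. cnj (q (s - (0 + (1 / sqrt n) *\<^sub>R t)))*?D t)"
   using n by (intro integral_lborel_scale) auto
  also have "... = (LBINT t. (\<bar>1 / sqrt n\<bar>^DIM('a)) *\<^sub>R (cnj (q (s - (0 + (1 / sqrt n) *\<^sub>R t)))*?D t))"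
   by simp
  also have "... = (LBINT t. ?F s t*gaussian t)"
   using n by (intro Bochner_Integration.integral_cong refl)
    (simp add: gaussian_def power_divide field_simps scaleR_conv_of_real)
  finally show ?thesis .
 qed
 let ?A = "%z. cmod (?E z*cnj (Q (fst z))*(p (snd z)*ph (- (fst z \<bullet> snd z)))) <= cmod ((of_real ?J*?E z)*p (snd z))"
 have i: "intg (%z. ?E z*cnj (Q (fst z))*(p (snd z)*ph (- (fst z \<bullet> snd z))))"
 proof (rule int_bound)
  show "intg (%z. (of_real ?J*?E z)*p (snd z))"
   using e p by (intro integrable_tensor) auto
  show "AEL z. ?A z"
  proof (rule AE_I2)
   fix z :: "'a*'a"
   show "?A z"
    using mult_right_mono[OF Qb, of "\<bar>e (fst z)\<bar>*cmod (p (snd z))" "fst z"]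
    by (simp add: norm_mult mult_ac)
  qed
 qed auto
 have "(LBINT w. of_real (e w)*(P w*cnj (Q w)))
   = (LBINT w. (LBINT s. of_real (e w)*cnj (Q w)*(p s*?B w s)))"
  unfolding P_def by (intro Bochner_Integration.integral_cong refl, subst integral_mult_right_zero) (simp add: mult_ac)
 also have "... = (LBINT s. (LBINT w. of_real (e w)*cnj (Q w)*(p s*?B w s)))"
  using Fubini_swap_lborel[OF i] by simp
 also have "... = (LBINT s. (LBINT w. p s*(of_real (e w)*cnj (Q w)*?B w s)))"
  by (simp add: mult_ac)
 also have "... = (LBINT s. (LBINT t. p s*(?F s t*gaussian t)))"
  by (simp add: inner)
 also have "... = (LBINT s. (LBINT t. F (s, t)))"
  by (simp add: F_def mult_ac)
 also have "... = (LBINT z. F z)"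
  by (rule Fubini_lborel(1)[OF F])
 finally show "(LBINT w. of_real (exp (- pi*(norm w)^2/n))*(P w*cnj (Q w))) = (LBINT z. F z)"
  by (simp add: e_def)
qed

lemma integral_gaussian: "(LBINT t. gaussian (t :: 'a::euclidean_space)) = 1"
 using gaussian_FT(2)[of 1 "0 :: 'a"] by (simp add: gaussian_def)

lemma norm_gaussian: "cmod (gaussian t) = exp (- pi*(norm t)^2)"
 by (simp add: gaussian_def)

lemma integrable_gaussian: "intg (%t :: 'a::euclidean_space. exp (- pi*(norm t)^2))"
 using gaussian_FT(1)[of 1, where 'a='a] by simp

lemma integral_gaussian_real: "(LBINT t. exp (- pi*(norm (t :: 'a::euclidean_space))^2)) = 1"
proof -
 have "complex_of_real (LBINT t. exp (- pi*(norm (t :: 'a))^2)) = of_real 1"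
  using integral_gaussian[where 'a='a] unfolding gaussian_def by simp
 thus ?thesis unfolding of_real_eq_iff .
qed

text \<open>Continuity of q gives pointwise convergence, the bound \<open>B\<close> together with
  |p| and the Gaussian gives a majorant, and the Gaussian has integral 1. \<open>Suc n\<close> keeps
  the scale away from division by 0.\<close>

lemma parseval_damped_limit:
 fixes p q :: "'a::euclidean_space => complex"
 assumes p: "intg p" and q: "intg q"
  and qB: "!!s. cmod (q s) <= B" and qc: "continuous_on UNIV q"
 shows "(%n. (LBINT z. p (fst z)*cnj (q (fst z - (1 / sqrt (real (Suc n))) *\<^sub>R snd z))*gaussian (snd z)))
  ---> (LBINT s. p s*cnj (q s))"
proof -
 have [measurable]: "p \<in> BM" "q \<in> BM" using p q by auto
 have B: "0 <= B" using order_trans[OF norm_ge_zero qB] .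
 have i: "intg (%s. p s*cnj (q s))"
 proof (rule int_bound)
  show "intg (%s. of_real B*p s)" using p by simp
  show "AEL s. cmod (p s*cnj (q s)) <= cmod (of_real B*p s)"
   using qB B by (intro AE_I2) (auto simp: norm_mult mult.commute[of "cmod (p _)"] intro!: mult_right_mono)
 qed auto
 have g: "intg (gaussian :: 'a => complex)" using nice_gaussian by (auto simp: nice_def)
 let ?A = "%z n. q (fst z - (1 / sqrt (real (Suc n))) *\<^sub>R snd z)"
 have "(%n. (LBINT z. p (fst z)*cnj (?A z n)*gaussian (snd z)))
  ---> (LBINT z. p (fst z)*cnj (q (fst z))*gaussian (snd z :: 'a))"
 proof (rule integral_dominated_convergence)
  show "intg (%z. cmod ((of_real B*p (fst z))*gaussian (snd z :: 'a)))"
   using g p by (intro integrable_norm integrable_tensor) auto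
  show "AEL z. cmod (p (fst z)*cnj (?A z n)*gaussian (snd z))
    <= cmod (of_real B*p (fst z)*gaussian (snd z))" for n
   using qB B by (intro AE_I2) (auto simp: norm_mult mult.commute[of "cmod (p _)"] intro!: mult_right_mono)
  have "(%n. ?A z n) ---> q (fst z)" for z :: "'a*'a"
  proof (rule continuous_on_tendsto_compose[OF qc])
   have "(%n. 1 / sqrt (real (Suc n))) ---> 0"
    by real_asymp
   thus "(%n. fst z - (1 / sqrt (real (Suc n))) *\<^sub>R snd z) ---> fst z"
    using tendsto_diff[OF tendsto_const tendsto_scaleR[OF _ tendsto_const], of "%n. 1 / sqrt (real (Suc n))" 0 sequentially "fst z" "snd z"] by simp
  qed auto
  thus "AEL z. (%n. p (fst z)*cnj (?A z n)*gaussian (snd z))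
    ---> p (fst z)*cnj (q (fst z))*gaussian (snd z)"
   by (intro always_eventually allI tendsto_intros)
 qed measurable
 also have "(LBINT z. p (fst z)*cnj (q (fst z))*gaussian (snd z :: 'a)) = (LBINT s. p s*cnj (q s))"
  using Fubini_lborel(1)[OF integrable_tensor[OF i g]] by (simp add: integral_gaussian)
 finally show ?thesis .
qed

text \<open>After the bound by half the sum of squares, the shift of q disappears by translation
  invariance and the Gaussian integrates to 1; hence the bound does not depend on
  \<open>c\<close>.\<close>

lemma parseval_damped_bound:
 fixes p q :: "'a::euclidean_space => complex"
 assumes p: "L2 p" and q: "L2 q"
 shows "cmod (LBINT z. p (fst z)*cnj (q (fst z - c *\<^sub>R snd z))*gaussian (snd z)) <= (sq_norm p + sq_norm q)/2"
proof -
 have [measurable]: "p \<in> BM" "q \<in> BM" using p q by measurable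
 let ?D = "%z. cmod (p (fst z))"
 have i1: "intg (%z. (?D z)^2*exp (- pi*(norm (snd z :: 'a))^2))"
  using integrable_gaussian p by (intro integrable_tensor) (auto simp: L2_def)
 have s: "(LBINT s. (cmod (q (s - d)))^2) = sq_norm q" for d
  using integral_lborel_shift[of "%s. (cmod (q s))^2" "- d"] by (simp add: sq_norm_def)
 have s': "(NNINT s. en ((cmod (q (s - d)))^2)) = (NNINT s. en ((cmod (q s))^2))" for d
  using nn_integral_lborel_shift[of "%s. en ((cmod (q s))^2)" "- d"] by simp
 let ?B = "%z. q (fst z - c *\<^sub>R snd z)"
 have i2: "intg (%z. (cmod (?B z))^2*exp (- pi*(norm (snd z :: 'a))^2))"
 proof (rule integrable_lborel_prodI')
  show "(NNINT t. (NNINT s. en (norm ((cmod (q (fst (s, t) - c *\<^sub>R snd (s, t))))^2*exp (- pi*(norm (snd (s, t) :: 'a))^2))))) < \<infinity>"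
   using integrable_nn_less_top[OF L2_sq_integrable[OF q]] integrable_nn_less_top[OF integrable_gaussian[where 'a='a]]
   by (simp add: ennreal_mult nn_integral_cmult nn_integral_multc ennreal_mult_less_top s')
 qed measurable
 let ?A = "%z. exp (- pi*(norm (snd z))^2)"
 let ?C = "%z. cmod (p (fst z)*cnj (?B z)*gaussian (snd z)) <= (1/2)*((?D z)^2*?A z) + (1/2)*((cmod (?B z))^2*?A z)"
 let ?E = "LBINT z. (cmod (?B z))^2*?A z"
 have "cmod (LBINT z. p (fst z)*cnj (?B z)*gaussian (snd z))
   <= (LBINT z. (1/2)*((?D z)^2*?A z) + (1/2)*((cmod (?B z))^2*?A z))"
 proof (rule order_trans[OF integral_norm_bound integral_mono_AE'])
  show "intg (%z. (1/2)*((?D z)^2*?A z) + (1/2)*((cmod (?B z))^2*?A z))"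
   using i1 i2 by auto
  show "AEL z. ?C z"
  proof (intro always_eventually allI)
   fix z :: "'a*'a"
   show "?C z"
    using mult_right_mono[OF norm_mult_le_half_sq[of "p (fst z)" "cnj (?B z)"], of "?A z"]
    by (simp add: norm_mult norm_gaussian field_simps)
  qed
 qed auto
 also have "... = (1/2)*(LBINT z. (?D z)^2*exp (- pi*(norm (snd z :: 'a))^2)) + (1/2)*?E"
  using i1 i2 by simp
 also have "(LBINT z. (?D z)^2*exp (- pi*(norm (snd z :: 'a))^2)) = sq_norm p"
  using Fubini_lborel(1)[OF i1] integral_gaussian_real[where 'a='a] by (simp add: sq_norm_def)
 also have "?E = sq_norm q"
  using Fubini_lborel(2)[OF i2] integral_gaussian_real[where 'a='a] by (simp add: s)
 finally show ?thesis by simp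
qed

text \<open>The frequency integral is regularized by a Gaussian; the bound
  \<open>parseval_damped_bound\<close> is uniform in the regularization and integrable in the time variable.\<close>

lemma moyal:
 fixes f1 f2 g1 g2 :: "'a::euclidean_space => complex"
 assumes f1: "L2 f1" and g1: "nice g1" and f2: "nice f2" and g2: "nice g2"
  and int: "intg (%z. STFT g1 f1 z*cnj (STFT g2 f2 z))"
 shows "(LBINT z. STFT g1 f1 z*cnj (STFT g2 f2 z)) = bracket f1 f2*cnj (bracket g1 g2)"
proof -
 note L2 = f1 nice_L2[OF g1] nice_L2[OF f2] nice_L2[OF g2]
 have m [measurable]: "f1 \<in> BM" "g1 \<in> BM"
  "f2 \<in> BM" "g2 \<in> BM"
  using L2 by measurable
 obtain Bf where Bf: "!!t. cmod (f2 t) <= Bf" using f2 by (auto simp: nice_def bounded_iff)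
 obtain Bg where Bg: "!!t. cmod (g2 t) <= Bg" using g2 by (auto simp: nice_def bounded_iff)
 obtain B1 where B1: "!!t. cmod (g1 t) <= B1" using g1 by (auto simp: nice_def bounded_iff)
 \<comment> \<open>For fixed x the transform, as a function of the frequency, is the Fourier
   transform of \<open>p x\<close>; thus the damped Parseval formula applies in each time
   slice.\<close>
 define p where "p x s = f1 s*cnj (g1 (s - x))" for x s
 define q where "q x s = f2 s*cnj (g2 (s - x))" for x s
 have shift: "intg (%s. (cmod (g (s - x)))^2)" if "L2 g" for g :: "'a => complex" and x
  using integrable_lborel_shift[OF L2_sq_integrable[OF that], of "- x"] by simp
 have L2s: "L2 (%s. g (s - x))" if "L2 g" for g :: "'a => complex" and x
  using that shift[OF that] by (auto simp: L2_def)
 have pi: "intg (p x)" and qi: "intg (q x)" for x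
  unfolding p_def q_def using L2 by (auto intro!: L2_mult_integrable L2s)
 have qB: "cmod (q x s) <= Bf*Bg" for x s
  unfolding q_def norm_mult complex_mod_cnj
  using Bf Bg by (intro mult_mono) (auto intro: order_trans[OF norm_ge_zero])
 have qc: "continuous_on UNIV (q x)" for x
  unfolding q_def using f2 g2
  by (auto simp: nice_def intro!: continuous_intros continuous_on_compose2[of UNIV g2])
 have L2mult: "L2 (%s. f s*cnj (g (s - x)))" if "L2 f" "g \<in> BM" "!!t. cmod (g t) <= B" for f g :: "'a => complex" and B x
  unfolding L2_def
 proof
  have [measurable]: "f \<in> BM" "g \<in> BM" using that by measurable
  show "(%s. f s*cnj (g (s - x))) \<in> BM" by measurable
  show "intg (%t. (cmod (f t*cnj (g (t - x))))^2)"
  proof (rule int_bound)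
   show "intg (%t. B^2*(cmod (f t))^2)" using that by (auto simp: L2_def)
   show "AEL t. norm ((cmod (f t*cnj (g (t - x))))^2) <= norm (B^2*(cmod (f t))^2)"
    using that(3) by (intro AE_I2) (auto simp: norm_mult power_mult_distrib mult.commute[of "(cmod (f _))^2"] intro!: mult_right_mono power_mono)
  qed measurable
 qed
 have pL: "L2 (p x)" and qL: "L2 (q x)" for x
  unfolding p_def q_def using L2mult[of f1 g1 B1] L2mult[of f2 g2 Bg] L2 B1 Bg by auto
 let ?A = "%z. STFT g1 f1 z*cnj (STFT g2 f2 z)"
 define e where "e n z = of_real (exp (- pi*(norm (snd z))^2/(real (Suc n))))*(?A z)" for n and z :: "'a*'a"
 define h where "h n x = (LBINT z. p x (fst z)*cnj (q x (fst z - (1 / sqrt (real (Suc n))) *\<^sub>R snd z))*gaussian (snd z))" for n x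
 have eint: "intg (e n)" for n
  unfolding e_def
  by (rule int_bound[OF int])
    (auto simp: norm_mult intro!: mult_left_le_one_le)
 have eq: "(LBINT z. e n z) = (LBINT x. h n x)" for n
 proof -
  have "(LBINT w. e n (x, w)) = h n x" for x
   using parseval_damped(2)[OF pi qi _ qB, of "Suc n" x x]
   by (simp add: e_def h_def STFT_eq p_def q_def)
  thus ?thesis using Fubini_lborel(1)[OF eint, of n] by simp
 qed
 let ?C = "LBINT z. STFT g1 f1 z*cnj (STFT g2 f2 z)"
 have 1: "(%n. (LBINT z. e n z)) ---> ?C"
 proof (rule integral_dominated_convergence)
  show "intg (%z. cmod (?A z))" using int by (rule integrable_norm)
  show "AEL z. cmod (e n z) <= cmod (?A z)" for n
   by (auto simp: e_def norm_mult intro!: mult_left_le_one_le)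
  have "(%n. exp (- pi*c/(real (Suc n)))) ---> 1" for c :: real
   by real_asymp
  hence "(%n. e n z) ---> of_real 1*(?A z)" for z
   unfolding e_def by (intro tendsto_intros)
  thus "AEL z. (%n. e n z) ---> STFT g1 f1 z*cnj (STFT g2 f2 z)"
   by simp
 qed (auto simp: e_def)
 \<comment> \<open>As a function of x this is the correlation of |f1|^2 with |g1|^2, hence
   integrable; together with its analogue for \<open>q\<close> it dominates the damped integrals
   over the time slices.\<close>
 have cp: "intg (%x. sq_norm (p x))"
  using Fubini_lborel(5)[OF integrable_conv(1)[OF L2_sq_integrable[OF L2(1)] L2_sq_integrable[OF L2(2)]]]
  by (simp add: sq_norm_def p_def norm_mult power_mult_distrib)
 have cq: "intg (%x. sq_norm (q x))"
  using Fubini_lborel(5)[OF integrable_conv(1)[OF L2_sq_integrable[OF L2(3)] L2_sq_integrable[OF L2(4)]]]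
  by (simp add: sq_norm_def q_def norm_mult power_mult_distrib)
 let ?B = "%x. LBINT s. p x s*cnj (q x s)"
 have 2: "(%n. (LBINT x. h n x)) ---> (LBINT x. ?B x)"
 proof (rule integral_dominated_convergence)
  show "intg (%x. (sq_norm (p x) + sq_norm (q x))/2)" using cp cq by auto
  show "AEL x. cmod (h n x) <= (sq_norm (p x) + sq_norm (q x))/2" for n
   unfolding h_def using parseval_damped_bound[OF pL qL] by auto
  show "AEL x. (%n. h n x) ---> (?B x)"
   unfolding h_def by (intro always_eventually allI parseval_damped_limit[where B="Bf*Bg"] pi qi qB qc)
  show "(%x. ?B x) \<in> borel_measurable lborel"
   unfolding p_def q_def by measurable
  show "h n \<in> borel_measurable lborel" for n
   unfolding h_def p_def q_def by measurable
 qed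
 have "?C = (LBINT x. ?B x)"
  using LIMSEQ_unique[OF 1] 2 unfolding eq by blast
 also have "... = (LBINT x. (LBINT s. (f1 s*cnj (f2 s))*(cnj (g1 (s - x)*cnj (g2 (s - x))))))"
  by (simp add: p_def q_def mult_ac)
 also have "... = (LBINT s. f1 s*cnj (f2 s))*(LBINT s. cnj (g1 s*cnj (g2 s)))"
  using L2 by (intro integrable_conv(2)[where v="%s. cnj (g1 s*cnj (g2 s))"]) (auto simp: L2_mult_integrable simp del: complex_cnj_mult)
 also have "... = bracket f1 f2*cnj (bracket g1 g2)"
  by (simp add: bracket_lborel flip: Bochner_Integration.integral_cnj)
 finally show ?thesis .
qed

section \<open>Windows in \<open>M\<^sup>1\<close>\<close>

text \<open>The constant C makes room for \<open>jbracket\<close>, which is submultiplicative only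
  up to a factor 2, so that products of such weights stay in the class. The lower bound 1 lets
  weighted integrability imply plain integrability.\<close>

definition tame :: "('a::euclidean_space \<times> 'a => real) => bool" where
 "tame w \<longleftrightarrow> continuous_on UNIV w & (\<forall>z. 1 <= w z) & (\<forall>z. w (- z) = w z) &
   (\<exists>C. \<forall>z1 z2. w (z1 + z2) <= C*w z1*w z2)"

lemma tameD:
 assumes "tame w"
 shows "continuous_on UNIV w" "1 <= w z" "0 < w z" "0 <= w z" "w (- z) = w z"
proof -
 show c: "continuous_on UNIV w" and 1: "1 <= w z" and "w (- z) = w z"
  using assms unfolding tame_def by blast+
 show "0 < w z" "0 <= w z" using 1 by linarith+
qed

lemma tame_measurable [measurable_dest]: "tame w ==> w \<in> BM"
 by (intro BM_contI tameD)

lemma tame_const: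
 assumes "tame w"
 obtains C where "1 <= C" "!!z1 z2. w (z1 + z2) <= C*w z1*w z2"
proof -
 obtain C where C: "!!z1 z2. w (z1 + z2) <= C*w z1*w z2" using assms unfolding tame_def by blast
 show ?thesis
 proof
  show "w (z1 + z2) <= max 1 C*w z1*w z2" for z1 z2
   by (rule order_trans[OF C]) (auto intro!: mult_right_mono tameD(4)[OF assms])
 qed simp
qed

lemma tame_bounded_on_ball:
 assumes "tame w"
 obtains M where "1 <= M" "!!z. norm z <= r ==> w z <= M"
proof -
 have "compact (w ` cball 0 r)"
  by (intro compact_continuous_image continuous_on_subset[OF tameD(1)[OF assms]]) auto
 then obtain M where M: "!!y. y \<in> w ` cball 0 r ==> norm y <= M"
  using compact_imp_bounded bounded_iff by metis
 show ?thesis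
 proof (rule that[of "max 1 M"])
  show "w z <= max 1 M" if "norm z <= r" for z
   using M[of "w z"] that by auto
 qed simp
qed

text \<open>Each unit of length costs one factor L = C*M, with M a bound of the weight on the unit
  ball: a vector of norm at most n + 2 is the sum of its (n+2)-th part and a vector of norm at most
  n + 1.\<close>

lemma tame_exp_bound:
 fixes w :: "'a::euclidean_space \<times> 'a => real"
 assumes "tame w"
 obtains k K where "0 <= k" "0 < K" "!!z. w z <= K*exp (k*norm z)"
proof -
 obtain C where C: "1 <= C" "!!z1 z2. w (z1 + z2) <= C*w z1*w z2"
  using tame_const[OF assms] by blast
 obtain M where M: "1 <= M" "!!z. norm z <= 1 ==> w z <= M"
  using tame_bounded_on_ball[OF assms, of 1] by blast
 define L where "L = C*M"
 have L: "1 <= L" using C(1) M(1) mult_mono[of 1 C 1 M] by (simp add: L_def)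
 have ind: "w z <= M*L^n" if "norm z <= Suc n" for n and z :: "'a*'a"
  using that
 proof (induction n arbitrary: z)
  case 0 thus ?case using M(2) by simp
 next
  case (Suc n)
  define y where "y = (1/real (Suc (Suc n))) *\<^sub>R z"
  define x where "x = (real (Suc n)/real (Suc (Suc n))) *\<^sub>R z"
  have xy: "z = y + x"
   by (simp add: x_def y_def flip: scaleR_left_distrib) (simp add: field_simps)
  have ny: "norm y <= 1" using Suc.prems by (simp add: y_def divide_le_eq)
  have "norm x = real (Suc n)/real (Suc (Suc n))*norm z" by (simp add: x_def)
  also have "... <= real (Suc n)/real (Suc (Suc n))*real (Suc (Suc n))"
   using Suc.prems by (intro mult_left_mono) auto
  finally have nx: "norm x <= real (Suc n)" by simp
  have "w z <= C*w y*w x" unfolding xy by (rule C)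
  also have "... <= C*M*(M*L^n)"
   using C(1) M(1) M(2)[OF ny] Suc.IH[OF nx] tameD(4)[OF assms]
   by (intro mult_mono) auto
  finally show ?case by (simp add: L_def mult_ac)
 qed
 let ?A = "%z. nat \<lfloor>norm z\<rfloor>"
 show ?thesis
 proof (rule that[of "ln L" "M"])
  show "0 <= ln L" "0 < M" using L M by auto
  fix z :: "'a*'a"
  have "norm z <= real (Suc (?A z))"
   using real_of_int_floor_add_one_ge[of "norm z"] by (simp add: of_nat_nat) linarith
  from ind[OF this] have "w z <= M*L^(?A z)" .
  also have "L^(?A z) = exp (ln L*real (?A z))"
   using L by (subst mult.commute, subst exp_of_nat_mult) simp
  also have "M*exp (ln L*real (?A z)) <= M*exp (ln L*norm z)"
   using L M(1) by (intro mult_left_mono) (auto intro!: mult_left_mono simp: of_nat_nat)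
  finally show "w z <= M*exp (ln L*norm z)" .
 qed
qed

text \<open>Completing the square, k r - c r^2 is at most k^2/(2c) - c r^2/2: half of the Gaussian
  pays for the exponential growth of the weight.\<close>

lemma tame_gaussian_integrable:
 fixes w :: "'a::euclidean_space \<times> 'a => real"
 assumes w: "tame w" and c: "0 < c"
 shows "intg (%z. w z*exp (- c*(norm z)^2))"
proof -
 obtain k K where K: "0 <= k" "0 < K" "!!z. w z <= K*exp (k*norm z)"
  by (rule tame_exp_bound[OF w]) (rule that)
 note [measurable] = w
 let ?A = "exp (k^2/(2*c))"
 let ?B = "%r. exp (- c*r^2)"
 show ?thesis
 proof (rule int_dom)
  show "intg (%z::'a*'a. K*?A*exp (- pi*(c/(2*pi))*(norm z)^2))"
   using c gaussian_FT(1)[of "c/(2*pi)", where 'a="'a*'a"] by (intro integrable_mult_right) simp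
   fix z :: "'a*'a"
   define r where "r = norm z"
   have "0 <= (k - c*r)^2/(2*c)" using c by simp
   also have "... = k^2/(2*c) - k*r + c*r^2/2"
    using c by (simp add: power2_diff field_simps) (simp add: power2_eq_square field_simps)
   finally have "k*r - c*r^2 <= k^2/(2*c) + (- c*r^2/2)" by simp
   hence "exp (k*r)*?B r <= ?A*exp (- c*r^2/2)"
    by (simp flip: exp_add)
   hence "K*(exp (k*r)*?B r) <= K*(?A*exp (- c*r^2/2))"
    using K by simp
   moreover have "w z*?B r <= K*exp (k*r)*?B r"
    using K(3)[of z] by (simp add: r_def)
   ultimately have fin: "w z*?B r <= K*(?A*exp (- c*r^2/2))"
    by (simp only: mult.assoc)
   show "norm (w z*exp (- c*(norm z)^2)) <= K*?A*exp (- pi*(c/(2*pi))*(norm z)^2)"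
    using fin K(2) tameD(4)[OF w, of z] by (simp add: r_def abs_mult mult.assoc)
 qed measurable
qed

lemma Lp_norm_1: "Lp_norm 1 f = (NNINT x. f x)"
proof -
 have "ennreal_powr x 1 = x" for x
  by (cases x) (auto simp: ennreal_powr_def)
 thus ?thesis by (simp add: Lp_norm_def nn_integral_completion)
qed

lemma Lpq_norm_11:
 assumes [measurable]: "F \<in> BM" "w \<in> BM"
 shows "Lpq_norm 1 1 w F = (NNINT z. en (cmod (F z)*w z))"
 unfolding Lpq_norm_def Lp_norm_1
 by (rule nn_integral_snd_lborel[where f="%z. en (cmod (F z)*w z)"]) measurable

lemma mod_norm_11:
 assumes f: "L2 f" and [measurable]: "w \<in> BM"
 shows "mod_norm 1 1 w (bracket f) = (NNINT z. en (cmod (VG f z)*w z))"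
proof -
 note [measurable] = f
 show ?thesis unfolding mod_norm_def stft_bracket by (rule Lpq_norm_11) measurable
qed

text \<open>The working form of \<open>M1 w\<close>, testable by a single integral;
  \<open>M1_iff\<close> shows that approximability by the Gaussian span amounts to the same.\<close>

definition MM :: "('a::euclidean_space \<times> 'a => real) => ('a => complex) => bool" where
 "MM w f \<longleftrightarrow> continuous_on UNIV f & L2 f & intg (%z. cmod (VG f z)*w z)"

text \<open>The reproducing kernel of the range of the Gaussian transform, up to the factor
  \<open>cg\<close>.\<close>

abbreviation RK :: "'a::euclidean_space \<times> 'a => 'a*'a => complex" where
 "RK z \<equiv> VG (tf_shift z gaussian)"

lemma RK_eq: "RK z x = ph ((snd z - snd x) \<bullet> fst z)*VG gaussian (x - z)"
 by (simp add: STFT_tf_shift)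

lemma norm_RK: "cmod (RK z x) = (1 / sqrt 2)^DIM('a)*exp (- (pi/2)*(norm (x - z :: 'a::euclidean_space \<times> 'a))^2)"
 by (simp only: RK_eq norm_mult norm_ph norm_STFT_gaussian)

lemma RK_le: "cmod (RK z x) <= exp (- (pi/2)*(norm (x - z :: 'a::euclidean_space \<times> 'a))^2)"
 unfolding norm_RK by (intro mult_left_le_one_le power_le_one) auto

lemma RK_cnj: "bracket (tf_shift z gaussian) (tf_shift x gaussian) = RK z x"
 "cnj (RK z x) = RK x z"
 by (simp_all add: STFT_def bracket_sym)

lemma continuous_on_STFT_gaussian: "continuous_on UNIV (VG (gaussian :: 'a::euclidean_space => complex))"
 unfolding STFT_gaussian[abs_def] by (intro continuous_intros) auto

lemma RK_measurable [measurable (raw)]: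
 assumes [measurable]: "z \<in> borel_measurable M" "x \<in> borel_measurable M"
 shows "(%t. RK (z t) (x t :: 'a::euclidean_space \<times> 'a)) \<in> borel_measurable M"
 unfolding RK_eq by measurable

text \<open>The kernel is a Gaussian centred at z; recentring it at the origin costs the factor C*w
  z by submultiplicativity, and what remains does not depend on z.\<close>

lemma tame_RK_integrable:
 assumes w: "tame w"
 shows "intg (%x. cmod (RK z x)*w x)"
  and "\<exists>G\<ge>0. \<forall>z. (LBINT x. cmod (RK z x)*w x) <= G*w z"
proof -
 note [measurable] = w
 obtain C where C: "1 <= C" "!!z1 z2. w (z1 + z2) <= C*w z1*w z2"
  using tame_const[OF w] by blast
 let ?B = "%x. exp (- (pi/2)*(norm x)^2)"
 have i: "intg (%x. w x*?B x)"
  by (rule tame_gaussian_integrable[OF w]) simp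
 let ?A = "%x z. exp (- (pi/2)*(norm (x - z))^2)"
 have i': "intg (%x. (C*w z)*(w (x - z)*?A x z))" for z
  using integrable_lborel_shift[OF i, of "- z"] by simp
 have le: "cmod (RK z x)*w x <= (C*w z)*(w (x - z)*?A x z)" for z x
 proof -
  have "cmod (RK z x)*w x <= ?A x z*(C*w z*w (x - z))"
   using C(2)[of z "x - z"] RK_le[of z x] tameD(4)[OF w] by (intro mult_mono) auto
  thus ?thesis by (simp add: mult_ac)
 qed
 show I: "intg (%x. cmod (RK z x)*w x)" for z
  by (rule int_dom[OF i'[of z]], measurable) (use le tameD(4)[OF w] in simp)
 define G where "G = C*(LBINT x. w x*?B x)"
 have "(LBINT x. cmod (RK z x)*w x) <= G*w z" for z
 proof -
  have "(LBINT x. cmod (RK z x)*w x) <= (LBINT x. (C*w z)*(w (x - z)*?A x z))"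
   by (intro integral_mono I i' le)
  also have "... = C*w z*(LBINT x. w x*?B x)"
   using integral_lborel_shift[of "%x. w x*?B x" "- z"] by simp
  finally show ?thesis by (simp add: G_def mult_ac)
 qed
 moreover have "G \<ge> 0" unfolding G_def using C tameD(4)[OF w]
  by (intro mult_nonneg_nonneg Bochner_Integration.integral_nonneg) auto
 ultimately show "\<exists>G\<ge>0. \<forall>z. (LBINT x. cmod (RK z x)*w x) <= G*w z" by blast
qed

lemma continuous_on_tf_shift:
 assumes "continuous_on UNIV g"
 shows "continuous_on UNIV (tf_shift z g)"
proof -
 let ?A = "(%t. ph (snd z \<bullet> t)*g (t - fst z))"
 have "continuous_on UNIV (%t. g (t - fst z))"
  by (rule continuous_on_compose2[OF assms]) (auto intro: continuous_intros)
 hence "continuous_on UNIV ?A"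
  by (intro continuous_on_mult continuous_on_ph continuous_on_inner continuous_on_const continuous_on_id)
 moreover have "tf_shift z g = ?A"
  by (rule ext) (rule tf_shift_eq)
 ultimately show ?thesis by simp
qed

lemma MM_tf_gaussian:
 assumes w: "tame w"
 shows "MM w (tf_shift z gaussian)"
proof -
 show ?thesis
  unfolding MM_def using tame_RK_integrable(1)[OF w] continuous_on_tf_shift[OF continuous_gaussian] L2_tf_shift[OF L2_gaussian]
  by blast
qed

lemma MM_D:
 assumes "MM w f"
 shows "continuous_on UNIV f" "L2 f" "intg (%z. cmod (VG f z)*w z)"
 using assms by (auto simp: MM_def)

lemma MM_measurable [measurable_dest]: "MM w f ==> f \<in> BM"
 by (simp add: MM_def L2_def)

lemma MM_STFT_integrable:
 assumes w: "tame w" and f: "MM w f"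
 shows "intg (VG f)"
proof -
 note [measurable] = f
 show ?thesis
  by (rule int_dom[OF MM_D(3)[OF f]], measurable) (rule order_trans[OF _ mult_left_mono[OF tameD(2)[OF w] norm_ge_zero]], simp)
qed

lemma MM_cmult:
 assumes "MM w f" shows "MM w (%t. c*f t)"
proof -
 have "VG (%t. c*f t) z = c*VG f z" for z
  by (simp add: STFT_def bracket_scale_left)
 thus ?thesis
  using assms by (auto simp: MM_def norm_mult mult.assoc intro!: continuous_intros)
qed

lemma STFT_add:
 assumes "L2 f" "L2 h" "L2 g"
 shows "STFT g (%t. f t + h t) z = STFT g f z + STFT g h z"
 using assms by (simp add: STFT_def bracket_add_left)

lemma STFT_diff:
 assumes "L2 f" "L2 h" "L2 g"
 shows "STFT g (%t. f t - h t) z = STFT g f z - STFT g h z"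
 using assms by (simp add: STFT_def bracket_diff_left)

lemma STFT_cmult: "STFT g (%t. c*f t) z = c*STFT g f z"
 by (simp add: STFT_def bracket_scale_left)

lemma MM_add:
 assumes w: "tame w" and f: "MM w f" and g: "MM w g"
 shows "MM w (%t. f t + g t)"
proof -
 note [measurable] = w f g
 have "intg (%z. cmod (VG (%t. f t + g t) z)*w z)"
 proof (rule int_dom)
  show "intg (%z. cmod (VG f z)*w z + cmod (VG g z)*w z)"
   using f g by (auto simp: MM_def)
  show "norm (cmod (VG (%t. f t + g t) z)*w z) <= cmod (VG f z)*w z + cmod (VG g z)*w z" for z
   using STFT_add[OF MM_D(2)[OF f] MM_D(2)[OF g] L2_gaussian, of z] tameD(4)[OF w, of z]
   by (simp add: abs_mult flip: distrib_right) (simp add: mult_right_mono norm_triangle_ineq)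
 qed measurable
 thus ?thesis using f g by (auto simp: MM_def intro!: continuous_intros)
qed

lemma MM_0: "MM w (%t. 0)"
 by (simp add: MM_def STFT_def bracket_def)

lemma MM_sum:
 assumes w: "tame w" and "finite A" "!!i. i \<in> A ==> MM w (f i)"
 shows "MM w (%t. \<Sum>i\<in>A. f i t)"
 using assms(2,3) by (induction A rule: finite_induct) (auto intro: MM_add[OF w] MM_0)

lemma MM_diff:
 assumes "tame w" "MM w f" "MM w g" shows "MM w (%t. f t - g t)"
 using MM_add[OF assms(1,2) MM_cmult[OF assms(3)], of "-1"] by simp

lemma gauss_span_MM: assumes w: "tame w" and s: "s \<in> gauss_span" shows "MM w s"
proof -
 obtain Z c where "finite Z" and s: "s = (%t. \<Sum>z\<in>Z. c z*tf_shift z gaussian t)"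
  using s by (auto simp: gauss_span_def)
 thus ?thesis by (auto intro!: MM_sum[OF w] MM_cmult MM_tf_gaussian[OF w])
qed

text \<open>A single approximant at distance less than 1 suffices: f is the sum of it and a
  difference of finite weighted norm.\<close>

lemma M1_imp_MM:
 assumes w: "tame w" and f: "f \<in> M1 w"
 shows "MM w f"
proof -
 have [measurable]: "w \<in> BM" using w by (rule tame_measurable)
 have cont: "continuous_on UNIV f" and i: "integrable lebesgue (%t. (cmod (f t))^2)" using f by (auto simp: M1_def)
 have [measurable]: "f \<in> BM" using cont by (rule BM_contI)
 have L2: "L2 f" using i by (auto simp: L2_def integrable_completion)
 let ?B = "%s n. (%t. f t - s n t)"
 let ?C = "%s n. mod_norm 1 1 w (bracket (?B s n))"
 obtain s where s: "!!n. s n \<in> gauss_span" "(%n. ?C s n) ---> 0"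
  using f by (auto simp: M1_def)
 have "eventually (%n. ?C s n < 1) sequentially"
  using s(2) by (rule order_tendstoD) simp
 then obtain n where n: "?C s n < 1"
  by (auto simp: eventually_sequentially)
 have sn: "MM w (s n)" by (rule gauss_span_MM[OF w s(1)])
 have [measurable]: "s n \<in> BM" using sn by (rule MM_measurable)
 have d: "L2 (?B s n)" using L2 sn by (auto simp: MM_def)
 have fin: "(NNINT z. en (cmod (VG (?B s n) z)*w z)) < \<infinity>"
  using n unfolding mod_norm_11[OF d \<open>w \<in> BM\<close>] by (auto intro: less_trans)
 have "intg (%z. cmod (VG (?B s n) z)*w z)"
 proof (rule integrableI_bounded)
  show "(NNINT z. en (norm (cmod (VG (?B s n) z)*w z))) < \<infinity>"
   using fin tameD(4)[OF w] by (simp add: abs_mult)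
 qed measurable
 hence "MM w (?B s n)"
  using cont L2 sn d by (auto simp: MM_def intro!: continuous_intros)
 from MM_add[OF w this sn] show ?thesis by simp
qed

text \<open>The orthogonality relations with a shifted Gaussian as second function. Their
  integrability premise holds because the transform of a square-integrable function is bounded and
  the kernel is a Gaussian.\<close>

lemma STFT_reproducing:
 assumes f: "L2 f"
 shows "VG f x = of_real (cg TYPE('a))*(LBINT z. VG f z * RK z x)"
  and "intg (%z. VG f z * RK z (x :: 'a::euclidean_space \<times> 'a))"
proof -
 note [measurable] = f
 let ?A = "tf_shift x gaussian"
 have n: "nice ?A"
 proof -
  have "intg ?A"
  proof (rule int_bound)
   show "intg (%t. gaussian (- fst x + t) :: complex)"
    using nice_gaussian by (intro integrable_lborel_shift) (auto simp: nice_def)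
  qed auto
  moreover have "continuous_on UNIV ?A"
   by (rule continuous_on_tf_shift[OF continuous_gaussian])
  ultimately show ?thesis using norm_gaussian_le_1 by (auto simp: nice_def bounded_iff)
 qed
 have g: "intg (RK x)"
 proof (rule int_dom)
  show "intg (%z. exp (- (pi/2)*(norm (- x + z))^2))"
   using gaussian_FT(1)[of "1/2", where 'a="'a*'a"] integrable_lborel_shift[of "%z. exp (- (pi/2)*(norm z)^2)" "- x"] by simp
  show "cmod (RK x z) <= exp (- (pi/2)*(norm (- x + z))^2)" for z
   using RK_le[of x] by simp
 qed measurable
 have int: "intg (%z. VG f z*cnj (RK x z))"
  by (rule int_dom[OF integrable_mult_right[OF integrable_norm[OF g], of "(sq_norm f + sq_norm (gaussian :: 'a => complex))/2"]], measurable)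
   (simp only: norm_mult complex_mod_cnj mult_right_mono[OF STFT_bound[OF f L2_gaussian] norm_ge_zero])
 show "intg (%z. VG f z * RK z x)" using int by (simp only: RK_cnj)
 have "(LBINT z. VG f z * RK z x) = bracket f ?A*cnj (bracket gaussian (gaussian :: 'a => complex))"
  using moyal[OF f nice_gaussian n nice_gaussian int] by (simp add: RK_cnj)
 also have "... = VG f x / of_real (cg TYPE('a))"
  by (simp add: STFT_def bracket_gaussian)
 finally show "VG f x = of_real (cg TYPE('a))*(LBINT z. VG f z * RK z x)"
  using cg_pos[where 'a='a] by (simp add: field_simps)
qed

lemma continuous_AE_zero:
 fixes g :: "'a::euclidean_space => 'b::real_normed_vector"
 assumes "continuous_on UNIV g" "AEL x. g x = 0"
 shows "g x = 0"
proof (rule ccontr)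
 assume x: "g x ~= 0"
 have o: "open {x. g x ~= 0}"
  using assms(1) by (simp add: open_Collect_neq)
 have "AE x in lebesgue. x \<notin> {x. g x ~= 0}"
  using AE_completion[OF assms(2)] by auto
 moreover have "{x. g x ~= 0} \<in> sets lebesgue"
  using o by (auto intro: borel_open)
 ultimately have "{x. g x ~= 0} \<in> null_sets lebesgue"
  by (subst AE_iff_null_sets) auto
 hence "negligible {x. g x ~= 0}" by (simp add: negligible_iff_null_sets)
 thus False using open_not_negligible[OF o] x by auto
qed

lemma nice_measurable [measurable_dest]: "nice f ==> f \<in> BM"
 using nice_L2 L2_measurable by blast

lemma nice_bound:
 assumes "nice f" obtains B where "0 <= B" "!!t. cmod (f t) <= B"
 using assms norm_ge_zero order_trans unfolding nice_def bounded_iff by (metis rangeI)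

lemma nice_tf_shift:
 assumes "nice g" shows "nice (tf_shift z g)"
proof -
 note [measurable] = assms
 obtain B where B: "!!t. cmod (g t) <= B" using nice_bound[OF assms] by blast
 have "intg (tf_shift z g)"
 proof (rule int_bound)
  show "intg (%t. g (- fst z + t))"
   using assms by (intro integrable_lborel_shift) (auto simp: nice_def)
 qed auto
 thus ?thesis using B assms by (auto simp: nice_def bounded_iff intro: continuous_on_tf_shift)
qed

lemma integral_norm_le_nn:
 shows "en (norm (integral\<^sup>L M f)) <= (\<integral>\<^sup>+x. en (norm (f x)) \<partial>M)"
 by (cases "integrable M f") (auto simp: integral_norm_bound_ennreal not_integrable_integral_eq)

section \<open>Synthesis integrals, the adjoint of the short-time Fourier transform\<close>

definition synth :: "('a::euclidean_space \<times> 'a => complex) => ('a => complex) => 'a => complex" where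
 "synth c k t = (LBINT z. c z*tf_shift z k t)"

lemma tf_shift_measurable2 [measurable (raw)]:
 assumes [measurable]: "k \<in> BM" "z \<in> borel_measurable M" "t \<in> borel_measurable M"
 shows "(%x. tf_shift (z x) k (t x)) \<in> borel_measurable M"
 by measurable

lemma synth_integrable_pair:
 fixes c :: "'a::euclidean_space \<times> 'a => complex"
 assumes c: "intg c" and k: "nice k" and g: "g \<in> BM" "!!t. cmod (g t) <= B"
 shows "intg (%p. c (fst p)*tf_shift (fst p) k (snd p)*g (snd p))"
proof (rule integrable_lborel_prodI)
 have [measurable]: "g \<in> BM" by fact
 have [measurable]: "k \<in> BM" using k by (rule nice_measurable)
 have [measurable]: "c \<in> BM" using c by auto
 show "(%p. c (fst p)*tf_shift (fst p) k (snd p)*g (snd p)) \<in> BM" by measurable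
 have ki: "(NNINT t. en (cmod (k t))) < \<infinity>"
  using k integrable_nn_less_top[of lborel k] by (simp add: nice_def)
 have B: "0 <= B" using g(2) norm_ge_zero order_trans by blast
 let ?A = "%z. NNINT t. en (norm (c (fst (z, t))*tf_shift (fst (z, t)) k (snd (z, t))*g (snd (z, t))))"
 let ?B = "NNINT t. en (cmod (k t))*en B"
 have "(NNINT z. ?A z)
   <= (NNINT z. en (cmod (c z))*?B)"
 proof (rule nn_integral_mono)
  fix z :: "'a*'a"
  have "(?A z)
   <= (NNINT t. en (cmod (c z))*(en (cmod (k (- fst z + t)))*en B))"
   by (intro nn_integral_mono) (auto simp: norm_mult g(2) mult_left_mono B mult.assoc simp flip: ennreal_mult)
  also have "... = en (cmod (c z))*(NNINT t. en (cmod (k (- fst z + t)))*en B)"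
   by (intro nn_integral_cmult) measurable
  also have "(NNINT t. en (cmod (k (- fst z + t)))*en B) = ?B"
   by (rule nn_integral_lborel_shift[where f="%t. en (cmod (k t))*en B"]) measurable
  finally show "(?A z)
    <= en (cmod (c z))*?B" .
 qed
 also have "... < \<infinity>"
  using integrable_nn_less_top[OF c] ki by (simp add: nn_integral_multc ennreal_mult_less_top)
 finally show "(NNINT z. ?A z) < \<infinity>" .
qed

lemma synth_integrable:
 assumes c: "intg c" and k: "nice k"
 shows "intg (%z. c z*tf_shift z k t)"
proof -
 note [measurable] = k
 have [measurable]: "c \<in> BM" using c by auto
 obtain B where B: "0 <= B" "!!t. cmod (k t) <= B" using nice_bound[OF k] by blast
 show ?thesis
 proof (rule int_bound)
  show "intg (%z. c z * of_real B)" using c by simp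
  show "AEL z. cmod (c z*tf_shift z k t) <= cmod (c z * of_real B)"
   using B by (intro AE_I2) (auto simp: norm_mult intro!: mult_left_mono)
 qed measurable
qed

lemma synth_nice:
 fixes c :: "'a::euclidean_space \<times> 'a => complex"
 assumes c: "intg c" and k: "nice k"
 shows "nice (synth c k)"
proof -
 note [measurable] = k
 have [measurable]: "c \<in> BM" using c by auto
 obtain B where B: "0 <= B" "!!t. cmod (k t) <= B" using nice_bound[OF k] by blast
 have "continuous_on UNIV (synth c k)"
  unfolding continuous_on_sequentially
 proof (intro allI ballI impI, elim conjE)
  fix x :: "nat => 'a" and a assume "x ---> a"
  show "(synth c k \<circ> x) ---> synth c k a"
   unfolding o_def synth_def
  proof (rule integral_dominated_convergence)
   show "intg (%z. cmod (c z)*B)" using c by simp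
   show "AEL z. cmod (c z*tf_shift z k (x n)) <= cmod (c z)*B" for n
    using B by (intro AE_I2) (auto simp: norm_mult intro!: mult_left_mono)
   have "(%n. tf_shift z k (x n)) ---> tf_shift z k a" for z
    by (rule continuous_on_tendsto_compose[OF continuous_on_tf_shift \<open>x ---> a\<close>])
      (use k in \<open>auto simp: nice_def\<close>)
   thus "AEL z. (%n. c z*tf_shift z k (x n)) ---> c z*tf_shift z k a"
    by (intro AE_I2 tendsto_intros)
  qed measurable
 qed
 moreover have "bounded (range (synth c k))"
  unfolding bounded_iff
 proof (intro exI ballI)
  fix y assume "y \<in> range (synth c k)"
  then obtain t where y: "y = synth c k t" by auto
  have "cmod y <= (LBINT z. cmod (c z*tf_shift z k t))"
   unfolding y synth_def by (rule integral_norm_bound)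
  also have "... <= (LBINT z. cmod (c z)*B)"
   using c B by (intro integral_mono integrable_norm synth_integrable k)
    (auto simp: norm_mult intro!: mult_left_mono)
  finally show "norm y <= (LBINT z. cmod (c z)*B)" .
 qed
 moreover have "intg (synth c k)"
  using Fubini_lborel(6)[OF synth_integrable_pair[OF c k, of "%_. 1" 1]] by (simp add: synth_def[abs_def])
 ultimately show ?thesis by (simp add: nice_def)
qed

lemma bracket_synth:
 assumes c: "intg c" and k: "nice k" and g: "g \<in> BM" "!!t. cmod (g t) <= B"
 shows "bracket (synth c k) g = (LBINT z. c z*bracket (tf_shift z k) g)"
proof -
 have [measurable]: "g \<in> BM" by fact
 note [measurable] = k
 note [measurable] = synth_nice[OF c k]
 note i = synth_integrable_pair[OF c k, of "%t. cnj (g t)" B]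
 have "bracket (synth c k) g = (LBINT t. (LBINT z. c z*tf_shift z k t*cnj (g t)))"
  by (simp add: bracket_lborel synth_def)
 also have "... = (LBINT z. (LBINT t. c z*tf_shift z k t*cnj (g t)))"
  using Fubini_swap_lborel[OF i] g by simp
 also have "... = (LBINT z. c z*bracket (tf_shift z k) g)"
  by (simp add: bracket_lborel mult.assoc)
 finally show ?thesis .
qed

lemma STFT_synth:
 assumes c: "intg c" and k: "nice k" and g: "nice g"
 shows "STFT g (synth c k) x = (LBINT z. c z*STFT g (tf_shift z k) x)"
proof -
 obtain B where B: "0 <= B" "!!t. cmod (tf_shift x g t) <= B" using nice_bound[OF nice_tf_shift[OF g]] by blast
 show ?thesis unfolding STFT_def
  using B nice_measurable[OF nice_tf_shift[OF g]] by (intro bracket_synth c k)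
qed

text \<open>Young's inequality in the weighted L^1 space: w x splits as C*w z*w (x - z), and Tonelli
  separates the factors.\<close>

lemma conv_weight:
 assumes [measurable]: "c \<in> BM" "h \<in> BM" "w \<in> BM"
  and C: "!!z1 z2. w (z1 + z2) <= C*w z1*w z2" and w: "!!z. 0 <= w z" "0 <= C"
 shows "(NNINT x. (NNINT z. c z*h (x - z))*en (w x))
   <= en C*(NNINT z. c z*en (w z))*(NNINT z. h z*en (w z))"
proof -
 let ?A = "%z. en C*(c z*en (w z))"
 let ?B = "%x z. h (x - z)*en (w (x - z))"
 have "(NNINT x. (NNINT z. c z*h (x - z))*en (w x))
   = (NNINT x. (NNINT z. c z*h (x - z)*en (w x)))"
  by (intro nn_integral_cong, subst nn_integral_multc) auto
 also have "... <= (NNINT x. (NNINT z. (?A z)*(?B x z)))"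
 proof (intro nn_integral_mono)
  fix x z
  have "en (w x) <= en C*en (w z)*en (w (x - z))"
   using C[of z "x - z"] w by (simp flip: ennreal_mult)
  hence "c z*h (x - z)*en (w x) <= c z*h (x - z)*(en C*en (w z)*en (w (x - z)))"
   by (rule mult_left_mono) simp
  thus "c z*h (x - z)*en (w x) <= (?A z)*(?B x z)"
   by (simp add: mult_ac)
 qed
 also have "... = (NNINT z. (NNINT x. (?A z)*(?B x z)))"
  by (rule lborel_pair.Fubini') measurable
 also have "... = (NNINT z. (?A z)*(NNINT x. h x*en (w x)))"
 proof (intro nn_integral_cong)
  fix z
  have "(NNINT x. (?A z)*(?B x z))
    = (?A z)*(NNINT x. h (- z + x)*en (w (- z + x)))"
   by (subst nn_integral_cmult) auto
  thus "(NNINT x. (?A z)*(?B x z))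
    = (?A z)*(NNINT x. h x*en (w x))"
   by (subst (asm) nn_integral_lborel_shift[where f="%x. h x*en (w x)"]) auto
 qed
 also have "... = en C*(NNINT z. c z*en (w z))*(NNINT z. h z*en (w z))"
  by (simp add: nn_integral_multc nn_integral_cmult)
 finally show ?thesis .
qed

text \<open>The transform of a synthesis integral is bounded pointwise by the convolution of |c|
  with |STFT g k|, so the weighted convolution inequality carries integrability from coefficients
  and windows to the result.\<close>

lemma synth_weighted:
 assumes w: "tame w" and C: "0 <= C" "!!z1 z2. w (z1 + z2) <= C*w z1*w z2"
  and c: "intg (%z. cmod (c z)*w z)" "c \<in> BM" and k: "nice k" and g: "nice g"
  and h: "intg (%z. cmod (STFT g k z)*w z)"
 shows "intg c"
  and "intg (%z. cmod (STFT g (synth c k) z)*w z)"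
  and "(LBINT z. cmod (STFT g (synth c k) z)*w z) <= C*(LBINT z. cmod (c z)*w z)*(LBINT z. cmod (STFT g k z)*w z)"
proof -
 note [measurable] = w
 have [measurable]: "c \<in> BM" by fact
 note [measurable] = k g
 show ci: "intg c"
  by (rule int_dom[OF c(1)], measurable) (rule order_trans[OF _ mult_left_mono[OF tameD(2)[OF w] norm_ge_zero]], simp)
 note [measurable] = synth_nice[OF ci k]
 let ?A = "LBINT z. cmod (STFT g k z)*w z"
 let ?B = "%x. cmod (STFT g (synth c k) x)"
 let ?C = "%x. NNINT z. en (cmod (c z))*en (cmod (STFT g k (x - z)))"
 let ?D = "LBINT z. cmod (c z)*w z"
 have "(NNINT x. en (?B x*w x))
   <= (NNINT x. (?C x)*en (w x))"
 proof (rule nn_integral_mono)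
  fix x
  have "en (?B x) <= ?C x"
   unfolding STFT_synth[OF ci k g]
   by (rule order_trans[OF integral_norm_le_nn]) (simp add: norm_mult norm_STFT_tf_shift ennreal_mult)
  thus "en (?B x*w x) <= (?C x)*en (w x)"
   using tameD(4)[OF w, of x] by (simp add: ennreal_mult mult_right_mono)
 qed
 also have "... <= en C*(NNINT z. en (cmod (c z))*en (w z))*(NNINT z. en (cmod (STFT g k z))*en (w z))"
  by (rule conv_weight[OF _ _ _ C(2) tameD(4)[OF w] C(1)]) auto
 also have "... = en C*en ?D*en ?A"
  using c(1) h tameD(4)[OF w] by (simp add: nn_integral_eq_integral flip: ennreal_mult)
 also have "... = en (C*?D*?A)"
  using C(1) tameD(4)[OF w] by (simp add: ennreal_mult Bochner_Integration.integral_nonneg)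
 finally have le: "(NNINT x. en (?B x*w x)) <= en (C*?D*?A)" .
 have nn: "0 <= C*?D*?A"
  using C(1) tameD(4)[OF w] by (intro mult_nonneg_nonneg Bochner_Integration.integral_nonneg) auto
 show i: "intg (%z. ?B z*w z)"
 proof (rule integrableI_bounded)
  show "(NNINT z. en (norm (?B z*w z))) < \<infinity>"
   using le_less_trans[OF le ennreal_less_top] tameD(4)[OF w] by (simp add: abs_mult)
 qed measurable
 show "(LBINT z. ?B z*w z) <= C*?D*?A"
  using le nn i tameD(4)[OF w] by (simp add: nn_integral_eq_integral)
qed

text \<open>Pointwise inversion: the difference of the two sides is tested against a cut-off of itself.\<close>

lemma STFT_inversion:
 fixes f :: "'a::euclidean_space => complex"
 assumes f: "L2 f" "continuous_on UNIV f" and i: "intg (VG f)"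
 shows "f t = of_real (cg TYPE('a)) * synth (VG f) gaussian t"
proof -
 define h where "h t = of_real (cg TYPE('a)) * synth (VG f) gaussian t" for t
 \<comment> \<open>The cut-off equals 1 at s = t and vanishes outside the ball of radius |t| + 1;
   the test function \<open>k\<close> is therefore continuous with compact support and sees the
   difference at t.\<close>
 let ?A = "%t s. max 0 (norm t + 1 - norm s)"
 define k where "k s = (h s - f s) * of_real (?A t s)" for s
 note [measurable] = f(1)
 have ns: "nice (synth (VG f) gaussian)" by (rule synth_nice[OF i nice_gaussian])
 note [measurable] = ns
 have hm [measurable]: "h \<in> BM" unfolding h_def by measurable
 have hL2: "L2 h" unfolding h_def using nice_L2[OF ns] by blast
 have hc: "continuous_on UNIV h" unfolding h_def using ns by (auto simp: nice_def intro!: continuous_intros)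
 have kc: "continuous_on UNIV k" unfolding k_def using hc f by (intro continuous_intros)
 have [measurable]: "k \<in> BM" using kc by (rule BM_contI)
 let ?B = "%t. cball 0 (norm t + 1)"
 have k0: "k s = 0" if "s \<notin> ?B t" for s using that by (simp add: k_def)
 have "compact (k ` ?B t)"
  by (intro compact_continuous_image continuous_on_subset[OF kc]) auto
 then obtain B where B: "!!y. y \<in> k ` ?B t ==> norm y <= B"
  using compact_imp_bounded bounded_iff by metis
 have kB: "cmod (k s) <= max 0 B" for s
  using B[of "k s"] k0[of s] by (cases "s \<in> ?B t") auto
 have ki: "intg k"
 proof -
  have "intg (%s. indicator (?B t) s *\<^sub>R k s)"
   by (rule borel_integrable_compact) (auto intro: continuous_on_subset[OF kc])
  moreover have "indicator (?B t) s *\<^sub>R k s = k s" for s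
   using k0[of s] by (auto simp: indicator_def)
  ultimately show ?thesis by simp
 qed
 have kn: "nice k" using kc ki kB by (auto simp: nice_def bounded_iff)
 have int: "intg (%z. VG f z*cnj (VG k z))"
  by (rule int_dom[OF integrable_mult_left[OF integrable_norm[OF i], of "(sq_norm k + sq_norm (gaussian :: 'a => complex))/2"]], measurable)
   (simp only: norm_mult complex_mod_cnj mult_left_mono[OF STFT_bound[OF nice_L2[OF kn] L2_gaussian] norm_ge_zero])
 let ?C = "LBINT z. VG f z*bracket (tf_shift z gaussian) k"
 have "bracket h k = of_real (cg TYPE('a))*?C"
  unfolding h_def bracket_scale_left using bracket_synth[OF i nice_gaussian _ kB] by simp
 also have "?C = (LBINT z. VG f z*cnj (VG k z))"
  by (simp add: STFT_def bracket_sym)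
 also have "... = bracket f k*cnj (bracket gaussian (gaussian :: 'a => complex))"
  by (rule moyal[OF f(1) nice_gaussian kn nice_gaussian int])
 finally have "bracket h k = bracket f k"
  using cg_pos[where 'a='a] by (simp add: bracket_gaussian)
 hence "bracket (%s. h s - f s) k = 0"
  using bracket_diff_left[OF hL2 f(1) nice_L2[OF kn]] by simp
 hence "(LBINT s. (h s - f s)*cnj (k s)) = 0"
  by (simp add: bracket_lborel)
 moreover have eq: "(h s - f s)*cnj (k s) = of_real ((cmod (h s - f s))^2*?A t s)" for s
  by (simp only: k_def complex_cnj_mult complex_cnj_complex_of_real complex_norm_square of_real_mult) (simp only: mult.assoc)
 ultimately have 0: "(LBINT s. (cmod (h s - f s))^2*?A t s) = 0"
  by (simp only: integral_complex_of_real of_real_eq_0_iff)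
 have "intg (%s. (h s - f s)*cnj (k s))"
  by (rule L2_mult_integrable[OF L2_diff[OF hL2 f(1)] nice_L2[OF kn]])
 hence "intg (%s. (cmod (h s - f s))^2*?A t s)"
  unfolding eq by (simp only: complex_of_real_integrable_eq)
 hence AE: "AEL s. (cmod (h s - f s))^2*?A t s = 0"
  using 0 by (subst (asm) integral_nonneg_eq_0_iff_AE) auto
 have "(cmod (h t - f t))^2*max 0 (norm t + 1 - norm t) = 0"
  by (rule continuous_AE_zero[OF _ AE]) (intro continuous_intros hc f)
 thus ?thesis by (simp add: h_def)
qed

lemma MM_synth:
 assumes w: "tame w" and c: "intg (%z. cmod (c z)*w z)" "c \<in> BM"
  and k: "nice k" "MM w k"
 shows "MM w (synth c k)"
proof -
 obtain C where C: "1 <= C" "!!z1 z2. w (z1 + z2) <= C*w z1*w z2"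
  using tame_const[OF w] by blast
 have "0 <= C" using C(1) by simp
 note sw = synth_weighted[OF w this C(2) c k(1) nice_gaussian MM_D(3)[OF k(2)]]
 have "nice (synth c k)" by (rule synth_nice[OF sw(1) k(1)])
 thus ?thesis unfolding MM_def
  using nice_L2 sw(2) by (auto simp: nice_def)
qed

lemma MM_inversion:
 fixes f :: "'a::euclidean_space => complex"
 assumes w: "tame w" and f: "MM w f"
 shows "f = (%t. of_real (cg TYPE('a)) * synth (VG f) gaussian t)"
 using STFT_inversion[OF MM_D(2,1)[OF f] MM_STFT_integrable[OF w f]] by (rule ext)

lemma nice_cmult: "nice f ==> nice (%t. c*f t)"
 unfolding nice_def bounded_iff
proof (elim conjE exE, intro conjI exI ballI)
 fix B y assume "\<forall>x\<in>range f. cmod x <= B" "y \<in> range (%t. c*f t)"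
 thus "cmod y <= cmod c*B" by (auto simp: norm_mult intro!: mult_left_mono)
qed (auto intro!: continuous_intros)

text \<open>Inversion writes f as a synthesis integral with integrable coefficients, which yields
  the boundedness and integrability that \<open>MM\<close> does not mention.\<close>

lemma MM_nice: assumes w: "tame w" and f: "MM w f" shows "nice f"
 by (subst MM_inversion[OF w f], rule nice_cmult, rule synth_nice[OF MM_STFT_integrable[OF w f] nice_gaussian])

section \<open>The antidual of \<open>M\<^sup>1\<close>\<close>

definition N1 :: "('a::euclidean_space \<times> 'a => real) => ('a => complex) => real" where
 "N1 w f = (LBINT z. cmod (VG f z)*w z)"

lemma N1_nonneg: "tame w ==> 0 <= N1 w f"
 unfolding N1_def by (intro Bochner_Integration.integral_nonneg) (simp add: tameD(4))

lemma STFT_gaussian_window_integrable: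
 assumes w: "tame w" and g: "MM w g"
 shows "intg (%z. cmod (STFT g gaussian z)*w z)"
  and "(LBINT z. cmod (STFT g gaussian z)*w z) = N1 w g"
proof -
 note [measurable] = w g
 have eq: "cmod (STFT g gaussian z)*w z = cmod (VG g (0 - z))*w (0 - z)" for z
  using norm_STFT_swap[of g gaussian z] norm_STFT_swap[of gaussian g z] tameD(5)[OF w] by simp
 show "intg (%z. cmod (STFT g gaussian z)*w z)"
  unfolding eq using integrable_lborel_reflect[OF MM_D(3)[OF g], of 0] .
 show "(LBINT z. cmod (STFT g gaussian z)*w z) = N1 w g"
  unfolding eq N1_def by (rule integral_lborel_reflect) measurable
qed

text \<open>With f written by the inversion formula, its transform for the window g is dominated by
  the convolution of |VG f| with |STFT g gaussian|, and the latter is a reflection of |VG g|. The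
  constant depends on w alone.\<close>

lemma STFT_windows_weighted:
 fixes w :: "'a::euclidean_space \<times> 'a => real"
 assumes w: "tame w"
 obtains C where "0 <= C"
  "!!f g. MM w f ==> MM w g ==> intg (%z. cmod (STFT g f z)*w z)"
  "!!f g. MM w f ==> MM w g ==> (LBINT z. cmod (STFT g f z)*w z) <= C*N1 w f*N1 w g"
proof -
 obtain C where C: "1 <= C" "!!z1 z2. w (z1 + z2) <= C*w z1*w z2"
  using tame_const[OF w] by blast
 have C0: "0 <= C" using C by simp
 define c0 where "c0 = cg TYPE('a)"
 have key: "intg (%z. cmod (STFT g f z)*w z) & (LBINT z. cmod (STFT g f z)*w z) <= c0*C*N1 w f*N1 w g"
  if f: "MM w f" and g: "MM w g" for f g
 proof -
  note [measurable] = f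
  have m: "VG f \<in> BM" by measurable
  note sw = synth_weighted[OF w C0 C(2) MM_D(3)[OF f] m nice_gaussian MM_nice[OF w g] STFT_gaussian_window_integrable(1)[OF w g]]
  have eq: "cmod (STFT g f z)*w z = c0*(cmod (STFT g (synth (VG f) gaussian) z)*w z)" for z
   by (subst MM_inversion[OF w f]) (simp add: STFT_cmult norm_mult c0_def less_imp_le[OF cg_pos])
  have "(LBINT z. cmod (STFT g f z)*w z) <= c0*(C*N1 w f*N1 w g)"
   unfolding eq using sw(3) STFT_gaussian_window_integrable(2)[OF w g]
   by (simp add: N1_def c0_def less_imp_le[OF cg_pos])
  thus ?thesis unfolding eq using sw(2) by (simp add: mult.assoc)
 qed
 show ?thesis
  by (rule that[of "c0*C"]) (use key C0 in \<open>auto simp: c0_def less_imp_le[OF cg_pos]\<close>)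
qed

section \<open>Continuity of the reproducing kernel in the weighted norm and Gaussian
  approximation\<close>

definition RKc :: "'a::euclidean_space \<times> 'a => 'a*'a => 'a*'a => complex" where
 "RKc z' z x = (if dist z' z <= 1 then RK z' x else 0)"

lemma RKc_measurable [measurable (raw)]:
 assumes [measurable]: "z' \<in> borel_measurable M" "z \<in> borel_measurable M" "x \<in> borel_measurable M"
 shows "(%t. RKc (z' t) (z t) (x t :: 'a::euclidean_space \<times> 'a)) \<in> borel_measurable M"
 unfolding RKc_def by measurable

text \<open>The reason for cutting the kernel off: its centre z' stays within 1 of z, so |x - z|^2
  is at most 2 |x - z'|^2 + 2, and at the price of half the exponent one Gaussian centred at z
  dominates all admissible z'.\<close>

lemma RKc_le: "cmod (RKc z' z x) <= exp (pi/2)*exp (- (pi/4)*(norm (x - z :: 'a::euclidean_space \<times> 'a))^2)"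
proof (cases "dist z' z <= 1")
 case True
 let ?A = "- (pi/4)*(norm (x - z))^2"
 let ?B = "norm (x - z')"
 have "norm (x - z) <= norm (x - z') + norm (z' - z)"
  using norm_triangle_ineq[of "x - z'" "z' - z"] by simp
 also have "... <= norm (x - z') + 1" using True by (simp add: dist_norm)
 finally have "(norm (x - z))^2 <= (norm (x - z') + 1)^2" by (intro power_mono) auto
 also have "... <= 2*?B^2 + 2"
  using sum_squares_bound[of "norm (x - z')" 1] by (simp add: power2_sum)
 finally have "(pi/4)*(norm (x - z))^2 <= (pi/4)*(2*?B^2 + 2)"
  by (intro mult_left_mono) auto
 hence "- (pi/2)*?B^2 <= pi/2 + ?A"
  by (simp add: algebra_simps)
 hence "exp (- (pi/2)*?B^2) <= exp (pi/2 + ?A)"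
  by (simp only: exp_le_cancel_iff)
 also have "... = exp (pi/2)*exp ?A" by (rule exp_add)
 finally show ?thesis using RK_le[of z' x] True by (simp add: RKc_def)
qed (simp add: RKc_def)

lemma RKc_self: "RKc z z = RK z" by (simp add: RKc_def fun_eq_iff)

lemma continuous_RK: "continuous_on UNIV (%z. RK z x)"
proof -
 have "continuous_on UNIV (%z :: 'a*'a. VG gaussian (x - z))"
  by (rule continuous_on_compose2[OF continuous_on_STFT_gaussian]) (auto intro: continuous_intros)
 thus ?thesis unfolding RK_eq by (intro continuous_intros)
qed

text \<open>For z' within distance 1 of z this is the weighted M^1 distance of two shifted
  Gaussians; otherwise it is merely the norm of the one at z.\<close>

definition RKd :: "('a::euclidean_space \<times> 'a => real) => 'a*'a => 'a*'a => ennreal" where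
 "RKd w z' z = (NNINT x. en (cmod (RK z x - RKc z' z x)*w x))"

text \<open>The two properties that every approximation below consumes: a bound linear in w z, which
  makes integrals against an \<open>MM\<close> transform converge, and convergence to 0, by
  dominated convergence under the Gaussian of \<open>RKc_le\<close>.\<close>

lemma RKd:
 fixes w :: "'a::euclidean_space \<times> 'a => real"
 assumes w: "tame w"
 obtains G where "0 <= G" "!!z' z. RKd w z' z <= en (G*w z)"
  "!!s z. s ---> z ==> (%n. RKd w (s n) z) ---> 0"
proof -
 have [measurable]: "w \<in> BM" using w by (rule tame_measurable)
 obtain C where C: "1 <= C" "!!z1 z2. w (z1 + z2) <= C*w z1*w z2"
  using tame_const[OF w] by blast
 define e where "e x = w x*exp (- (pi/4)*(norm x)^2)" for x
 have e: "intg e" unfolding e_def by (rule tame_gaussian_integrable[OF w]) simp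
 have e0: "0 <= e x" for x unfolding e_def using tameD(4)[OF w, of x] by simp
 define G where "G = 2*exp (pi/2)*C*(LBINT x. e x)"
 have G: "0 <= G" unfolding G_def using C e0 by (intro mult_nonneg_nonneg Bochner_Integration.integral_nonneg) auto
 let ?A = "%z. 2*exp (pi/2)*C*w z"
 have ptw: "cmod (RK z x - RKc z' z x)*w x <= (?A z)*e (- z + x)" for z z' x
 proof -
  have "cmod (RK z x - RKc z' z x) <= cmod (RKc z z x) + cmod (RKc z' z x)"
   by (simp add: RKc_self norm_triangle_ineq4)
  also have "... <= 2*(exp (pi/2)*exp (- (pi/4)*(norm (x - z))^2))"
   using RKc_le[of z z x] RKc_le[of z' z x] by simp
  finally have "cmod (RK z x - RKc z' z x)*w x <= 2*(exp (pi/2)*exp (- (pi/4)*(norm (x - z))^2))*(C*w z*w (x - z))"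
   using C(2)[of z "x - z"] tameD(4)[OF w, of x] by (intro mult_mono) auto
  also have "... = (?A z)*e (- z + x)" by (simp add: e_def mult_ac)
  finally show ?thesis .
 qed
 let ?C = "%z e. NNINT x. en ((?A z)*e (- z + x))"
 have dom: "(?C z e) = en (G*w z)" for z
 proof -
  have pos: "0 <= 2*exp (pi/2)*C*w z" using C tameD(4)[OF w, of z] by simp
  have "(?C z e) = en (?A z)*(NNINT x. en (e (- z + x)))"
   using e pos unfolding ennreal_mult'[OF pos]
   by (intro nn_integral_cmult) (auto simp: e_def)
  also have "(NNINT x. en (e (- z + x))) = (NNINT x. en (e x))"
   using e by (intro nn_integral_lborel_shift[where f="%x. en (e x)"]) auto
  also have "... = en (LBINT x. e x)"
   using e e0 by (intro nn_integral_eq_integral) auto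
  finally show ?thesis using pos e0
   by (simp add: G_def Bochner_Integration.integral_nonneg mult_ac flip: ennreal_mult)
 qed
 let ?B = "%z x s. (%n. en (cmod (RK z x - RKc (s n) z x)*w x))"
 show ?thesis
 proof (rule that[OF G])
  show "RKd w z' z <= en (G*w z)" for z' z
   unfolding RKd_def dom[symmetric] using ptw by (intro nn_integral_mono ennreal_leI)
  fix s and z :: "'a*'a" assume s: "s ---> z"
  have "(%n. (NNINT x. en (cmod (RK z x - RKc (s n) z x)*w x))) ---> (NNINT (x :: 'a*'a). 0)"
  proof (rule nn_integral_dominated_convergence)
   show "AEL x. en (cmod (RK z x - RKc (s n) z x)*w x) <= en ((?A z)*e (- z + x))" for n
    using ptw by (intro AE_I2 ennreal_leI)
   show "(?C z e) < \<infinity>"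
    unfolding dom by simp
   have "(?B z x s) ---> 0" for x
   proof -
    have "eventually (%n. dist (s n) z <= 1) sequentially"
     using tendstoD[OF s, of 1] by (auto elim!: eventually_mono)
    hence ev: "eventually (%n. RK (s n) x = RKc (s n) z x) sequentially"
     by eventually_elim (simp add: RKc_def)
    have "(%n. RK (s n) x) ---> RK z x"
     by (rule continuous_on_tendsto_compose[OF continuous_RK s]) auto
    hence "(%n. RKc (s n) z x) ---> RK z x"
     using ev by (rule Lim_transform_eventually)
    hence "(?B z x s) ---> en (cmod (RK z x - RK z x)*w x)"
     by (intro tendsto_intros tendsto_ennrealI)
    thus ?thesis by simp
   qed
   thus "AEL x. (?B z x s) ---> 0" by simp
  qed (use e in \<open>auto simp: e_def\<close>)
  thus "(%n. RKd w (s n) z) ---> 0" by (simp add: RKd_def)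
 qed
qed

lemma RKd_measurable:
 assumes [measurable]: "s \<in> BM" "w \<in> BM"
 shows "(%z. RKd w (s z) z) \<in> BM"
 unfolding RKd_def by measurable

text \<open>Grouping an integral by the values of a simple function. It serves once for the
  transforms of the Riemann sums and once for the values of a functional on them.\<close>

lemma sum_integral_range:
 fixes u G :: "'b::euclidean_space => complex" and s :: "'b => 'b"
 assumes u: "intg u" and fin: "finite (range s)" and [measurable]: "s \<in> BM" "Measurable.pred borel P"
 shows "(\<Sum>k\<in>range s. (LBINT z. (if s z = k & P z then u z else 0))*G k) = (LBINT z. (if P z then u z*G (s z) else 0))"
proof -
 have [measurable]: "u \<in> BM" using u by auto
 have i: "intg (%z. if s z = k & P z then u z else 0)" for k
  by (rule int_bound[OF u]) auto
 let ?A = "%z. \<Sum>k\<in>range s. (if s z = k & P z then u z else 0)*G k"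
 have "(\<Sum>k\<in>range s. (LBINT z. (if s z = k & P z then u z else 0))*G k)
   = (LBINT z. ?A z)"
  using i by simp
 also have "... = (LBINT z. (if P z then u z*G (s z) else 0))"
 proof (intro Bochner_Integration.integral_cong refl)
  fix z
  have "(?A z) = (\<Sum>k\<in>range s. if k = s z then (if P z then u z*G (s z) else 0) else 0)"
   by (intro sum.cong refl) auto
  thus "(?A z) = (if P z then u z*G (s z) else 0)"
   using fin by simp
 qed
 finally show ?thesis .
qed

text \<open>The mass of u on a level set of s, restricted to points that s moves by at most 1: a
  sequence of simple functions tends to the identity only pointwise, so far-off values must be
  discarded.\<close>

definition approx_coeff :: "('b::euclidean_space => complex) => ('b => 'b) => 'b => complex" where
 "approx_coeff u s k = (LBINT z. (if s z = k & dist (s z) z <= 1 then u z else 0))"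

definition gauss_approx :: "('a::euclidean_space => complex) => ('a*'a => 'a*'a) => 'a => complex" where
 "gauss_approx f s = (%t. \<Sum>k\<in>range s. (of_real (cg TYPE('a))*approx_coeff (VG f) s k)*tf_shift k gaussian t)"

text \<open>Riemann-type sums of the inversion formula, along simple functions \<open>s n\<close> converging to the
 identity and cut off to the set where \<open>s n z\<close> is close to \<open>z\<close>.\<close>

lemma MM_approx:
 fixes f :: "'a::euclidean_space => complex"
 assumes w: "tame w" and f: "MM w f" and fin: "!!n::nat. finite (range (s n))"
  and sm: "!!n. s n \<in> BM" and lim: "!!z. (%n. s n z) ---> z"
 shows "gauss_approx f (s n) \<in> gauss_span"
  and "(%n. (NNINT x. en (cmod (VG (%t. f t - gauss_approx f (s n) t) x)*w x))) ---> 0"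
proof -
 have [measurable]: "w \<in> BM" using w by (rule tame_measurable)
 have [measurable]: "f \<in> BM" using f by (rule MM_measurable)
 have [measurable]: "s n \<in> BM" for n by (rule sm)
 define u where "u = VG f"
 have u: "intg u" unfolding u_def by (rule MM_STFT_integrable[OF w f])
 have [measurable]: "u \<in> BM" using u by auto
 define c0 where "c0 = cg TYPE('a)"
 have c0: "0 < c0" by (simp add: c0_def)
 let ?E = "gauss_approx f"
 show sp: "?E (s n) \<in> gauss_span" for n
  unfolding gauss_span_def gauss_approx_def using fin[of n]
  by (intro CollectI exI[of _ "range (s n)"] exI[of _ "%k. of_real (cg TYPE('a))*approx_coeff (VG f) (s n) k"] conjI refl)
 obtain G where G: "0 <= G" "!!z' z. RKd w z' z <= en (G*w z)"
  "!!s z. s ---> z ==> (%n. RKd w (s n) z) ---> 0"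
  by (rule RKd[OF w]) (rule that)
 have ux: "intg (%z. u z * RK z x)" for x unfolding u_def by (rule STFT_reproducing(2)[OF MM_D(2)[OF f]])
 have RK1: "cmod (RK z x) <= 1" for z x :: "'a*'a"
  using RK_le[of z x] by (rule order_trans) simp
 have RKc1: "cmod (RKc z' z x) <= 1" for z' z x :: "'a*'a"
  using RK1 by (simp add: RKc_def)
 have uxc: "intg (%z. u z * RKc (s n z) z x)" for n x
  by (rule int_dom[OF integrable_norm[OF u]], measurable) (simp add: norm_mult mult_left_le RKc1)
 have Sapp: "VG (?E (s n)) x = of_real c0*(LBINT z. u z * RKc (s n z) z x)" for n x
 proof -
  have "VG (?E (s n)) x = (\<Sum>k\<in>range (s n). of_real c0*approx_coeff u (s n) k * RK k x)"
   using fin[of n] by (simp add: STFT_def gauss_approx_def c0_def u_def bracket_sum_left bracket_scale_left L2_cmult)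
  also have "... = of_real c0*(\<Sum>k\<in>range (s n). approx_coeff u (s n) k * RK k x)"
   by (simp add: sum_distrib_left mult.assoc)
  also have "(\<Sum>k\<in>range (s n). approx_coeff u (s n) k * RK k x) = (LBINT z. (if dist (s n z) z <= 1 then u z * RK (s n z) x else 0))"
   unfolding approx_coeff_def by (rule sum_integral_range[OF u fin]) measurable
  also have "... = (LBINT z. u z * RKc (s n z) z x)"
   by (intro Bochner_Integration.integral_cong) (auto simp: RKc_def)
  finally show ?thesis .
 qed
 let ?A = "%s n. VG (%t. f t - ?E (s n) t)"
 have diff: "?A s n x = of_real c0*(LBINT z. u z*(RK z x - RKc (s n z) z x))" for n x
 proof -
  have "?A s n x = VG f x - VG (?E (s n)) x"
   by (rule STFT_diff[OF MM_D(2)[OF f] MM_D(2)[OF gauss_span_MM[OF w sp]] L2_gaussian])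
  also have "... = of_real c0*((LBINT z. u z * RK z x) - (LBINT z. u z * RKc (s n z) z x))"
   unfolding Sapp using STFT_reproducing(1)[OF MM_D(2)[OF f], of x] by (simp add: c0_def u_def right_diff_distrib)
  finally show ?thesis using ux uxc by (simp add: right_diff_distrib)
 qed
 let ?B = "%u z. en (c0*cmod (u z))"
 let ?C = "%u s n. NNINT z. ?B u z * RKd w (s n z) z"
 let ?D = "%s n. NNINT x. en (cmod (?A s n x)*w x)"
 have le: "(?D s n)
   <= ?C u s n" for n
 proof -
  have "(?D s n)
    <= (NNINT x. (NNINT z. ?B u z*en (cmod (RK z x - RKc (s n z) z x)*w x)))"
  proof (rule nn_integral_mono)
   fix x
   have wx: "0 <= w x" by (rule tameD(4)[OF w])
   have "en (cmod (?A s n x)) = en (cmod (LBINT z. of_real c0*(u z*(RK z x - RKc (s n z) z x))))"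
    unfolding diff by simp
   also have "... <= (NNINT z. en (cmod (of_real c0*(u z*(RK z x - RKc (s n z) z x)))))"
    by (rule integral_norm_le_nn)
   finally have "en (cmod (?A s n x))*en (w x) <= (NNINT z. en (cmod (of_real c0*(u z*(RK z x - RKc (s n z) z x)))))*en (w x)"
    by (rule mult_right_mono) simp
   also have "... = (NNINT z. en (cmod (of_real c0*(u z*(RK z x - RKc (s n z) z x))))*en (w x))"
    by (rule nn_integral_multc[symmetric]) measurable
   also have "... = (NNINT z. ?B u z*en (cmod (RK z x - RKc (s n z) z x)*w x))"
    using c0 wx by (simp add: norm_mult mult_ac flip: ennreal_mult)
   finally show "en (cmod (?A s n x)*w x) <= (NNINT z. ?B u z*en (cmod (RK z x - RKc (s n z) z x)*w x))"
    using wx by (simp add: ennreal_mult)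
  qed
  also have "... = (NNINT z. (NNINT x. ?B u z*en (cmod (RK z x - RKc (s n z) z x)*w x)))"
   by (rule lborel_pair.Fubini') measurable
  also have "... = ?C u s n"
   unfolding RKd_def by (intro nn_integral_cong nn_integral_cmult) measurable
  finally show ?thesis .
 qed
 \<comment> \<open>The majorant is a multiple of |u z|*w z, integrable because f lies in
   \<open>MM\<close>; here the linear bound on \<open>RKd\<close> is spent.\<close>
 have "(%n. ?C u s n) ---> (NNINT (z :: 'a*'a). 0)"
 proof (rule nn_integral_dominated_convergence)
  show "AEL z. ?B u z * RKd w (s n z) z <= ?B u z*en (G*w z)" for n
   by (intro AE_I2 mult_left_mono G) simp
  have "intg (%z. (c0*G)*(cmod (u z)*w z))"
   using MM_D(3)[OF f] by (intro integrable_mult_right) (simp add: u_def)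
  hence "(NNINT z. en (norm ((c0*G)*(cmod (u z)*w z)))) < \<infinity>" by (rule integrable_nn_less_top)
  thus "(NNINT z. ?B u z*en (G*w z)) < \<infinity>"
   using c0 G(1) tameD(4)[OF w] by (simp add: abs_mult mult_ac flip: ennreal_mult)
  have "(%n. ?B u z * RKd w (s n z) z) ---> ?B u z*0" for z
   using G(3)[OF lim[of z]] by (intro ennreal_tendsto_cmult) auto
  thus "AEL z. (%n. ?B u z * RKd w (s n z) z) ---> 0"
   by simp
  have [measurable]: "(%z. RKd w (s n z) z) \<in> BM" for n by (rule RKd_measurable) measurable
  show "(%z. ?B u z * RKd w (s n z) z) \<in> borel_measurable lborel" for n by measurable
 qed measurable
 hence lim0: "(%n. ?C u s n) ---> 0" by simp
 show "(%n. ?D s n) ---> 0"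
  by (rule tendsto_sandwich[OF _ _ tendsto_const lim0]) (auto simp: le)
qed

lemma simple_approx_id:
 obtains s :: "nat => 'b::euclidean_space => 'b"
 where "!!n. finite (range (s n))" "!!n. s n \<in> BM" "!!z. (%n. s n z) ---> z"
proof -
 have "(%x. x) \<in> borel_measurable (borel :: 'b measure)" by measurable
 from borel_measurable_implies_sequence_metric[OF this, of 0] obtain s :: "nat => 'b => 'b"
  where s: "\<forall>i. simple_function borel (s i)" "\<forall>x\<in>space borel. (%i. s i x) ---> x"
  by blast
 show ?thesis
  using s simple_functionD(1)[of borel "s _"]
  by (intro that[of s]) (auto intro: borel_measurable_simple_function)
qed

text \<open>The direction from \<open>MM\<close> is density of the Gaussian span, supplied by the
  Riemann-type sums.\<close>

theorem M1_iff:
 assumes w: "tame w"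
 shows "f \<in> M1 w \<longleftrightarrow> MM w f"
proof
 assume f: "MM w f"
 note [measurable] = w
 obtain s where s: "!!n. finite (range (s n))" "!!n. s n \<in> BM" "!!z :: 'a*'a. (%n. s n z) ---> z"
  by (rule simple_approx_id) (rule that)
 note ap = MM_approx[OF w f s]
 note [measurable] = f
 have "L2 (%t. f t - gauss_approx f (s n) t)" for n
  using MM_D(2)[OF f] MM_D(2)[OF gauss_span_MM[OF w ap(1)]] by blast
 hence "(%n. mod_norm 1 1 w (bracket (%t. f t - gauss_approx f (s n) t))) ---> 0"
  using ap(2) by (simp add: mod_norm_11)
 thus "f \<in> M1 w"
  using ap(1) MM_D(1,2)[OF f] by (auto simp: M1_def L2_def integrable_completion intro!: exI[of _ "%n. gauss_approx f (s n)"])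
qed (rule M1_imp_MM[OF w])

lemma mod_norm_N1:
 assumes w: "tame w" and f: "MM w f"
 shows "mod_norm 1 1 w (bracket f) = en (N1 w f)"
 using MM_D(3)[OF f] tameD(4)[OF w]
 by (simp add: mod_norm_11[OF MM_D(2)[OF f] tame_measurable[OF w]] N1_def nn_integral_eq_integral)

lemma antidualD:
 assumes w: "tame w" and F: "F \<in> M1_antidual w"
 shows "MM w f ==> MM w g ==> F (%t. c*f t + g t) = cnj c*F f + F g"
  and "F (%t. 0) = 0"
  and "MM w f ==> F (%t. c*f t) = cnj c*F f"
  and "MM w f ==> MM w g ==> F (%t. f t - g t) = F f - F g"
  and "finite A ==> (!!i. i \<in> A ==> MM w (h i)) ==> F (%t. \<Sum>i\<in>A. c' i*h i t) = (\<Sum>i\<in>A. cnj (c' i)*F (h i))"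
  and "\<exists>C\<ge>0. \<forall>g. MM w g --> cmod (F g) <= C*N1 w g"
proof -
 show lin: "F (%t. c*f t + g t) = cnj c*F f + F g" if "MM w f" "MM w g" for f g c
  using F that M1_iff[OF w] by (auto simp: M1_antidual_def)
 show z: "F (%t. 0) = 0"
  using lin[OF MM_0 MM_0, of 1] by simp
 show sc: "F (%t. c*f t) = cnj c*F f" if "MM w f" for f c
  using lin[OF that MM_0, of c] z by simp
 show "F (%t. f t - g t) = F f - F g" if "MM w f" "MM w g" for f g
  using lin[OF that(2,1), of "-1"] by simp
 show "F (%t. \<Sum>i\<in>A. c' i*h i t) = (\<Sum>i\<in>A. cnj (c' i)*F (h i))" if "finite A" "!!i. i \<in> A ==> MM w (h i)"
  using that
 proof (induction A rule: finite_induct)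
  case (insert x A)
  have "MM w (%t. \<Sum>i\<in>A. c' i*h i t)" using insert by (intro MM_sum[OF w] MM_cmult) auto
  from lin[OF _ this, of "h x" "c' x"] show ?case using insert by simp
 qed (simp add: z)
 have "\<exists>C::real. \<forall>g\<in>M1 w. en (cmod (F g)) <= en C*mod_norm 1 1 w (bracket g)"
  using F by (simp add: M1_antidual_def)
 then obtain C where C: "!!g. g \<in> M1 w ==> en (cmod (F g)) <= en C*mod_norm 1 1 w (bracket g)"
  by metis
 show "\<exists>C\<ge>0. \<forall>g. MM w g --> cmod (F g) <= C*N1 w g"
 \<comment> \<open>\<open>ennreal\<close> maps a negative C to 0, so replacing C by max 0 C does not
   tighten the bound and gives a nonnegative real constant.\<close>
 proof (intro exI[of _ "max 0 C"] conjI allI impI)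
  fix g assume g: "MM w g"
  have "en (cmod (F g)) <= en C*en (N1 w g)"
   using C[of g] M1_iff[OF w] g mod_norm_N1[OF w g] by simp
  also have "... <= en (max 0 C)*en (N1 w g)"
   by (intro mult_right_mono ennreal_leI) auto
  also have "... = en (max 0 C*N1 w g)"
   using N1_nonneg[OF w, of g] by (intro ennreal_mult[symmetric]) auto
  finally show "cmod (F g) <= max 0 C*N1 w g"
   using N1_nonneg[OF w, of g] by (subst (asm) ennreal_le_iff) auto
 qed simp
qed

lemma antidualI:
 assumes w: "tame w"
  and lin: "!!f g c. MM w f ==> MM w g ==> F (%t. c*f t + g t) = cnj c*F f + F g"
  and b: "0 <= C" "!!g. MM w g ==> cmod (F g) <= C*N1 w g"
 shows "F \<in> M1_antidual w"
proof -
 have "en (cmod (F g)) <= en C*mod_norm 1 1 w (bracket g)" if "MM w g" for g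
  using b(2)[OF that] b(1) N1_nonneg[OF w, of g] by (simp add: mod_norm_N1[OF w that] flip: ennreal_mult)
 thus ?thesis using lin M1_iff[OF w] unfolding M1_antidual_def by blast
qed

lemma N1_RK:
 assumes w: "tame w"
 obtains G where "0 <= G" "!!z. N1 w (tf_shift z gaussian) <= G*w z"
 using tame_RK_integrable(2)[OF w] unfolding N1_def by blast

text \<open>Both claims concern shifted Gaussians as elements of M^1: they depend continuously on
  the shift, by \<open>RKd\<close>, and their norm grows at most like w.\<close>

lemma antidual_stft:
 assumes w: "tame w" and F: "F \<in> M1_antidual w"
 shows "continuous_on UNIV (stft gaussian F)"
  and "\<exists>C\<ge>0. \<forall>z. cmod (stft gaussian F z) <= C*w z"
proof -
 obtain C where C: "0 <= C" "!!g. MM w g ==> cmod (F g) <= C*N1 w g"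
  using antidualD(6)[OF w F] by blast
 obtain G where G: "0 <= G" "!!z. N1 w (tf_shift z gaussian) <= G*w z"
  by (rule N1_RK[OF w]) (rule that)
 let ?A = "stft gaussian F"
 have "cmod (?A z) <= (C*G)*w z" for z
  unfolding stft_def using C(2)[OF MM_tf_gaussian[OF w, of z]] mult_left_mono[OF G(2)[of z] C(1)] by simp
 thus "\<exists>C\<ge>0. \<forall>z. cmod (?A z) <= C*w z"
  using C(1) G(1) by (intro exI[of _ "C*G"]) auto
 obtain G' where G': "!!s z. s ---> z ==> (%n. RKd w (s n) z) ---> 0"
  using RKd[OF w] by metis
 let ?B = "%z x n. (%t. tf_shift z gaussian t - tf_shift (x n) gaussian t)"
 let ?C = "%z x n. cmod (?A z - ?A (x n))"
 show "continuous_on UNIV ?A"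
  unfolding continuous_on_sequentially
 proof (intro allI ballI impI, elim conjE)
  fix x :: "nat => 'a*'a" and z assume x: "x ---> z"
  have "eventually (%n. dist (x n) z <= 1) sequentially"
   using tendstoD[OF x, of 1] by (auto elim!: eventually_mono)
  hence ev: "eventually (%n. en (?C z x n) <= en C * RKd w (x n) z) sequentially"
  proof eventually_elim
   case (elim n)
   note m = MM_diff[OF w MM_tf_gaussian[OF w, of z] MM_tf_gaussian[OF w, of "x n"]]
   have "?C z x n = cmod (F (?B z x n))"
    by (simp add: stft_def antidualD(4)[OF w F] MM_tf_gaussian[OF w])
   also have "... <= C*N1 w (?B z x n)"
    by (rule C(2)[OF m])
   finally have "en (?C z x n) <= en (C*N1 w (?B z x n))"
    by (rule ennreal_leI)
   also have "... = en C*mod_norm 1 1 w (bracket (?B z x n))"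
    using mod_norm_N1[OF w m] C(1) by (simp add: ennreal_mult')
   also have "mod_norm 1 1 w (bracket (?B z x n)) = RKd w (x n) z"
    using elim by (simp add: mod_norm_11[OF MM_D(2)[OF m] tame_measurable[OF w]] RKd_def RKc_def STFT_diff)
   finally show ?case .
  qed
  have "(%n. en C * RKd w (x n) z) ---> en C*0"
   by (intro ennreal_tendsto_cmult G'[OF x]) simp
  hence lim0: "(%n. en C * RKd w (x n) z) ---> 0" by simp
  have "(%n. en (?C z x n)) ---> 0"
   by (rule tendsto_sandwich[OF _ ev tendsto_const lim0]) auto
  hence "(%n. ?C z x n) ---> 0"
   using tendsto_ennreal_iff[of "%n. ?C z x n" sequentially 0] by simp
  hence "(%n. ?A z - ?A (x n)) ---> 0" by (rule tendsto_norm_zero_cancel)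
  hence "(%n. ?A z - (?A z - ?A (x n))) ---> ?A z - 0"
   by (intro tendsto_intros)
  thus "(?A \<circ> x) ---> ?A z" by (simp add: o_def)
 qed
qed

text \<open>Antilinearity evaluates F on the Riemann sums of g. Continuity of F gives the limit on
  one side and dominated convergence on the other, so the inversion formula holds under the
  functional. All later integral formulas for functionals rest on this.\<close>

lemma antidual_rep:
 fixes F :: "('a::euclidean_space => complex) => complex"
 assumes w: "tame w" and F: "F \<in> M1_antidual w" and g: "MM w g"
 shows "intg (%z. stft gaussian F z*cnj (VG g z))"
  and "F g = of_real (cg TYPE('a))*(LBINT z. stft gaussian F z*cnj (VG g z))"
proof -
 define u where "u = VG g"
 have u: "intg u" unfolding u_def by (rule MM_STFT_integrable[OF w g])
 have [measurable]: "u \<in> BM" using u by auto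
 let ?B = "stft gaussian F"
 have Fc: "continuous_on UNIV ?B" by (rule antidual_stft[OF w F])
 have [measurable]: "?B \<in> BM" by (rule BM_contI[OF Fc])
 obtain K where K: "0 <= K" "!!z. cmod (?B z) <= K*w z"
  using antidual_stft(2)[OF w F] by blast
 obtain M where M: "1 <= M" "!!z. norm z <= 1 ==> w z <= M"
  using tame_bounded_on_ball[OF w, of 1] by blast
 obtain C where C: "1 <= C" "!!z1 z2. w (z1 + z2) <= C*w z1*w z2"
  using tame_const[OF w] by blast
 \<comment> \<open>Moving the point by at most 1 changes the weight by a bounded factor, so the
   growth bound at the sampled point can be stated at z; this gives a majorant independent of
   n.\<close>
 have near: "cmod (?B z') <= K*C*M*w z" if "dist z' z <= 1" for z z'
 proof -
  have "w z' <= C*w (z' - z)*w z" using C(2)[of "z' - z" z] by simp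
  also have "... <= C*M*w z"
   using C(1) M(2)[of "z' - z"] that tameD(4)[OF w, of z] by (intro mult_right_mono mult_left_mono) (auto simp: dist_norm)
  finally have "K*w z' <= K*(C*M*w z)" using K(1) by (rule mult_left_mono)
  thus ?thesis using K(2)[of z'] by (simp add: mult_ac)
 qed
 have dom: "intg (%z. (K*C*M)*(cmod (u z)*w z))"
  using MM_D(3)[OF g] by (intro integrable_mult_right) (simp add: u_def)
 let ?J = "%z. (K*C*M)*(cmod (u z)*w z)"
 show "intg (%z. ?B z*cnj (VG g z))"
  unfolding u_def[symmetric]
 proof (rule int_dom[OF dom])
  show "cmod (?B z*cnj (u z)) <= ?J z" for z
   using mult_right_mono[OF near[of z z], of "cmod (u z)"] by (simp add: norm_mult mult_ac)
 qed measurable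
 obtain s where s: "!!n. finite (range (s n))" "!!n. s n \<in> BM" "!!z :: 'a*'a. (%n. s n z) ---> z"
  by (rule simple_approx_id) (rule that)
 have [measurable]: "s n \<in> BM" for n by (rule s(2))
 note ap = MM_approx[OF w g s]
 let ?C = "%g n. gauss_approx g (s n)"
 have apM: "MM w (?C g n)" for n by (rule gauss_span_MM[OF w ap(1)])
 obtain K' where K': "0 <= K'" "!!g. MM w g ==> cmod (F g) <= K'*N1 w g"
  using antidualD(6)[OF w F] by blast
 let ?A = "%n z. if dist (s n z) z <= 1 then cnj (u z)*?B (s n z) else 0"
 let ?E = "%n. \<Sum>k\<in>range (s n). (LBINT z. (if s n z = k & dist (s n z) z <= 1 then cnj (u z) else 0))*?B k"
 let ?F = "of_real (cg TYPE('a))"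
 let ?I = "%n. \<Sum>k\<in>range (s n). cnj (approx_coeff u (s n) k)*?B k"
 have Fs: "F (?C g n) = ?F*(LBINT z. ?A n z)" for n
 proof -
  have "F (?C g n) = (\<Sum>k\<in>range (s n). ?F*(cnj (approx_coeff u (s n) k)*?B k))"
   unfolding gauss_approx_def
   by (subst antidualD(5)[OF w F s(1) MM_tf_gaussian[OF w]]) (simp add: u_def stft_def mult.assoc)
  also have "... = ?F*(?I n)"
   by (simp add: sum_distrib_left)
  also have "(?I n) = ?E n"
   unfolding approx_coeff_def by (simp flip: Bochner_Integration.integral_cnj add: if_distrib[of cnj] cong: if_cong)
  also have "(?E n)
    = (LBINT z. ?A n z)"
   using u s(1) by (intro sum_integral_range) auto
  finally show ?thesis .
 qed
 let ?H = "%z. (%n. ?A n z) ---> cnj (u z)*?B z"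
 have 1: "(%n. (LBINT z. ?A n z)) ---> (LBINT z. cnj (u z)*?B z)"
 proof (rule integral_dominated_convergence[OF _ _ dom])
  show "AEL z. cmod (?A n z) <= ?J z" for n
  proof (rule AE_I2)
   fix z
   show "cmod (?A n z) <= ?J z"
    using mult_left_mono[OF near[of "s n z" z], of "cmod (u z)"] K C M tameD(4)[OF w, of z]
    by (auto simp: norm_mult mult_ac)
  qed
  have "?H z" for z
  proof -
   have "eventually (%n. dist (s n z) z <= 1) sequentially"
    using tendstoD[OF s(3)[of z], of 1] by (auto elim!: eventually_mono)
   hence ev: "eventually (%n. cnj (u z)*?B (s n z) = ?A n z) sequentially"
    by eventually_elim simp
   have "(%n. ?B (s n z)) ---> ?B z"
    by (rule continuous_on_tendsto_compose[OF Fc s(3)]) auto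
   hence "(%n. cnj (u z)*?B (s n z)) ---> cnj (u z)*?B z"
    by (intro tendsto_intros)
   thus ?thesis using ev by (rule Lim_transform_eventually)
  qed
  thus "AEL z. ?H z"
   by simp
 qed measurable
 have 1: "(%n. F (?C g n)) ---> ?F*(LBINT z. cnj (u z)*?B z)"
  unfolding Fs using 1 by (intro tendsto_intros)
 let ?D = "%g n. NNINT x. en (cmod (VG (%t. g t - ?C g n t) x)*w x)"
 have "(%n. en K'*(?D g n)) ---> en K'*0"
  by (intro ennreal_tendsto_cmult ap(2)) simp
 hence lim0: "(%n. en K'*(?D g n)) ---> 0"
  by simp
 let ?G = "%g n. cmod (F g - F (?C g n))"
 have le: "en (?G g n) <= en K'*(?D g n)" for n
 proof -
  note m = MM_diff[OF w g apM[of n]]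
  have "?G g n <= K'*N1 w (%t. g t - ?C g n t)"
   using K'(2)[OF m] antidualD(4)[OF w F g apM[of n]] by simp
  hence "en (?G g n) <= en K'*en (N1 w (%t. g t - ?C g n t))"
   using K'(1) N1_nonneg[OF w] by (simp flip: ennreal_mult)
  thus ?thesis
   using mod_norm_N1[OF w m] by (simp add: mod_norm_11[OF MM_D(2)[OF m] tame_measurable[OF w]])
 qed
 have "(%n. en (?G g n)) ---> 0"
  by (rule tendsto_sandwich[OF _ _ tendsto_const lim0]) (auto simp: le)
 hence "(%n. ?G g n) ---> 0"
  using tendsto_ennreal_iff[of "%n. ?G g n" sequentially 0] by simp
 hence "(%n. F g - F (?C g n)) ---> 0" by (rule tendsto_norm_zero_cancel)
 hence "(%n. F g - (F g - F (?C g n))) ---> F g - 0" by (intro tendsto_intros)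
 hence "(%n. F (?C g n)) ---> F g" by simp
 from LIMSEQ_unique[OF this 1] show "F g = ?F*(LBINT z. ?B z*cnj (VG g z))"
  by (simp add: u_def mult.commute)
qed

section \<open>Mixed norms\<close>

lemma ennreal_powr_measurable [measurable (raw)]:
 assumes [measurable]: "f \<in> borel_measurable M"
 shows "(%x. ennreal_powr (f x) r) \<in> borel_measurable M"
 unfolding ennreal_powr_def by measurable

lemma ennreal_powr_ennreal: "0 <= x ==> ennreal_powr (en x) r = en (x powr r)"
 by (simp add: ennreal_powr_def)

lemma ennreal_powr_top [simp]: "ennreal_powr top r = top"
 by (simp add: ennreal_powr_def)

lemma ennreal_powr_0 [simp]: "ennreal_powr 0 r = 0"
 by (simp add: ennreal_powr_def)

lemma ennreal_powr_inverse: "0 < r ==> ennreal_powr (ennreal_powr x r) (1/r) = x"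
 by (cases x) (auto simp: ennreal_powr_ennreal powr_powr)

lemma ennreal_powr_inverse': "0 < r ==> ennreal_powr (ennreal_powr x (1/r)) r = x"
 using ennreal_powr_inverse[of "1/r" x] by simp

lemma ennreal_powr_mono: "0 <= r ==> x <= y ==> ennreal_powr x r <= ennreal_powr y r"
 by (cases x; cases y) (auto simp: ennreal_powr_ennreal powr_mono2 top_unique)

lemma ennreal_powr_le_iff: "0 < r ==> ennreal_powr x r <= ennreal_powr y r \<longleftrightarrow> x <= y"
 using ennreal_powr_mono[of r x y] ennreal_powr_mono[of "1/r" "ennreal_powr x r" "ennreal_powr y r"]
 by (auto simp: ennreal_powr_inverse)

lemma ennreal_powr_eq_0_iff: "ennreal_powr x r = 0 \<longleftrightarrow> x = 0"
 by (cases x) (auto simp: ennreal_powr_ennreal)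

lemma ennreal_powr_mult: "ennreal_powr (x*y) r = ennreal_powr x r*ennreal_powr y r"
proof (cases "x = 0 \<or> y = 0")
 case False
 thus ?thesis
 proof (cases "x = top \<or> y = top")
  case True thus ?thesis using False by (auto simp: ennreal_mult_eq_top_iff ennreal_top_mult ennreal_mult_top ennreal_powr_eq_0_iff)
 next
  case False
  then obtain a b where "x = en a" "0 <= a" "y = en b" "0 <= b" by (cases x; cases y) auto
  thus ?thesis by (simp add: ennreal_powr_ennreal powr_mult flip: ennreal_mult)
 qed
qed auto

lemma enn2real_ge_1: "1 <= p ==> p ~= \<infinity> ==> 1 <= enn2real p"
 by (cases p) auto

text \<open>The interface to the norm: both cases become statements over \<open>lborel\<close>
  without essential supremum or outer root, and all later estimates go through them.\<close>

lemma Lp_norm_le_iff: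
 assumes [measurable]: "f \<in> BM" and p: "1 <= p"
 shows "p = \<infinity> ==> Lp_norm p f <= B \<longleftrightarrow> (AEL x. f x <= B)"
  and "p ~= \<infinity> ==> Lp_norm p f <= B \<longleftrightarrow> (NNINT x. ennreal_powr (f x) (enn2real p)) <= ennreal_powr B (enn2real p)"
proof -
 have m: "f \<in> borel_measurable lebesgue" by (rule measurable_completion) simp
 show "Lp_norm p f <= B \<longleftrightarrow> (AEL x. f x <= B)" if "p = \<infinity>"
 proof
  assume "Lp_norm p f <= B"
  hence "esssup lebesgue f <= B" using that by (simp add: Lp_norm_def)
  moreover have "AE x in lebesgue. f x <= esssup lebesgue f" by (rule esssup_AE)
  ultimately have "AE x in lebesgue. f x <= B" by (auto elim: eventually_mono intro: order_trans)
  thus "AEL x. f x <= B" by (simp add: AE_completion_iff)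
 next
  assume "AEL x. f x <= B"
  thus "Lp_norm p f <= B" using that m by (simp add: Lp_norm_def esssup_I AE_completion)
 qed
 let ?A = "NNINT x. ennreal_powr (f x) (enn2real p)"
 show "Lp_norm p f <= B \<longleftrightarrow> ?A <= ennreal_powr B (enn2real p)" if "p ~= \<infinity>"
 proof -
  have P: "0 < enn2real p" using enn2real_ge_1[OF p that] by simp
  have "Lp_norm p f = ennreal_powr ?A (1/enn2real p)"
   using that by (simp add: Lp_norm_def nn_integral_completion)
  thus ?thesis
   using ennreal_powr_le_iff[OF P, of "ennreal_powr ?A (1/enn2real p)" B]
   by (simp add: ennreal_powr_inverse'[OF P])
 qed
qed

lemma Lp_norm_mono:
 assumes [measurable]: "f \<in> BM" "g \<in> BM" and p: "1 <= p"
  and le: "AEL x. f x <= g x"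
 shows "Lp_norm p f <= Lp_norm p g"
proof (cases "p = \<infinity>")
 case True
 have "AEL x. g x <= Lp_norm p g" using Lp_norm_le_iff(1)[of g p "Lp_norm p g"] True p by simp
 hence "AEL x. f x <= Lp_norm p g" using le by eventually_elim auto
 thus ?thesis using Lp_norm_le_iff(1)[of f p] True p by simp
next
 case False
 have P: "0 < enn2real p" using enn2real_ge_1[OF p False] by simp
 have "(NNINT x. ennreal_powr (f x) (enn2real p)) <= (NNINT x. ennreal_powr (g x) (enn2real p))"
  using le P by (intro nn_integral_mono_AE) (auto elim!: eventually_mono intro!: ennreal_powr_mono)
 also have "... <= ennreal_powr (Lp_norm p g) (enn2real p)"
  using Lp_norm_le_iff(2)[of g p "Lp_norm p g"] False p by simp
 finally show ?thesis using Lp_norm_le_iff(2)[of f p] False p by simp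
qed

lemma Lp_norm_cmult:
 assumes [measurable]: "f \<in> BM" and p: "1 <= p"
 shows "Lp_norm p (%x. c*f x) <= c*Lp_norm p f"
proof (cases "p = \<infinity>")
 case True
 have "AEL x. f x <= Lp_norm p f" using Lp_norm_le_iff(1)[of f p "Lp_norm p f"] True p by simp
 hence "AEL x. c*f x <= c*Lp_norm p f" by eventually_elim (rule mult_left_mono, auto)
 thus ?thesis using Lp_norm_le_iff(1)[of "%x. c*f x" p] True p by simp
next
 case False
 have "(NNINT x. ennreal_powr (c*f x) (enn2real p)) = ennreal_powr c (enn2real p)*(NNINT x. ennreal_powr (f x) (enn2real p))"
  by (simp add: ennreal_powr_mult nn_integral_cmult)
 also have "... <= ennreal_powr c (enn2real p)*ennreal_powr (Lp_norm p f) (enn2real p)"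
  using Lp_norm_le_iff(2)[of f p "Lp_norm p f"] False p by (intro mult_left_mono) auto
 finally show ?thesis using Lp_norm_le_iff(2)[of "%x. c*f x" p] False p by (simp add: ennreal_powr_mult)
qed

lemma Lp_norm_shift:
 fixes f :: "'a::euclidean_space => ennreal"
 assumes [measurable]: "f \<in> BM" and p: "1 <= p"
 shows "Lp_norm p (%x. f (c + x)) = Lp_norm p f"
proof -
 have le: "Lp_norm p (%x. f (c + x)) <= Lp_norm p f" if [measurable]: "f \<in> BM" for f :: "'a => ennreal" and c
 proof (cases "p = \<infinity>")
  case True
  have "AEL x. f x <= Lp_norm p f" using Lp_norm_le_iff(1)[of f p "Lp_norm p f"] True p by simp
  hence "AE x in distr lborel borel ((+) c). f x <= Lp_norm p f" by (subst lborel_distr_plus)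
  hence "AEL x. f (c + x) <= Lp_norm p f" by (subst (asm) AE_distr_iff) auto
  thus ?thesis using Lp_norm_le_iff(1)[of "%x. f (c + x)" p] True p by simp
 next
  case False
  thus ?thesis
   using nn_integral_lborel_shift[of "%x. ennreal_powr (f x) (enn2real p)" c] by (simp add: Lp_norm_def nn_integral_completion)
 qed
 show ?thesis using le[of f c] le[of "%x. f (c + x)" "- c"] by (intro antisym) auto
qed

text \<open>For finite p the power must pass under the liminf; each threshold below the power of the
  liminf is pulled back through the exponent 1/P. For p = \<infinity> the countably many exceptional
  sets are united.\<close>

lemma Lp_norm_Fatou:
 assumes [measurable]: "!!n. f n \<in> BM" "g \<in> BM" and p: "1 <= p"
  and lim: "AEL x. g x <= liminf (%n. f n x)" and B: "!!n::nat. Lp_norm p (f n) <= B"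
 shows "Lp_norm p g <= B"
proof (cases "p = \<infinity>")
 case True
 have "AEL x. \<forall>n. f n x <= B"
  unfolding AE_all_countable using B Lp_norm_le_iff(1)[of "f _" p B] True p by simp
 with lim have "AEL x. g x <= B"
 proof eventually_elim
  case (elim x)
  have "liminf (%n. f n x) <= B"
   using elim(2) Liminf_mono[of "%n. f n x" "%n. B" sequentially] by (simp add: Liminf_const)
  thus ?case using elim(1) by simp
 qed
 thus ?thesis using Lp_norm_le_iff(1)[of g p] True p by simp
next
 case False
 define P where "P = enn2real p"
 have P: "0 < P" using enn2real_ge_1[OF p False] by (simp add: P_def)
 let ?A = "%y. ennreal_powr y (1/P)"
 have pw: "ennreal_powr (liminf (%n. h n)) P <= liminf (%n. ennreal_powr (h n) P)" for h :: "nat => ennreal"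
  unfolding le_Liminf_iff
 proof (intro allI impI)
  fix y assume y: "y < ennreal_powr (liminf h) P"
  have "?A y < liminf h"
  proof (rule ccontr)
   assume "\<not> ?thesis"
   hence "liminf h <= ?A y" by simp
   hence "ennreal_powr (liminf h) P <= y" using ennreal_powr_mono[of P "liminf h" "?A y"] P by (simp add: ennreal_powr_inverse')
   thus False using y by simp
  qed
  hence "eventually (%n. ?A y < h n) sequentially"
   using le_Liminf_iff[of "liminf h" sequentially h] by blast
  thus "eventually (%n. y < ennreal_powr (h n) P) sequentially"
  proof eventually_elim
   case (elim n)
   show ?case
   proof (rule ccontr)
    assume "\<not> ?thesis"
    hence "ennreal_powr (h n) P <= y" by simp
    hence "h n <= ?A y" using ennreal_powr_mono[of "1/P" "ennreal_powr (h n) P" y] P by (simp add: ennreal_powr_inverse)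
    thus False using elim by simp
   qed
  qed
 qed
 have "(NNINT x. ennreal_powr (g x) P) <= (NNINT x. liminf (%n. ennreal_powr (f n x) P))"
  using lim P by (intro nn_integral_mono_AE) (auto elim!: eventually_mono intro!: order_trans[OF ennreal_powr_mono pw])
 also have "... <= liminf (%n. (NNINT x. ennreal_powr (f n x) P))"
  by (rule nn_integral_liminf) measurable
 also have "... <= liminf (%n. ennreal_powr B P)"
  using B Lp_norm_le_iff(2)[of "f _" p B] False p by (intro Liminf_mono always_eventually allI) (simp add: P_def)
 also have "... = ennreal_powr B P" by (simp add: Liminf_const)
 finally show ?thesis using Lp_norm_le_iff(2)[of g p B] False p by (simp add: P_def)
qed

text \<open>For p = \<infinity> an essential supremum is at most y exactly when the integral of the
  indicator of the points above y vanishes, which is a measurable condition on the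
  parameter.\<close>

lemma Lp_norm_measurable [measurable (raw)]:
 assumes [measurable]: "case_prod F \<in> borel_measurable (N \<Otimes>\<^sub>M borel)" and p: "1 <= p"
 shows "(%n. Lp_norm p (F n)) \<in> borel_measurable N"
proof (cases "p = \<infinity>")
 case False
 have "(%n. (NNINT x. ennreal_powr (F n x) (enn2real p))) \<in> borel_measurable N" by measurable
 thus ?thesis using False by (simp add: Lp_norm_def nn_integral_completion)
next
 case True
 let ?A = "%n y. NNINT x. (if F n x <= y then 0 else 1)"
 show ?thesis
 proof (rule borel_measurableI_le)
  fix y
  have "Lp_norm p (F n) <= y \<longleftrightarrow> (?A n y) = 0" if n: "n \<in> space N" for n
  proof -
   have [measurable]: "F n \<in> BM" using n by measurable
   have "Lp_norm p (F n) <= y \<longleftrightarrow> (AEL x. F n x <= y)" using Lp_norm_le_iff(1)[of "F n" p y] True p by simp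
   also have "... \<longleftrightarrow> (AEL x. (if F n x <= y then 0 else 1 :: ennreal) = 0)"
    by (intro AE_cong) auto
   also have "... \<longleftrightarrow> (?A n y) = 0"
    by (subst nn_integral_0_iff_AE) auto
   finally show ?thesis .
  qed
  hence "{n \<in> space N. Lp_norm p (F n) <= y} = {n \<in> space N. ?A n y = 0}" by auto
  also have "... \<in> sets N" by measurable
  finally show "{n \<in> space N. Lp_norm p (F n) <= y} \<in> sets N" .
 qed
qed

text \<open>The graph of t^P lies above its tangent at s, rearranged to avoid subtraction.\<close>

lemma powr_tangent:
 fixes s t P :: real
 assumes "0 <= s" "0 <= t" "1 <= P"
 shows "P * s powr (P - 1)*t <= t powr P + (P - 1) * s powr P"
proof (cases "s = 0 \<or> t = 0")
 case True thus ?thesis using assms by auto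
next
 case False
 hence "(t powr P) powr (1/P)*(s powr P) powr (1 - 1/P) <= 1/P*t powr P + (1 - 1/P) * s powr P"
  using assms by (intro Youngs_inequality_0) (auto simp: field_simps)
 moreover have "(t powr P) powr (1/P) = t" using assms False by (simp add: powr_powr)
 moreover have "(s powr P) powr (1 - 1/P) = s powr (P - 1)"
  using assms by (simp add: powr_powr algebra_simps)
 ultimately show ?thesis using assms by (simp add: field_simps)
qed

text \<open>Jensen's inequality for h/A under the probability density A/S, since (h/A)^P*A =
  h^P*A^(1-P). It comes from integrating the tangent inequality and then choosing s. As h vanishes
  where A does, the convention that 0 to any power is 0 loses nothing.\<close>

lemma weighted_jensen:
 assumes [measurable]: "h \<in> borel_measurable M" "A \<in> borel_measurable M" and P: "1 <= P"
  and S: "(\<integral>\<^sup>+r. A r \<partial>M) = en S" "0 < S" and h0: "AE r in M. A r = 0 --> h r = 0"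
 shows "ennreal_powr (\<integral>\<^sup>+r. h r \<partial>M) P <= en (S powr (P - 1))*(\<integral>\<^sup>+r. ennreal_powr (h r) P*en (enn2real (A r) powr (1 - P)) \<partial>M)"
proof -
 let ?C = "%A r. en (enn2real (A r) powr (1 - P))"
 define J where "J = (\<integral>\<^sup>+r. ennreal_powr (h r) P*?C A r \<partial>M)"
 have Afin: "AE r in M. A r ~= \<infinity>" using S by (intro nn_integral_PInf_AE) auto
 let ?A = "\<integral>\<^sup>+r. h r \<partial>M"
 have tan: "en (P * s powr (P - 1))*?A <= J + en ((P - 1) * s powr P*S)" if s: "0 <= s" for s
 proof -
  have "(\<integral>\<^sup>+r. en (P * s powr (P - 1))*h r \<partial>M) <= (\<integral>\<^sup>+r. ennreal_powr (h r) P*?C A r + en ((P - 1) * s powr P)*A r \<partial>M)"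
  proof (rule nn_integral_mono_AE)
   show "AE r in M. en (P * s powr (P - 1))*h r <= ennreal_powr (h r) P*?C A r + en ((P - 1) * s powr P)*A r"
    using Afin h0
   proof eventually_elim
    case (elim r)
    show ?case
    proof (cases "A r = 0")
     case True thus ?thesis using elim by simp
    next
     case False
     obtain a where a: "A r = en a" "0 <= a" using elim by (cases "A r") auto
     have a0: "0 < a" using False a by (cases "a = 0") auto
     show ?thesis
     proof (cases "h r")
      case top
      thus ?thesis using a a0 by (simp add: ennreal_top_mult)
     next
      case (real t)
      have "P * s powr (P - 1)*(t/a)*a <= ((t/a) powr P + (P - 1) * s powr P)*a"
       using powr_tangent[OF s _ P, of "t/a"] real a0 by (intro mult_right_mono) auto
      hence "P * s powr (P - 1)*t <= (t/a) powr P*a + (P - 1) * s powr P*a"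
       using a0 by (simp add: distrib_right)
      also have "(t/a) powr P*a = t powr P*a powr (1 - P)"
       using a0 real by (simp add: powr_divide powr_diff)
      finally have "en (P * s powr (P - 1)*t) <= en (t powr P*a powr (1 - P) + (P - 1) * s powr P*a)"
       by (rule ennreal_leI)
      thus ?thesis using real a s P
       by (simp add: ennreal_powr_ennreal ennreal_mult)
     qed
    qed
   qed
  qed
  also have "... = J + en ((P - 1) * s powr P)*en S"
   by (simp add: nn_integral_add nn_integral_cmult S J_def)
  finally show ?thesis using S P by (simp add: nn_integral_cmult ennreal_mult)
 qed
 show ?thesis
 proof (cases "J = top")
  case True
  thus ?thesis using S unfolding J_def[symmetric] by (simp add: ennreal_mult_top)
 next
  case False
  then obtain j where j: "J = en j" "0 <= j" by (cases J) auto
  \<comment> \<open>Any positive slope shows that the integral of h is finite; s = 1 is taken. Only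
    then is the optimal s available as a real number.\<close>
  have "?A ~= top"
  proof
   assume "?A = top"
   thus False using tan[of 1] P j S by (simp add: ennreal_mult_top top_unique flip: ennreal_plus)
  qed
  then obtain i where i: "?A = en i" "0 <= i" by (cases "\<integral>\<^sup>+r. h r \<partial>M") auto
  \<comment> \<open>The optimal tangent point is the mean of h/A, namely i/S.\<close>
  have "en (P*(i/S) powr (P - 1)*i) <= en (j + (P - 1)*(i/S) powr P*S)"
   using tan[of "i/S"] i j P S by (simp add: ennreal_mult)
  hence "P*(i/S) powr (P - 1)*i <= j + (P - 1)*(i/S) powr P*S"
   using i j P S by (subst (asm) ennreal_le_iff) auto
  moreover have "(i/S) powr (P - 1)*i = (i/S) powr P*S"
   using i S by (cases "i = 0") (auto simp: powr_diff)
  ultimately have "(i/S) powr P*S <= j" by (simp add: algebra_simps)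
  hence "S powr (P - 1)*((i/S) powr P*S) <= S powr (P - 1)*j" by (intro mult_left_mono) auto
  moreover have "S powr (P - 1)*((i/S) powr P*S) = i powr P"
   using i S by (simp add: powr_divide powr_diff)
  ultimately show ?thesis unfolding J_def[symmetric] i j using i j by (simp add: ennreal_powr_ennreal flip: ennreal_mult)
 qed
qed

text \<open>With A r the norm of the slice r and S its integral, Jensen in each x followed by
  Tonelli bounds the P-th power by S^(P-1) times the integral of A^P*A^(1-P), that is by S^P. For p
  = \<infinity> the null sets of the two variables are interchanged.\<close>

lemma Lp_norm_Minkowski:
 fixes H :: "'a::euclidean_space => 'm => ennreal"
 assumes M: "sigma_finite_measure M" and [measurable]: "case_prod H \<in> borel_measurable (borel \<Otimes>\<^sub>M M)" and p: "1 <= p"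
 shows "Lp_norm p (%x. \<integral>\<^sup>+r. H x r \<partial>M) <= (\<integral>\<^sup>+r. Lp_norm p (%x. H x r) \<partial>M)"
proof -
 interpret M: sigma_finite_measure M by fact
 interpret pair_sigma_finite "lborel :: 'a measure" M ..
 define A where "A r = Lp_norm p (%x. H x r)" for r
 have H2: "(%(r, x). H x r) \<in> borel_measurable (M \<Otimes>\<^sub>M borel)" by measurable
 have [measurable]: "A \<in> borel_measurable M" unfolding A_def by (rule Lp_norm_measurable[OF H2 p])
 have H3 [measurable]: "(%x. H x r) \<in> BM" if "r \<in> space M" for r using that by measurable
 have H4 [measurable]: "H x \<in> borel_measurable M" for x by measurable
 have mI: "(%x. \<integral>\<^sup>+r. H x r \<partial>M) \<in> BM" by measurable
 let ?A = "%r P. en (enn2real (A r) powr (1 - P))"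
 let ?B = "%x. \<integral>\<^sup>+r. H x r \<partial>M"
 let ?C = "%x r. ennreal_powr (H x r)"
 let ?D = "\<integral>\<^sup>+r. A r \<partial>M"
 let ?E = "lborel \<Otimes>\<^sub>M M"
 let ?F = "%x P. \<integral>\<^sup>+r. ?C x r P*?A r P \<partial>M"
 let ?G = "%r P. NNINT x. ?C x r P*?A r P"
 let ?H = "%P. NNINT x. ennreal_powr (?B x) P"
 show ?thesis
 proof (cases "p = \<infinity>")
  case True
  have "AE r in M. AEL x. H x r <= A r"
  proof (rule AE_I2)
   fix r assume r: "r \<in> space M"
   show "AEL x. H x r <= A r" unfolding A_def
    using Lp_norm_le_iff(1)[OF H3[OF r] p True, of "Lp_norm p (%x. H x r)"] by simp
  qed
  moreover have "{x \<in> space ?E. H (fst x) (snd x) <= A (snd x)} \<in> sets ?E"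
   by measurable
  ultimately have "AEL x. AE r in M. H x r <= A r"
   by (subst AE_commute)
  hence "AEL x. ?B x <= ?D"
   by eventually_elim (rule nn_integral_mono_AE)
  thus ?thesis using Lp_norm_le_iff(1)[OF mI p True] by (simp add: A_def)
 next
  case False
  define P where "P = enn2real p"
  have P: "1 <= P" using enn2real_ge_1[OF p False] by (simp add: P_def)
  have An: "(NNINT x. ?C x r P) <= ennreal_powr (A r) P" if r: "r \<in> space M" for r
   using Lp_norm_le_iff(2)[OF H3[OF r] p False, of "A r"] by (simp add: A_def P_def)
  show ?thesis
  proof (cases "?D")
   case top thus ?thesis by (simp add: A_def)
  next
   case (real S)
   have "AE r in M. AEL x. A r = 0 --> H x r = 0"
   proof (rule AE_I2)
    fix r assume r: "r \<in> space M"
    show "AEL x. A r = 0 --> H x r = 0"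
    proof (cases "A r = 0")
     case True
     hence "(NNINT x. ?C x r P) = 0" using An[OF r] by simp
     moreover have "(%x. ?C x r P) \<in> borel_measurable lborel" using H3[OF r] by measurable
     ultimately have "AEL x. ?C x r P = 0"
      by (subst (asm) nn_integral_0_iff_AE) auto
     thus ?thesis by (simp add: ennreal_powr_eq_0_iff)
    qed simp
   qed
   moreover have "{x \<in> space ?E. A (snd x) = 0 --> H (fst x) (snd x) = 0} \<in> sets ?E"
    by measurable
   ultimately have h0: "AEL x. AE r in M. A r = 0 --> H x r = 0"
    by (subst AE_commute)
   have "(?H P) <= ennreal_powr (en S) P"
   proof (cases "S = 0")
    case True
    have A0: "AE r in M. A r = 0"
     using real True by (simp add: nn_integral_0_iff_AE)
    have "AEL x. ennreal_powr (?B x) P = 0"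
     using h0
    proof eventually_elim
     case (elim x)
     hence "AE r in M. H x r = 0" using A0 by eventually_elim simp
     hence "(?B x) = 0" by (simp add: nn_integral_0_iff_AE)
     thus ?case by simp
    qed
    hence "(?H P) = 0"
     by (subst nn_integral_0_iff_AE) auto
    thus ?thesis by simp
   next
    case False
    hence S: "0 < S" using real by simp
    have "(?H P)
      <= (NNINT x. en (S powr (P - 1))*(?F x P))"
     using h0 by (intro nn_integral_mono_AE) (auto elim!: eventually_mono intro!: weighted_jensen P S real)
    also have "... = en (S powr (P - 1))*(NNINT x. ?F x P)"
     by (rule nn_integral_cmult) measurable
    also have "(NNINT x. ?F x P)
      = (\<integral>\<^sup>+r. (?G r P) \<partial>M)"
     by (rule Fubini'[symmetric]) measurable
    also have "... <= ?D"
    proof (rule nn_integral_mono_AE)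
     have "AE r in M. A r ~= \<infinity>" using real by (intro nn_integral_PInf_AE) auto
     thus "AE r in M. ?G r P <= A r"
     proof (rule AE_mp, intro AE_I2 impI)
      fix r assume r: "r \<in> space M" "A r ~= \<infinity>"
      then obtain a where a: "A r = en a" "0 <= a" by (cases "A r") auto
      have "(?G r P)
        = (NNINT x. ?C x r P)*?A r P"
       using ennreal_powr_measurable[OF H3[OF r(1)], of P] by (intro nn_integral_multc) simp
      also have "... <= ennreal_powr (A r) P*?A r P"
       by (intro mult_right_mono An r) simp
      also have "... = A r"
       using a by (cases "a = 0") (auto simp: ennreal_powr_ennreal simp flip: ennreal_mult powr_add)
      finally show "(?G r P) <= A r" .
     qed
    qed
    also have "en (S powr (P - 1))*?D = ennreal_powr (en S) P"
     using real S by (simp add: ennreal_powr_ennreal powr_diff flip: ennreal_mult)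
    finally show ?thesis by (simp add: mult_left_mono)
   qed
   thus ?thesis using Lp_norm_le_iff(2)[OF mI p False] real by (simp add: A_def P_def)
  qed
 qed
qed

text \<open>A substitute for Hoelder against a weight with height and mass at most R. With b the
  norm of f, points where f is at most b contribute b*r, and at the others f is at most
  b^(1-P)*f^P.\<close>

lemma Lp_norm_integral_bound:
 assumes [measurable]: "f \<in> BM" "r \<in> BM" and p: "1 <= p"
  and r: "!!x. r x <= R" "(NNINT x. r x) <= R" "1 <= R"
 shows "(NNINT x. f x*r x) <= 2 * R*Lp_norm p f"
proof (cases "p = \<infinity>")
 case True
 have "AEL x. f x <= Lp_norm p f" using Lp_norm_le_iff(1)[of f p "Lp_norm p f"] True p by simp
 hence "(NNINT x. f x*r x) <= (NNINT x. Lp_norm p f*r x)"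
  by (intro nn_integral_mono_AE) (auto elim!: eventually_mono intro!: mult_right_mono)
 also have "... <= Lp_norm p f * R"
  by (simp add: nn_integral_cmult mult_left_mono r)
 also have "... <= Lp_norm p f*(2 * R)"
  using mult_right_mono[of 1 2 R] by (intro mult_left_mono) auto
 finally show ?thesis by (simp add: mult_ac)
next
 case False
 define P where "P = enn2real p"
 have P: "1 <= P" using enn2real_ge_1[OF p False] by (simp add: P_def)
 let ?B = "%x. ennreal_powr (f x) P"
 have n: "(NNINT x. ?B x) <= ennreal_powr (Lp_norm p f) P"
  using Lp_norm_le_iff(2)[of f p "Lp_norm p f"] False p by (simp add: P_def)
 let ?A = "%b. en (b powr (1 - P))"
 show ?thesis
 proof (cases "Lp_norm p f")
  case top thus ?thesis using r by (auto simp: ennreal_mult_top)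
 next
  case (real b)
  show ?thesis
  proof (cases "b = 0")
   case True
   hence "(NNINT x. ?B x) = 0" using n real by simp
   hence "AEL x. f x = 0" by (simp add: nn_integral_0_iff_AE ennreal_powr_eq_0_iff)
   hence "(NNINT x. f x*r x) = 0" by (subst nn_integral_0_iff_AE) auto
   thus ?thesis by simp
  next
   case False
   hence b: "0 < b" using real by simp
   have pw: "f x*r x <= en b*r x + ?A b*?B x * R" for x
   proof (cases "f x <= en b")
    case True
    hence "f x*r x <= en b*r x" by (rule mult_right_mono) simp
    thus ?thesis by (rule order_trans) simp
   next
    case False
    have "f x <= ?A b*?B x"
    proof (cases "f x")
     case top thus ?thesis using b by (simp add: ennreal_mult_top)
    next
     case (real t)
     have tb: "b <= t" using False real b by (simp add: not_le ennreal_less_iff less_imp_le)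
     have "t = t powr (1 - P)*t powr P" using tb b by (simp flip: powr_add)
     also have "... <= b powr (1 - P)*t powr P"
      using P tb b by (intro mult_right_mono powr_mono2') auto
     finally show ?thesis using real by (simp add: ennreal_powr_ennreal flip: ennreal_mult)
    qed
    hence "f x*r x <= (?A b*?B x) * R"
     by (intro mult_mono r) auto
    thus ?thesis by (rule order_trans) simp
   qed
   have "(NNINT x. f x*r x) <= (NNINT x. en b*r x + ?A b*?B x * R)"
    by (intro nn_integral_mono pw)
   also have "... = en b*(NNINT x. r x) + ?A b*(NNINT x. ?B x) * R"
    by (simp add: nn_integral_add nn_integral_cmult nn_integral_multc)
   also have "... <= en b * R + ?A b*ennreal_powr (en b) P * R"
    using n real by (intro add_mono mult_left_mono mult_right_mono r) auto
   also have "?A b*ennreal_powr (en b) P = en b"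
    using b by (simp add: ennreal_powr_ennreal flip: ennreal_mult powr_add)
   also have "en b * R + en b * R = 2 * R*en b"
    by (metis mult.commute mult.left_commute mult_2)
   finally show ?thesis using real by simp
  qed
 qed
qed

section \<open>Mixed norms of Borel functions on phase space\<close>

definition LPQ :: "ennreal => ennreal => ('a::euclidean_space \<times> 'a => ennreal) => ennreal" where
 "LPQ p q F = Lp_norm q (%\<omega>. Lp_norm p (%x. F (x, \<omega>)))"

lemma LPQ_inner_measurable:
 fixes F :: "'a::euclidean_space \<times> 'a => ennreal"
 assumes [measurable]: "F \<in> BM" and p: "1 <= p"
 shows "(%\<omega>. Lp_norm p (%x. F (x, \<omega>))) \<in> BM"
 by (rule Lp_norm_measurable[OF _ p]) measurable

lemma AE_lborel_pair:
 assumes "AEL z. P z"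
 shows "AEL x. AEL y. P (x, y)" "AEL y. AEL x. P (x, y)"
proof -
 have 1: "AE z in lborel \<Otimes>\<^sub>M lborel. P z" using assms by (subst lborel_prod)
 thus "AEL x. AEL y. P (x, y)" by (rule lborel_pair.AE_pair)
 have "AE z in distr (lborel \<Otimes>\<^sub>M lborel) (lborel \<Otimes>\<^sub>M lborel) (%(x, y). (y, x)). P z"
  using 1 by (subst (asm) lborel_pair.distr_pair_swap)
 hence "AE z in lborel \<Otimes>\<^sub>M lborel. P (case z of (x, y) => (y, x))"
  by (rule AE_distrD[rotated]) measurable
 from lborel_pair.AE_pair[OF this] show "AEL y. AEL x. P (x, y)" by simp
qed

lemma LPQ_mono_AE:
 assumes [measurable]: "F \<in> BM" "G \<in> BM" and p: "1 <= p" "1 <= q"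
  and le: "AEL z. F z <= G z"
 shows "LPQ p q F <= LPQ p q G"
 unfolding LPQ_def
proof (rule Lp_norm_mono[OF LPQ_inner_measurable LPQ_inner_measurable])
 show "AEL \<omega>. Lp_norm p (%x. F (x, \<omega>)) <= Lp_norm p (%x. G (x, \<omega>))"
  using AE_lborel_pair(2)[OF le] by eventually_elim (rule Lp_norm_mono, use p in measurable)
qed (use p in measurable)

lemma LPQ_mono:
 assumes [measurable]: "F \<in> BM" "G \<in> BM" and p: "1 <= p" "1 <= q"
  and le: "!!z. F z <= G z"
 shows "LPQ p q F <= LPQ p q G"
 by (rule LPQ_mono_AE) (use assms in auto)

lemma LPQ_cmult:
 assumes [measurable]: "F \<in> BM" and p: "1 <= p" "1 <= q"
 shows "LPQ p q (%z. c*F z) <= c*LPQ p q F"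
proof -
 note [measurable] = LPQ_inner_measurable[OF assms(1) p(1)]
 have m: "(%\<omega>. Lp_norm p (%x. c*F (x, \<omega>))) \<in> BM"
  by (rule LPQ_inner_measurable[where F="%z. c*F z"]) (use p in auto)
 have "LPQ p q (%z. c*F z) <= Lp_norm q (%\<omega>. c*Lp_norm p (%x. F (x, \<omega>)))"
  unfolding LPQ_def by (intro Lp_norm_mono m AE_I2 Lp_norm_cmult p) measurable
 also have "... <= c*LPQ p q F" unfolding LPQ_def by (intro Lp_norm_cmult p) measurable
 finally show ?thesis .
qed

lemma LPQ_shift:
 assumes [measurable]: "F \<in> BM" and p: "1 <= p" "1 <= q"
 shows "LPQ p q (%z. F (c + z)) = LPQ p q F"
proof -
 have "LPQ p q (%z. F (c + z)) = Lp_norm q (%\<omega>. Lp_norm p (%x. F (fst c + x, snd c + \<omega>)))"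
  by (simp add: LPQ_def plus_prod_def)
 also have "... = Lp_norm q (%\<omega>. Lp_norm p (%x. F (x, snd c + \<omega>)))"
 proof -
  have "Lp_norm p (%x. F (fst c + x, snd c + \<omega>)) = Lp_norm p (%x. F (x, snd c + \<omega>))" for \<omega>
   using Lp_norm_shift[of "%x. F (x, snd c + \<omega>)" p "fst c"] p by simp
  thus ?thesis by simp
 qed
 also have "... = LPQ p q F"
  unfolding LPQ_def using Lp_norm_shift[OF LPQ_inner_measurable[OF assms(1) p(1)] p(2)] by simp
 finally show ?thesis .
qed

text \<open>Fatou in each variable. For fixed frequency the inner norms need not be bounded, so for
  y above their liminf the inner step runs along a subsequence whose norms stay below y.\<close>

lemma LPQ_Fatou:
 assumes [measurable]: "!!n. F n \<in> BM" "G \<in> BM" and p: "1 <= p" "1 <= q"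
  and lim: "!!z. (%n. F n z) ---> G z" and B: "!!n::nat. LPQ p q (F n) <= B"
 shows "LPQ p q G <= B"
 unfolding LPQ_def
proof (rule Lp_norm_Fatou[OF LPQ_inner_measurable LPQ_inner_measurable p(2)])
 let ?A = "%n \<omega>. Lp_norm p (%x. F n (x, \<omega>))"
 show "AEL \<omega>. Lp_norm p (%x. G (x, \<omega>)) <= liminf (%n. ?A n \<omega>)"
 proof (rule AE_I2)
  fix \<omega> :: 'a
  define L where "L = liminf (%n. ?A n \<omega>)"
  show "Lp_norm p (%x. G (x, \<omega>)) <= L"
  proof (rule dense_ge)
   fix y assume "L < y"
   hence fr: "frequently (%n. ?A n \<omega> <= y) sequentially"
   proof -
    have "\<not> eventually (%n. y < ?A n \<omega>) sequentially"
    proof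
     assume "eventually (%n. y < ?A n \<omega>) sequentially"
     hence "y <= L" unfolding L_def
      by (intro Liminf_bounded) (auto elim: eventually_mono)
     thus False using \<open>L < y\<close> by simp
    qed
    thus ?thesis by (simp add: not_eventually not_less)
   qed
   have "\<exists>r. strict_mono r & (\<forall>n::nat. Lp_norm p (%x. F (r n) (x, \<omega>)) <= y)"
   proof -
    have "infinite {n. ?A n \<omega> <= y}"
     using fr by (simp add: frequently_cofinite flip: cofinite_eq_sequentially)
    thus ?thesis using infinite_enumerate[of "{n. ?A n \<omega> <= y}"] by auto
   qed
   then obtain r where r: "strict_mono r" "!!n::nat. Lp_norm p (%x. F (r n) (x, \<omega>)) <= y" by blast
   show "Lp_norm p (%x. G (x, \<omega>)) <= y"
   proof (rule Lp_norm_Fatou[of "%n x. F (r n) (x, \<omega>)"])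
    show "AEL x. G (x, \<omega>) <= liminf (%n. F (r n) (x, \<omega>))"
    proof (rule AE_I2)
     fix x
     have "(%n. F (r n) (x, \<omega>)) ---> G (x, \<omega>)"
      using LIMSEQ_subseq_LIMSEQ[OF lim[of "(x, \<omega>)"] r(1)] by (simp add: o_def)
     hence "liminf (%n. F (r n) (x, \<omega>)) = G (x, \<omega>)" by (rule lim_imp_Liminf[OF sequentially_bot])
     thus "G (x, \<omega>) <= liminf (%n. F (r n) (x, \<omega>))" by simp
    qed
   qed (use p r in auto)
  qed
 qed
qed (use B p in \<open>auto simp: LPQ_def\<close>)

lemma LPQ_Minkowski:
 assumes M: "sigma_finite_measure M" and [measurable]: "case_prod H \<in> borel_measurable (borel \<Otimes>\<^sub>M M)" and p: "1 <= p" "1 <= q"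
 shows "LPQ p q (%z. \<integral>\<^sup>+r. H z r \<partial>M) <= (\<integral>\<^sup>+r. LPQ p q (%z. H z r) \<partial>M)"
proof -
 interpret M: sigma_finite_measure M by fact
 let ?B = "borel \<Otimes>\<^sub>M M"
 have m1: "(%(n, x). H (x, fst n) (snd n)) \<in> borel_measurable (?B \<Otimes>\<^sub>M borel)" by measurable
 have m: "(%n. Lp_norm p (%x. H (x, fst n) (snd n))) \<in> borel_measurable ?B"
  by (rule Lp_norm_measurable[OF m1 p(1)])
 hence m2: "case_prod (%\<omega> r. Lp_norm p (%x. H (x, \<omega>) r)) \<in> borel_measurable ?B"
  by (simp add: case_prod_beta')
 note [measurable] = m2
 let ?A = "(%\<omega>. \<integral>\<^sup>+r. Lp_norm p (%x. H (x, \<omega>) r) \<partial>M)"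
 have "LPQ p q (%z. \<integral>\<^sup>+r. H z r \<partial>M) <= Lp_norm q ?A"
  unfolding LPQ_def
 proof (rule Lp_norm_mono[OF LPQ_inner_measurable[where F="%z. \<integral>\<^sup>+r. H z r \<partial>M"]])
  show "AEL \<omega>. Lp_norm p (%x. \<integral>\<^sup>+r. H (x, \<omega>) r \<partial>M) <= (\<integral>\<^sup>+r. Lp_norm p (%x. H (x, \<omega>) r) \<partial>M)"
   by (intro AE_I2 Lp_norm_Minkowski[OF M _ p(1)]) measurable
  show "?A \<in> BM" by measurable
 qed (use p in measurable)
 also have "... <= (\<integral>\<^sup>+r. LPQ p q (%z. H z r) \<partial>M)"
  unfolding LPQ_def by (rule Lp_norm_Minkowski[OF M m2 p(2)])
 finally show ?thesis .
qed

text \<open>Minkowski's integral inequality for counting measure on a two-point set.\<close>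

lemma LPQ_add:
 assumes [measurable]: "F \<in> BM" "G \<in> BM" and p: "1 <= p" "1 <= q"
 shows "LPQ p q (%z. F z + G z) <= LPQ p q F + LPQ p q G"
proof -
 have M: "sigma_finite_measure (count_space (UNIV :: bool set))"
  by (rule sigma_finite_measure_count_space_countable) simp
 have [measurable]: "(%(z, r). if r then F z else G z) \<in> borel_measurable (borel \<Otimes>\<^sub>M count_space (UNIV :: bool set))"
  by measurable
 have "LPQ p q (%z. \<integral>\<^sup>+r. (if r then F z else G z) \<partial>count_space (UNIV :: bool set)) <= (\<integral>\<^sup>+r. LPQ p q (%z. if r then F z else G z) \<partial>count_space UNIV)"
  by (rule LPQ_Minkowski[OF M _ p]) measurable
 thus ?thesis by (simp add: nn_integral_count_space_finite UNIV_bool add.commute)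
qed

lemma LPQ_local:
 assumes [measurable]: "F \<in> BM" "r \<in> BM" "s \<in> BM" and p: "1 <= p" "1 <= q"
  and r: "!!x. r x <= R" "(NNINT x. r x) <= R" and s: "!!x. s x <= R" "(NNINT x. s x) <= R" and R: "1 <= R"
 shows "(NNINT z. F z*(r (fst z) * s (snd z))) <= 2 * R*(2 * R)*LPQ p q F"
proof -
 note [measurable] = LPQ_inner_measurable[OF assms(1) p(1)]
 have "(NNINT z. F z*(r (fst z) * s (snd z))) = (NNINT \<omega>. (NNINT x. (F (x, \<omega>)*r x) * s \<omega>))"
  by (subst nn_integral_snd_lborel[symmetric]) (auto simp: mult.assoc)
 also have "... = (NNINT \<omega>. (NNINT x. F (x, \<omega>)*r x) * s \<omega>)"
  by (intro nn_integral_cong nn_integral_multc) measurable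
 also have "... <= (NNINT \<omega>. (2 * R*Lp_norm p (%x. F (x, \<omega>))) * s \<omega>)"
  by (intro nn_integral_mono mult_right_mono Lp_norm_integral_bound p r R) auto
 also have "... = 2 * R*(NNINT \<omega>. Lp_norm p (%x. F (x, \<omega>)) * s \<omega>)"
  by (subst nn_integral_cmult[symmetric]) (auto simp: mult.assoc)
 also have "... <= 2 * R*(2 * R*Lp_norm q (%\<omega>. Lp_norm p (%x. F (x, \<omega>))))"
  by (intro mult_left_mono Lp_norm_integral_bound p s R) auto
 finally show ?thesis by (simp add: LPQ_def mult.assoc)
qed

text \<open>For values in [0,1] the power g^P is at most g, and R >= 1 is at most its own power; one
  bound serves every exponent.\<close>

lemma Lp_norm_le_of_bounded_integrable:
 assumes [measurable]: "g \<in> BM" and p: "1 <= p"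
  and g: "!!x. g x <= 1" "(NNINT x. g x) <= R" "1 <= R"
 shows "Lp_norm p g <= R"
proof (cases "p = \<infinity>")
 case True
 have "g x <= R" for x using g(1)[of x] g(3) by (rule order_trans)
 thus ?thesis using Lp_norm_le_iff(1)[of g p R] True p by simp
next
 case False
 define P where "P = enn2real p"
 have P: "1 <= P" using enn2real_ge_1[OF p False] by (simp add: P_def)
 have "ennreal_powr (g x) P <= g x" for x
 proof (cases "g x")
  case (real t)
  hence t: "t <= 1" using g(1)[of x] by (simp flip: ennreal_1)
  have "t powr P <= t powr 1"
   using powr_mono'[of 1 P t] P t real by simp
  thus ?thesis using real by (cases "t = 0") (auto simp: ennreal_powr_ennreal)
 qed (use g(1)[of x] in \<open>simp add: top_unique\<close>)
 hence "(NNINT x. ennreal_powr (g x) P) <= (NNINT x. g x)" by (intro nn_integral_mono)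
 also have "... <= R" by (rule g)
 also have "R <= ennreal_powr R P"
 proof (cases R)
  case (real t)
  hence t: "1 <= t" using g(3) by (simp flip: ennreal_1)
  hence "t powr 1 <= t powr P" using P by (intro powr_mono) auto
  thus ?thesis using real t by (simp add: ennreal_powr_ennreal)
 qed simp
 finally show ?thesis using Lp_norm_le_iff(2)[of g p R] False p by (simp add: P_def)
qed

lemma borel_measurable_AE:
 fixes f g :: "'e::euclidean_space => 'b::topological_space"
 assumes g: "g \<in> BM" and eq: "AEL x. f x = g x"
 shows "f \<in> borel_measurable lebesgue"
proof (rule measurableI)
 fix A :: "'b set" assume A: "A \<in> sets borel"
 obtain N where N: "N \<in> null_sets lborel" "{x. f x ~= g x} \<subseteq> N"
  using eq unfolding eventually_ae_filter by auto
 have "f x = g x" if "x \<notin> N" for x using N(2) that by blast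
 hence "f -` A = (g -` A - N) \<union> (f -` A \<inter> N)" by auto
 moreover have "g -` A \<in> sets lborel" using measurable_sets[OF g A] by simp
 hence "g -` A - N \<in> sets lborel" using N(1) by auto
 hence "g -` A - N \<in> sets lebesgue" by (rule sets_completionI_sets)
 moreover have "f -` A \<inter> N \<in> sets lebesgue" using N(1) by (rule null_sets_completion) auto
 ultimately have "f -` A \<in> sets lebesgue" by (metis sets.Un)
 thus "f -` A \<inter> space lebesgue \<in> sets lebesgue" by simp
qed simp

lemma Lp_norm_AE_borel:
 assumes g: "g \<in> BM" and eq: "AEL x. f x = g x"
 shows "Lp_norm p f = Lp_norm p g"
proof -
 have "esssup lebesgue f = esssup lebesgue g"
 proof (rule esssup_AE_cong)
  show "f \<in> borel_measurable lebesgue" by (rule borel_measurable_AE[OF g eq])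
  show "g \<in> borel_measurable lebesgue" by (rule measurable_completion) (use g in simp)
  show "AE x in lebesgue. f x = g x" using eq by (rule AE_completion)
 qed
 moreover have "(\<integral>\<^sup>+x. ennreal_powr (f x) (enn2real p) \<partial>lebesgue) = (\<integral>\<^sup>+x. ennreal_powr (g x) (enn2real p) \<partial>lebesgue)"
  using AE_completion[OF eq] by (intro nn_integral_cong_AE) (auto elim: eventually_mono)
 ultimately show ?thesis by (simp add: Lp_norm_def)
qed

lemma Lpq_norm_AE_borel:
 assumes [measurable]: "F \<in> BM" "\<mu>' \<in> BM" and eq: "AEL z. \<mu> z = \<mu>' z" and p: "1 <= p"
 shows "Lpq_norm p q \<mu> F = LPQ p q (%z. en (cmod (F z)*\<mu>' z))"
 unfolding Lpq_norm_def LPQ_def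
proof (rule Lp_norm_AE_borel[OF LPQ_inner_measurable])
 show "AEL \<omega>. Lp_norm p (%x. en (cmod (F (x, \<omega>))*\<mu> (x, \<omega>))) = Lp_norm p (%x. en (cmod (F (x, \<omega>))*\<mu>' (x, \<omega>)))"
  using AE_lborel_pair(2)[OF eq]
 proof eventually_elim
  case (elim \<omega>)
  show ?case
   by (rule Lp_norm_AE_borel) (use elim in \<open>auto elim: eventually_mono\<close>)
 qed
qed (use p in measurable)

text \<open>The lower bound 1 follows from 1 = w 0 and w 0 <= w z*w (- z) = (w z)^2.\<close>

lemma submult_tame: "submult_weight w ==> tame w"
proof -
 assume w: "submult_weight w"
 have s: "w (z1 + z2) <= w z1*w z2" and pos: "0 < w z" and ev: "w (- z) = w z" and 0: "w 0 = 1" for z z1 z2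
  using w unfolding submult_weight_def by blast+
 have "1 <= w z" for z
 proof (rule ccontr)
  assume "\<not> 1 <= w z"
  hence "w z*w z < 1*1" using pos[of z] by (intro mult_strict_mono) auto
  thus False using s[of z "- z"] 0 ev[of z] by simp
 qed
 moreover have "\<exists>C. \<forall>z1 z2. w (z1 + z2) <= C*w z1*w z2" using s by (intro exI[of _ 1]) simp
 ultimately show "tame w" using w ev unfolding tame_def submult_weight_def by blast
qed

text \<open>A moderate weight is only Lebesgue measurable; averaging it over a unit cube yields an
  equivalent Borel weight.\<close>

lemma moderate_borel:
 fixes w \<mu> :: "'a::euclidean_space \<times> 'a => real"
 assumes w: "tame w" and \<mu>: "\<mu> \<in> moderate_weights w"
 obtains \<mu>' K where "\<mu>' \<in> BM" "!!z. 0 < \<mu>' z" "1 <= K" "!!z. \<mu>' z <= K*\<mu> z" "!!z. \<mu> z <= K*\<mu>' z"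
  "!!z1 z2. \<mu>' (z1 + z2) <= K*w z1*\<mu>' z2"
proof -
 have ml: "\<mu> \<in> borel_measurable lebesgue" and pos: "!!z. 0 < \<mu> z" using \<mu> unfolding moderate_weights_def by blast+
 obtain C0 where C0: "!!z1 z2. \<mu> (z1 + z2) <= C0*w z1*\<mu> z2" using \<mu> unfolding moderate_weights_def by blast
 define C where "C = max 1 C0"
 have C: "1 <= C" "!!z1 z2. \<mu> (z1 + z2) <= C*w z1*\<mu> z2"
 proof -
  show "\<mu> (z1 + z2) <= C*w z1*\<mu> z2" for z1 z2
   by (rule order_trans[OF C0]) (auto simp: C_def intro!: mult_right_mono tameD(4)[OF w] less_imp_le[OF pos])
 qed (simp add: C_def)
 obtain g where g [measurable]: "g \<in> BM" and eq: "AEL z. \<mu> z = g z"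
  using completion_ex_borel_measurable_real[OF ml] by auto
 define Q where "Q = cbox (0 :: 'a*'a) One"
 have [measurable]: "Q \<in> sets borel" by (simp add: Q_def)
 have Q1: "measure lborel Q = 1" by (simp add: Q_def prod.neutral)
 have "bounded Q" by (simp add: Q_def)
 then obtain r where r: "!!s. s \<in> Q ==> norm s <= r" by (auto simp: bounded_iff)
 obtain M where M: "1 <= M" "!!z. norm z <= r ==> w z <= M" by (rule tame_bounded_on_ball[OF w]) (rule that)
 define L where "L = C*M"
 have L: "1 <= L" using C(1) M(1) mult_mono[of 1 C 1 M] by (simp add: L_def)
 have up: "\<mu> (z + s) <= L*\<mu> z" and lo: "\<mu> z <= L*\<mu> (z + s)" if "s \<in> Q" for z s
 proof -
  have ws: "w s <= M" using M(2) r that by simp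
  have "\<mu> (s + z) <= C*w s*\<mu> z" by (rule C)
  also have "... <= L*\<mu> z" unfolding L_def
   using ws C(1) less_imp_le[OF pos] by (intro mult_right_mono mult_left_mono) auto
  finally show "\<mu> (z + s) <= L*\<mu> z" by (simp add: add.commute)
  have "\<mu> (- s + (z + s)) <= C*w (- s)*\<mu> (z + s)" by (rule C)
  also have "... <= L*\<mu> (z + s)" unfolding L_def tameD(5)[OF w]
   using ws C(1) less_imp_le[OF pos] by (intro mult_right_mono mult_left_mono) auto
  finally show "\<mu> z <= L*\<mu> (z + s)" by simp
 qed
 define \<mu>' where "\<mu>' z = (LBINT s. indicator Q s*g (z + s))" for z
 have m: "\<mu>' \<in> BM" unfolding \<mu>'_def by measurable
 have AEs: "AEL s. \<mu> (z + s) = g (z + s)" for z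
 proof -
  have "AE s in distr lborel borel ((+) z). \<mu> s = g s" using eq by (subst lborel_distr_plus)
  thus ?thesis by (rule AE_distrD[rotated]) measurable
 qed
 have fin: "emeasure lborel Q < \<infinity>" using emeasure_bounded_finite[OF \<open>bounded Q\<close>] .
 have iQ: "intg (%s. indicator Q s*c)" for c :: real
  using fin by (intro integrable_mult_left integrable_real_indicator) auto
 have ig: "intg (%s. indicator Q s*g (z + s))" for z
 proof (rule int_bound[OF iQ[of "L*\<mu> z"]])
  show "AEL s. norm (indicator Q s*g (z + s)) <= norm (indicator Q s*(L*\<mu> z))"
   using AEs[of z]
  proof eventually_elim
   case (elim s)
   thus ?case using up[of s z] pos[of z] pos[of "z + s"] L by (auto simp: indicator_def)
  qed
 qed measurable
 have Qi: "(LBINT s. indicator Q s*c) = c" for c :: real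
  using Q1 by simp
 have u1: "\<mu>' z <= L*\<mu> z" for z
 proof -
  have "\<mu>' z <= (LBINT s. indicator Q s*(L*\<mu> z))" unfolding \<mu>'_def
   using AEs[of z]
   by (intro integral_mono_AE ig iQ) (auto elim!: eventually_mono simp: indicator_def dest: up[of _ z])
  thus ?thesis by (simp add: Q1)
 qed
 have u2: "\<mu> z <= L*\<mu>' z" for z
 proof -
  have "(LBINT s. indicator Q s*\<mu> z) <= (LBINT s. L*(indicator Q s*g (z + s)))"
   using AEs[of z]
   by (intro integral_mono_AE integrable_mult_right ig iQ) (auto elim!: eventually_mono simp: indicator_def dest: lo[of _ z])
  thus ?thesis by (simp add: Q1 \<mu>'_def)
 qed
 have p': "0 < \<mu>' z" for z
  using u2[of z] pos[of z] L zero_less_mult_pos[of L "\<mu>' z"] by linarith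
 \<comment> \<open>L compares the averaged weight with \<mu> in either direction and C is the
   moderation constant of \<mu>; the averaged weight is moderate by going to \<mu>, shifting, and
   returning.\<close>
 define K where "K = L*C*L"
 have K: "1 <= K" "L <= K"
 proof -
  have "1*1 <= L*C" using L C by (intro mult_mono) auto
  hence "1*L <= (L*C)*L" using L by (intro mult_right_mono) auto
  thus "L <= K" by (simp add: K_def)
  thus "1 <= K" using L by simp
 qed
 show ?thesis
 proof (rule that[OF m p' K(1)])
  show "\<mu>' z <= K*\<mu> z" for z
   using u1[of z] mult_right_mono[OF K(2) less_imp_le[OF pos[of z]]] by simp
  show "\<mu> z <= K*\<mu>' z" for z
   using u2[of z] mult_right_mono[OF K(2) less_imp_le[OF p'[of z]]] by simp
  show "\<mu>' (z1 + z2) <= K*w z1*\<mu>' z2" for z1 z2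
  proof -
   have "\<mu>' (z1 + z2) <= L*\<mu> (z1 + z2)" by (rule u1)
   also have "... <= L*(C*w z1*\<mu> z2)" using L C(2) by (intro mult_left_mono) auto
   also have "... <= L*(C*w z1*(L*\<mu>' z2))"
    using L C(1) u2 tameD(4)[OF w, of z1] by (intro mult_left_mono) auto
   finally show ?thesis by (simp add: K_def mult_ac)
  qed
 qed
qed

lemma Lpq_norm_moderate:
 assumes \<mu>: "\<mu> \<in> borel_measurable lebesgue" "!!z. 0 < \<mu> z" and [measurable]: "\<mu>' \<in> BM" and pos: "!!z. 0 < \<mu>' z"
  and K: "1 <= K" "!!z. \<mu>' z <= K*\<mu> z" "!!z. \<mu> z <= K*\<mu>' z"
  and p: "1 <= p" "1 <= q" and [measurable]: "F \<in> BM"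
 shows "Lpq_norm p q \<mu> F <= en K*LPQ p q (%z. en (cmod (F z))*en (\<mu>' z))"
  and "LPQ p q (%z. en (cmod (F z))*en (\<mu>' z)) <= en K*Lpq_norm p q \<mu> F"
proof -
 obtain g where g [measurable]: "g \<in> BM" and eq: "AEL z. \<mu> z = g z"
  using completion_ex_borel_measurable_real[OF \<mu>(1)] by auto
 let ?B = "%z. en (cmod (F z)*g z)"
 let ?C = "Lpq_norm p q \<mu> F"
 have e: "?C = LPQ p q (%z. ?B z)"
  by (rule Lpq_norm_AE_borel[OF _ g eq p(1)]) measurable
 let ?A = "LPQ p q (%z. en (cmod (F z))*en (\<mu>' z))"
 have "?C <= LPQ p q (%z. en K*(en (cmod (F z))*en (\<mu>' z)))"
  unfolding e
 proof (rule LPQ_mono_AE)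
  show "AEL z. ?B z <= en K*(en (cmod (F z))*en (\<mu>' z))"
   using eq
  proof eventually_elim
   case (elim z)
   have "cmod (F z)*\<mu> z <= cmod (F z)*(K*\<mu>' z)" by (intro mult_left_mono K) auto
   hence "?B z <= en (K*(cmod (F z)*\<mu>' z))"
    using elim by (intro ennreal_leI) (simp add: mult_ac)
   thus ?case using K(1) less_imp_le[OF pos[of z]] by (simp add: ennreal_mult)
  qed
 qed (use p in measurable)
 also have "... <= en K*?A"
  by (rule LPQ_cmult[OF _ p]) measurable
 finally show "?C <= en K*?A" .
 have "?A <= LPQ p q (%z. en K*?B z)"
 proof (rule LPQ_mono_AE)
  show "AEL z. en (cmod (F z))*en (\<mu>' z) <= en K*?B z"
   using eq
  proof eventually_elim
   case (elim z)
   have "cmod (F z)*\<mu>' z <= cmod (F z)*(K*\<mu> z)" by (intro mult_left_mono K) auto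
   hence "en (cmod (F z)*\<mu>' z) <= en (K*(cmod (F z)*g z))"
    using elim by (intro ennreal_leI) (simp add: mult_ac)
   thus ?case using K(1) less_imp_le[OF pos[of z]] less_imp_le[OF \<mu>(2)[of z]] elim by (simp add: ennreal_mult)
  qed
 qed (use p in measurable)
 also have "... <= en K*?C" unfolding e by (rule LPQ_cmult[OF _ p]) measurable
 finally show "?A <= en K*?C" .
qed

section \<open>Correlations and Young's inequality\<close>

definition corr :: "('a::euclidean_space \<times> 'a => ennreal) => ('a*'a => ennreal) => 'a*'a => ennreal" where
 "corr H F y = (NNINT r. H r*F (y + r))"

lemma corr_measurable [measurable (raw)]:
 assumes [measurable]: "H \<in> BM" "F \<in> BM" "y \<in> borel_measurable M"
 shows "(%x. corr H F (y x)) \<in> borel_measurable M"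
 unfolding corr_def by measurable

lemma corr_mono: "(!!z. F z <= G z) ==> corr H F y <= corr H G y"
 unfolding corr_def by (intro nn_integral_mono mult_left_mono) auto

text \<open>Moderation moves the weight from z to r + z at the cost w r, evenness of w fixing the
  sign; then the mixed norm passes under the integral by Minkowski and is translation
  invariant.\<close>

lemma LPQ_corr:
 assumes [measurable]: "H \<in> BM" "F \<in> BM" "\<mu>' \<in> BM" "w \<in> BM"
  and p: "1 <= p" "1 <= q" and mod: "!!z1 z2. \<mu>' (z1 + z2) <= K*w z1*\<mu>' z2"
  and ev: "!!z. w (- z) = w z" and pos: "0 <= K" "!!z. 0 <= w z" "!!z. 0 <= \<mu>' z"
 shows "LPQ p q (%z. corr H F z*en (\<mu>' z)) <= en K*(NNINT r. H r*en (w r))*LPQ p q (%z. F z*en (\<mu>' z))"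
proof -
 let ?A = "%r. en K*(H r*en (w r))"
 let ?B = "%r z. en (\<mu>' (r + z))"
 let ?C = "%z. en (\<mu>' z)"
 let ?D = "LPQ p q (%z. F z*?C z)"
 let ?E = "%r. LPQ p q (%z. (?A r)*(F (r + z)*?B r z))"
 let ?F = "%z. NNINT r. (?A r)*(F (r + z)*?B r z)"
 have "LPQ p q (%z. corr H F z*?C z) <= LPQ p q (%z. ?F z)"
 proof (rule LPQ_mono)
  fix z
  have "corr H F z*?C z = (NNINT r. H r*F (z + r)*?C z)"
   unfolding corr_def by (rule nn_integral_multc[symmetric]) measurable
  also have "... <= ?F z"
  proof (rule nn_integral_mono)
   fix r
   have "?C z <= en (K*w r*\<mu>' (r + z))"
    using mod[of "- r" "r + z"] ev[of r] by (intro ennreal_leI) simp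
   also have "... = en K*en (w r)*?B r z"
    using pos by (simp add: ennreal_mult)
   finally have "H r*F (z + r)*?C z <= H r*F (z + r)*(en K*en (w r)*?B r z)"
    by (rule mult_left_mono) simp
   thus "H r*F (z + r)*?C z <= (?A r)*(F (r + z)*?B r z)"
    by (simp add: mult_ac add.commute)
  qed
  finally show "corr H F z*?C z <= ?F z" .
 qed (use p in measurable)
 also have "... <= (NNINT r. ?E r)"
  by (rule LPQ_Minkowski[OF sigma_finite_lborel _ p]) measurable
 also have "... <= (NNINT r. (?A r)*?D)"
 proof (rule nn_integral_mono)
  fix r
  have "?E r <= (?A r)*LPQ p q (%z. F (r + z)*?B r z)"
   by (rule LPQ_cmult[OF _ p]) measurable
  also have "LPQ p q (%z. F (r + z)*?B r z) = ?D"
   by (rule LPQ_shift[where F="%z. F z*?C z", OF _ p]) measurable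
  finally show "?E r <= (?A r)*?D" .
 qed
 also have "... = en K*(NNINT r. H r*en (w r))*?D"
  by (simp add: nn_integral_multc nn_integral_cmult)
 finally show ?thesis .
qed

lemma MM_tf_shift:
 assumes w: "tame w" and f: "MM w f"
 shows "MM w (tf_shift z f)"
proof -
 note [measurable] = w f
 obtain C where C: "1 <= C" "!!z1 z2. w (z1 + z2) <= C*w z1*w z2"
  using tame_const[OF w] by blast
 have "intg (%x. cmod (VG (tf_shift z f) x)*w x)"
 proof (rule int_dom)
  show "intg (%x. (C*w z)*(cmod (VG f (- z + x))*w (- z + x)))"
   by (intro integrable_mult_right integrable_lborel_shift[OF MM_D(3)[OF f]])
  show "norm (cmod (VG (tf_shift z f) x)*w x) <= (C*w z)*(cmod (VG f (- z + x))*w (- z + x))" for x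
   using mult_left_mono[OF C(2)[of z "x - z"] norm_ge_zero[of "VG f (x - z)"]] tameD(4)[OF w, of x]
   by (simp add: norm_STFT_tf_shift abs_mult mult_ac)
 qed measurable
 thus ?thesis
  using continuous_on_tf_shift[OF MM_D(1)[OF f]] L2_tf_shift[OF MM_D(2)[OF f]] unfolding MM_def by blast
qed

lemma antidual_lincomb:
 assumes w: "tame w" and f: "f \<in> M1_antidual w" and g: "g \<in> M1_antidual w"
 shows "(%k. c*f k + g k) \<in> M1_antidual w"
proof -
 obtain C1 where C1: "0 <= C1" "!!g. MM w g ==> cmod (f g) <= C1*N1 w g" using antidualD(6)[OF w f] by blast
 obtain C2 where C2: "0 <= C2" "!!h. MM w h ==> cmod (g h) <= C2*N1 w h" using antidualD(6)[OF w g] by blast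
 show ?thesis
 proof (rule antidualI[OF w])
  show "0 <= cmod c*C1 + C2" using C1 C2 by simp
  show "cmod (c*f h + g h) <= (cmod c*C1 + C2)*N1 w h" if "MM w h" for h
  proof -
   have "cmod (c*f h + g h) <= cmod c*cmod (f h) + cmod (g h)" by (metis norm_triangle_ineq norm_mult)
   also have "... <= cmod c*(C1*N1 w h) + C2*N1 w h"
    using C1(2)[OF that] C2(2)[OF that] by (intro add_mono mult_left_mono) auto
   finally show ?thesis by (simp add: algebra_simps)
  qed
  show "c*f (%t. d*h t + k t) + g (%t. d*h t + k t) = cnj d*(c*f h + g h) + (c*f k + g k)" if "MM w h" "MM w k" for h k d
   unfolding antidualD(1)[OF w f that] antidualD(1)[OF w g that] by (simp add: algebra_simps)
 qed
qed

lemma antidual_diff: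
 assumes w: "tame w" and f: "f \<in> M1_antidual w" and g: "g \<in> M1_antidual w"
 shows "(%k. f k - g k) \<in> M1_antidual w"
 using antidual_lincomb[OF w g f, of "-1"] by simp

lemma stft_measurable:
 assumes w: "tame w" and f: "f \<in> M1_antidual w"
 shows "stft gaussian f \<in> BM"
 by (rule BM_contI[OF antidual_stft(1)[OF w f]])

text \<open>The weak inversion formula at a shifted window: passing from the Gaussian to another
  window costs a correlation with the transform of that window.\<close>

lemma stft_rep:
 fixes f :: "('a::euclidean_space => complex) => complex"
 assumes w: "tame w" and f: "f \<in> M1_antidual w" and \<phi>: "MM w \<phi>"
 shows "stft \<phi> f z = of_real (cg TYPE('a))*(LBINT x. stft gaussian f x*cnj (VG (tf_shift z \<phi>) x))"
  and "stft \<phi> f \<in> BM"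
  and "en (cmod (stft \<phi> f z)) <= corr (%x. en (cg TYPE('a)*cmod (VG \<phi> x))) (%x. en (cmod (stft gaussian f x))) z"
proof -
 note [measurable] = stft_measurable[OF w f]
 note [measurable] = \<phi>
 let ?A = "stft gaussian f"
 let ?B = "of_real (cg TYPE('a))"
 show 1: "stft \<phi> f z = ?B*(LBINT x. ?A x*cnj (VG (tf_shift z \<phi>) x))" for z
  using antidual_rep(2)[OF w f MM_tf_shift[OF w \<phi>]] by (simp add: stft_def)
 have "(%z. ?B*(LBINT x. ?A x*cnj (ph ((snd z - snd x) \<bullet> fst z)*VG \<phi> (x - z)))) \<in> BM"
  by measurable
 thus "stft \<phi> f \<in> BM" unfolding 1[abs_def] by (simp add: STFT_tf_shift)
 have c0: "0 <= cg TYPE('a)" by (simp add: less_imp_le)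
 have "en (cmod (stft \<phi> f z)) = en (cmod (LBINT x. ?B*(?A x*cnj (VG (tf_shift z \<phi>) x))))"
  unfolding 1 by simp
 also have "... <= (NNINT x. en (cmod (?B*(?A x*cnj (VG (tf_shift z \<phi>) x)))))"
  by (rule integral_norm_le_nn)
 also have "... = (NNINT x. en (cg TYPE('a)*cmod (VG \<phi> (x - z)))*en (cmod (?A x)))"
  using c0 by (simp add: norm_mult norm_STFT_tf_shift mult_ac flip: ennreal_mult)
 also have "... = (NNINT x. en (cg TYPE('a)*cmod (VG \<phi> (z + x - z)))*en (cmod (?A (z + x))))"
  by (rule nn_integral_lborel_shift[symmetric]) measurable
 finally show "en (cmod (stft \<phi> f z)) <= corr (%x. en (cg TYPE('a)*cmod (VG \<phi> x))) (%x. en (cmod (?A x))) z"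
  by (simp add: corr_def)
qed

text \<open>The endpoint of Young's inequality for functions of growth w. It makes every integral
  below converge for arbitrary functionals in the antidual.\<close>

lemma corr_weight_bound:
 assumes w: "tame w" and C: "0 <= C" "!!z1 z2. w (z1 + z2) <= C*w z1*w z2" and k: "0 <= k"
  and [measurable]: "H \<in> BM" and F: "!!z. F z <= en (k*w z)"
 shows "corr H F y <= en (k*C)*(NNINT r. H r*en (w r))*en (w y)"
proof -
 note [measurable] = w
 let ?A = "en (k*C)"
 have "corr H F y <= (NNINT r. (?A*en (w y))*(H r*en (w r)))"
  unfolding corr_def
 proof (rule nn_integral_mono)
  fix r
  have "k*w (y + r) <= k*(C*w y*w r)" using C(2) k by (rule mult_left_mono)
  hence "F (y + r) <= en (k*C*w y*w r)"
   by (intro order_trans[OF F] ennreal_leI) (simp add: mult_ac)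
  also have "... = ?A*en (w y)*en (w r)"
   using k C(1) tameD(4)[OF w] by (simp add: ennreal_mult)
  finally have "H r*F (y + r) <= H r*(?A*en (w y)*en (w r))" by (rule mult_left_mono) simp
  thus "H r*F (y + r) <= (?A*en (w y))*(H r*en (w r))" by (simp add: mult_ac)
 qed
 also have "... = ?A*(NNINT r. H r*en (w r))*en (w y)"
  by (subst nn_integral_cmult) (auto simp: mult_ac)
 finally show ?thesis .
qed

section \<open>Kernel operators on modulation spaces\<close>

text \<open>Both \<mu> and its Borel equivalent \<mu>' are kept: norms are estimated with \<mu>' and
  translated back by \<open>mod_norm_le\<close> at the price of a factor K each way.\<close>

locale modulation =
 fixes w \<mu> \<mu>' :: "'a::euclidean_space \<times> 'a => real" and K :: real and p q :: ennreal
 assumes w: "tame w" and \<mu>: "\<mu> \<in> moderate_weights w"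
  and \<mu>'_meas [measurable]: "\<mu>' \<in> BM" and \<mu>'_pos: "!!z. 0 < \<mu>' z"
  and K: "1 <= K" and \<mu>'_le: "!!z. \<mu>' z <= K*\<mu> z" and \<mu>_le: "!!z. \<mu> z <= K*\<mu>' z"
  and mod: "!!z1 z2. \<mu>' (z1 + z2) <= K*w z1*\<mu>' z2"
  and p: "1 <= p" and q: "1 <= q"
begin

lemma w_meas [measurable]: "w \<in> BM"
 using w by (rule tame_measurable)

lemma w_nonneg: "0 <= w z" by (rule tameD(4)[OF w])

lemma K_nonneg: "0 <= K" using K by simp

definition nrm :: "('a*'a => ennreal) => ennreal" where
 "nrm F = LPQ p q (%z. F z*en (\<mu>' z))"

abbreviation wint :: "('a*'a => ennreal) => ennreal" where
 "wint H \<equiv> (NNINT r. H r*en (w r))"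

abbreviation absF :: "'a functional => 'a*'a => ennreal" where
 "absF f \<equiv> (%x. en (cmod (stft gaussian f x)))"

lemma nrm_mono:
 assumes [measurable]: "F \<in> BM" "G \<in> BM" and le: "!!z. F z <= G z"
 shows "nrm F <= nrm G"
 unfolding nrm_def by (intro LPQ_mono p q mult_right_mono le) auto

lemma nrm_add:
 assumes [measurable]: "F \<in> BM" "G \<in> BM"
 shows "nrm (%z. F z + G z) <= nrm F + nrm G"
 unfolding nrm_def distrib_right by (intro LPQ_add p q) measurable

lemma nrm_corr:
 assumes [measurable]: "H \<in> BM" "F \<in> BM"
 shows "nrm (corr H F) <= en K*wint H*nrm F"
 unfolding nrm_def using tameD(5)[OF w] K_nonneg w_nonneg less_imp_le[OF \<mu>'_pos]
 by (intro LPQ_corr p q mod) auto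

lemma mod_norm_le:
 assumes [measurable]: "stft gaussian f \<in> BM"
 shows "mod_norm p q \<mu> f <= en K*nrm (absF f)"
  and "nrm (absF f) <= en K*mod_norm p q \<mu> f"
proof -
 have m: "\<mu> \<in> borel_measurable lebesgue" "!!z. 0 < \<mu> z" using \<mu> unfolding moderate_weights_def by blast+
 show "mod_norm p q \<mu> f <= en K*nrm (absF f)"
  unfolding mod_norm_def nrm_def by (rule Lpq_norm_moderate(1)[OF m \<mu>'_meas \<mu>'_pos K \<mu>'_le \<mu>_le p q assms])
 show "nrm (absF f) <= en K*mod_norm p q \<mu> f"
  unfolding mod_norm_def nrm_def by (rule Lpq_norm_moderate(2)[OF m \<mu>'_meas \<mu>'_pos K \<mu>'_le \<mu>_le p q assms])
qed

lemma Mpq_iff: "f \<in> Mpq w p q \<mu> \<longleftrightarrow> f \<in> M1_antidual w & nrm (absF f) < \<infinity>"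
proof (cases "f \<in> M1_antidual w")
 case True
 have [measurable]: "stft gaussian f \<in> BM" by (rule stft_measurable[OF w True])
 have "stft gaussian f \<in> borel_measurable lebesgue" by (rule measurable_completion) simp
 moreover have "Lpq_norm p q \<mu> (stft gaussian f) < \<infinity> \<longleftrightarrow> nrm (absF f) < \<infinity>"
  using mod_norm_le[of f] unfolding mod_norm_def
  by (auto intro: le_less_trans simp: ennreal_mult_less_top)
 ultimately show ?thesis using True by (simp add: Mpq_def Lpq_def)
qed (simp add: Mpq_def)

text \<open>Completing the square again; half of the Gaussian is retained because the remaining
  factor still has to be integrated in each variable.\<close>

lemma gauss_weight_bound: "\<exists>K0>0. \<forall>z. w z*exp (- (pi/2)*(norm z)^2) <= K0*exp (- (pi/4)*(norm z)^2)"
proof -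
 obtain k K1 where k: "0 <= k" "0 < K1" "!!z. w z <= K1*exp (k*norm z)"
  by (rule tame_exp_bound[OF w]) (rule that)
 let ?A = "%r. exp (- (pi/2)*r^2)"
 let ?B = "exp (k^2/pi)"
 have "w z*exp (- (pi/2)*(norm z)^2) <= (K1*?B)*exp (- (pi/4)*(norm z)^2)" for z
 proof -
  define r where "r = norm z"
  have "0 <= (k - pi/2*r)^2/pi" by simp
  also have "... = k^2/pi - k*r + pi/4*r^2"
   by (simp add: power2_diff field_simps) (simp add: power2_eq_square)
  finally have "k*r + (- (pi/2)*r^2) <= k^2/pi + (- (pi/4)*r^2)" by (simp add: algebra_simps)
  hence "exp (k*r)*?A r <= ?B*exp (- (pi/4)*r^2)"
   by (simp flip: exp_add)
  hence "K1*(exp (k*r)*?A r) <= K1*(?B*exp (- (pi/4)*r^2))"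
   using k(2) by (intro mult_left_mono) auto
  moreover have "w z*?A r <= K1*exp (k*r)*?A r"
   using k(3)[of z] by (intro mult_right_mono) (auto simp: r_def)
  ultimately show ?thesis by (simp only: r_def mult.assoc)
 qed
 thus ?thesis using k(2) by (intro exI[of _ "K1*?B"]) auto
qed

text \<open>The Gaussian left over after absorbing the weight is a product of two such factors,
  which is what mixed-norm estimates ask for.\<close>

definition ge :: "'a => ennreal" where "ge x = en (exp (- (pi/4)*(norm x)^2))"

lemma ge_meas [measurable]: "ge \<in> BM"
 unfolding ge_def by measurable

lemma ge_prod: "en (exp (- (pi/4)*(norm z)^2)) = ge (fst z)*ge (snd z)"
proof -
 have "- (pi/4)*(norm z)^2 = - (pi/4)*(norm (fst z))^2 + - (pi/4)*(norm (snd z))^2"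
  by (simp add: norm_prod_def distrib_left)
 thus ?thesis by (simp only: ge_def exp_add) (simp add: ennreal_mult)
qed

lemma ge_bound:
 obtains R where "1 <= R" "!!x. ge x <= 1" "(NNINT x. ge x) <= en R"
proof -
 have "intg (%x::'a. exp (- (pi/4)*(norm x)^2))"
  using gaussian_FT(1)[of "1/4", where 'a='a] by simp
 hence "(NNINT x. ge x) = en (LBINT x. exp (- (pi/4)*(norm (x :: 'a))^2))"
  unfolding ge_def by (intro nn_integral_eq_integral) auto
 also have "... <= en (max 1 (LBINT x. exp (- (pi/4)*(norm (x :: 'a))^2)))" by (intro ennreal_leI) simp
 finally show ?thesis by (intro that[of "max 1 (LBINT x. exp (- (pi/4)*(norm (x :: 'a))^2))"]) (auto simp: ge_def)
qed

text \<open>The embedding of the modulation space into functions of growth w: by the reproducing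
  formula |V f| at x is at most a Gaussian average around x, moderation puts the weight inside the
  average, and \<open>LPQ_local\<close> bounds it by the mixed norm.\<close>

lemma stft_pointwise_bound:
 obtains c where "0 <= c" "!!f x. f \<in> M1_antidual w ==> absF f x <= en (c*w x)*nrm (absF f)"
proof -
 let ?A = "%z. exp (- (pi/4)*(norm z)^2)"
 let ?D = "%z. exp (- (pi/2)*(norm z)^2)"
 obtain K0 where K0: "0 < K0" "!!z. w z*?D z <= K0*?A z"
  using gauss_weight_bound by blast
 obtain R where R: "1 <= R" "!!x. ge x <= 1" "(NNINT x. ge x) <= en R"
  by (rule ge_bound) (rule that)
 define c1 where "c1 = cg TYPE('a)*(K*K0)"
 have c1: "0 <= c1" unfolding c1_def using K_nonneg K0 by (intro mult_nonneg_nonneg) (auto simp: less_imp_le)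
 let ?E = "c1*(2 * R*(2 * R))"
 define c where "c = K/\<mu>' 0*?E"
 let ?F = "%x r. \<mu>' (x + r)"
 let ?B = "%f x r. (absF f (x + r)*en (?F x r))*(ge (fst r)*ge (snd r))"
 let ?C = "%x. en (\<mu>' x)"
 have main: "absF f x <= en (c*w x)*nrm (absF f)" if f: "f \<in> M1_antidual w" for f x
 proof -
  note [measurable] = stft_measurable[OF w f]
  have "absF f x <= corr (%x. en (cg TYPE('a)*cmod (VG (gaussian :: 'a => complex) x))) (absF f) x"
   by (rule stft_rep(3)[OF w f]) (use MM_tf_gaussian[OF w, of 0] in simp)
  hence "absF f x*?C x <= corr (%x. en (cg TYPE('a)*cmod (VG (gaussian :: 'a => complex) x))) (absF f) x*?C x"
   by (rule mult_right_mono) simp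
  also have "... = (NNINT r. en (cg TYPE('a)*cmod (VG (gaussian :: 'a => complex) r))*absF f (x + r)*?C x)"
   unfolding corr_def by (rule nn_integral_multc[symmetric]) measurable
  also have "... <= (NNINT r. en c1*(?B f x r))"
  proof (rule nn_integral_mono)
   fix r :: "'a*'a"
   have "cmod (VG (gaussian :: 'a => complex) r) <= ?D r"
    using RK_le[of 0 r] by simp
   moreover have "\<mu>' x <= K*w r*?F x r"
    using mod[of "- r" "x + r"] tameD(5)[OF w, of r] by simp
   ultimately have "cmod (VG (gaussian :: 'a => complex) r)*\<mu>' x <= ?D r*(K*w r*?F x r)"
    using less_imp_le[OF \<mu>'_pos[of x]] by (intro mult_mono) auto
   also have "... = K*?F x r*(w r*?D r)" by simp
   also have "... <= K*?F x r*(K0*?A r)"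
    using K_nonneg less_imp_le[OF \<mu>'_pos[of "x + r"]] by (intro mult_left_mono K0) auto
   finally have "cg TYPE('a)*(cmod (VG (gaussian :: 'a => complex) r)*\<mu>' x) <= cg TYPE('a)*(K*?F x r*(K0*?A r))"
    by (intro mult_left_mono) (auto simp: less_imp_le)
   hence le: "en (cg TYPE('a)*(cmod (VG (gaussian :: 'a => complex) r)*\<mu>' x)) <= en (c1*?F x r*?A r)"
    by (intro ennreal_leI) (simp add: c1_def mult_ac)
   have "en (cg TYPE('a)*cmod (VG (gaussian :: 'a => complex) r))*absF f (x + r)*?C x
     = en (cg TYPE('a)*(cmod (VG (gaussian :: 'a => complex) r)*\<mu>' x))*absF f (x + r)"
    using less_imp_le[OF \<mu>'_pos[of x]] less_imp_le[OF cg_pos[where 'a='a]] by (simp add: mult_ac flip: ennreal_mult)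
   also have "... <= en (c1*?F x r*?A r)*absF f (x + r)"
    using le by (rule mult_right_mono) simp
   also have "... = en c1*(?B f x r)"
    unfolding ge_prod[symmetric] using c1 less_imp_le[OF \<mu>'_pos[of "x + r"]] by (simp add: mult_ac flip: ennreal_mult)
   finally show "en (cg TYPE('a)*cmod (VG (gaussian :: 'a => complex) r))*absF f (x + r)*?C x <= en c1*(?B f x r)" .
  qed
  also have "... = en c1*(NNINT r. (absF f (x + r)*en (?F x r))*(ge (fst r)*ge (snd r)))"
   by (rule nn_integral_cmult) measurable
  also have "... <= en c1*(2*en R*(2*en R)*LPQ p q (%r. absF f (x + r)*en (?F x r)))"
   using R(1) by (intro mult_left_mono LPQ_local p q R(3) order_trans[OF R(2)]) (auto simp flip: ennreal_1 intro!: ennreal_leI)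
  also have "LPQ p q (%r. absF f (x + r)*en (?F x r)) = nrm (absF f)"
   unfolding nrm_def by (rule LPQ_shift[where F="%r. absF f r*?C r", OF _ p q]) measurable
  finally have "absF f x*?C x <= en c1*(2*en R*(2*en R)*nrm (absF f))" .
  hence 1: "absF f x*?C x <= en ?E*nrm (absF f)"
  proof -
   have e2: "2*en R = en (2 * R)" using R(1) by (simp add: ennreal_mult)
   have "en c1*(en (2 * R)*en (2 * R)) = en ?E"
    using c1 R(1) by (simp flip: ennreal_mult)
   thus ?thesis
    using \<open>absF f x*en (\<mu>' x) <= en c1*(2*en R*(2*en R)*nrm (absF f))\<close>
    unfolding e2 by (simp only: mult.assoc[symmetric])
  qed
  \<comment> \<open>Moderation between x and 0 bounds 1/\<mu>' x by K/\<mu>' 0 times w x, so the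
    weight can be divided out.\<close>
  have "\<mu>' 0 <= K*w x*\<mu>' x" using mod[of "- x" x] tameD(5)[OF w, of x] by simp
  hence "1 <= K/\<mu>' 0*w x*\<mu>' x" using \<mu>'_pos[of 0] by (simp add: field_simps)
  hence "absF f x*1 <= absF f x*en (K/\<mu>' 0*w x*\<mu>' x)"
   by (intro mult_left_mono) (auto simp flip: ennreal_1 intro!: ennreal_leI)
  also have "... = en (K/\<mu>' 0*w x)*(absF f x*?C x)"
   using K_nonneg w_nonneg[of x] less_imp_le[OF \<mu>'_pos] by (simp add: mult_ac flip: ennreal_mult)
  also have "... <= en (K/\<mu>' 0*w x)*(en ?E*nrm (absF f))"
   by (rule mult_left_mono[OF 1]) simp
  also have "... = en (c*w x)*nrm (absF f)"
   using K_nonneg w_nonneg[of x] less_imp_le[OF \<mu>'_pos] c1 R(1) unfolding mult.assoc[symmetric]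
   by (subst ennreal_mult[symmetric]) (auto simp: c_def mult_ac)
  finally show ?thesis by simp
 qed
 have "0 <= c" unfolding c_def using K_nonneg less_imp_le[OF \<mu>'_pos[of 0]] c1 R(1) by (intro mult_nonneg_nonneg divide_nonneg_nonneg) auto
 thus ?thesis by (rule that) (rule main)
qed

text \<open>An M^1 window lies in every mixed-norm space with weight w: its weighted transform is
  dominated by its own weighted transform convolved with a Gaussian, and Minkowski leaves the mixed
  norm of that Gaussian to be estimated.\<close>

lemma LPQ_window_finite:
 fixes \<phi> :: "'a => complex"
 assumes \<phi>: "MM w \<phi>"
 shows "LPQ p q (%z. en (cmod (VG \<phi> z))*en (w z)) < \<infinity>"
proof -
 obtain C where C: "1 <= C" "!!z1 z2. w (z1 + z2) <= C*w z1*w z2" using tame_const[OF w] by blast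
 obtain K0 where K0: "0 < K0" "!!z. w z*exp (- (pi/2)*(norm z)^2) <= K0*exp (- (pi/4)*(norm z)^2)"
  using gauss_weight_bound by blast
 obtain R where R: "1 <= R" "!!x. ge x <= 1" "(NNINT x. ge x) <= en R"
  by (rule ge_bound) (rule that)
 note [measurable] = \<phi>
 define u where "u z = en (cmod (VG \<phi> z))" for z
 have [measurable]: "u \<in> BM" unfolding u_def by measurable
 define c1 where "c1 = cg TYPE('a)*C*K0"
 have c1: "0 <= c1" unfolding c1_def using C K0 by (intro mult_nonneg_nonneg) (auto simp: less_imp_le)
 define E where "E z = ge (fst z)*ge (snd z)" for z :: "'a*'a"
 have [measurable]: "E \<in> BM" unfolding E_def by measurable
 let ?G = "(%\<omega>. Lp_norm p (%x. ge \<omega>*ge x))"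
 have E: "LPQ p q E <= en R*en R"
 proof -
  have "LPQ p q E = Lp_norm q ?G"
   by (simp add: LPQ_def E_def mult.commute)
  also have "... <= Lp_norm q (%\<omega>. en R*ge \<omega>)"
  proof (rule Lp_norm_mono[OF _ _ q])
   have "Lp_norm p ge <= en R"
    by (rule Lp_norm_le_of_bounded_integrable[OF _ p R(2,3)]) (use R(1) in \<open>auto simp flip: ennreal_1 intro!: ennreal_leI\<close>)
   thus "AEL \<omega>. Lp_norm p (%x. ge \<omega>*ge x) <= en R*ge \<omega>"
    by (intro AE_I2 order_trans[OF Lp_norm_cmult[OF _ p]]) (auto simp: mult.commute[of "ge _"] intro!: mult_right_mono)
   show "?G \<in> BM"
    by (rule Lp_norm_measurable[OF _ p]) measurable
  qed measurable
  also have "... <= en R*Lp_norm q ge" by (rule Lp_norm_cmult[OF _ q]) measurable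
  also have "... <= en R*en R"
   by (intro mult_left_mono Lp_norm_le_of_bounded_integrable[OF _ q R(2,3)]) (use R(1) in \<open>auto simp flip: ennreal_1 intro!: ennreal_leI\<close>)
  finally show ?thesis .
 qed
 let ?A = "%r. en c1*(u r*en (w r))"
 let ?B = "en (cg TYPE('a))"
 let ?C = "%z r. exp (- (pi/4)*(norm (z - r))^2)"
 let ?D = "%r z. en (cmod (RK r z))"
 let ?E = "%r. LPQ p q (%z. (?A r)*E (- r + z))"
 let ?F = "en R*en R"
 have "LPQ p q (%z. u z*en (w z)) <= LPQ p q (%z. (NNINT r. (?A r)*E (- r + z)))"
 proof (rule LPQ_mono)
  fix z
  have "u z <= ?B*(NNINT r. u r*?D r z)"
  proof -
   have "u z = ?B*en (cmod (LBINT r. VG \<phi> r * RK r z))"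
    unfolding u_def by (subst STFT_reproducing(1)[OF MM_D(2)[OF \<phi>]]) (simp add: norm_mult ennreal_mult less_imp_le)
   also have "en (cmod (LBINT r. VG \<phi> r * RK r z)) <= (NNINT r. u r*?D r z)"
    by (rule order_trans[OF integral_norm_le_nn]) (simp add: norm_mult u_def ennreal_mult)
   finally show ?thesis by (simp add: mult_left_mono)
  qed
  hence "u z*en (w z) <= ?B*(NNINT r. u r*?D r z)*en (w z)"
   by (rule mult_right_mono) simp
  also have "... = (NNINT r. ?B*(u r*?D r z)*en (w z))"
   by (simp add: nn_integral_cmult nn_integral_multc)
  also have "... <= (NNINT r. (?A r)*E (- r + z))"
  proof (rule nn_integral_mono)
   fix r
   have "cmod (RK r z)*w z <= exp (- (pi/2)*(norm (z - r))^2)*(C*w r*w (z - r))"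
    using RK_le[of r z] C(2)[of r "z - r"] w_nonneg[of z] by (intro mult_mono) auto
   also have "... = C*w r*(w (z - r)*exp (- (pi/2)*(norm (z - r))^2))" by simp
   also have "... <= C*w r*(K0*?C z r)"
    using C(1) w_nonneg[of r] by (intro mult_left_mono K0) auto
   finally have "cg TYPE('a)*(cmod (RK r z)*w z) <= cg TYPE('a)*(C*w r*(K0*?C z r))"
    by (intro mult_left_mono) (auto simp: less_imp_le)
   hence le: "en (cg TYPE('a)*(cmod (RK r z)*w z)) <= en (c1*w r*?C z r)"
    by (intro ennreal_leI) (simp add: c1_def mult_ac)
   have "?B*(u r*?D r z)*en (w z) = u r*en (cg TYPE('a)*(cmod (RK r z)*w z))"
    using w_nonneg[of z] less_imp_le[OF cg_pos[where 'a='a]] by (simp add: mult_ac ennreal_mult)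
   also have "... <= u r*en (c1*w r*?C z r)"
    using le by (rule mult_left_mono) simp
   also have "... = (?A r)*E (- r + z)"
    unfolding E_def ge_prod[symmetric] using c1 w_nonneg[of r] by (simp add: ennreal_mult mult_ac)
   finally show "?B*(u r*?D r z)*en (w z) <= (?A r)*E (- r + z)" .
  qed
  finally show "u z*en (w z) <= (NNINT r. (?A r)*E (- r + z))" .
 qed (use p q in measurable)
 also have "... <= (NNINT r. ?E r)"
  by (rule LPQ_Minkowski[OF sigma_finite_lborel _ p q]) measurable
 also have "... <= (NNINT r. (?A r)*?F)"
 proof (rule nn_integral_mono)
  fix r
  have "?E r <= (?A r)*LPQ p q (%z. E (- r + z))"
   by (rule LPQ_cmult[OF _ p q]) measurable
  also have "... <= (?A r)*?F"
   using E by (subst LPQ_shift[OF _ p q]) (auto intro: mult_left_mono)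
  finally show "?E r <= (?A r)*?F" .
 qed
 also have "... = en c1*(NNINT r. u r*en (w r))*?F"
  by (simp add: nn_integral_multc nn_integral_cmult)
 also have "... < \<infinity>"
  using integrable_nn_less_top[OF MM_D(3)[OF \<phi>]] w_nonneg
  by (simp add: ennreal_mult_less_top u_def abs_mult flip: ennreal_mult)
 finally show ?thesis by (simp add: u_def)
qed

end

context modulation
begin

text \<open>Operators of the form \<open>\<langle>T f, g\<rangle> = \<integral> Q f (y) \<langle>\<pi>(y)\<phi>, g\<rangle> dy\<close> with a density \<open>Q f\<close> that is controlled by a
 correlation of \<open>|V f|\<close> with a kernel in \<open>L\<^sup>1\<^sub>w\<close>.\<close>

definition kernel_op :: "('a => complex) => ('a functional => 'a*'a => complex) => ('a*'a => ennreal) => ('a functional => 'a functional) => bool" where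
 "kernel_op \<phi> Q H T \<longleftrightarrow> MM w \<phi> & H \<in> BM & wint H < \<infinity> &
   (\<forall>f\<in>M1_antidual w. Q f \<in> BM & (\<forall>y. en (cmod (Q f y)) <= corr H (absF f) y) &
    (\<forall>g. MM w g --> T f g = (LBINT y. Q f y*cnj (STFT \<phi> g y)))) &
   (\<forall>f\<in>M1_antidual w. \<forall>g\<in>M1_antidual w. \<forall>c y. Q (%k. c*f k + g k) y = c*Q f y + Q g y)"

lemma kernel_opD:
 assumes "kernel_op \<phi> Q H T"
 shows "MM w \<phi>" "H \<in> BM" "wint H < \<infinity>"
  and "f \<in> M1_antidual w ==> Q f \<in> BM"
  and "f \<in> M1_antidual w ==> en (cmod (Q f y)) <= corr H (absF f) y"
  and "f \<in> M1_antidual w ==> MM w g ==> T f g = (LBINT y. Q f y*cnj (STFT \<phi> g y))"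
  and "f \<in> M1_antidual w ==> f' \<in> M1_antidual w ==> Q (%k. c*f k + f' k) y = c*Q f y + Q f' y"
 using assms unfolding kernel_op_def by blast+

lemma absF_meas: "f \<in> M1_antidual w ==> absF f \<in> BM"
proof -
 assume f: "f \<in> M1_antidual w"
 note [measurable] = stft_measurable[OF w f]
 show ?thesis by measurable
qed

lemma absF_bound:
 assumes f: "f \<in> M1_antidual w"
 obtains k where "0 <= k" "!!z. absF f z <= en (k*w z)"
proof -
 obtain k where "0 <= k" "!!z. cmod (stft gaussian f z) <= k*w z" using antidual_stft(2)[OF w f] by blast
 thus ?thesis by (intro that[of k]) (auto intro!: ennreal_leI)
qed

text \<open>The density grows at most like w, so pairing it with an integrable weighted transform is
  legitimate for every functional, before any mixed norm is considered.\<close>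

lemma kernel_op_density_bound:
 assumes T: "kernel_op \<phi> Q H T" and f: "f \<in> M1_antidual w"
 obtains k where "0 <= k" "!!y. cmod (Q f y) <= k*w y"
proof -
 obtain C where C: "1 <= C" "!!z1 z2. w (z1 + z2) <= C*w z1*w z2" using tame_const[OF w] by blast
 obtain k where k: "0 <= k" "!!z. absF f z <= en (k*w z)" by (rule absF_bound[OF f]) (rule that)
 note H = kernel_opD(2,3)[OF T]
 obtain h where h: "wint H = en h" "0 <= h" using H(2) by (cases "wint H") auto
 have C0: "0 <= C" using C(1) by simp
 show ?thesis
 proof (rule that[of "k*C*h"])
  show "0 <= k*C*h" using k C h by simp
  fix y
  have "en (cmod (Q f y)) <= corr H (absF f) y" by (rule kernel_opD(5)[OF T f])
  also have "... <= en (k*C)*wint H*en (w y)"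
   by (rule corr_weight_bound[OF w C0 C(2) k(1) H(1) k(2)])
  also have "... = en (k*C*h*w y)"
   using k C h w_nonneg[of y] by (simp add: ennreal_mult)
  finally show "cmod (Q f y) <= k*C*h*w y"
   using k C h w_nonneg[of y] by (subst (asm) ennreal_le_iff) auto
 qed
qed

lemma kernel_op_integrable:
 assumes T: "kernel_op \<phi> Q H T" and f: "f \<in> M1_antidual w" and g: "MM w g"
 shows "intg (%y. Q f y*cnj (STFT \<phi> g y))"
  and "(!!y. cmod (Q f y) <= k*w y) ==> 0 <= k ==> cmod (T f g) <= k*(LBINT z. cmod (STFT \<phi> g z)*w z)"
proof -
 note \<phi> = kernel_opD(1)[OF T] and [measurable] = kernel_opD(4)[OF T f] and Teq = kernel_opD(6)[OF T f g]
 have [measurable]: "g \<in> BM" "\<phi> \<in> BM" using g \<phi> by (auto intro: MM_measurable)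
 let ?A = "%z. STFT \<phi> g z"
 have i: "intg (%z. cmod (?A z)*w z)"
  by (rule STFT_windows_weighted[OF w]) (use g \<phi> in blast)
 obtain k0 where k0: "0 <= k0" "!!y. cmod (Q f y) <= k0*w y" by (rule kernel_op_density_bound[OF T f]) (rule that)
 have le: "cmod (Q f y*cnj (?A y)) <= k*(cmod (?A y)*w y)" if "cmod (Q f y) <= k*w y" for k y
  using mult_right_mono[OF that, of "cmod (?A y)"] by (simp add: norm_mult mult_ac)
 show I: "intg (%y. Q f y*cnj (?A y))"
  by (rule int_dom[OF integrable_mult_right[OF i, of k0]], measurable) (intro le k0)
 show "cmod (T f g) <= k*(LBINT z. cmod (?A z)*w z)" if "!!y. cmod (Q f y) <= k*w y" "0 <= k"
 proof -
  have "cmod (T f g) <= (LBINT y. cmod (Q f y*cnj (?A y)))" unfolding Teq by (rule integral_norm_bound)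
  also have "... <= (LBINT y. k*(cmod (?A y)*w y))"
   by (intro integral_mono integrable_norm I integrable_mult_right i le that)
  finally show ?thesis by simp
 qed
qed

lemma kernel_op_antidual:
 assumes T: "kernel_op \<phi> Q H T" and f: "f \<in> M1_antidual w"
 shows "T f \<in> M1_antidual w"
proof -
 note \<phi> = kernel_opD(1)[OF T] and Teq = kernel_opD(6)[OF T f]
 obtain k where k: "0 <= k" "!!y. cmod (Q f y) <= k*w y" by (rule kernel_op_density_bound[OF T f]) (rule that)
 obtain C where C: "0 <= C" "!!f g. MM w f ==> MM w g ==> (LBINT z. cmod (STFT g f z)*w z) <= C*N1 w f*N1 w g"
  by (rule STFT_windows_weighted[OF w]) blast
 show ?thesis
 proof (rule antidualI[OF w])
  fix g h c assume g: "MM w g" and h: "MM w h"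
  have cg: "MM w (%t. c*g t)" by (rule MM_cmult[OF g])
  have "STFT \<phi> (%t. c*g t + h t) y = c*STFT \<phi> g y + STFT \<phi> h y" for y
   using STFT_add[OF MM_D(2)[OF cg] MM_D(2)[OF h] MM_D(2)[OF \<phi>]] by (simp add: STFT_cmult)
  hence "T f (%t. c*g t + h t) = (LBINT y. cnj c*(Q f y*cnj (STFT \<phi> g y)) + Q f y*cnj (STFT \<phi> h y))"
   by (subst Teq[OF MM_add[OF w cg h]]) (simp add: algebra_simps)
  also have "... = cnj c*T f g + T f h"
   using kernel_op_integrable(1)[OF T f g] kernel_op_integrable(1)[OF T f h] by (simp add: Teq[OF g] Teq[OF h])
  finally show "T f (%t. c*g t + h t) = cnj c*T f g + T f h" .
 next
  show "0 <= k*(C*N1 w \<phi>)" using k(1) C(1) N1_nonneg[OF w] by simp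
  fix g assume g: "MM w g"
  have "cmod (T f g) <= k*(LBINT z. cmod (STFT \<phi> g z)*w z)" using k by (intro kernel_op_integrable(2)[OF T f g])
  also have "... <= k*(C*N1 w g*N1 w \<phi>)" using C(2)[OF g \<phi>] k(1) by (rule mult_left_mono)
  finally show "cmod (T f g) <= k*(C*N1 w \<phi>)*N1 w g" by (simp add: mult_ac)
 qed
qed

definition winP :: "('a => complex) => 'a*'a => ennreal" where
 "winP \<phi> r = en (cmod (STFT \<phi> gaussian r))"

lemma winP:
 assumes \<phi>: "MM w \<phi>"
 shows "winP \<phi> \<in> BM" "wint (winP \<phi>) < \<infinity>"
proof -
 note [measurable] = \<phi>
 show "winP \<phi> \<in> BM" unfolding winP_def by measurable
 show "wint (winP \<phi>) < \<infinity>"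
  using integrable_nn_less_top[OF STFT_gaussian_window_integrable(1)[OF w \<phi>]] w_nonneg
  by (simp add: winP_def abs_mult ennreal_mult)
qed

text \<open>Evaluating T f on a shifted Gaussian exchanges the roles of window and argument; T is
  thus dominated on phase space by two successive correlations, to each of which Young's inequality
  applies.\<close>

lemma kernel_op_stft:
 assumes T: "kernel_op \<phi> Q H T" and f: "f \<in> M1_antidual w"
 shows "absF (T f) x <= corr (winP \<phi>) (%y. en (cmod (Q f y))) x"
proof -
 note \<phi> = kernel_opD(1)[OF T] and [measurable] = kernel_opD(4)[OF T f] and Teq = kernel_opD(6)[OF T f]
 note [measurable] = \<phi>
 have "absF (T f) x = en (cmod (LBINT y. Q f y*cnj (STFT \<phi> (tf_shift x gaussian) y)))"
  by (simp add: stft_def Teq[OF MM_tf_gaussian[OF w]])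
 also have "... <= (NNINT y. en (cmod (Q f y*cnj (STFT \<phi> (tf_shift x gaussian) y))))"
  by (rule integral_norm_le_nn)
 also have "... = (NNINT y. winP \<phi> (y - x)*en (cmod (Q f y)))"
  by (simp add: norm_mult norm_STFT_tf_shift winP_def ennreal_mult mult.commute)
 also have "... = (NNINT y. winP \<phi> (x + y - x)*en (cmod (Q f (x + y))))"
 proof -
  note [measurable] = winP(1)[OF \<phi>]
  show ?thesis by (rule nn_integral_lborel_shift[symmetric]) measurable
 qed
 finally show ?thesis by (simp add: corr_def)
qed

lemma kernel_op_nrm:
 assumes T: "kernel_op \<phi> Q H T" and f: "f \<in> M1_antidual w"
 shows "nrm (absF (T f)) <= en K*wint (winP \<phi>)*(en K*wint H*nrm (absF f))"
proof -
 note \<phi> = kernel_opD(1)[OF T] and [measurable] = kernel_opD(4)[OF T f] kernel_opD(2)[OF T] and Qle = kernel_opD(5)[OF T f]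
 note [measurable] = winP(1)[OF \<phi>] stft_measurable[OF w f] stft_measurable[OF w kernel_op_antidual[OF T f]]
 have "nrm (absF (T f)) <= nrm (corr (winP \<phi>) (corr H (absF f)))"
  by (intro nrm_mono order_trans[OF kernel_op_stft[OF T f] corr_mono] Qle) measurable
 also have "... <= en K*wint (winP \<phi>)*nrm (corr H (absF f))"
  by (rule nrm_corr) measurable
 also have "... <= en K*wint (winP \<phi>)*(en K*wint H*nrm (absF f))"
  by (intro mult_left_mono nrm_corr) auto
 finally show ?thesis .
qed

lemma kernel_op_bounded:
 assumes T: "kernel_op \<phi> Q H T"
 shows "bounded_on_Mpq w p q \<mu> T"
proof -
 note \<phi> = kernel_opD(1)[OF T] and H = kernel_opD(3)[OF T]
 let ?B = "en K*wint (winP \<phi>)*(en K*wint H)"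
 obtain b where b: "en K*?B*en K = en b" "0 <= b"
  using winP(2)[OF \<phi>] H by (cases "en K*?B*en K") (auto simp: ennreal_mult_eq_top_iff)
 let ?A = "mod_norm p q \<mu>"
 let ?C = "Mpq w p q \<mu>"
 have 1: "T f \<in> ?C & ?A (T f) <= en b*?A f" if f: "f \<in> ?C" for f
 proof -
  have fa: "f \<in> M1_antidual w" "nrm (absF f) < \<infinity>" using f by (auto simp: Mpq_iff)
  note Ta = kernel_op_antidual[OF T fa(1)]
  have fin: "nrm (absF (T f)) < \<infinity>"
   by (rule le_less_trans[OF kernel_op_nrm[OF T fa(1)]]) (use winP(2)[OF \<phi>] H fa(2) in \<open>auto simp: ennreal_mult_less_top\<close>)
  have "?A (T f) <= en K*nrm (absF (T f))" by (rule mod_norm_le(1)[OF stft_measurable[OF w Ta]])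
  also have "... <= en K*(en K*wint (winP \<phi>)*(en K*wint H*(en K*?A f)))"
   by (intro mult_left_mono order_trans[OF kernel_op_nrm[OF T fa(1)]] mod_norm_le(2)[OF stft_measurable[OF w fa(1)]]) auto
  also have "... = en b*?A f" unfolding b(1)[symmetric] by (simp add: mult.assoc)
  finally show ?thesis using Ta fin by (simp add: Mpq_iff)
 qed
 have 2: "T (%k. c*f k + g k) h = c*T f h + T g h" if f: "f \<in> ?C" and g: "g \<in> ?C" and h: "h \<in> M1 w" for f g c h
 proof -
  have fa: "f \<in> M1_antidual w" and ga: "g \<in> M1_antidual w" using f g by (auto simp: Mpq_iff)
  have hM: "MM w h" using h by (simp add: M1_iff[OF w])
  have Teq: "T f h = (LBINT y. Q f y*cnj (STFT \<phi> h y))" if "f \<in> M1_antidual w" for f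
   by (rule kernel_opD(6)[OF T that hM])
  have Ql: "Q (%k. c*f k + g k) y = c*Q f y + Q g y" for y by (rule kernel_opD(7)[OF T fa ga])
  have "T (%k. c*f k + g k) h = (LBINT y. c*(Q f y*cnj (STFT \<phi> h y)) + Q g y*cnj (STFT \<phi> h y))"
   by (simp only: Teq[OF antidual_lincomb[OF w fa ga]] Ql) (simp add: distrib_right mult.assoc)
  also have "... = c*T f h + T g h"
   using kernel_op_integrable(1)[OF T fa hM] kernel_op_integrable(1)[OF T ga hM] by (simp add: Teq[OF fa] Teq[OF ga])
  finally show ?thesis .
 qed
 show ?thesis unfolding bounded_on_Mpq_def using 1 2 by blast
qed

text \<open>Bounded sequences have pointwise convergent subsequences on the phase space side, because the
  functions \<open>V f\<close> are uniformly bounded by \<open>w\<close> and equicontinuous.\<close>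

lemma stft_subsequence:
 assumes f: "!!n::nat. f n \<in> M1_antidual w" and B: "!!n. nrm (absF (f n)) <= en B" "0 <= B"
 obtains r g c where "strict_mono r" "g \<in> M1_antidual w" "nrm (absF g) <= en B" "0 <= c"
  "!!x. (%n. stft gaussian (f (r n)) x) ---> stft gaussian g x"
  "!!n x. cmod (stft gaussian (f n) x) <= c*w x" "!!x. cmod (stft gaussian g x) <= c*w x"
proof -
 obtain c0 where c0: "0 <= c0" "!!f x. f \<in> M1_antidual w ==> absF f x <= en (c0*w x)*nrm (absF f)"
  by (rule stft_pointwise_bound) (rule that)
 define c where "c = c0*B"
 have c: "0 <= c" using c0 B by (simp add: c_def)
 define F where "F n = stft gaussian (f n)" for n
 have [measurable]: "F n \<in> BM" for n unfolding F_def by (rule stft_measurable[OF w f])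
 have Fb: "cmod (F n x) <= c*w x" for n x
 proof -
  have "en (cmod (F n x)) <= en (c0*w x)*en B"
   unfolding F_def by (rule order_trans[OF c0(2)[OF f]]) (intro mult_left_mono B, simp)
  also have "... = en (c*w x)" using c0 B w_nonneg[of x] by (simp add: c_def mult_ac flip: ennreal_mult)
  finally show ?thesis using c w_nonneg[of x] by (subst (asm) ennreal_le_iff) auto
 qed
 obtain G' where G': "!!s z. s ---> z ==> (%n. RKd w (s n) z) ---> 0"
  using RKd[OF w] by metis
 have cg0: "0 <= cg TYPE('a)" by (simp add: less_imp_le)
 let ?A = "of_real (cg TYPE('a))"
 let ?B = "en (cg TYPE('a)*c)"
 let ?F = "%F n u. LBINT z. F n z*cnj (RK u z)"
 let ?G = "%x z y. RK x z - RK y z"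
 \<comment> \<open>Subtracting the reproducing formulas at x and y leaves the difference of two
   kernels against functions of common growth c*w; the resulting modulus of continuity is
   independent of n.\<close>
 have eqc: "en (cmod (F n x - F n y)) <= ?B * RKd w y x" if "dist y x <= 1" for n x y
 proof -
  have i: "intg (%z. F n z*cnj (RK u z))" for u
   unfolding F_def by (rule antidual_rep(1)[OF w f MM_tf_gaussian[OF w]])
  have rep: "F n u = ?A*(?F F n u)" for u
   unfolding F_def using antidual_rep(2)[OF w f MM_tf_gaussian[OF w, of u]] by (simp add: stft_def)
  have "F n x - F n y = ?A*(?F F n x) - ?A*(?F F n y)"
   by (subst rep[of x], subst rep[of y]) (rule refl)
  also have "... = (LBINT z. ?A*(F n z*cnj (?G x z y)))"
   using i by (simp add: right_diff_distrib)
  finally have "en (cmod (F n x - F n y)) <= (NNINT z. en (cmod (?A*(F n z*cnj (?G x z y)))))"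
   by (simp only: integral_norm_le_nn)
  also have "... <= (NNINT z. ?B*en (cmod (RK x z - RKc y x z)*w z))"
  proof (rule nn_integral_mono)
   fix z
   have "cmod (F n z)*cmod (?G x z y) <= (c*w z)*cmod (?G x z y)" by (intro mult_right_mono Fb) auto
   hence "cg TYPE('a)*(cmod (F n z)*cmod (?G x z y)) <= cg TYPE('a)*((c*w z)*cmod (?G x z y))"
    using cg0 by (rule mult_left_mono)
   moreover have "RKc y x z = RK y z" using that by (simp add: RKc_def)
   moreover have "cmod (?A*(F n z*cnj (?G x z y))) = cg TYPE('a)*(cmod (F n z)*cmod (?G x z y))"
    unfolding norm_mult complex_mod_cnj norm_of_real using cg0 by simp
   ultimately have "cmod (?A*(F n z*cnj (?G x z y))) <= cg TYPE('a)*c*(cmod (RK x z - RKc y x z)*w z)"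
    by (simp only: mult_ac)
   thus "en (cmod (?A*(F n z*cnj (?G x z y)))) <= ?B*en (cmod (RK x z - RKc y x z)*w z)"
    using cg0 c w_nonneg[of z] by (subst ennreal_mult[symmetric]) (auto intro!: ennreal_leI)
  qed
  also have "... = ?B * RKd w y x"
   unfolding RKd_def by (rule nn_integral_cmult) measurable
  finally show ?thesis .
 qed
 obtain D :: "('a*'a) set" where D: "countable D" "!!X. open X ==> X ~= {} ==> \<exists>d\<in>D. d \<in> X"
  using countable_dense_setE by blast
 \<comment> \<open>Dividing by the weight makes the values uniformly bounded, as required by the
   diagonal extraction over the countable dense set \<open>D\<close>.\<close>
 have "cmod (F n x / of_real (w x)) <= c" if "x \<in> D" for n x
  using Fb[of n x] tameD(3)[OF w, of x] by (simp add: norm_divide pos_divide_le_eq)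
 then obtain r where r: "strict_mono r" "!!x. x \<in> D ==> \<exists>l. (%n. F (r n) x / of_real (w x)) ---> l"
  using function_convergent_subsequence[OF D(1), of "%n x. F n x / of_real (w x)" c] by metis
 let ?C = "%F x. (%n. F (r n) x)"
 have convD: "Cauchy (?C F x)" if x: "x \<in> D" for x
 proof -
  obtain l where "(%n. F (r n) x / of_real (w x)) ---> l" using r(2)[OF x] by blast
  hence "(%n. F (r n) x / of_real (w x) * of_real (w x)) ---> l * of_real (w x)" by (intro tendsto_intros)
  moreover have "w x ~= 0" using tameD(3)[OF w, of x] by simp
  ultimately have "(?C F x) ---> l * of_real (w x)" by simp
  thus ?thesis by (rule LIMSEQ_imp_Cauchy)
 qed
 have conv: "Cauchy (?C F x)" for x
 proof (rule metric_CauchyI)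
  fix e :: real assume e: "0 < e"
  have "x \<in> closure D"
   unfolding closure_approachable
  proof (intro allI impI)
   fix e :: real assume "0 < e"
   hence "ball x e ~= {}" by simp
   from D(2)[OF open_ball this] show "\<exists>y\<in>D. dist y x < e" by (simp only: mem_ball dist_commute)
  qed
  then obtain s where s: "!!n. s n \<in> D" "s ---> x" unfolding closure_sequential by blast
  hence "(%n. ?B * RKd w (s n) x) ---> ?B*0"
   by (intro ennreal_tendsto_cmult G') auto
  hence "eventually (%n. ?B * RKd w (s n) x < en (e/3)) sequentially"
   using e by (intro order_tendstoD(2)[where y=0]) auto
  moreover have "eventually (%n. dist (s n) x < 1) sequentially" using s(2) by (rule tendstoD) simp
  ultimately have "eventually (%n. ?B * RKd w (s n) x < en (e/3) & dist (s n) x < 1) sequentially"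
   by eventually_elim simp
  then obtain j where j: "?B * RKd w (s j) x < en (e/3)" "dist (s j) x < 1"
   using eventually_happens' sequentially_bot by blast
  from eqc[OF less_imp_le[OF j(2)]] have near: "cmod (F n x - F n (s j)) < e/3" for n
   using le_less_trans[OF _ j(1)] by (metis e ennreal_less_iff norm_ge_zero)
  have "0 < e/3" using e by simp
  then obtain M where M: "\<forall>m\<ge>M. \<forall>n\<ge>M. dist (F (r m) (s j)) (F (r n) (s j)) < e/3"
   using metric_CauchyD[OF convD[OF s(1)[of j]]] by blast
  show "\<exists>M. \<forall>m\<ge>M. \<forall>n\<ge>M. dist (F (r m) x) (F (r n) x) < e"
  proof (intro exI[of _ M] allI impI)
   fix m n assume mn: "M <= m" "M <= n"
   have "dist (F (r m) x) (F (r n) x) <= dist (F (r m) x) (F (r m) (s j)) + dist (F (r m) (s j)) (F (r n) (s j)) + dist (F (r n) x) (F (r n) (s j))"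
    using dist_triangle[of "F (r m) x" "F (r n) x" "F (r m) (s j)"] dist_triangle2[of "F (r m) (s j)" "F (r n) x" "F (r n) (s j)"] by linarith
   moreover have "dist (F (r m) (s j)) (F (r n) (s j)) < e/3" using M mn by blast
   ultimately show "dist (F (r m) x) (F (r n) x) < e"
    using near[of "r m"] near[of "r n"] unfolding dist_norm by linarith
  qed
 qed
 define L where "L x = lim (?C F x)" for x
 have L: "(?C F x) ---> L x" for x
  using conv[of x] unfolding L_def by (simp add: Cauchy_convergent_iff convergent_LIMSEQ_iff)
 have [measurable]: "L \<in> BM"
  by (rule borel_measurable_LIMSEQ_metric[OF _ L]) measurable
 have Lb: "cmod (L x) <= c*w x" for x
  by (rule tendsto_upperbound[OF tendsto_norm[OF L[of x]]]) (auto simp: Fb)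
 \<comment> \<open>The limit functional is obtained by inserting the pointwise limit of the
   transforms into the weak inversion formula.\<close>
 define g where "g h = ?A*(LBINT z. L z*cnj (VG h z))" for h
 have gi: "intg (%z. L z*cnj (VG h z))" if h: "MM w h" for h
 proof (rule int_dom[OF integrable_mult_right[OF MM_D(3)[OF h], of c]])
  note [measurable] = h
  show "(%z. L z*cnj (VG h z)) \<in> borel_measurable lborel" by measurable
  show "cmod (L z*cnj (VG h z)) <= c*(cmod (VG h z)*w z)" for z
   using mult_right_mono[OF Lb[of z], of "cmod (VG h z)"] by (simp add: norm_mult mult_ac)
 qed
 have ga: "g \<in> M1_antidual w"
 proof (rule antidualI[OF w])
  fix h k d assume h: "MM w h" and k: "MM w k"
  have "VG (%t. d*h t + k t) y = d*VG h y + VG k y" for y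
   using STFT_add[OF MM_D(2)[OF MM_cmult[OF h]] MM_D(2)[OF k] L2_gaussian] by (simp add: STFT_cmult)
  hence "g (%t. d*h t + k t) = ?A*(LBINT z. cnj d*(L z*cnj (VG h z)) + L z*cnj (VG k z))"
   by (simp add: g_def algebra_simps)
  thus "g (%t. d*h t + k t) = cnj d*g h + g k"
   using gi[OF h] gi[OF k] by (simp add: g_def algebra_simps)
 next
  show "0 <= cg TYPE('a)*c" using cg0 c by simp
  fix h assume h: "MM w h"
  have "cmod (LBINT z. L z*cnj (VG h z)) <= (LBINT z. c*(cmod (VG h z)*w z))"
  proof (rule order_trans[OF integral_norm_bound integral_mono])
   show "intg (%z. cmod (L z*cnj (VG h z)))" by (rule integrable_norm[OF gi[OF h]])
   show "intg (%z. c*(cmod (VG h z)*w z))" by (rule integrable_mult_right[OF MM_D(3)[OF h]])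
   show "cmod (L z*cnj (VG h z)) <= c*(cmod (VG h z)*w z)" for z
    using mult_right_mono[OF Lb[of z], of "cmod (VG h z)"] by (simp add: norm_mult mult_ac)
  qed
  hence "cmod (LBINT z. L z*cnj (VG h z)) <= c*N1 w h" by (simp add: N1_def)
  thus "cmod (g h) <= cg TYPE('a)*c*N1 w h"
   using cg0 by (simp add: g_def norm_mult mult_left_mono mult.assoc)
 qed
 let ?D = "stft gaussian g"
 have gL: "?D x = L x" for x
 proof -
  have "(%n. (LBINT z. F (r n) z*cnj (RK x z))) ---> (LBINT z. L z*cnj (RK x z))"
  proof (rule integral_dominated_convergence)
   show "intg (%z. c*(cmod (RK x z)*w z))" by (intro integrable_mult_right tame_RK_integrable(1)[OF w])
   show "AEL z. (%n. F (r n) z*cnj (RK x z)) ---> L z*cnj (RK x z)"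
    by (intro AE_I2 tendsto_intros L)
   show "AEL z. cmod (F (r n) z*cnj (RK x z)) <= c*(cmod (RK x z)*w z)" for n
   proof (rule AE_I2)
    fix z show "cmod (F (r n) z*cnj (RK x z)) <= c*(cmod (RK x z)*w z)"
     using mult_right_mono[OF Fb[of "r n" z] norm_ge_zero[of "RK x z"]] unfolding norm_mult complex_mod_cnj by (simp only: mult_ac)
   qed
  qed measurable
  hence "(%n. ?A*(LBINT z. F (r n) z*cnj (RK x z))) ---> ?A*(LBINT z. L z*cnj (RK x z))"
   by (intro tendsto_intros)
  moreover have "?A*(?F F n x) = F n x" for n
   unfolding F_def using antidual_rep(2)[OF w f MM_tf_gaussian[OF w, of x]] by (simp add: stft_def)
  ultimately have "(?C F x) ---> ?D x" by (simp only: stft_def g_def)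
  thus ?thesis using L[of x] by (rule LIMSEQ_unique)
 qed
 let ?E = "%z. en (\<mu>' z)"
 \<comment> \<open>Pointwise convergence of the transforms keeps the norm bound by Fatou, also for
   infinite exponents.\<close>
 have gn: "nrm (absF g) <= en B"
  unfolding nrm_def
 proof (rule LPQ_Fatou[OF _ _ p q])
  show "(%z. absF (f (r n)) z*?E z) \<in> BM" for n
   using absF_meas[OF f] by measurable
  show "(%z. absF g z*?E z) \<in> BM"
   using absF_meas[OF ga] by measurable
  show "LPQ p q (%z. absF (f (r n)) z*?E z) <= en B" for n
   using B(1)[of "r n"] by (simp add: nrm_def)
  fix z
  have "(%n. en (cmod (stft gaussian (f (r n)) z)*\<mu>' z)) ---> en (cmod (?D z)*\<mu>' z)"
   using L[of z] unfolding gL F_def by (intro tendsto_intros tendsto_ennrealI)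
  thus "(%n. absF (f (r n)) z*?E z) ---> absF g z*?E z"
   using less_imp_le[OF \<mu>'_pos[of z]] by (simp add: ennreal_mult)
 qed
 show ?thesis
 proof (rule that[OF r(1) ga gn c])
  show "(%n. stft gaussian (f (r n)) x) ---> ?D x" for x using L[of x] by (simp add: gL F_def)
  show "cmod (stft gaussian (f n) x) <= c*w x" for n x using Fb[of n x] by (simp add: F_def)
  show "cmod (?D x) <= c*w x" for x using Lb[of x] by (simp add: gL)
 qed
qed

end

context modulation
begin

text \<open>The translated window is a translate of |VG \<phi>|; moderation splits \<mu>' x into w
  (x - y), absorbed by the norm of the window with weight w, and \<mu>' y, which is at most a
  multiple of w y.\<close>

lemma nrm_window:
 assumes \<phi>: "MM w \<phi>"
 obtains c where "0 <= c" "!!y. nrm (%x. winP \<phi> (y - x)) <= en (c*w y)"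
proof -
 note [measurable] = \<phi>
 define u where "u z = en (cmod (VG \<phi> z))" for z
 have [measurable]: "u \<in> BM" unfolding u_def by measurable
 have eq: "winP \<phi> (y - x) = u (- y + x)" for x y
  using norm_STFT_swap[of gaussian \<phi> "x - y"] norm_STFT_swap[of \<phi> gaussian "x - y"] by (simp add: winP_def u_def)
 obtain l where l: "LPQ p q (%z. u z*en (w z)) = en l" "0 <= l"
  using LPQ_window_finite[OF \<phi>] unfolding u_def by (cases "LPQ p q (%z. en (cmod (VG \<phi> z))*en (w z))") auto
 let ?A = "%y. en (K*\<mu>' y)"
 let ?B = "%y x. en (w (- y + x))"
 have "nrm (%x. winP \<phi> (y - x)) <= en (K*K*\<mu>' 0*l*w y)" for y
 proof -
  have "nrm (%x. winP \<phi> (y - x)) <= LPQ p q (%x. ?A y*(u (- y + x)*?B y x))"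
   unfolding nrm_def eq
  proof (rule LPQ_mono[OF _ _ p q])
   fix x
   have "\<mu>' x <= K*w (- y + x)*\<mu>' y" using mod[of "- y + x" y] by simp
   hence "en (\<mu>' x) <= ?A y*?B y x"
    using K_nonneg w_nonneg less_imp_le[OF \<mu>'_pos[of y]] by (subst ennreal_mult[symmetric]) (auto intro!: ennreal_leI simp: mult_ac)
   hence "u (- y + x)*en (\<mu>' x) <= u (- y + x)*(?A y*?B y x)"
    by (rule mult_left_mono) simp
   thus "u (- y + x)*en (\<mu>' x) <= ?A y*(u (- y + x)*?B y x)"
    by (simp add: mult_ac)
  qed measurable
  also have "... <= ?A y*LPQ p q (%x. u (- y + x)*?B y x)"
   by (rule LPQ_cmult[OF _ p q]) measurable
  also have "LPQ p q (%x. u (- y + x)*?B y x) = en l"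
   unfolding l(1)[symmetric] by (rule LPQ_shift[where F="%x. u x*en (w x)", OF _ p q]) measurable
  also have "?A y*en l = en (K*\<mu>' y*l)"
   using K_nonneg l less_imp_le[OF \<mu>'_pos[of y]] by (simp add: ennreal_mult)
  also have "... <= en (K*(K*w y*\<mu>' 0)*l)"
   using mod[of y 0] K_nonneg l by (intro ennreal_leI mult_right_mono mult_left_mono) auto
  finally show ?thesis by (simp add: mult_ac)
 qed
 moreover have "0 <= K*K*\<mu>' 0*l" using K_nonneg l less_imp_le[OF \<mu>'_pos[of 0]] by simp
 ultimately show ?thesis by (intro that[of "K*K*\<mu>' 0*l"])
qed

text \<open>If the kernel is small at infinity the operator is compact: the far part is controlled by
  Young's inequality, the part over a ball by dominated convergence.\<close>

lemma kernel_op_compact: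
 assumes T: "kernel_op \<phi> Q H T"
  and HR: "!!R::nat. HR R \<in> BM" "(%R. wint (HR R)) ---> 0"
  and far: "!!f R y. f \<in> M1_antidual w ==> norm y > real R ==> en (cmod (Q f y)) <= corr (HR R) (absF f) y"
 shows "compact_on_Mpq w p q \<mu> T"
 unfolding compact_on_Mpq_def
proof (intro conjI allI impI kernel_op_bounded[OF T])
 fix f :: "nat => 'a functional"
 let ?G = "mod_norm p q \<mu>"
 let ?N = "Mpq w p q \<mu>"
 assume f: "\<forall>n. f n \<in> ?N & ?G (f n) <= 1"
 have fa: "f n \<in> M1_antidual w" for n using f by (auto simp: Mpq_iff)
 have fB: "nrm (absF (f n)) <= en K" for n
 proof -
  have "nrm (absF (f n)) <= en K*?G (f n)" by (rule mod_norm_le(2)[OF stft_measurable[OF w fa]])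
  also have "... <= en K*1" using f by (intro mult_left_mono) auto
  finally show ?thesis by simp
 qed
 let ?K = "%g. stft gaussian g"
 let ?O = "%f r n. stft gaussian (f (r n))"
 obtain r g c where r: "strict_mono r" and ga: "g \<in> M1_antidual w" and gn: "nrm (absF g) <= en K" and c: "0 <= c"
  and lim: "!!x. (%n. ?O f r n x) ---> ?K g x"
  and fb: "!!n x. cmod (stft gaussian (f n) x) <= c*w x" and gb: "!!x. cmod (?K g x) <= c*w x"
  by (rule stft_subsequence[OF fa fB K_nonneg]) (rule that)
 have gM: "g \<in> ?N" using ga gn by (auto simp: Mpq_iff intro: le_less_trans)
 define d where "d n = (%k. f (r n) k - g k)" for n
 have da: "d n \<in> M1_antidual w" for n unfolding d_def by (rule antidual_diff[OF w fa ga])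
 note [measurable] = stft_measurable[OF w fa] stft_measurable[OF w ga] stft_measurable[OF w da] kernel_opD(2)[OF T] kernel_opD(4)[OF T da] HR(1)
 note \<phi> = kernel_opD(1)[OF T]
 note [measurable] = winP(1)[OF \<phi>]
 have dst: "stft gaussian (d n) x = ?O f r n x - ?K g x" for n x by (simp add: d_def stft_def)
 have dlim: "(%n. absF (d n) x) ---> 0" for x
 proof -
  have "(%n. en (cmod (?O f r n x - ?K g x))) ---> en (cmod (?K g x - ?K g x))"
   by (intro tendsto_intros tendsto_ennrealI lim)
  thus ?thesis by (simp add: dst)
 qed
 have db: "absF (d n) x <= en ((2*c)*w x)" for n x
  using norm_triangle_ineq4[of "?O f r n x" "?K g x"] fb[of "r n" x] gb[of x]
  unfolding dst by (intro ennreal_leI) linarith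
 have dn: "nrm (absF (d n)) <= en (2*K)" for n
 proof -
  have "nrm (absF (d n)) <= nrm (%x. absF (f (r n)) x + absF g x)"
   using norm_triangle_ineq4[of "?O f r n _" "?K g _"]
   by (intro nrm_mono) (auto simp: dst simp flip: ennreal_plus intro!: ennreal_leI)
  also have "... <= nrm (absF (f (r n))) + nrm (absF g)" by (rule nrm_add) measurable
  also have "... <= en K + en K" by (intro add_mono fB gn)
  finally show ?thesis using K_nonneg by (simp flip: ennreal_plus)
 qed
 obtain C where C: "1 <= C" "!!z1 z2. w (z1 + z2) <= C*w z1*w z2" using tame_const[OF w] by blast
 have C0: "0 <= C" using C(1) by simp
 obtain h where h: "wint H = en h" "0 <= h" using kernel_opD(3)[OF T] by (cases "wint H") auto
 define qn where "qn n y = en (cmod (Q (d n) y))" for n y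
 have [measurable]: "qn n \<in> BM" for n unfolding qn_def by measurable
 define b where "b = 2*c*C*h"
 have b: "0 <= b" using c C0 h by (simp add: b_def)
 let ?F = "%b y. en (b*w y)"
 have qnb: "qn n y <= ?F b y" for n y
 proof -
  have "qn n y <= corr H (absF (d n)) y" unfolding qn_def by (rule kernel_opD(5)[OF T da])
  also have "... <= en (2*c*C)*wint H*en (w y)"
   using c by (intro corr_weight_bound[OF w C0 C(2)] db) auto
  also have "... = ?F b y"
   unfolding h(1) using c C0 h(2) w_nonneg[of y] by (simp add: b_def flip: ennreal_mult)
  finally show ?thesis .
 qed
 have qnlim: "(%n. qn n y) ---> 0" for y
 proof -
  have "(%n. corr H (absF (d n)) y) ---> (NNINT (x :: 'a*'a). 0)"
   unfolding corr_def
  proof (rule nn_integral_dominated_convergence)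
   show "AEL s. H s*absF (d n) (y + s) <= H s*en ((2*c)*w (y + s))" for n
    by (intro AE_I2 mult_left_mono db) simp
   have "(NNINT s. H s*en ((2*c)*w (y + s))) <= en (2*c*C)*wint H*en (w y)"
    using corr_weight_bound[OF w C0 C(2), of "2*c" H "%z. en ((2*c)*w z)" y] c by (simp add: corr_def)
   also have "... < \<infinity>" unfolding h(1) by (simp add: ennreal_mult_less_top)
   finally show "(NNINT s. H s*en ((2*c)*w (y + s))) < \<infinity>" .
   \<comment> \<open>H may be infinite on a null set, and multiplication by an infinite factor does
     not preserve limits to 0; such points are excluded.\<close>
   have Hfin: "AEL s. H s*en (w s) ~= \<infinity>"
    using kernel_opD(3)[OF T] by (intro nn_integral_PInf_AE) auto
   thus "AEL s. (%n. H s*absF (d n) (y + s)) ---> 0"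
   proof eventually_elim
    case (elim s)
    have "w s ~= 0" using tameD(3)[OF w, of s] by simp
    hence "H s ~= \<infinity>" using elim w_nonneg[of s] by (auto simp: ennreal_mult_eq_top_iff)
    hence "H s < top" by (simp add: less_top)
    hence "(%n. H s*absF (d n) (y + s)) ---> H s*0" by (intro ennreal_tendsto_cmult dlim) auto
    thus ?case by simp
   qed
  qed measurable
  hence l0: "(%n. corr H (absF (d n)) y) ---> 0" by simp
  show ?thesis unfolding qn_def
   by (rule tendsto_sandwich[OF _ _ tendsto_const l0]) (use kernel_opD(5)[OF T da] in simp_all)
 qed
 let ?C = "%y x. winP \<phi> (y - x)"
 obtain cw where cw: "0 <= cw" "!!y. nrm (%x. ?C y x) <= ?F cw y" by (rule nrm_window[OF \<phi>]) (rule that)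
 let ?L = "wint (winP \<phi>)"
 obtain P where P: "?L = en P" "0 <= P" using winP(2)[OF \<phi>] by (cases "?L") auto
 let ?A = "%R. indicator (cball 0 (real R))"
 define near where "near R n = (NNINT y. ?A R y*qn n y*?F cw y)" for R n
 let ?D = "%R d n. corr (HR R) (absF (d n))"
 let ?H = "%R. en K*wint (HR R)*en (2*K)"
 let ?I = "%d n. nrm (absF (T (d n)))"
 let ?J = "corr (winP \<phi>)"
 have Td: "?I d n <= near R n + en K*en P*(?H R)" for R n
 proof -
  define I where "I x = (NNINT y. ?A R y*qn n y*?C y x)" for x
  have [measurable]: "cball (0 :: 'a*'a) (real R) \<in> sets borel" by simp
  have [measurable]: "I \<in> BM" unfolding I_def by measurable
  have [measurable]: "stft gaussian (T (d n)) \<in> BM" by (rule stft_measurable[OF w kernel_op_antidual[OF T da]])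
  have ptw: "absF (T (d n)) x <= I x + ?J (?D R d n) x" for x
  proof -
   have "absF (T (d n)) x <= ?J (qn n) x" unfolding qn_def by (rule kernel_op_stft[OF T da])
   \<comment> \<open>The correlation is recentred so that the integration variable is the
     phase-space point y itself; only then can the integral be split at |y| = R.\<close>
   also have "... = (NNINT y. winP \<phi> (- x + y)*qn n (x + (- x + y)))"
    unfolding corr_def by (rule nn_integral_lborel_shift[symmetric]) measurable
   also have "... = (NNINT y. ?C y x*qn n y)" by simp
   also have "... <= (NNINT y. ?A R y*qn n y*?C y x + ?C y x*?D R d n y)"
   proof (rule nn_integral_mono)
    fix y
    show "?C y x*qn n y <= ?A R y*qn n y*?C y x + ?C y x*?D R d n y"
    proof (cases "norm y > real R")
     case True
     hence "?C y x*qn n y <= ?C y x*?D R d n y"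
      unfolding qn_def by (intro mult_left_mono far da) auto
     thus ?thesis by (rule order_trans) simp
    next
     case False
     thus ?thesis by (simp add: mult.commute)
    qed
   qed
   also have "... = I x + (NNINT y. ?C y x*?D R d n y)"
    unfolding I_def by (rule nn_integral_add) measurable
   also have "(NNINT y. ?C y x*?D R d n y) = (NNINT y. winP \<phi> (x + y - x)*?D R d n (x + y))"
    by (rule nn_integral_lborel_shift[symmetric]) measurable
   finally show ?thesis by (simp add: corr_def[of "winP \<phi>"])
  qed
  have "?I d n <= nrm (%x. I x + ?J (?D R d n) x)"
   by (intro nrm_mono ptw) measurable
  also have "... <= nrm I + nrm (?J (?D R d n))" by (rule nrm_add) measurable
  also have "... <= near R n + en K*en P*(?H R)"
  proof (rule add_mono)
   have "nrm I = LPQ p q (%x. (NNINT y. (?A R y*qn n y)*(?C y x*en (\<mu>' x))))"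
   proof -
    have "I x*en (\<mu>' x) = (NNINT y. ?A R y*qn n y*?C y x*en (\<mu>' x))" for x
     unfolding I_def by (rule nn_integral_multc[symmetric]) measurable
    thus ?thesis unfolding nrm_def by (simp add: mult.assoc)
   qed
   also have "... <= (NNINT y. LPQ p q (%x. (?A R y*qn n y)*(?C y x*en (\<mu>' x))))"
    by (rule LPQ_Minkowski[OF sigma_finite_lborel _ p q]) measurable
   also have "... <= (NNINT y. (?A R y*qn n y)*nrm (%x. ?C y x))"
    unfolding nrm_def by (intro nn_integral_mono LPQ_cmult p q) measurable
   also have "... <= near R n" unfolding near_def
    by (intro nn_integral_mono mult_left_mono cw) simp
   finally show "nrm I <= near R n" .
   have "nrm (?J (?D R d n)) <= en K*?L*nrm (?D R d n)"
    by (rule nrm_corr) measurable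
   also have "... <= en K*?L*(en K*wint (HR R)*nrm (absF (d n)))"
    by (intro mult_left_mono nrm_corr) auto
   also have "... <= en K*en P*(?H R)"
    unfolding P(1) by (intro mult_left_mono dn) auto
   finally show "nrm (?J (?D R d n)) <= en K*en P*(?H R)" .
  qed
  finally show ?thesis .
 qed
 let ?M = "%b M. en (b*M*(cw*M))"
 have nearlim: "(%n. near R n) ---> 0" for R
 proof -
  have [measurable]: "cball (0 :: 'a*'a) (real R) \<in> sets borel" by simp
  obtain M where M: "1 <= M" "!!z. norm z <= real R ==> w z <= M" by (rule tame_bounded_on_ball[OF w]) (rule that)
  have "(%n. near R n) ---> (NNINT (y :: 'a*'a). 0)"
   unfolding near_def
  proof (rule nn_integral_dominated_convergence)
   show "AEL y. ?A R y*qn n y*?F cw y <= ?A R y*?M b M" for n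
   proof (rule AE_I2)
    fix y :: "'a*'a"
    show "?A R y*qn n y*?F cw y <= ?A R y*?M b M"
    proof (cases "norm y <= real R")
     case True
     have "qn n y <= en (b*M)"
      by (rule order_trans[OF qnb]) (use M(2)[OF True] b in \<open>auto intro!: ennreal_leI mult_left_mono\<close>)
     moreover have "?F cw y <= en (cw*M)"
      using M(2)[OF True] cw(1) by (auto intro!: ennreal_leI mult_left_mono)
     ultimately have "qn n y*?F cw y <= en (b*M)*en (cw*M)" by (rule mult_mono) auto
     also have "... = ?M b M" using b M(1) cw(1) by (subst ennreal_mult[symmetric]) auto
     finally show ?thesis using True by simp
    qed simp
   qed
   have "emeasure lborel (cball (0 :: 'a*'a) (real R)) < \<infinity>" by (rule emeasure_bounded_finite) simp
   thus "(NNINT y. indicator (cball (0 :: 'a*'a) (real R)) y*?M b M) < \<infinity>"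
    by (subst nn_integral_multc) (auto simp: ennreal_mult_less_top)
   show "AEL y. (%n. ?A R y*qn n y*?F cw y) ---> 0"
   proof (rule AE_I2)
    fix y :: "'a*'a"
    have "(%n. (?A R y*?F cw y)*qn n y) ---> (?A R y*?F cw y)*0"
     by (intro ennreal_tendsto_cmult qnlim) (auto simp: indicator_def)
    thus "(%n. ?A R y*qn n y*?F cw y) ---> 0" by (simp add: mult_ac)
   qed
  qed measurable
  thus ?thesis by simp
 qed
 let ?B = "en K*en P*en K*en (2*K)"
 have nlim: "(%n. ?I d n) ---> 0"
 proof (rule order_tendstoI)
  fix e :: ennreal assume e: "0 < e"
  obtain e' where e': "0 < e'" "e' + e' < e"
  proof -
   obtain x where x: "0 < x" "x < e" using dense[OF e] by blast
   hence "x ~= top" by auto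
   then obtain t where t: "x = en t" "0 <= t" by (cases x) auto
   hence "0 < t" using x by (simp add: ennreal_less_zero_iff)
   thus ?thesis using x t by (intro that[of "en (t/2)"]) (auto simp flip: ennreal_plus)
  qed
  have "(%R. ?B*wint (HR R)) ---> ?B*0"
   by (intro ennreal_tendsto_cmult HR) (simp add: ennreal_mult_less_top)
  hence "eventually (%R. ?B*wint (HR R) < e') sequentially"
   using e'(1) by (intro order_tendstoD(2)[where y=0]) auto
  then obtain R where R: "?B*wint (HR R) < e'"
   by (auto simp: eventually_sequentially)
  have "eventually (%n. near R n < e') sequentially" using nearlim e'(1) by (rule order_tendstoD)
  thus "eventually (%n. ?I d n < e) sequentially"
  proof eventually_elim
   case (elim n)
   have "?I d n <= near R n + ?B*wint (HR R)"
    using Td[of n R] by (simp only: mult_ac)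
   also have "... <= e' + e'" using elim R by (intro add_mono) auto
   also have "... < e" by (rule e')
   finally show ?case .
  qed
 qed simp
 have eqn: "?G (%h. T (f (r n)) h - T g h) <= en K*?I d n" for n
 proof -
  have "T (d n) h = T (f (r n)) h - T g h" if h: "MM w h" for h
  proof -
   have Ql: "Q (d n) y = Q (f (r n)) y - Q g y" for y
    using kernel_opD(7)[OF T ga fa[of "r n"], of "-1" y] by (simp add: d_def)
   show ?thesis
    using kernel_op_integrable(1)[OF T fa[of "r n"] h] kernel_op_integrable(1)[OF T ga h]
    by (simp add: kernel_opD(6)[OF T _ h] da fa ga Ql left_diff_distrib)
  qed
  \<comment> \<open>The two functionals are compared only on \<open>MM\<close>; that is enough
    because the norm evaluates them at shifted Gaussians.\<close>
  hence "stft gaussian (%h. T (f (r n)) h - T g h) = stft gaussian (T (d n))"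
   using MM_tf_gaussian[OF w] by (auto simp: stft_def fun_eq_iff)
  hence "?G (%h. T (f (r n)) h - T g h) = ?G (T (d n))"
   by (simp add: mod_norm_def)
  thus ?thesis using mod_norm_le(1)[OF stft_measurable[OF w kernel_op_antidual[OF T da]], of n] by simp
 qed
 have "(%n. en K*?I d n) ---> en K*0"
  by (intro ennreal_tendsto_cmult nlim) simp
 hence l0: "(%n. en K*?I d n) ---> 0" by simp
 have "(%n. ?G (%h. T (f (r n)) h - T g h)) ---> 0"
  by (rule tendsto_sandwich[OF _ _ tendsto_const l0]) (auto simp: eqn)
 moreover have "T g \<in> ?N" using kernel_op_bounded[OF T] gM by (auto simp: bounded_on_Mpq_def)
 ultimately show "\<exists>r g. strict_mono r & g \<in> ?N & (%n. ?G (%h. T (f (r n)) h - g h)) ---> 0"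
  using r by blast
qed

end

section \<open>Multiplication and differentiation of windows\<close>

text \<open>Integration by parts on \<open>\<real>\<^sup>d\<close>: the integral of \<open>h (t + b) - h t\<close> vanishes by translation invariance.\<close>

lemma integral_directional_derivative_0:
 fixes h :: "'a::euclidean_space => complex"
 assumes D: "!!t. (h has_derivative D t) (at t)" and h: "intg h"
  and i: "intg (%t. D t b)" and c: "continuous_on UNIV (%t. D t b)"
 shows "(LBINT t. D t b) = 0"
proof -
 have [measurable]: "(%t. D t b) \<in> BM" using c by (rule BM_contI)
 let ?B = "%t s. t + s *\<^sub>R b"
 have FTC: "(LBINT s. indicator {0..1} s *\<^sub>R D (?B t s) b) = h (t + b) - h t" for t
 proof -
  have "((%s. h (?B t s)) has_vector_derivative D (?B t s) b) (at s within {0..1})" for s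
  proof -
   have "((%s. h (?B t s)) has_derivative (%r. D (?B t s) (r *\<^sub>R b))) (at s)"
    by (rule has_derivative_compose[of "%s. t + s *\<^sub>R b" "%r. r *\<^sub>R b" s UNIV h "D (?B t s)"])
      (auto intro!: derivative_eq_intros D)
   moreover have "D (?B t s) (r *\<^sub>R b) = r *\<^sub>R D (?B t s) b" for r
    using D[THEN has_derivative_linear] by (rule linear_scale)
   ultimately show ?thesis
    unfolding has_vector_derivative_def by (simp add: has_derivative_at_withinI)
  qed
  moreover have "continuous_on {0..1} (%s. D (?B t s) b)"
   by (rule continuous_on_compose2[OF c]) (auto intro!: continuous_intros)
  ultimately show ?thesis
   using integral_FTC_atLeastAtMost[of 0 1 "%s. h (?B t s)" "%s. D (?B t s) b"] by auto
 qed
 let ?C = "NNINT t. en (norm (D t b))"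
 have sh: "(NNINT t. en (norm (D (?B t s) b))) = ?C" for s
  using nn_integral_lborel_shift[of "%t. en (norm (D t b))" "s *\<^sub>R b"] by (simp add: add.commute)
 let ?A = "%s. NNINT t. en (norm (indicator {0..1} (snd (t, s)) *\<^sub>R D (fst (t, s) + snd (t, s) *\<^sub>R b) b))"
 let ?D = "(%z. indicator {0..1} (snd z) *\<^sub>R D (fst z + snd z *\<^sub>R b) b)"
 have I: "intg ?D"
 proof (rule integrable_lborel_prodI')
  have [measurable]: "{0..1::real} \<in> sets borel" by simp
  have [measurable]: "(%z :: 'a \<times> real. D (fst z + snd z *\<^sub>R b) b) \<in> BM"
   by (rule measurable_compose[of "%z :: 'a \<times> real. fst z + snd z *\<^sub>R b" borel borel "%t. D t b"]) auto
  show "?D \<in> BM" by measurable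
  have "(NNINT s. ?A s)
    = (NNINT s. indicator {0..1::real} s*?C)"
  proof (intro nn_integral_cong)
   fix s :: real
   show "(?A s) = indicator {0..1} s*?C"
    by (cases "s \<in> {0..1}") (auto simp: sh)
  qed
  also have "... = ?C" by (simp add: nn_integral_multc)
  also have "... < \<infinity>" using integrable_nn_less_top[OF i] .
  finally show "(NNINT s. ?A s) < \<infinity>" .
 qed
 have "(LBINT t. h (t + b) - h t) = 0"
  using integral_lborel_shift[OF borel_measurable_integrable[OF h, simplified], of b] integrable_lborel_shift[OF h, of b] h
  by (simp add: add.commute)
 hence "0 = (LBINT t. (LBINT s. indicator {0..1} s *\<^sub>R D (?B t s) b))" by (simp add: FTC)
 also have "... = (LBINT s. (LBINT t. indicator {0..1} s *\<^sub>R D (?B t s) b))"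
  using Fubini_swap_lborel[OF I] by simp
 also have "... = (LBINT s. indicator {0..1::real} s *\<^sub>R (LBINT t. D t b))"
 proof -
  have "(LBINT t. D (?B t s) b) = (LBINT t. D t b)" for s
   using integral_lborel_shift[of "%t. D t b" "s *\<^sub>R b"] by (simp add: add.commute)
  thus ?thesis by simp
 qed
 also have "... = (LBINT t. D t b)" by simp
 finally show ?thesis by simp
qed

definition Xop :: "'a::euclidean_space => ('a => complex) => 'a => complex" where
 "Xop b f t = of_real (t \<bullet> b)*f t"

lemma Xop_measurable [measurable]: "f \<in> BM ==> Xop b f \<in> BM"
 unfolding Xop_def[abs_def] by measurable

text \<open>The coordinate x of the shift is the difference between the coordinate of t and that of
  t - x: one multiplies f, the other the window.\<close>

lemma STFT_Xop:
 assumes f: "L2 f" "L2 (Xop b f)" and g: "L2 g" "L2 (Xop b g)"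
 shows "of_real (fst z \<bullet> b)*STFT g f z = STFT g (Xop b f) z - STFT (Xop b g) f z"
proof -
 have [measurable]: "f \<in> BM" "g \<in> BM" using f g by (auto intro: L2_measurable)
 have "STFT g (Xop b f) z - STFT (Xop b g) f z
   = (LBINT t. Xop b f t*cnj (tf_shift z g t) - f t*cnj (tf_shift z (Xop b g) t))"
  unfolding STFT_def using f g by (simp add: bracket_L2 L2_mult_integrable)
 also have "... = (LBINT t. of_real (fst z \<bullet> b)*(f t*cnj (tf_shift z g t)))"
  by (intro Bochner_Integration.integral_cong refl) (simp add: Xop_def tf_shift_eq inner_diff_left algebra_simps)
 also have "... = of_real (fst z \<bullet> b)*STFT g f z"
  unfolding STFT_def using f g by (simp add: bracket_L2)
 finally show ?thesis by simp
qed

lemma partial_derivI: "(f has_derivative D) (at t) ==> partial_deriv b f t = D b"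
 unfolding partial_deriv_def using frechet_derivative_at[of f D t] by simp

lemma ph_has_derivative [derivative_intros]:
 assumes "(g has_derivative g') (at t within s)"
 shows "((%t. ph (g t)) has_derivative (%v. of_real (g' v)*(2 * of_real pi*\<i>*ph (g t)))) (at t within s)"
proof -
 have "(%t. ph (g t)) = (%t. exp (2 * of_real pi*\<i> * of_real (g t)))"
  by (simp add: ph_def cis_conv_exp fun_eq_iff mult_ac)
 moreover have "((%t. exp (2 * of_real pi*\<i>*complex_of_real (g t))) has_derivative (%v. 2 * of_real pi*\<i> * of_real (g' v)*exp (2 * of_real pi*\<i> * of_real (g t)))) (at t within s)"
 proof -
  have "((%t. 2 * of_real pi*\<i>*complex_of_real (g t)) has_derivative (%v. 2 * of_real pi*\<i> * of_real (g' v))) (at t within s)"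
   by (intro has_derivative_mult_right has_derivative_of_real assms)
  from has_derivative_compose[OF this DERIV_exp[unfolded has_field_derivative_def]] show ?thesis by (simp add: mult_ac)
 qed
 ultimately show ?thesis by (simp add: ph_def cis_conv_exp mult_ac)
qed

text \<open>The integrand of the transform has a derivative of integral 0; the product rule
  distributes it over f, the window and the phase, and the phase yields -2 pi i times the
  frequency.\<close>

lemma STFT_partial_deriv:
 fixes f g :: "'a::euclidean_space => complex"
 assumes f: "nice f" "!!t. f differentiable (at t)" "nice (partial_deriv b f)"
  and g: "nice g" "!!t. g differentiable (at t)" "nice (partial_deriv b g)"
 shows "2 * of_real pi*\<i> * of_real (snd z \<bullet> b)*STFT g f z = STFT g (partial_deriv b f) z + STFT (partial_deriv b g) f z"
proof -
 define x w where "x = fst z" and "w = snd z"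
 note L = f(1,3)[THEN nice_L2] g(1,3)[THEN nice_L2]
 let ?B = "partial_deriv b"
 have [measurable]: "f \<in> BM" "g \<in> BM" "?B f \<in> BM" "?B g \<in> BM"
  using L by (auto intro: L2_measurable)
 define Df where "Df t = frechet_derivative f (at t)" for t
 define Dg where "Dg t = frechet_derivative g (at t)" for t
 have Df: "(f has_derivative Df t) (at t)" for t unfolding Df_def using f(2) by (simp add: frechet_derivative_works)
 have Dg: "(g has_derivative Dg t) (at t)" for t unfolding Dg_def using g(2) by (simp add: frechet_derivative_works)
 let ?A = "%t. ph (- (w \<bullet> t))"
 define h where "h t = f t*cnj (g (t - x))*?A t" for t
 define D where "D t v = f t*cnj (g (t - x))*(of_real (- (w \<bullet> v))*(2 * of_real pi*\<i>*?A t))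
    + (f t*cnj (Dg (t - x) v) + Df t v * cnj (g (t - x)))*?A t" for t v
 have hD: "(h has_derivative D t) (at t)" for t
 proof -
  have gs: "((%t. g (t - x)) has_derivative (%v. Dg (t - x) v)) (at t)"
   by (rule has_derivative_compose[of "%t. t - x" "%v. v" t UNIV g, OF _ Dg]) (auto intro!: derivative_eq_intros)
  show ?thesis
   unfolding h_def[abs_def] D_def[abs_def]
   by (rule derivative_eq_intros refl Df gs has_derivative_cnj)+ simp
 qed
 have i: "intg (%t. u t*cnj (v (t - x))*?A t)" if "L2 u" "L2 v" for u v
  using L2_mult_integrable[OF that(1) L2_tf_shift[OF that(2), of z]] by (simp add: tf_shift_eq x_def w_def mult_ac)
 let ?C = "2 * of_real pi*\<i> * of_real (w \<bullet> b)"
 have Db: "D t b = - ?C*(f t*cnj (g (t - x))*?A t)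
   + (f t*cnj (?B g (t - x))*?A t + ?B f t*cnj (g (t - x))*?A t)" for t
  by (simp add: D_def partial_derivI[OF Df] partial_derivI[OF Dg] algebra_simps)
 have cs: "continuous_on UNIV (%t. u (t - x))" if "nice u" for u :: "'a => complex"
  by (rule continuous_on_compose2[of UNIV u]) (use that in \<open>auto simp: nice_def intro!: continuous_intros\<close>)
 have c: "continuous_on UNIV u" if "nice u" for u :: "'a => complex" using that by (simp add: nice_def)
 have "(LBINT t. D t b) = 0"
 proof (rule integral_directional_derivative_0[OF hD])
  show "intg h" unfolding h_def by (intro i L)
  show "intg (%t. D t b)" unfolding Db
   by (rule Bochner_Integration.integrable_add[OF integrable_mult_right Bochner_Integration.integrable_add])
     (rule i[OF L(1) L(3)] i[OF L(1) L(4)] i[OF L(2) L(3)])+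
  show "continuous_on UNIV (%t. D t b)" unfolding Db ph_def cis_conv_exp
   by (intro continuous_intros c[OF f(1)] c[OF f(3)] cs[OF g(1)] cs[OF g(3)])
 qed
 moreover have "(LBINT t. D t b) = - ?C*STFT g f z + (STFT (?B g) f z + STFT g (?B f) z)"
  unfolding Db using i[OF L(1) L(3)] i[OF L(1) L(4)] i[OF L(2) L(3)] by (simp add: STFT_eq x_def w_def)
 ultimately show ?thesis by (simp add: w_def algebra_simps)
qed

lemma gaussian_has_derivative: "(gaussian has_derivative (%v. of_real (- 2*pi*(t \<bullet> v))*gaussian t)) (at t)"
proof -
 have "((%t. complex_of_real (exp (- pi*(t \<bullet> t)))) has_derivative (%v. of_real (exp (- pi*(t \<bullet> t))*(- pi*(t \<bullet> v + v \<bullet> t))))) (at t)"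
  by (rule derivative_eq_intros refl)+ (simp add: fun_eq_iff algebra_simps)
 thus ?thesis
  unfolding gaussian_def[abs_def] power2_norm_eq_inner by (simp add: inner_commute mult_ac)
qed

text \<open>r <= 1 + r^2/2 <= exp (pi r^2/2), so half of the Gaussian pays for the linear
  factor.\<close>

lemma norm_Xop_gaussian_le:
 assumes "norm b <= 1"
 shows "cmod (Xop b gaussian t) <= exp (- pi*(1/2)*(norm t)^2)"
proof -
 define r where "r = norm t"
 let ?A = "exp (- pi*r^2)"
 let ?B = "exp (- pi*(1/2)*r^2)"
 have "0 <= (r - 1)^2" by simp
 hence "r <= 1 + r^2/2" by (simp add: power2_diff field_simps)
 also have "... <= 1 + pi/2*r^2" using pi_ge_two mult_right_mono[of 1 pi "r^2"] by simp
 also have "... <= exp (pi/2*r^2)" by (rule exp_ge_add_one_self)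
 finally have "r*?A <= exp (pi/2*r^2)*?A" by (rule mult_right_mono) simp
 also have "... = ?B" by (simp flip: exp_add)
 finally have 1: "r*?A <= ?B" .
 have "\<bar>t \<bullet> b\<bar> <= r*1" unfolding r_def
  by (rule order_trans[OF Cauchy_Schwarz_ineq2]) (intro mult_left_mono assms, simp)
 hence "\<bar>t \<bullet> b\<bar>*?A <= r*?A" by (intro mult_right_mono) auto
 from this 1 have "\<bar>t \<bullet> b\<bar>*?A <= ?B" by (rule order_trans)
 thus ?thesis by (simp add: Xop_def norm_mult norm_gaussian r_def)
qed

lemma nice_Xop_gaussian:
 fixes b :: "'a::euclidean_space"
 assumes b: "b \<in> Basis"
 shows "nice (Xop b gaussian)"
proof -
 note le = norm_Xop_gaussian_le[of b]
 have nb: "norm b <= 1" using b by simp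
 have "intg (Xop b gaussian)"
 proof (rule int_bound[OF gaussian_FT(1)[of "1/2", where 'a='a]])
  show "AEL t. norm (Xop b gaussian t) <= norm (exp (- pi*(1/2)*(norm t)^2))" using le[OF nb] by simp
 qed simp_all
 moreover have "continuous_on UNIV (Xop b gaussian)"
  unfolding Xop_def[abs_def] by (intro continuous_intros continuous_gaussian)
 moreover have "cmod (Xop b gaussian t) <= 1" for t :: 'a
  by (rule order_trans[OF le[OF nb]]) simp
 ultimately show ?thesis by (auto simp: nice_def bounded_iff)
qed

lemma partial_deriv_gaussian: "partial_deriv b gaussian = (%t. - 2 * of_real pi*Xop b gaussian t)"
 by (rule ext) (simp add: partial_derivI[OF gaussian_has_derivative] Xop_def)

text \<open>The transforms of X applied to the function and to the window are two unknowns. The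
  position rule gives their difference and the frequency rule their sum, since the derivative of the
  Gaussian is -2 pi X applied to it.\<close>

lemma STFT_Xop_gaussian:
 fixes b :: "'a::euclidean_space"
 assumes b: "b \<in> Basis"
 shows "VG (Xop b gaussian) z = (of_real (fst z \<bullet> b) - \<i> * of_real (snd z \<bullet> b))/2*VG gaussian z"
proof -
 note n = nice_Xop_gaussian[OF b]
 have gd: "gaussian differentiable (at (t :: 'a))" for t using gaussian_has_derivative by (rule differentiableI)
 let ?C = "of_real (fst z \<bullet> b)"
 let ?D = "%gaussian. STFT (Xop b gaussian) gaussian z"
 have 1: "?C*VG gaussian z = VG (Xop b gaussian) z - ?D gaussian"
  by (rule STFT_Xop) (auto intro: nice_L2 n)
 let ?B = "partial_deriv b"
 have np: "nice (?B gaussian)" unfolding partial_deriv_gaussian by (rule nice_cmult[OF n])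
 let ?A = "of_real (snd z \<bullet> b)"
 have 2: "2 * of_real pi*\<i>*?A*VG gaussian z = VG (?B gaussian) z + STFT (?B gaussian) gaussian z"
  by (rule STFT_partial_deriv[OF nice_gaussian gd np nice_gaussian gd np])
 have 3: "VG (?B gaussian) z = - 2 * of_real pi*VG (Xop b gaussian) z"
  unfolding partial_deriv_gaussian by (rule STFT_cmult)
 have 4: "STFT (?B gaussian) gaussian z = - 2 * of_real pi*?D gaussian"
 proof -
  have "tf_shift z (%t. - 2 * of_real pi*Xop b gaussian t) = (%t. - 2 * of_real pi*tf_shift z (Xop b gaussian) t)" by (rule tf_shift_scale)
  hence "cnj (STFT (?B gaussian) gaussian z) = - 2 * of_real pi*cnj (?D gaussian)"
   unfolding partial_deriv_gaussian STFT_def bracket_sym by (simp only: bracket_scale_left)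
  hence "cnj (cnj (STFT (?B gaussian) gaussian z)) = cnj (- 2 * of_real pi*cnj (?D gaussian))" by (rule arg_cong)
  thus ?thesis by simp
 qed
 define A where "A = VG (Xop b gaussian) z"
 define B where "B = ?D gaussian"
 define V where "V = VG gaussian z"
 have e1: "?C*V = A - B" using 1 by (simp add: A_def B_def V_def)
 have "of_real (2*pi)*(\<i>*?A*V) = of_real (2*pi)*(- (A + B))"
  using 2 unfolding 3 4 by (simp add: A_def B_def V_def algebra_simps)
 hence e2: "\<i>*?A*V = - (A + B)"
  unfolding mult_cancel_left by simp
 have "(?C - \<i>*?A)/2*V = (?C*V - \<i>*?A*V)/2"
  by (simp add: left_diff_distrib diff_divide_distrib)
 also have "... = A" unfolding e1 e2 by simp
 finally show ?thesis by (simp add: A_def V_def)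
qed

lemma MM_Xop_gaussian:
 fixes b :: "'a::euclidean_space" and w :: "'a*'a => real"
 assumes w: "tame w" and b: "b \<in> Basis"
 shows "MM w (Xop b gaussian)"
proof -
 note n = nice_Xop_gaussian[OF b]
 note [measurable] = w
 let ?A = "%z. of_real (fst z \<bullet> b) - \<i> * of_real (snd z \<bullet> b)"
 let ?B = "%z. cmod (VG (Xop b gaussian) z)"
 have "intg (%z. ?B z*w z)"
 proof (rule int_dom[OF tame_gaussian_integrable[OF w, of "pi/4"]])
   fix z :: "'a*'a"
   define r where "r = norm z"
   have "cmod (?A z) <= cmod (of_real (fst z \<bullet> b)) + cmod (\<i> * of_real (snd z \<bullet> b))"
    by (rule norm_triangle_ineq4)
   also have "... <= norm (fst z) + norm (snd z)"
    using b Basis_le_norm[OF b, of "fst z"] Basis_le_norm[OF b, of "snd z"] by (simp add: norm_mult)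
   also have "... <= 2*r" unfolding r_def using norm_fst_le[of "fst z" "snd z"] norm_snd_le[of "snd z" "fst z"] by simp
   finally have a: "cmod ((?A z)/2) <= r" by (simp add: norm_divide)
   have "0 <= (r - 1)^2" by simp
   hence "r <= 1 + 1/2*r^2" by (simp add: power2_diff field_simps)
   also have "... <= 1 + pi/4*r^2" using pi_ge_two by (intro add_left_mono mult_right_mono) auto
   also have "... <= exp (pi/4*r^2)" by (rule exp_ge_add_one_self)
   finally have "cmod ((?A z)/2) <= exp (pi/4*r^2)" using a by simp
   moreover have "cmod (VG (gaussian :: 'a => complex) z) <= exp (- (pi/2)*r^2)" using RK_le[of 0 z] by (simp add: r_def)
   ultimately have "?B z <= exp (pi/4*r^2)*exp (- (pi/2)*r^2)"
    unfolding STFT_Xop_gaussian[OF b] norm_mult by (intro mult_mono) auto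
   also have "... = exp (- (pi/4)*r^2)" by (simp flip: exp_add)
   finally have "?B z*w z <= exp (- (pi/4)*r^2)*w z"
    by (rule mult_right_mono) (rule tameD(4)[OF w])
   thus "norm (?B z*w z) <= w z*exp (- (pi/4)*(norm z)^2)"
    using tameD(4)[OF w, of z] by (simp add: r_def abs_mult mult.commute)
 qed simp_all
 thus ?thesis using n nice_L2[OF n] by (simp add: MM_def nice_def)
qed

lemma jbracket_ge_1: "1 <= jbracket x"
 by (simp add: jbracket_def)

lemma jbracket_nonneg [simp]: "0 <= jbracket x"
 by (simp add: jbracket_def)

lemma norm_le_jbracket: "norm x <= jbracket x"
 unfolding jbracket_def by (rule real_le_rsqrt) simp

lemma jbracket_add: "jbracket (x + y) <= 2*jbracket x*jbracket y"
proof -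
 let ?A = "(1 + (norm x)^2)*(1 + (norm y)^2)"
 let ?B = "2*(norm x)^2 + 2*(norm y)^2"
 have "norm (x + y) <= norm x + norm y" by (rule norm_triangle_ineq)
 hence "(norm (x + y))^2 <= (norm x + norm y)^2" by (intro power_mono) auto
 also have "... <= ?B"
  using sum_squares_bound[of "norm x" "norm y"] by (simp add: power2_sum)
 finally have "(norm (x + y))^2 <= ?B" .
 hence "1 + (norm (x + y))^2 <= 2^2*?A"
 proof -
  have "2^2*?A = 4 + 4*(norm x)^2 + 4*(norm y)^2 + 4*((norm x)^2*(norm y)^2)"
   by (simp add: algebra_simps)
  moreover have "0 <= (norm x)^2" "0 <= (norm y)^2" "0 <= (norm x)^2*(norm y)^2" by simp_all
  ultimately show ?thesis
   using \<open>(norm (x + y))^2 <= 2*(norm x)^2 + 2*(norm y)^2\<close> by linarith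
 qed
 hence "sqrt (1 + (norm (x + y))^2) <= sqrt (2^2*?A)" by simp
 thus ?thesis by (simp add: jbracket_def real_sqrt_mult)
qed

lemma continuous_jbracket [continuous_intros]: "continuous_on S f ==> continuous_on S (%x. jbracket (f x))"
 unfolding jbracket_def by (intro continuous_intros)

lemma tame_mult:
 assumes u: "tame u" and v: "tame v"
 shows "tame (%z. u z * v z)"
proof -
 obtain C where C: "1 <= C" "!!z1 z2. u (z1 + z2) <= C*u z1*u z2" using tame_const[OF u] by blast
 obtain D where D: "1 <= D" "!!z1 z2. v (z1 + z2) <= D * v z1 * v z2" using tame_const[OF v] by blast
 have "u (z1 + z2) * v (z1 + z2) <= (C*D)*(u z1 * v z1)*(u z2 * v z2)" for z1 z2
 proof -
  have "u (z1 + z2) * v (z1 + z2) <= (C*u z1*u z2)*(D * v z1 * v z2)"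
   using C D tameD(4)[OF u] tameD(4)[OF v] by (intro mult_mono) auto
  thus ?thesis by (simp add: mult_ac)
 qed
 moreover have "1 <= u z * v z" for z
  using tameD(2)[OF u, of z] tameD(2)[OF v, of z] mult_mono[of 1 "u z" 1 "v z"] by simp
 moreover have "continuous_on UNIV (%z. u z * v z)" by (intro continuous_intros tameD(1) u v)
 ultimately show ?thesis unfolding tame_def using tameD(5)[OF u] tameD(5)[OF v] by metis
qed

lemma tame_jbracket_fst: "tame (%z. jbracket (fst z))"
 unfolding tame_def using jbracket_add jbracket_ge_1
 by (intro conjI allI exI[of _ 2]) (auto intro!: continuous_intros simp: jbracket_def)

lemma tame_jbracket_snd: "tame (%z. jbracket (snd z))"
 unfolding tame_def using jbracket_add jbracket_ge_1
 by (intro conjI allI exI[of _ 2]) (auto intro!: continuous_intros simp: jbracket_def)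

lemma tame_1: "tame (%z. 1)"
 unfolding tame_def by (auto intro!: exI[of _ 1])

lemma tame_power: "tame u ==> tame (%z. u z^n)"
 by (induction n) (auto intro: tame_1 tame_mult)

lemma MM_mono:
 assumes u: "tame u" and v: "tame v" and le: "!!z. u z <= C * v z" and f: "MM v f"
 shows "MM u f"
proof -
 note [measurable] = u f
 have "intg (%z. cmod (VG f z)*u z)"
  by (rule int_dom[OF integrable_mult_right[OF MM_D(3)[OF f], of C]], measurable)
   (simp add: abs_mult tameD(4)[OF u] mult.left_commute[of C] mult_left_mono[OF le])
 thus ?thesis using MM_D(1,2)[OF f] by (simp add: MM_def)
qed

lemma integrable_weight_mono:
 assumes w: "w \<in> BM" and c: "intg (%z. cmod (u z)*w' z)" "u \<in> BM" "k \<in> BM"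
  and le: "!!z. cmod (k z)*w z <= C*w' z" and nn: "!!z. 0 <= w z"
 shows "intg (%z. cmod (k z*u z)*w z)"
proof (rule int_dom[OF integrable_mult_right[OF c(1), of C]])
 have [measurable]: "w \<in> BM" "u \<in> BM" "k \<in> BM" by fact+
 show "(%z. cmod (k z*u z)*w z) \<in> borel_measurable lborel" by measurable
 show "norm (cmod (k z*u z)*w z) <= C*(cmod (u z)*w' z)" for z
  using mult_left_mono[OF le norm_ge_zero, of "u z" z] nn[of z] by (simp add: norm_mult abs_mult mult_ac)
qed

text \<open>Under the synthesis integral t = x + (t - x): the first part multiplies the
  coefficients, at the cost of one factor \<open>jbracket (fst z)\<close>, and the second turns the
  synthesis window into X applied to the Gaussian.\<close>

lemma MM_Xop:
 fixes b :: "'a::euclidean_space"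
 assumes w: "tame w" and b: "b \<in> Basis" and f: "MM (%z. w z*jbracket (fst z)) f"
 shows "MM w (Xop b f)"
proof -
 have wj: "tame (%z. w z*jbracket (fst z))" by (intro tame_mult w tame_jbracket_fst)
 note [measurable] = w f
 define u where "u = VG f"
 have [measurable]: "u \<in> BM" unfolding u_def by measurable
 have ui: "intg (%z. cmod (u z)*(w z*jbracket (fst z)))" using MM_D(3)[OF f] by (simp add: u_def)
 have le1: "\<bar>fst z \<bullet> b\<bar> <= jbracket (fst z)" for z :: "'a*'a"
  using Basis_le_norm[OF b, of "fst z"] norm_le_jbracket[of "fst z"] by simp
 have i1: "intg (%z. cmod (of_real (fst z \<bullet> b)*u z)*w z)"
  by (rule integrable_weight_mono[OF _ ui, where C=1]) (use le1 tameD(4)[OF w] in \<open>auto intro!: mult_left_mono simp: mult.commute[of "\<bar>_\<bar>"]\<close>)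
 have i2: "intg (%z. cmod (1*u z)*w z)"
  by (rule integrable_weight_mono[OF _ ui, where C=1]) (use mult_left_mono[OF jbracket_ge_1 tameD(4)[OF w]] tameD(4)[OF w] in simp_all)
 have i2: "intg (%z. cmod (u z)*w z)" using i2 by simp
 have n: "MM w gaussian" using MM_tf_gaussian[OF w, of 0] by simp
 let ?A = "(%z. of_real (fst z \<bullet> b)*u z)"
 let ?C = "synth ?A gaussian"
 have s1: "MM w ?C"
  by (rule MM_synth[OF w i1 _ nice_gaussian n]) measurable
 let ?B = "synth u (Xop b gaussian)"
 have s2: "MM w ?B"
  by (rule MM_synth[OF w i2 _ nice_Xop_gaussian[OF b] MM_Xop_gaussian[OF w b]]) measurable
 obtain C where C: "1 <= C" "!!z1 z2. w (z1 + z2) <= C*w z1*w z2" using tame_const[OF w] by blast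
 have C0: "0 <= C" using C by simp
 have c1: "intg ?A"
  by (rule synth_weighted(1)[OF w C0 C(2) i1 _ nice_gaussian nice_gaussian MM_D(3)[OF n]]) measurable
 have c2: "intg u"
  by (rule synth_weighted(1)[OF w C0 C(2) i2 _ nice_gaussian nice_gaussian MM_D(3)[OF n]]) measurable
 have eq: "Xop b f = (%t. of_real (cg TYPE('a))*(?C t + ?B t))"
 proof
  fix t
  have "?C t + ?B t
   = (LBINT z. of_real (fst z \<bullet> b)*u z*tf_shift z gaussian t + u z*tf_shift z (Xop b gaussian) t)"
   unfolding synth_def using synth_integrable[OF c1 nice_gaussian] synth_integrable[OF c2 nice_Xop_gaussian[OF b]]
   by (intro Bochner_Integration.integral_add[symmetric]) auto
  also have "... = (LBINT z. of_real (t \<bullet> b)*(u z*tf_shift z gaussian t))"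
   by (intro Bochner_Integration.integral_cong refl) (simp add: tf_shift_eq Xop_def inner_diff_left algebra_simps)
  also have "... = of_real (t \<bullet> b) * synth u gaussian t" by (simp add: synth_def)
  finally show "Xop b f t = of_real (cg TYPE('a))*(?C t + ?B t)"
   using fun_cong[OF MM_inversion[OF wj f], of t] by (simp add: Xop_def u_def)
 qed
 show ?thesis unfolding eq by (intro MM_cmult MM_add[OF w] s1 s2)
qed

lemma tf_gaussian_has_derivative:
 "(tf_shift z gaussian has_derivative (%v. (2 * of_real pi*\<i> * of_real (snd z \<bullet> v) + of_real (- 2*pi*((t - fst z) \<bullet> v)))*tf_shift z gaussian t)) (at t)"
proof -
 let ?A = "%t. gaussian (t - fst z)"
 have gs: "((%t. ?A t) has_derivative (%v. of_real (- 2*pi*((t - fst z) \<bullet> v))*?A t)) (at t)"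
  by (rule has_derivative_compose[of "%t. t - fst z" "%v. v" t UNIV gaussian, OF _ gaussian_has_derivative]) (auto intro!: derivative_eq_intros)
 have "((%t. ph (snd z \<bullet> t)*?A t) has_derivative (%v. ph (snd z \<bullet> t)*(of_real (- 2*pi*((t - fst z) \<bullet> v))*?A t) + (of_real (snd z \<bullet> v)*(2 * of_real pi*\<i>*ph (snd z \<bullet> t)))*?A t)) (at t)"
  by (rule derivative_eq_intros refl gs)+ simp
 thus ?thesis unfolding tf_shift_eq[abs_def] by (simp add: algebra_simps)
qed

lemma tf_gaussian_deriv_bound:
 shows "cmod ((2 * of_real pi*\<i> * of_real (snd z \<bullet> v) + of_real (- 2*pi*((t - fst z) \<bullet> v)))*tf_shift z gaussian t) <= 4*pi*jbracket (snd z)*norm v"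
proof -
 define s where "s = t - fst z"
 let ?A = "exp (- pi*(norm s)^2)"
 have e: "norm s*?A <= 1"
 proof (cases "s = 0")
  case False
  have "norm (sgn s) <= 1" using False by (simp add: norm_sgn)
  from norm_Xop_gaussian_le[OF this, of s] have "\<bar>s \<bullet> sgn s\<bar>*?A <= exp (- pi*(1/2)*(norm s)^2)"
   by (simp add: Xop_def norm_mult norm_gaussian)
  also have "... <= 1" by simp
  also have "s \<bullet> sgn s = norm s" using False by (simp add: sgn_div_norm power2_norm_eq_inner[symmetric] power2_eq_square)
  finally show ?thesis by simp
 qed simp
 let ?D = "tf_shift z gaussian t"
 let ?B = "cmod (2 * of_real pi*\<i> * of_real (snd z \<bullet> v)*?D)"
 let ?E = "jbracket (snd z)"
 have A: "?B <= 2*pi*(?E*norm v)"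
 proof -
  have "\<bar>snd z \<bullet> v\<bar> <= ?E*norm v"
   by (rule order_trans[OF Cauchy_Schwarz_ineq2]) (intro mult_right_mono norm_le_jbracket, simp)
  moreover have "cmod (gaussian s) <= 1" by (rule norm_gaussian_le_1)
  ultimately have "\<bar>snd z \<bullet> v\<bar>*cmod (gaussian s) <= (?E*norm v)*1"
   using order_trans[OF zero_le_one jbracket_ge_1[of "snd z"]] by (intro mult_mono) auto
  thus ?thesis by (simp add: norm_mult s_def)
 qed
 let ?C = "of_real (- 2*pi*(s \<bullet> v))"
 have B: "cmod (?C*?D) <= 2*pi*(?E*norm v)"
 proof -
  have "\<bar>s \<bullet> v\<bar>*?A <= (norm s*norm v)*?A"
   by (intro mult_right_mono Cauchy_Schwarz_ineq2) simp
  also have "... <= 1*norm v" using mult_right_mono[OF e, of "norm v"] by (simp add: mult_ac)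
  also have "... <= ?E*norm v" by (intro mult_right_mono jbracket_ge_1) simp
  finally show ?thesis by (simp add: norm_mult norm_gaussian s_def)
 qed
 have "cmod ((2 * of_real pi*\<i> * of_real (snd z \<bullet> v) + ?C)*?D)
   <= ?B + cmod (?C*?D)"
  unfolding distrib_right by (rule norm_triangle_ineq)
 thus ?thesis using A B by (simp add: s_def)
qed

text \<open>Differentiation under the synthesis integral. The derivative of a shifted Gaussian
  consists of a frequency factor, which costs one \<open>jbracket (snd z)\<close>, and X applied to
  the Gaussian, so that the derivative is again a sum of synthesis integrals.\<close>

lemma MM_partial_deriv:
 fixes b :: "'a::euclidean_space"
 assumes w: "tame w" and f: "MM (%z. w z*jbracket (snd z)) f"
 shows "f differentiable (at t)" and "b \<in> Basis ==> MM w (partial_deriv b f)"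
proof -
 let ?C = "%z. jbracket (snd z)"
 have wj: "tame (%z. w z*?C z)" by (intro tame_mult w tame_jbracket_snd)
 note [measurable] = w f
 define c0 where "c0 = complex_of_real (cg TYPE('a))"
 define u where "u = VG f"
 have [measurable]: "u \<in> BM" unfolding u_def by measurable
 have ui: "intg (%z. cmod (u z)*(w z*?C z))" using MM_D(3)[OF f] by (simp add: u_def)
 have n: "MM w gaussian" using MM_tf_gaussian[OF w, of 0] by simp
 have jm [measurable]: "(%z :: 'a*'a. ?C z) \<in> BM"
  by (intro BM_contI continuous_intros)
 have i1: "intg (%z. cmod (of_real (?C z)*u z)*w z)"
  by (rule integrable_weight_mono[OF _ ui, where C=1]) (use tameD(4)[OF w] in \<open>simp_all add: mult.commute\<close>)
 obtain C where C: "1 <= C" "!!z1 z2. w (z1 + z2) <= C*w z1*w z2" using tame_const[OF w] by blast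
 have C0: "0 <= C" using C by simp
 have juc: "intg (%z. of_real (?C z)*u z)"
  by (rule synth_weighted(1)[OF w C0 C(2) i1 _ nice_gaussian nice_gaussian MM_D(3)[OF n]]) measurable
 have ju: "intg (%z. cmod (u z)*?C z)"
  using integrable_norm[OF juc] order_trans[OF zero_le_one jbracket_ge_1] by (simp add: norm_mult mult.commute)
 let ?A = "%z. tf_shift z gaussian"
 have finv: "f t = c0*(LBINT z. u z*?A z t)" for t
  using fun_cong[OF MM_inversion[OF wj f], of t] by (simp add: c0_def u_def synth_def)
 have u: "intg u" unfolding u_def by (rule MM_STFT_integrable[OF wj f])
 define d where "d z t v = (2 * of_real pi*\<i> * of_real (snd z \<bullet> v) + of_real (- 2*pi*((t - fst z) \<bullet> v)))*?A z t" for z :: "'a*'a" and t v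
 have dD: "(tf_shift z gaussian has_derivative d z t) (at t)" for z :: "'a*'a" and t unfolding d_def by (rule tf_gaussian_has_derivative)
 have dB: "cmod (d z t v) <= 4*pi*?C z*norm v" for z :: "'a*'a" and t v unfolding d_def by (rule tf_gaussian_deriv_bound)
 have [measurable]: "(%z. d z t v) \<in> BM" for t v unfolding d_def by measurable
 have di: "intg (%z. u z*d z t v)" for t v
 proof (rule int_dom[OF integrable_mult_right[OF ju, of "4*pi*norm v"]])
  show "cmod (u z*d z t v) <= 4*pi*norm v * (cmod (u z)*?C z)" for z
   using mult_left_mono[OF dB[of z t v], of "cmod (u z)"] by (simp add: norm_mult mult_ac)
 qed measurable
 define Df where "Df t v = c0*(LBINT z. u z*d z t v)" for t v
 \<comment> \<open>The mean value inequality bounds the difference quotients uniformly in h, which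
   furnishes the majorant for exchanging limit and integral.\<close>
 have lip: "cmod (?A z (t + h) - ?A z t) <= 4*pi*?C z*norm h" for z :: "'a*'a" and t h
 proof -
  have "cmod (?A z (t + h) - ?A z t) <= (4*pi*?C z)*norm ((t + h) - t)"
  proof (rule differentiable_bound[of UNIV])
   show "(tf_shift z gaussian has_derivative d z x) (at x within UNIV)" for x using dD by simp
   show "onorm (d z x) <= 4*pi*?C z" for x
    by (rule onorm_le) (rule dB)
  qed auto
  thus ?thesis by simp
 qed
 have lin: "linear (Df t)" for t
 proof (rule linearI)
  have dl: "linear (d z t)" for z using dD by (rule has_derivative_linear)
  fix v v' and r :: real
  show "Df t (v + v') = Df t v + Df t v'" unfolding Df_def using di by (simp add: linear_add[OF dl] distrib_left)
  show "Df t (r *\<^sub>R v) = r *\<^sub>R Df t v" unfolding Df_def by (simp add: linear_scale[OF dl] scaleR_conv_of_real mult.left_commute)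
 qed
 let ?E = "%t h i. norm (f (t + h i) - f t - Df t (h i))"
 have fD: "(f has_derivative Df t) (at t)" for t
  unfolding has_derivative_at
 proof
  show "bounded_linear (Df t)" using lin by (simp add: linear_conv_bounded_linear)
  show "(%h. norm (f (t + h) - f t - Df t h)/norm h) \<midarrow>0\<rightarrow> 0"
   unfolding tendsto_at_iff_sequentially o_def
  proof (intro allI impI)
   fix h :: "nat => 'a" assume h: "\<forall>i. h i \<in> UNIV - {0}" "h ---> 0"
   define e where "e i z = cmod (u z)*(cmod (?A z (t + h i) - ?A z t - d z t (h i))/norm (h i))" for i z
   have eb: "norm (e i z) <= 8*pi*(cmod (u z)*?C z)" for i z
   proof -
    have hi: "0 < norm (h i)" using h(1) by auto
    have "cmod (?A z (t + h i) - ?A z t - d z t (h i)) <= 8*pi*?C z*norm (h i)"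
     using norm_triangle_ineq4[of "?A z (t + h i) - ?A z t" "d z t (h i)"] lip[of z t "h i"] dB[of z t "h i"] by simp
    hence "cmod (?A z (t + h i) - ?A z t - d z t (h i))/norm (h i) <= 8*pi*?C z"
     using hi by (simp add: divide_le_eq)
    hence "e i z <= cmod (u z)*(8*pi*?C z)" unfolding e_def by (rule mult_left_mono) simp
    moreover have "0 <= e i z" by (simp add: e_def)
    ultimately show ?thesis by (simp add: mult_ac)
   qed
   have tm [measurable]: "(%z. ?A z s) \<in> BM" for s :: 'a by measurable
   have em [measurable]: "e i \<in> BM" for i unfolding e_def by measurable
   have ei: "intg (e i)" for i
    by (rule int_dom[OF integrable_mult_right[OF ju, of "8*pi"] _ eb]) simp
   have "(%i. (LBINT z. e i z)) ---> (LBINT (z :: 'a*'a). 0)"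
   proof (rule integral_dominated_convergence[OF _ _ integrable_mult_right[OF ju, of "8*pi"]])
    show "AEL z. norm (e i z) <= 8*pi*(cmod (u z)*?C z)" for i using eb by simp
    show "AEL z. (%i. e i z) ---> 0"
    proof (rule AE_I2)
     fix z
     have "(%h. norm (?A z (t + h) - ?A z t - d z t h)/norm h) \<midarrow>0\<rightarrow> 0"
      using dD[of z t] by (simp add: has_derivative_at)
     hence "(%i. norm (?A z (t + h i) - ?A z t - d z t (h i))/norm (h i)) ---> 0"
      using h unfolding tendsto_at_iff_sequentially o_def by blast
     hence "(%i. e i z) ---> cmod (u z)*0" unfolding e_def by (intro tendsto_intros)
     thus "(%i. e i z) ---> 0" by simp
    qed
   qed (auto intro: em)
   hence "(%i. cmod c0*(LBINT z. e i z)) ---> cmod c0*0" by (intro tendsto_intros) simp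
   hence l0: "(%i. cmod c0*(LBINT z. e i z)) ---> 0" by simp
   have le: "?E t h i/norm (h i) <= cmod c0*(LBINT z. e i z)" for i
   proof -
    have hi: "0 < norm (h i)" using h(1) by auto
    have si: "intg (%z. u z*?A z s)" for s by (rule synth_integrable[OF u nice_gaussian])
    have "f (t + h i) - f t - Df t (h i) = c0*(LBINT z. u z*(?A z (t + h i) - ?A z t - d z t (h i)))"
     unfolding finv Df_def using si di by (simp add: right_diff_distrib)
    hence "?E t h i <= cmod c0*(LBINT z. cmod (u z*(?A z (t + h i) - ?A z t - d z t (h i))))"
     by (simp only: norm_mult) (intro mult_left_mono order_trans[OF integral_norm_bound] order_refl, auto simp: norm_mult)
    also have "(LBINT z. cmod (u z*(?A z (t + h i) - ?A z t - d z t (h i)))) = (LBINT z. norm (h i)*e i z)"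
     using hi by (intro Bochner_Integration.integral_cong refl) (simp add: e_def norm_mult)
    finally have "?E t h i <= (cmod c0*(LBINT z. e i z))*norm (h i)"
     by (simp add: mult_ac)
    thus ?thesis using hi by (simp add: divide_le_eq)
   qed
   show "(%i. ?E t h i/norm (h i)) ---> 0"
    by (rule tendsto_sandwich[OF _ _ tendsto_const l0]) (auto simp: le)
  qed
 qed
 thus "f differentiable (at t)" by (rule differentiableI)
 assume b: "b \<in> Basis"
 let ?B = "%z. 2 * of_real pi*\<i> * of_real (snd z \<bullet> b)"
 have le1: "cmod (?B z)*w z <= (2*pi)*(w z*?C z)" for z :: "'a*'a"
 proof -
  have "\<bar>snd z \<bullet> b\<bar> <= ?C z" using Basis_le_norm[OF b, of "snd z"] norm_le_jbracket[of "snd z"] by simp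
  hence "\<bar>snd z \<bullet> b\<bar>*w z <= ?C z*w z" by (rule mult_right_mono) (rule tameD(4)[OF w])
  thus ?thesis by (simp add: norm_mult mult_ac)
 qed
 have i1': "intg (%z. cmod ((?B z)*u z)*w z)"
  by (rule integrable_weight_mono[OF _ ui _ _ le1]) (use tameD(4)[OF w] in auto)
 have i2: "intg (%z. cmod (1*u z)*w z)"
  by (rule integrable_weight_mono[OF _ ui, where C=1]) (use mult_left_mono[OF jbracket_ge_1 tameD(4)[OF w]] tameD(4)[OF w] in simp_all)
 have i2: "intg (%z. cmod (u z)*w z)" using i2 by simp
 let ?D = "synth (%z. (?B z)*u z) gaussian"
 have s1: "MM w ?D"
  by (rule MM_synth[OF w i1' _ nice_gaussian n]) measurable
 let ?F = "synth u (Xop b gaussian)"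
 have s2: "MM w ?F"
  by (rule MM_synth[OF w i2 _ nice_Xop_gaussian[OF b] MM_Xop_gaussian[OF w b]]) measurable
 have c1: "intg (%z. (?B z)*u z)"
  by (rule synth_weighted(1)[OF w C0 C(2) i1' _ nice_gaussian nice_gaussian MM_D(3)[OF n]]) measurable
 let ?G = "- 2 * of_real pi"
 have eq: "partial_deriv b f = (%t. c0*(?D t + ?G*?F t))"
 proof
  fix t
  have "?D t + ?G*?F t
   = (LBINT z. (?B z)*u z*?A z t + ?G*(u z*tf_shift z (Xop b gaussian) t))"
   unfolding synth_def using synth_integrable[OF c1 nice_gaussian, of t] synth_integrable[OF u nice_Xop_gaussian[OF b], of t] by simp
  also have "... = (LBINT z. u z*d z t b)"
   by (intro Bochner_Integration.integral_cong refl) (simp add: d_def tf_shift_eq Xop_def algebra_simps)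
  finally show "partial_deriv b f t = c0*(?D t + ?G*?F t)"
   using partial_derivI[OF fD, of b t] by (simp add: Df_def)
 qed
 show "MM w (partial_deriv b f)" unfolding eq by (intro MM_cmult MM_add[OF w] s1 s2)
qed

text \<open>An abstract binomial rule, so that multiplication and differentiation are treated at
  once: c is the factor in front of the transform, s the sign with which the operator falls on the
  window, and \<open>K n\<close> says that n further applications of P are allowed.\<close>

lemma power_Leibniz:
 fixes V :: "'f => 'f => complex"
 assumes K: "!!n f. K (Suc n) f ==> K n (P f)" "!!n f. K (Suc n) f ==> K n f"
  and rel: "!!n f g. K (Suc n) f ==> K (Suc n) g ==> c*V g f = V g (P f) + s*V (P g) f"
  and f: "K n f" "K n g"
 shows "c^n*V g f = (\<Sum>j\<le>n. of_nat (n choose j) * s^(n - j)*V ((P ^^ (n - j)) g) ((P ^^ j) f))"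
 using f
proof (induction n arbitrary: f g)
 case (Suc n)
 define A where "A j = s^(Suc n - j)*V ((P ^^ (Suc n - j)) g) ((P ^^ j) f)" for j
 have "c^Suc n*V g f = c^n*(c*V g f)" by (simp add: mult_ac)
 also have "... = c^n*V g (P f) + s*(c^n*V (P g) f)"
  unfolding rel[OF Suc.prems] by (simp add: algebra_simps)
 also have "c^n*V g (P f) = (\<Sum>j\<le>n. of_nat (n choose j)*A (Suc j))"
  using Suc.IH[OF K(1)[OF Suc.prems(1)] K(2)[OF Suc.prems(2)]] by (simp add: A_def mult.assoc funpow_swap1)
 also have "s*(c^n*V (P g) f) = (\<Sum>j\<le>n. of_nat (n choose j)*A j)"
  unfolding Suc.IH[OF K(2)[OF Suc.prems(1)] K(1)[OF Suc.prems(2)]] sum_distrib_left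
  by (intro sum.cong refl) (simp add: A_def Suc_diff_le funpow_swap1 mult_ac)
 also have "... = A 0 + (\<Sum>j\<le>n. of_nat (n choose Suc j)*A (Suc j))"
  using sum.atMost_Suc_shift[of "%j. of_nat (n choose j)*A j" n] by (simp add: binomial_eq_0)
 finally have "c^Suc n*V g f = A 0 + (\<Sum>j\<le>n. of_nat (Suc n choose Suc j)*A (Suc j))"
  by (simp add: sum.distrib[symmetric] distrib_right add_ac)
 also have "... = (\<Sum>j\<le>Suc n. of_nat (Suc n choose j)*A j)"
  unfolding sum.atMost_Suc_shift by simp
 finally show ?case by (simp only: A_def mult.assoc)
qed simp

text \<open>Multi-indices dominated by \<alpha> and supported in S; enlarging S by one direction at
  a time drives the induction of the several-variable rule.\<close>

definition below :: "'b set => ('b => nat) => ('b => nat) set" where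
 "below S \<alpha> = {\<beta>. \<forall>b. \<beta> b <= (if b \<in> S then \<alpha> b else 0)}"

lemma sum_below_insert:
 assumes "b \<notin> S"
 shows "sum F (below (insert b S) \<alpha>) = (\<Sum>\<beta>\<in>below S \<alpha>. \<Sum>j\<le>\<alpha> b. F (\<beta>(b := j)))"
proof -
 have "\<beta> b = 0" if "\<beta> \<in> below S \<alpha>" for \<beta> using that assms unfolding below_def by (auto dest: spec[of _ b])
 thus ?thesis
  using assms unfolding sum.cartesian_product
  by (intro sum.reindex_bij_witness[where i="%(\<beta>, j). \<beta>(b := j)" and j="%\<beta>. (\<beta>(b := 0), \<beta> b)"])
    (auto simp: below_def fun_eq_iff split: if_splits dest: spec[of _ b])
qed

text \<open>One direction of the list at a time, by \<open>power_Leibniz\<close>. The operators are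
  applied in list order on both arguments throughout, so none is ever moved past another.\<close>

lemma foldr_Leibniz:
 fixes V :: "'f => 'f => complex" and \<alpha> :: "'b => nat"
 assumes K: "!!n b f. b \<in> set bs ==> K (Suc n) f ==> K n (P b f)" "!!n f. K (Suc n) f ==> K n f"
  and rel: "!!n b f g. b \<in> set bs ==> K (Suc n) f ==> K (Suc n) g ==> c b*V g f = V g (P b f) + s b*V (P b g) f"
  and d: "distinct bs"
 shows "(!!b. b \<in> set bs ==> \<beta> b <= \<alpha> b) ==> K (sum \<alpha> (set bs) + n) f ==> K n (foldr (%b. P b ^^ \<beta> b) bs f)"
  and "K (sum \<alpha> (set bs) + n) f ==> K (sum \<alpha> (set bs) + n) g ==>
   (\<Prod>b\<in>set bs. c b^\<alpha> b)*V g f = (\<Sum>\<beta>\<in>below (set bs) \<alpha>. (\<Prod>b\<in>set bs. of_nat (\<alpha> b choose \<beta> b) * s b^(\<alpha> b - \<beta> b))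
    *V (foldr (%b. P b ^^ (\<alpha> b - \<beta> b)) bs g) (foldr (%b. P b ^^ \<beta> b) bs f))"
proof -
 have mono: "K (m + k) f ==> K m f" for m k f by (induction k) (auto dest: K(2))
 have pow: "K (m + k) f ==> K m ((P b ^^ k) f)" if "b \<in> set bs" for m k b f
  by (induction k arbitrary: m) (auto dest!: K(1)[OF that] simp flip: add_Suc)
 let ?A = "%\<beta> xs. foldr (%b. P b ^^ \<beta> b) xs"
 have fold: "K n (?A \<beta> xs f)" if "!!b. b \<in> set xs ==> \<beta> b <= \<alpha> b" "K (sum \<alpha> (set xs) + n) f" "distinct xs" "set xs \<subseteq> set bs" for xs \<beta> n f
  using that
 proof (induction xs arbitrary: n)
  case (Cons b xs)
  have "K (sum \<alpha> (set xs) + (n + \<alpha> b)) f" using Cons.prems(2,3) by (simp add: add_ac)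
  hence "K (n + \<alpha> b) (?A \<beta> xs f)" using Cons.prems by (intro Cons.IH) auto
  hence "K (n + \<beta> b + (\<alpha> b - \<beta> b)) (?A \<beta> xs f)" using Cons.prems(1)[of b] by simp
  hence "K (n + \<beta> b) (?A \<beta> xs f)" by (rule mono)
  thus ?case using Cons.prems(4) by (simp add: pow)
 qed simp
 show "(!!b. b \<in> set bs ==> \<beta> b <= \<alpha> b) ==> K (sum \<alpha> (set bs) + n) f ==> K n (?A \<beta> bs f)" by (rule fold) (auto simp: d)
 have "(\<Prod>b\<in>set xs. c b^\<alpha> b)*V g f = (\<Sum>\<beta>\<in>below (set xs) \<alpha>. (\<Prod>b\<in>set xs. of_nat (\<alpha> b choose \<beta> b) * s b^(\<alpha> b - \<beta> b))
    *V (foldr (%b. P b ^^ (\<alpha> b - \<beta> b)) xs g) (?A \<beta> xs f))"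
  if "K (sum \<alpha> (set xs) + n) f" "K (sum \<alpha> (set xs) + n) g" "distinct xs" "set xs \<subseteq> set bs" for xs n
  using that
 proof (induction xs arbitrary: n)
  case Nil
  have "below {} \<alpha> = {%_. 0}" by (auto simp: below_def)
  thus ?case by simp
 next
  case (Cons b xs)
  have b: "b \<in> set bs" "b \<notin> set xs" using Cons.prems by auto
  have Kf: "K (sum \<alpha> (set xs) + (n + \<alpha> b)) f" "K (sum \<alpha> (set xs) + (n + \<alpha> b)) g" using Cons.prems b by (simp_all add: add_ac)
  define G where "G \<beta> = foldr (%b. P b ^^ (\<alpha> b - \<beta> b)) xs g" for \<beta>
  define F where "F \<beta> = ?A \<beta> xs f" for \<beta>
  define w where "w \<beta> = (\<Prod>b\<in>set xs. of_nat (\<alpha> b choose \<beta> b) * s b^(\<alpha> b - \<beta> b))" for \<beta>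
  have le: "\<beta> a <= \<alpha> a" if "\<beta> \<in> below (set xs) \<alpha>" for \<beta> a
   using that unfolding below_def by (auto split: if_splits dest!: spec[of _ a])
  have KG: "K (\<alpha> b) (G \<beta>)" "K (\<alpha> b) (F \<beta>)" if "\<beta> \<in> below (set xs) \<alpha>" for \<beta>
   unfolding G_def F_def
   by (rule mono[of "\<alpha> b" n], subst add.commute, rule fold, use le[OF that] Cons.prems Kf in auto)+
  have pl: "c b^\<alpha> b*V (G \<beta>) (F \<beta>) = (\<Sum>j\<le>\<alpha> b. of_nat (\<alpha> b choose j) * s b^(\<alpha> b - j)*V ((P b ^^ (\<alpha> b - j)) (G \<beta>)) ((P b ^^ j) (F \<beta>)))"
   if "\<beta> \<in> below (set xs) \<alpha>" for \<beta>
   by (rule power_Leibniz[where K=K]) (fact K(1)[OF b(1)] K(2) rel[OF b(1)] KG(1)[OF that] KG(2)[OF that])+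
  have upd: "G (\<beta>(b := j)) = G \<beta>" "F (\<beta>(b := j)) = F \<beta>" "w (\<beta>(b := j)) = w \<beta>" for \<beta> j
   unfolding G_def F_def w_def using b(2) by (auto intro!: foldr_cong prod.cong)
  have "(\<Prod>b\<in>set (b # xs). c b^\<alpha> b)*V g f = c b^\<alpha> b*(\<Sum>\<beta>\<in>below (set xs) \<alpha>. w \<beta>*V (G \<beta>) (F \<beta>))"
   using Cons.IH[OF Kf] Cons.prems b by (simp add: w_def G_def F_def mult.assoc)
  also have "... = (\<Sum>\<beta>\<in>below (set xs) \<alpha>. w \<beta>*(c b^\<alpha> b*V (G \<beta>) (F \<beta>)))"
   by (simp add: sum_distrib_left mult_ac)
  also have "... = (\<Sum>\<beta>\<in>below (set xs) \<alpha>. w \<beta>*(\<Sum>j\<le>\<alpha> b. of_nat (\<alpha> b choose j) * s b^(\<alpha> b - j)*V ((P b ^^ (\<alpha> b - j)) (G \<beta>)) ((P b ^^ j) (F \<beta>))))"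
   by (intro sum.cong refl) (simp only: pl)
  also have "... = (\<Sum>\<beta>\<in>below (insert b (set xs)) \<alpha>. of_nat (\<alpha> b choose \<beta> b) * s b^(\<alpha> b - \<beta> b)*w \<beta>*V ((P b ^^ (\<alpha> b - \<beta> b)) (G \<beta>)) ((P b ^^ \<beta> b) (F \<beta>)))"
   unfolding sum_below_insert[OF b(2)] by (simp add: upd sum_distrib_left mult_ac)
  finally show ?case using b(2) by (simp add: w_def G_def F_def mult.assoc)
 qed
 from this[of bs n] show "K (sum \<alpha> (set bs) + n) f ==> K (sum \<alpha> (set bs) + n) g ==>
   (\<Prod>b\<in>set bs. c b^\<alpha> b)*V g f = (\<Sum>\<beta>\<in>below (set bs) \<alpha>. (\<Prod>b\<in>set bs. of_nat (\<alpha> b choose \<beta> b) * s b^(\<alpha> b - \<beta> b))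
    *V (foldr (%b. P b ^^ (\<alpha> b - \<beta> b)) bs g) (?A \<beta> bs f))" using d by simp
qed

lemma basis_list: "distinct (basis_list :: 'a::euclidean_space list)" "set (basis_list :: 'a list) = Basis"
proof -
 have "\<exists>bs. distinct bs & set bs = (Basis :: 'a set)" using finite_distinct_list[OF finite_Basis] by blast
 from someI_ex[OF this] show "distinct (basis_list :: 'a list)" "set (basis_list :: 'a list) = Basis"
  by (simp_all add: basis_list_def)
qed

text \<open>Position directions precede frequency directions: the fold then differentiates before it
  multiplies, which is the order in \<open>mono_deriv\<close>.\<close>

definition pbasis_list :: "('a::euclidean_space \<times> 'a) list" where
 "pbasis_list = map (%b. (b, 0)) basis_list @ map (Pair 0) basis_list"

lemma pbasis_list: "distinct (pbasis_list :: ('a::euclidean_space \<times> 'a) list)" "set (pbasis_list :: ('a*'a) list) = Basis"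
 using basis_list[where 'a='a] nonzero_Basis[where 'a='a]
 by (auto simp: pbasis_list_def distinct_map inj_on_def Basis_prod_def image_iff)

definition XD :: "'a::euclidean_space \<times> 'a => ('a => complex) => 'a => complex" where
 "XD b = (if fst b = 0 then partial_deriv (snd b) else Xop (fst b))"

lemma foldr_XD: "foldr (%b. XD b ^^ \<beta> b) pbasis_list \<phi> = mono_deriv (mi_fst \<beta>) (mi_snd \<beta>) (\<phi> :: 'a::euclidean_space => complex)"
proof -
 let ?B = "foldr (%b. XD (b, 0) ^^ \<beta> (b, 0))"
 have X: "?B xs f = (%t. of_real (\<Prod>b\<in>set xs. (t \<bullet> b)^\<beta> (b, 0))*f t)"
  if "distinct xs" "set xs \<subseteq> Basis" for xs and f :: "'a => complex"
  using that
 proof (induction xs)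
  case (Cons b xs)
  have "b ~= 0" using Cons.prems by auto
  hence "(XD (b, 0) ^^ n) g = (%t. of_real ((t \<bullet> b)^n)*g t)" for n and g :: "'a => complex"
   by (induction n) (simp_all add: XD_def Xop_def fun_eq_iff)
  thus ?case using Cons by (simp add: mult.assoc)
 qed simp
 let ?A = "foldr (%b. XD (0, b) ^^ \<beta> (0, b)) basis_list \<phi>"
 have "foldr (%b. XD b ^^ \<beta> b) pbasis_list \<phi> = ?B basis_list ?A"
  by (simp add: pbasis_list_def foldr_map comp_def)
 also have "?A = mi_deriv (mi_snd \<beta>) \<phi>"
  by (simp add: mi_deriv_def mi_snd_def XD_def)
 finally show ?thesis
  by (subst (asm) X) (simp_all add: basis_list mono_deriv_def monomial_def mi_fst_def fun_eq_iff)
qed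

definition xj :: "nat => 'a::euclidean_space \<times> 'a => real" where
 "xj n z = jbracket (fst z)^n*jbracket (snd z)^n"

lemma tame_xj: "tame (xj n)"
 unfolding xj_def[abs_def] by (intro tame_mult tame_power tame_jbracket_fst tame_jbracket_snd)

text \<open>Each multiplication or differentiation uses up one power of the polynomial weight; with
  N powers at the start, N applications are possible.\<close>

lemma MM_XD:
 assumes u: "tame u" and f: "MM (%z. u z*xj (Suc n) z) f" and b: "b \<in> Basis"
 shows "MM (%z. u z*xj n z) (XD b f)" and "MM (%z. u z*xj n z) f"
  and "fst b = 0 ==> f differentiable (at t)"
proof -
 have t: "tame (%z. u z*xj k z)" for k by (intro tame_mult u tame_xj)
 let ?A = "%z. jbracket (fst z)"
 let ?B = "%z. jbracket (snd z)"
 have t1: "tame (%z. u z*xj n z*?A z)" and t2: "tame (%z. u z*xj n z*?B z)"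
  by (intro tame_mult t tame_jbracket_fst tame_jbracket_snd)+
 let ?C = "%z. u z*xj n z"
 have jf: "1*(?C z) <= ?A z*(?C z)" and js: "1*(?C z) <= ?B z*(?C z)" for z
  by (intro mult_right_mono jbracket_ge_1 tameD(4)[OF t])+
 have j2: "1*(?A z*(?C z)) <= ?B z*(?A z*(?C z))"
   "1*(?B z*(?C z)) <= ?A z*(?B z*(?C z))" for z
  by (intro mult_right_mono jbracket_ge_1 mult_nonneg_nonneg jbracket_nonneg tameD(4)[OF t])+
 have f1: "MM (%z. u z*xj n z*?A z) f"
  by (rule MM_mono[OF t1 t _ f, where C=1]) (use j2(1) in \<open>simp add: xj_def mult_ac\<close>)
 have f2: "MM (%z. u z*xj n z*?B z) f"
  by (rule MM_mono[OF t2 t _ f, where C=1]) (use j2(2) in \<open>simp add: xj_def mult_ac\<close>)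
 show "MM (%z. u z*xj n z) f"
  by (rule MM_mono[OF t t1 _ f1, where C=1]) (use jf in \<open>simp add: mult_ac\<close>)
 show "f differentiable (at t)" by (rule MM_partial_deriv(1)[OF t f2])
 show "MM (%z. u z*xj n z) (XD b f)"
  using b MM_Xop[OF t _ f1] MM_partial_deriv(2)[OF t f2] by (auto simp: XD_def Basis_prod_def)
qed

lemma STFT_XD:
 assumes u: "tame u" and f: "MM (%z. u z*xj (Suc n) z) f" and g: "MM (%z. u z*xj (Suc n) z) g" and b: "b \<in> Basis"
 shows "(if fst b = 0 then 2 * of_real pi*\<i> else 1) * of_real (z \<bullet> b)*STFT g f z
   = STFT g (XD b f) z + (if fst b = 0 then 1 else - 1)*STFT (XD b g) f z"
proof -
 have t: "tame (%z. u z*xj k z)" for k by (intro tame_mult u tame_xj)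
 note n = MM_nice[OF t f] MM_nice[OF t g] MM_nice[OF t MM_XD(1)[OF u f b]] MM_nice[OF t MM_XD(1)[OF u g b]]
 show ?thesis
 proof (cases "fst b = 0")
  case True
  thus ?thesis
   using STFT_partial_deriv[OF n(1) MM_XD(3)[OF u f b True] _ n(2) MM_XD(3)[OF u g b True], of "snd b" z] n(3,4)
   by (simp add: XD_def inner_prod_def)
 next
  case False
  hence "snd b = 0" using b by (auto simp: Basis_prod_def)
  thus ?thesis
   using False STFT_Xop[of f "fst b" g z] n[THEN nice_L2] by (simp add: XD_def inner_prod_def)
 qed
qed

lemma multi_index_below: "{\<beta>. multi_index \<beta> & \<beta> <= \<alpha>} = below Basis \<alpha>" if "multi_index \<alpha>"
 using that by (auto simp: multi_index_def below_def le_fun_def) (metis le_zero_eq)+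

lemma sum_Basis_prod: "(\<Sum>b\<in>Basis. h b) = (\<Sum>b\<in>Basis. h (b, 0)) + (\<Sum>b\<in>Basis. h (0 :: 'a, b :: 'b))"
 for h :: "'a::euclidean_space \<times> 'b::euclidean_space => 'c::comm_monoid_add"
 unfolding Basis_prod_def by (subst sum.union_disjoint) (auto simp: sum.reindex inj_on_def)

lemma prod_Basis_prod: "(\<Prod>b\<in>Basis. h b) = (\<Prod>b\<in>Basis. h (b, 0))*(\<Prod>b\<in>Basis. h (0 :: 'a, b :: 'b))"
 for h :: "'a::euclidean_space \<times> 'b::euclidean_space => 'c::comm_monoid_mult"
 unfolding Basis_prod_def by (subst prod.union_disjoint) (auto simp: prod.reindex inj_on_def)

lemma mi_deg_fst_snd: "mi_deg \<alpha> = mi_deg (mi_fst \<alpha>) + mi_deg (mi_snd \<alpha>)"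
 by (simp add: mi_deg_def sum_Basis_prod mi_fst_def mi_snd_def)

text \<open>The Leibniz rule for all 2d directions. Frequency directions contribute the factors 2 pi
  i; position directions contribute the signs, one for every multiplication that falls on the
  window.\<close>

lemma STFT_monomial:
 fixes f g :: "'a::euclidean_space => complex"
 assumes u: "tame u" and f: "MM (%z. u z*xj N z) f" and g: "MM (%z. u z*xj N z) g"
  and \<alpha>: "multi_index \<alpha>" "mi_deg \<alpha> <= N"
 shows "\<beta> <= \<alpha> ==> MM u (mono_deriv (mi_fst \<beta>) (mi_snd \<beta>) f)"
  and "(2 * of_real pi*\<i>)^mi_deg (mi_snd \<alpha>) * of_real (monomial \<alpha> z)*STFT g f z
   = (\<Sum>\<beta> | multi_index \<beta> & \<beta> <= \<alpha>. of_nat (mi_choose \<alpha> \<beta>)*(-1)^(mi_deg (mi_fst \<alpha>) + mi_deg (mi_fst \<beta>))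
    *STFT (mono_deriv (%b. mi_fst \<alpha> b - mi_fst \<beta> b) (%b. mi_snd \<alpha> b - mi_snd \<beta> b) g) (mono_deriv (mi_fst \<beta>) (mi_snd \<beta>) f) z)"
proof -
 define K where "K n = MM (%z. u z*xj n z)" for n
 define c where "c b = (if fst b = 0 then 2 * of_real pi*\<i> else 1)*complex_of_real (z \<bullet> b)" for b :: "'a*'a"
 define s where "s b = (if fst b = 0 then 1 else - 1 :: complex)" for b :: "'a*'a"
 have b0: "(SOME b. b \<in> Basis) \<in> (Basis :: ('a*'a) set)" by (rule SOME_Basis)
 let ?A = "set pbasis_list"
 have K1: "K n (XD b f)" if "b \<in> ?A" "K (Suc n) f" for n b f using that MM_XD(1)[OF u] by (simp add: K_def pbasis_list)
 have K2: "K n f" if "K (Suc n) f" for n f using that MM_XD(2)[OF u _ b0] by (simp add: K_def)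
 have rel: "c b*STFT g f z = STFT g (XD b f) z + s b*STFT (XD b g) f z" if "b \<in> ?A" "K (Suc n) f" "K (Suc n) g" for n b f g
  unfolding c_def s_def using that by (intro STFT_XD[OF u]) (auto simp: K_def pbasis_list)
 have L1: "K n (foldr (%b. XD b ^^ \<beta> b) pbasis_list f)" if "!!b. b \<in> ?A ==> \<beta> b <= \<alpha> b" "K (sum \<alpha> ?A + n) f" for \<beta> n f
  by (rule foldr_Leibniz(1)[where V="%g f. STFT g f z" and c=c and s=s]) (fact K1 K2 rel pbasis_list(1) that)+
 let ?E = "%\<alpha> \<beta>. \<Prod>b\<in>set pbasis_list. of_nat (\<alpha> b choose \<beta> b) * s b^(\<alpha> b - \<beta> b)"
 have L2: "(\<Prod>b\<in>set pbasis_list. c b^\<alpha> b)*STFT g f z = (\<Sum>\<beta>\<in>below ?A \<alpha>. (?E \<alpha> \<beta>)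
   *STFT (foldr (%b. XD b ^^ (\<alpha> b - \<beta> b)) pbasis_list g) (foldr (%b. XD b ^^ \<beta> b) pbasis_list f) z)"
  if "K (sum \<alpha> ?A + n) f" "K (sum \<alpha> ?A + n) g" for n
  by (rule foldr_Leibniz(2)[where V="%g f. STFT g f z" and c=c and s=s]) (fact K1 K2 rel pbasis_list(1) that)+
 have deg: "N = sum \<alpha> ?A + (N - mi_deg \<alpha>)" using \<alpha>(2) by (simp add: mi_deg_def pbasis_list)
 have Kfg: "K (sum \<alpha> ?A + (N - mi_deg \<alpha>)) f" "K (sum \<alpha> ?A + (N - mi_deg \<alpha>)) g"
  using f g deg by (simp_all add: K_def)
 have K0: "MM u h" if "K n h" for n h
  by (rule MM_mono[OF u _ _ that[unfolded K_def], where C=1])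
    (use mult_left_mono[OF tameD(2)[OF tame_xj] tameD(4)[OF u]] in \<open>auto intro!: tame_mult u tame_xj\<close>)
 let ?D = "%\<beta>. mono_deriv (mi_fst \<beta>) (mi_snd \<beta>)"
 show "MM u (?D \<beta> f)" if "\<beta> <= \<alpha>"
  using K0[OF L1[OF _ Kfg(1), of \<beta>]] that by (auto simp: foldr_XD le_fun_def)
 let ?F = "2 * of_real pi*\<i>"
 have c: "(\<Prod>b\<in>set pbasis_list. c b^\<alpha> b) = ?F^mi_deg (mi_snd \<alpha>) * of_real (monomial \<alpha> z)"
  by (simp add: pbasis_list prod_Basis_prod c_def monomial_def power_mult_distrib prod.distrib power_sum mi_deg_def mi_snd_def nonzero_Basis mult_ac)
 let ?B = "%\<alpha>. mi_deg (mi_fst \<alpha>)"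
 have s: "(?E \<alpha> \<beta>) = of_nat (mi_choose \<alpha> \<beta>)*(-1)^(?B \<alpha> + ?B \<beta>)"
  if "\<beta> \<in> below Basis \<alpha>" for \<beta>
 proof -
  have le: "\<beta> b <= \<alpha> b" for b
  proof -
   have "\<beta> b <= (if b \<in> Basis then \<alpha> b else 0)" using that by (simp only: below_def mem_Collect_eq)
   thus ?thesis by (simp split: if_splits)
  qed
  \<comment> \<open>Since \<beta> is at most \<alpha>, the exponents \<alpha> - \<beta> and \<alpha>
    + \<beta> have the same parity; the sum avoids truncated subtraction.\<close>
  have e: "(- 1 :: complex)^(\<alpha> b - \<beta> b) = (- 1)^(\<alpha> b + \<beta> b)" for b
   using le[of b] by (simp add: minus_one_power_iff)
  have "(\<Prod>b\<in>Basis. s b^(\<alpha> b - \<beta> b)) = (-1)^(?B \<alpha> + ?B \<beta>)"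
   by (simp add: prod_Basis_prod s_def e nonzero_Basis mi_deg_def mi_fst_def power_sum[symmetric] sum.distrib)
  thus ?thesis by (simp add: pbasis_list prod.distrib mi_choose_def)
 qed
 have D: "mi_fst (%b. \<alpha> b - \<beta> b) = (%b. mi_fst \<alpha> b - mi_fst \<beta> b)" "mi_snd (%b. \<alpha> b - \<beta> b) = (%b. mi_snd \<alpha> b - mi_snd \<beta> b)" for \<beta>
  by (simp_all add: mi_fst_def[abs_def] mi_snd_def[abs_def])
 let ?C = "%\<alpha> \<beta> g. STFT (mono_deriv (%b. mi_fst \<alpha> b - mi_fst \<beta> b) (%b. mi_snd \<alpha> b - mi_snd \<beta> b) g)"
 have "?F^mi_deg (mi_snd \<alpha>) * of_real (monomial \<alpha> z)*STFT g f z
   = (\<Sum>\<beta>\<in>below Basis \<alpha>. of_nat (mi_choose \<alpha> \<beta>)*(-1)^(?B \<alpha> + ?B \<beta>)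
    *?C \<alpha> \<beta> g (?D \<beta> f) z)"
  using L2[OF Kfg] unfolding foldr_XD pbasis_list(2) D c[unfolded pbasis_list(2)] by (simp add: s[unfolded pbasis_list(2)])
 thus "?F^mi_deg (mi_snd \<alpha>) * of_real (monomial \<alpha> z)*STFT g f z
   = (\<Sum>\<beta> | multi_index \<beta> & \<beta> <= \<alpha>. of_nat (mi_choose \<alpha> \<beta>)*(-1)^(?B \<alpha> + ?B \<beta>)
    *?C \<alpha> \<beta> g (?D \<beta> f) z)"
  by (simp add: multi_index_below[OF \<alpha>(1)])
qed


text \<open>Orthogonality relations with a functional in place of a function. The weak inversion
  formula represents it by its Gaussian transform, Fubini brings the transform outside, and what
  remains is \<open>moyal\<close> for shifted Gaussians.\<close>

lemma functional_moyal:
 fixes f :: "'a::euclidean_space functional"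
 assumes w: "tame w" and f: "f \<in> M1_antidual w" and g: "MM w g" and h: "MM w h" and \<phi>: "MM w \<phi>"
 shows "(LBINT z. cnj (STFT g h z) * stft \<phi> f z) = cnj (bracket \<phi> g)*f h"
  and "intg (%z. cnj (STFT g h z) * stft \<phi> f z)"
proof -
 note [measurable] = tame_measurable[OF w] MM_measurable[OF g] MM_measurable[OF h] MM_measurable[OF \<phi>] stft_measurable[OF w f] stft_rep(2)[OF w f \<phi>]
 define k where "k = complex_of_real (cg TYPE('a))"
 define F where "F = stft gaussian f"
 have [measurable]: "F \<in> BM" unfolding F_def by measurable
 obtain C where C: "1 <= C" "!!z1 z2. w (z1 + z2) <= C*w z1*w z2" using tame_const[OF w] by blast
 obtain B where B: "0 <= B" "!!z. cmod (F z) <= B*w z" using antidual_stft(2)[OF w f] by (auto simp: F_def)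
 have C1: "intg (%z. cmod (STFT g f z)*w z)" if "MM w f" "MM w g" for f g
  by (rule STFT_windows_weighted[OF w]) (use that in blast)
 have n: "MM w gaussian" using MM_tf_gaussian[OF w, of 0] by simp
 let ?C = "%z x. cnj (VG (tf_shift z \<phi>) x)"
 have rep: "stft \<phi> f z = k*(LBINT x. F x*?C z x)" for z
  using stft_rep(1)[OF w f \<phi>] by (simp add: k_def F_def)
 let ?A = "%r. en (cmod (VG \<phi> r)*w r)"
 let ?E = "%g z. cnj (STFT g h z)"
 let ?B = "%g z x. en (norm (?E g z*(F x*?C z x)))"
 let ?D = "%g. (%p. cnj (STFT g h (fst p))*(F (snd p)*cnj (VG (tf_shift (fst p) \<phi>) (snd p))))"
 let ?F = "en (B*C)*(NNINT r. ?A r)"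
 let ?G = "%g z. cmod (STFT g h z)"
 let ?H = "(%r. ?A r)"
 have I: "intg (?D g)"
 proof (rule integrable_lborel_prodI)
  have "(NNINT z. (NNINT x. ?B g z x))
   <= (NNINT z. en (?G g z*w z)*?F)"
  proof (rule nn_integral_mono)
   fix z
   have "?B g z x
     <= en (?G g z)*(en (B*C*w z)*?H (x - z))" for x
   proof -
    have "cmod (F x) <= B*(C*w z*w (x - z))"
     using order_trans[OF B(2) mult_left_mono[OF C(2)[of z "x - z"] B(1)]] by simp
    hence "?G g z*(cmod (F x)*cmod (VG \<phi> (x - z))) <= ?G g z*(B*(C*w z*w (x - z))*cmod (VG \<phi> (x - z)))"
     by (intro mult_left_mono mult_right_mono) auto
    thus ?thesis
     using B(1) C(1) tameD(4)[OF w] by (simp add: norm_mult norm_STFT_tf_shift mult_ac flip: ennreal_mult)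
   qed
   hence "(NNINT x. ?B g z x)
    <= (NNINT x. en (?G g z)*(en (B*C*w z)*?H (x - z)))"
    by (intro nn_integral_mono)
   also have "... = en (?G g z)*(en (B*C*w z)*(NNINT x. ?H (x - z)))"
    by (simp add: nn_integral_cmult)
   also have "(NNINT x. ?H (x - z)) = (NNINT r. ?A r)"
    using nn_integral_lborel_shift[of "%r. ?A r" "- z"] by simp
   finally show "(NNINT x. ?B g z x)
    <= en (?G g z*w z)*?F"
    using B(1) C(1) tameD(4)[OF w] by (simp add: ennreal_mult mult_ac)
  qed
  also have "... = (NNINT z. en (?G g z*w z))*?F"
   by (rule nn_integral_multc) measurable
  also have "... < \<infinity>"
   using integrable_nn_less_top[OF C1[OF h g]] integrable_nn_less_top[OF MM_D(3)[OF \<phi>]] tameD(4)[OF w]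
   by (auto simp: ennreal_mult_less_top)
  finally show "(NNINT z. (NNINT x. en (norm (cnj (STFT g h (fst (z, x)))*(F (snd (z, x))*cnj (VG (tf_shift (fst (z, x)) \<phi>) (snd (z, x)))))))) < \<infinity>" by simp
  have [measurable]: "(%p :: ('a*'a) \<times> ('a*'a). F (snd p)) \<in> BM"
   by (rule measurable_compose[of snd borel borel F]) measurable
  have "(%p. cnj (STFT g h (fst p))*(F (snd p)*cnj (ph ((snd (fst p) - snd (snd p)) \<bullet> fst (fst p))*VG \<phi> (snd p - fst p)))) \<in> BM"
   by measurable
  thus "(?D g) \<in> BM"
   by (simp only: STFT_tf_shift[OF MM_measurable[OF \<phi>] gaussian_measurable])
 qed
 show "intg (%z. ?E g z * stft \<phi> f z)"
  using integrable_mult_right[OF Fubini_lborel(5)[OF I], of k] by (simp add: rep mult.left_commute[of "?E g z" k for z])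
 let ?I = "%x. STFT \<phi> (tf_shift x gaussian)"
 let ?J = "%g. cnj (bracket \<phi> g)"
 have "(LBINT z. ?E g z * stft \<phi> f z) = k*(LBINT z. (LBINT x. ?E g z*(F x*?C z x)))"
  by (simp add: rep mult.left_commute[of "?E g z" k for z])
 also have "... = k*(LBINT x. (LBINT z. ?E g z*(F x*?C z x)))"
  using Fubini_swap_lborel[OF I] by simp
 also have "... = k*(LBINT x. F x*(?J g*cnj (VG h x)))"
 proof -
  have "(LBINT z. ?E g z*(F x*?C z x)) = F x*(?J g*cnj (VG h x))" for x
  proof -
   have sw: "?C z x = ?I x z" for z by (simp add: STFT_def bracket_sym)
   have wx: "MM w (tf_shift x gaussian)" by (rule MM_tf_gaussian[OF w])
   note ng = nice_tf_shift[OF nice_gaussian, of x]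
   obtain B' where B': "!!z. cmod (?I x z) <= B'"
    using STFT_bound[OF nice_L2[OF ng] nice_L2[OF MM_nice[OF w \<phi>]]] by blast
   have i0: "intg (STFT g h)"
    by (rule int_dom[OF C1[OF h g]], measurable) (rule order_trans[OF _ mult_left_mono[OF tameD(2)[OF w] norm_ge_zero]], simp)
   have "intg (%z. ?I x z*?E g z)"
    by (rule int_dom[OF integrable_mult_right[OF integrable_norm[OF i0], of B']], measurable)
     (simp add: norm_mult mult_right_mono[OF B'])
   from moyal[OF nice_L2[OF ng] MM_nice[OF w \<phi>] MM_nice[OF w h] MM_nice[OF w g] this]
   show ?thesis unfolding sw by (simp add: mult_ac STFT_def bracket_sym)
  qed
  thus ?thesis by simp
 qed
 also have "... = ?J g*f h"
  using antidual_rep(2)[OF w f h] by (simp add: k_def F_def mult_ac)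
 finally show "(LBINT z. ?E g z * stft \<phi> f z) = ?J g*f h" .
qed

lemma finite_multi_index_below: "multi_index \<alpha> ==> finite {\<beta>. multi_index \<beta> & \<beta> <= (\<alpha> :: 'a::euclidean_space => nat)}"
proof -
 have "{\<beta>. multi_index \<beta> & \<beta> <= \<alpha>} \<subseteq> {\<beta>. \<forall>b. (b \<in> Basis --> \<beta> b \<in> {..Max (\<alpha> ` Basis)}) & (b \<notin> Basis --> \<beta> b = 0)}"
  by (auto simp: multi_index_def le_fun_def intro: order_trans[OF _ Max_ge])
 thus ?thesis by (rule finite_subset) (rule finite_set_of_finite_funs, auto)
qed

lemma Phi_MM:
 assumes u: "tame u" and \<phi>1: "MM (%z. u z*xj N z) \<phi>1" and \<alpha>: "multi_index \<alpha>" "mi_deg \<alpha> <= N"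
 shows "MM u (Phi \<phi>1 \<phi>3 \<phi>4 \<alpha>)"
 unfolding Phi_def[abs_def]
 by (intro MM_cmult MM_sum[OF u finite_multi_index_below[OF \<alpha>(1)]] STFT_monomial(1)[OF u \<phi>1 \<phi>1 \<alpha>]) auto

text \<open>The monomial rule is conjugated, since the kernel contains the conjugate of the
  transform; hence the powers of -2 pi i in \<open>Phi\<close>. Each term is then evaluated by
  \<open>functional_moyal\<close>, and antilinearity of f conjugates the coefficients of
  \<open>Phi\<close> in turn.\<close>

lemma Phi_integral:
 assumes u: "tame u" and f: "f \<in> M1_antidual u" and \<phi>1: "MM (%z. u z*xj N z) \<phi>1" and \<phi>4: "MM (%z. u z*xj N z) \<phi>4"
  and \<phi>3: "MM u \<phi>3" and \<alpha>: "multi_index \<alpha>" "mi_deg \<alpha> <= N"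
 shows "(LBINT z. of_real (monomial \<alpha> z)*cnj (STFT \<phi>4 \<phi>1 z) * stft \<phi>3 f z) = (-1)^mi_deg \<alpha>*f (Phi \<phi>1 \<phi>3 \<phi>4 \<alpha>)"
proof -
 define I where "I = {\<beta>. multi_index \<beta> & \<beta> <= \<alpha>}"
 define k where "k = (2 * of_real pi*\<i>)^mi_deg (mi_snd \<alpha>)"
 have k0: "k ~= 0" by (simp add: k_def)
 \<comment> \<open>The only sign not coming from multiplications: (-1) to |\<alpha>2|, which
   combines with (-1) to |\<alpha>1| to the sign of the claim.\<close>
 have ck: "cnj k = (-1)^mi_deg (mi_snd \<alpha>)*k" by (simp add: k_def power_mult_distrib[symmetric])
 define D where "D \<beta> = mono_deriv (%b. mi_fst \<alpha> b - mi_fst \<beta> b) (%b. mi_snd \<alpha> b - mi_snd \<beta> b) \<phi>4" for \<beta>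
 define E where "E \<beta> = mono_deriv (mi_fst \<beta>) (mi_snd \<beta>) \<phi>1" for \<beta>
 define c where "c \<beta> = complex_of_nat (mi_choose \<alpha> \<beta>)*(-1)^mi_deg (mi_fst \<beta>)" for \<beta>
 have E: "MM u (E \<beta>)" if "\<beta> \<in> I" for \<beta> unfolding E_def by (rule STFT_monomial(1)[OF u \<phi>1 \<phi>1 \<alpha>]) (use that in \<open>simp add: I_def\<close>)
 have D: "MM u (D \<beta>)" for \<beta>
  using STFT_monomial(1)[OF u \<phi>4 \<phi>4 \<alpha>, of "%b. \<alpha> b - \<beta> b"] by (simp add: D_def mi_fst_def[abs_def] mi_snd_def[abs_def] le_fun_def)
 let ?C = "mi_deg (mi_fst \<alpha>)"
 let ?E = "%z. of_real (monomial \<alpha> z)"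
 have mono: "?E z*cnj (STFT \<phi>4 \<phi>1 z) = (-1)^?C/cnj k*(\<Sum>\<beta>\<in>I. c \<beta>*cnj (STFT (D \<beta>) (E \<beta>) z))" for z
 proof -
  have "k*?E z*STFT \<phi>4 \<phi>1 z = (-1)^?C*(\<Sum>\<beta>\<in>I. c \<beta>*STFT (D \<beta>) (E \<beta>) z)"
   using STFT_monomial(2)[OF u \<phi>1 \<phi>4 \<alpha>, of z] by (simp add: k_def I_def D_def E_def c_def sum_distrib_left power_add mult_ac)
  from arg_cong[OF this, of cnj] show ?thesis using k0 by (simp add: field_simps c_def)
 qed
 let ?A = "%E. \<Sum>\<beta>\<in>I. c \<beta>*(cnj (bracket \<phi>3 (D \<beta>))*f (E \<beta>))"
 let ?B = "Phi \<phi>1 \<phi>3 \<phi>4 \<alpha>"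
 let ?D = "%E z. \<Sum>\<beta>\<in>I. c \<beta>*(cnj (STFT (D \<beta>) (E \<beta>) z) * stft \<phi>3 f z)"
 have "(LBINT z. ?E z*cnj (STFT \<phi>4 \<phi>1 z) * stft \<phi>3 f z)
   = (LBINT z. (-1)^?C/cnj k*(?D E z))"
  by (simp add: mono sum_distrib_right sum_distrib_left mult_ac)
 also have "... = (-1)^?C/cnj k*(?A E)"
 proof -
  have "(LBINT z. ?D E z) = (\<Sum>\<beta>\<in>I. c \<beta>*(LBINT z. cnj (STFT (D \<beta>) (E \<beta>) z) * stft \<phi>3 f z))"
   by (subst Bochner_Integration.integral_sum) (auto intro!: functional_moyal(2)[OF u f D E \<phi>3])
  also have "... = ?A E"
   by (intro sum.cong refl) (simp add: functional_moyal(1)[OF u f D E \<phi>3])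
  finally show ?thesis by simp
 qed
 also have "... = (-1)^mi_deg \<alpha>*f ?B"
 proof -
  have P: "?B = (%t. \<Sum>\<beta>\<in>I. (1/cnj k*(c \<beta>*bracket \<phi>3 (D \<beta>)))*E \<beta> t)"
   by (simp add: Phi_def fun_eq_iff I_def k_def c_def D_def E_def sum_distrib_left mult_ac)
  have "f ?B = (\<Sum>\<beta>\<in>I. cnj (1/cnj k*(c \<beta>*bracket \<phi>3 (D \<beta>)))*f (E \<beta>))"
   unfolding P by (rule antidualD(5)[OF u f]) (auto simp: I_def finite_multi_index_below[OF \<alpha>(1)] intro: E[unfolded I_def])
  hence "f ?B = 1/k*(?A E)"
   by (simp add: sum_distrib_left c_def mult_ac)
  thus ?thesis using k0 by (simp add: ck mi_deg_fst_snd[of \<alpha>] power_add field_simps)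
 qed
 finally show ?thesis .
qed

section \<open>Weak Taylor expansion\<close>

text \<open>The standard smooth function that is flat at 0; the polynomial factor makes the family
  closed under differentiation.\<close>

definition flat :: "real poly => real => real" where
 "flat p x = (if 0 < x then poly p (1/x)*exp (- 1/x) else 0)"

lemma flat_tendsto_0: "(flat p \<longlongrightarrow> 0) (at 0)"
proof -
 have "((%y. \<Sum>i\<le>degree p. coeff p i*(y^i/exp y)) \<longlongrightarrow> (\<Sum>i\<le>degree p. coeff p i*0)) at_top"
  by (intro tendsto_intros tendsto_power_div_exp_0)
 hence "((%y. poly p y*exp (- y)) \<longlongrightarrow> 0) at_top"
  by (simp add: poly_altdef sum_distrib_right exp_minus sum_divide_distrib field_simps)
 from filterlim_compose[OF this filterlim_inverse_at_top_right]
 have "((%x. poly p (inverse x)*exp (- inverse x)) \<longlongrightarrow> 0) (at_right 0)" .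
 hence "(flat p \<longlongrightarrow> 0) (at_right 0)"
  by (rule Lim_transform_eventually) (auto simp: flat_def eventually_at_right_field inverse_eq_divide intro!: exI[of _ 1])
 moreover have "(flat p \<longlongrightarrow> 0) (at_left 0)"
  by (rule Lim_transform_eventually[of "%_. 0"]) (auto simp: flat_def eventually_at_left_field intro!: exI[of _ "- 1"])
 ultimately show ?thesis by (simp add: filterlim_split_at)
qed

text \<open>In y = 1/x the derivative of p(y) exp(-y) with respect to x is y^2 (p - p')(y) exp(-y),
  whence the factor \<open>[:0, 0, 1:]\<close>.\<close>

lemma flat_deriv: "(flat p has_real_derivative flat ([:0, 0, 1:]*(p - pderiv p)) x) (at x)"
proof -
 consider "x < 0" | "x = 0" | "0 < x" by linarith
 thus ?thesis
 proof cases
  case 1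
  hence "((%_. 0) has_real_derivative flat ([:0, 0, 1:]*(p - pderiv p)) x) (at x)" by (simp add: flat_def)
  thus ?thesis
   by (rule has_field_derivative_transform_within_open[of _ _ _ "{..<0}"]) (use 1 in \<open>auto simp: flat_def\<close>)
 next
  case 2
  \<comment> \<open>At 0 the difference quotient of \<open>flat p\<close> is \<open>flat\<close> of
    the polynomial y p(y), which tends to 0.\<close>
  have "((%h. (flat p (0 + h) - flat p 0)/h) \<longlongrightarrow> 0) (at 0)"
   by (rule Lim_transform_eventually[OF flat_tendsto_0[of "[:0, 1:]*p"]]) (simp add: flat_def eventually_at_filter)
  thus ?thesis using 2 by (simp add: flat_def DERIV_def)
 next
  case 3
  have "((%x. poly p (1/x)*exp (- 1/x)) has_real_derivative flat ([:0, 0, 1:]*(p - pderiv p)) x) (at x)"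
   using 3 by (auto intro!: derivative_eq_intros poly_DERIV[THEN DERIV_chain2] simp: flat_def field_simps power2_eq_square)
  thus ?thesis
   by (rule has_field_derivative_transform_within_open[of _ _ _ "{0<..}"]) (use 3 in \<open>auto simp: flat_def\<close>)
 qed
qed

text \<open>Generated rather than defined by differentiability of all orders: the class contains the
  derivatives of its members, so smoothness follows by induction, and it is stable under
  translation.\<close>

inductive_set smooth1 :: "(real => real) set" where
 flat: "(%x. flat p (c*x + d)) \<in> smooth1"
| add: "f \<in> smooth1 ==> g \<in> smooth1 ==> (%x. f x + g x) \<in> smooth1"
| mult: "f \<in> smooth1 ==> g \<in> smooth1 ==> (%x. f x*g x) \<in> smooth1"

lemma smooth1_deriv:
 assumes "f \<in> smooth1"
 shows "\<exists>g\<in>smooth1. \<forall>x. (f has_real_derivative g x) (at x)"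
 using assms
proof induction
 case (flat p c d)
 let ?A = "%p. [:0, 0, 1:]*(p - pderiv p)"
 have "((%x. flat p (c*x + d)) has_real_derivative flat (smult c (?A p)) (c*x + d)) (at x)" for x
 proof -
  have "((%x. c*x + d) has_real_derivative c) (at x)" by (auto intro!: derivative_eq_intros)
  from DERIV_chain2[OF flat_deriv this] have "((%x. flat p (c*x + d)) has_real_derivative flat (?A p) (c*x + d)*c) (at x)" .
  also have "flat (?A p) (c*x + d)*c = flat (smult c (?A p)) (c*x + d)"
   by (simp add: flat_def)
  finally show ?thesis .
 qed
 thus ?case by (intro bexI[of _ "%x. flat (smult c (?A p)) (c*x + d)"] allI smooth1.flat)
next
 case (add f g)
 obtain f' where f': "f' \<in> smooth1" "!!x. (f has_real_derivative f' x) (at x)" using add.IH(1) by blast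
 obtain g' where g': "g' \<in> smooth1" "!!x. (g has_real_derivative g' x) (at x)" using add.IH(2) by blast
 show ?case by (rule bexI[of _ "%x. f' x + g' x"]) (intro allI DERIV_add f' g' smooth1.add)+
next
 case (mult f g)
 obtain f' where f': "f' \<in> smooth1" "!!x. (f has_real_derivative f' x) (at x)" using mult.IH(1) by blast
 obtain g' where g': "g' \<in> smooth1" "!!x. (g has_real_derivative g' x) (at x)" using mult.IH(2) by blast
 show ?case by (rule bexI[of _ "%x. f' x*g x + g' x*f x"]) (intro allI DERIV_mult f' g' smooth1.add smooth1.mult mult.hyps)+
qed

lemma smooth1_funpow:
 assumes "f \<in> smooth1"
 shows "(deriv ^^ n) f \<in> smooth1" and "((deriv ^^ n) f has_real_derivative (deriv ^^ Suc n) f x) (at x)"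
proof -
 have d: "deriv h \<in> smooth1 & (h has_real_derivative deriv h x) (at x)" if "h \<in> smooth1" for h x
 proof -
  obtain g where g: "g \<in> smooth1" "!!x. (h has_real_derivative g x) (at x)" using smooth1_deriv[of h] \<open>h \<in> smooth1\<close> by blast
  hence "deriv h = g" by (auto intro: DERIV_imp_deriv)
  with g show ?thesis by simp
 qed
 show s: "(deriv ^^ n) f \<in> smooth1" by (induction n) (simp_all add: assms d)
 show "((deriv ^^ n) f has_real_derivative (deriv ^^ Suc n) f x) (at x)" using d[OF s] by simp
qed

lemma smooth1_shift: "f \<in> smooth1 ==> (%x. f (x + s)) \<in> smooth1"
proof (induction rule: smooth1.induct)
 case (flat p c d)
 show ?case using smooth1.flat[of p c "c * s + d"] by (simp add: algebra_simps)
qed (auto intro: smooth1.intros)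

lemma funpow_deriv_shift:
 assumes "f \<in> smooth1"
 shows "(deriv ^^ n) (%x. f (x + s)) = (%x. (deriv ^^ n) f (x + s))"
proof (induction n)
 case (Suc n)
 have "((%x. (deriv ^^ n) f (x + s)) has_real_derivative (deriv ^^ Suc n) f (x + s)) (at x)" for x
  using DERIV_shift[of "(deriv ^^ n) f"] smooth1_funpow(2)[OF assms, of n "x + s"] by blast
 thus ?case by (auto simp: Suc intro: DERIV_imp_deriv)
qed simp

text \<open>One factor per coordinate. All derivatives of such a product are explicit products
  again, and translates stay in the class.\<close>

definition bump :: "('e::euclidean_space => real => real) => bool" where
 "bump r \<longleftrightarrow> (\<forall>b\<in>Basis. r b \<in> smooth1 & (\<exists>B. \<forall>x. B < \<bar>x\<bar> --> r b x = 0))"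

text \<open>The derivative \<open>\<partial>\<^sup>\<gamma>\<close> of the test function \<open>y \<mapsto> \<Prod>b\<in>Basis. r b (y \<bullet> b)\<close>.\<close>

definition pr :: "('e::euclidean_space => real => real) => ('e => nat) => 'e => complex" where
 "pr r \<gamma> y = of_real (\<Prod>b\<in>Basis. (deriv ^^ \<gamma> b) (r b) (y \<bullet> b))"

definition inc :: "'e => ('e => nat) => 'e => nat" where
 "inc b \<gamma> = \<gamma>(b := Suc (\<gamma> b))"

lemma pr_has_derivative:
 fixes r :: "'e::euclidean_space => real => real"
 assumes r: "bump r"
 shows "(pr r \<gamma> has_derivative (%v. \<Sum>b\<in>Basis. of_real (v \<bullet> b)*pr r (inc b \<gamma>) y)) (at y)"
proof -
 define h where "h b n = (deriv ^^ n) (r b)" for b n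
 let ?B = "%b y. h b (Suc (\<gamma> b)) (y \<bullet> b)"
 let ?C = "%b y. h b (\<gamma> b) (y \<bullet> b)"
 have 1: "((%y. ?C b y) has_derivative (%v. (v \<bullet> b)*?B b y)) (at y)" if "b \<in> Basis" for b
 proof -
  have "(h b (\<gamma> b) has_real_derivative h b (Suc (\<gamma> b)) (y \<bullet> b)) (at (y \<bullet> b))"
   unfolding h_def by (rule smooth1_funpow) (use r that in \<open>auto simp: bump_def\<close>)
  hence "(h b (\<gamma> b) has_derivative (*) (?B b y)) (at (y \<bullet> b))" by (simp add: has_field_derivative_def)
  from has_derivative_compose[of "%y. y \<bullet> b" "%v. v \<bullet> b" y UNIV, OF has_derivative_inner_left[OF has_derivative_ident] this] show ?thesis
   by (simp add: mult.commute)
 qed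
 let ?D = "%j b y. h j (inc b \<gamma> j) (y \<bullet> j)"
 let ?A = "%b y. \<Prod>j\<in>Basis. ?D j b y"
 have "(\<Sum>b\<in>Basis. (v \<bullet> b)*?B b y*(\<Prod>j\<in>Basis - {b}. ?C j y)) = (\<Sum>b\<in>Basis. (v \<bullet> b)*(?A b y))" for v
 proof (intro sum.cong refl)
  fix b :: 'e assume "b \<in> Basis"
  hence "(?A b y) = ?B b y*(\<Prod>j\<in>Basis - {b}. ?D j b y)"
   by (subst prod.remove[of _ b]) (auto simp: inc_def)
  also have "(\<Prod>j\<in>Basis - {b}. ?D j b y) = (\<Prod>j\<in>Basis - {b}. ?C j y)"
   by (intro prod.cong) (auto simp: inc_def)
  finally show "(v \<bullet> b)*?B b y*(\<Prod>j\<in>Basis - {b}. ?C j y) = (v \<bullet> b)*(?A b y)" by simp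
 qed
 with has_derivative_prod[of Basis "%b y. h b (\<gamma> b) (y \<bullet> b)", OF 1]
 have "((%y. \<Prod>b\<in>Basis. ?C b y) has_derivative (%v. \<Sum>b\<in>Basis. (v \<bullet> b)*(?A b y))) (at y)" by simp
 from has_derivative_of_real[OF this, where 'a=complex] show ?thesis by (simp add: pr_def[abs_def] h_def)
qed

lemma pr_partial_deriv:
 assumes r: "bump r" and b: "b \<in> Basis"
 shows "partial_deriv b (pr r \<gamma>) = pr r (inc b \<gamma>)"
 by (rule ext) (use b in \<open>simp add: partial_derivI[OF pr_has_derivative[OF r]] inner_Basis if_distrib if_distribR cong: if_cong\<close>)

lemma pr_continuous: "bump r ==> continuous_on S (pr r \<gamma>)"
 using has_derivative_continuous[OF pr_has_derivative] by (auto intro: continuous_at_imp_continuous_on)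

lemma pr_mi_deriv:
 assumes r: "bump r" and \<alpha>: "multi_index \<alpha>"
 shows "mi_deriv \<alpha> (pr r (%_. 0)) = pr r \<alpha>"
proof -
 have pow: "(partial_deriv b ^^ n) (pr r \<gamma>) = pr r (\<gamma>(b := \<gamma> b + n))" if "b \<in> Basis" for b n \<gamma>
  by (induction n) (auto simp: pr_partial_deriv[OF r that] inc_def fun_upd_def intro!: arg_cong[where f="pr r"])
 let ?A = "(%b. if b \<in> Basis then \<alpha> b else 0)"
 have "foldr (%b. partial_deriv b ^^ \<alpha> b) xs (pr r (%_. 0)) = pr r (%b. if b \<in> set xs then \<alpha> b else 0)"
  if "distinct xs" "set xs \<subseteq> Basis" for xs
  using that
 proof (induction xs)
  case (Cons b xs)
  have "(%c. if c \<in> set xs then \<alpha> c else 0)(b := \<alpha> b) = (%c. if c \<in> set (b # xs) then \<alpha> c else 0)" by auto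
  thus ?case using Cons by (simp add: pow)
 qed simp
 from this[OF basis_list(1)] have "mi_deriv \<alpha> (pr r (%_. 0)) = pr r ?A"
  by (simp add: mi_deriv_def basis_list(2))
 also have "?A = \<alpha>" using \<alpha> by (auto simp: multi_index_def)
 finally show ?thesis .
qed

lemma pr_support:
 fixes r :: "'e::euclidean_space => real => real"
 assumes r: "bump r"
 obtains R where "0 < R" "!!y \<gamma>. R < norm y ==> pr r \<gamma> y = 0"
proof -
 let ?B = "%b x. \<forall>n. (deriv ^^ n) (r b) x = 0"
 have "\<exists>B. \<forall>x. B < \<bar>x\<bar> --> (?B b x)" if "b \<in> Basis" for b
 proof -
  from r that have "\<exists>B. \<forall>x. B < \<bar>x\<bar> --> r b x = 0" by (simp add: bump_def)
  then obtain B where B: "\<forall>x. B < \<bar>x\<bar> --> r b x = 0" ..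
  have "(deriv ^^ n) (r b) x = 0" if "B < \<bar>x\<bar>" for n x
   using that
  proof (induction n arbitrary: x)
   case (Suc n)
   have o: "open {x. B < \<bar>x\<bar>}" by (intro open_Collect_less continuous_intros)
   have "((%_. 0) has_real_derivative 0) (at x)" by simp
   hence "((deriv ^^ n) (r b) has_real_derivative 0) (at x)"
    by (rule has_field_derivative_transform_within_open[OF _ o]) (use Suc in auto)
   thus ?case by (simp add: DERIV_imp_deriv)
  qed (use B in simp)
  thus ?thesis by blast
 qed
 hence "\<forall>b\<in>Basis. \<exists>B. \<forall>x. B < \<bar>x\<bar> --> (?B b x)" by (rule ballI)
 from bchoice[OF this] obtain B where B: "\<forall>b\<in>Basis. \<forall>x. B b < \<bar>x\<bar> --> (?B b x)" ..
 let ?A = "\<Sum>b\<in>Basis. \<bar>B b\<bar>"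
 show ?thesis
 proof
  show "0 < ?A + 1" by (intro add_nonneg_pos sum_nonneg) auto
  fix y :: 'e and \<gamma> assume y: "?A + 1 < norm y"
  have "\<exists>b\<in>Basis. B b < \<bar>y \<bullet> b\<bar>"
  proof (rule ccontr)
   assume "\<not> ?thesis"
   hence "(\<Sum>b\<in>Basis. \<bar>y \<bullet> b\<bar>) <= ?A" by (intro sum_mono) force
   with norm_le_l1[of y] y show False by simp
  qed
  then obtain b where b: "b \<in> Basis" "B b < \<bar>y \<bullet> b\<bar>" ..
  with B have "(deriv ^^ \<gamma> b) (r b) (y \<bullet> b) = 0" by simp
  hence "(\<Prod>b\<in>Basis. (deriv ^^ \<gamma> b) (r b) (y \<bullet> b)) = 0" using b(1) by (intro prod_zero) auto
  thus "pr r \<gamma> y = 0" by (simp add: pr_def)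
 qed
qed

lemma pr_test_function: "bump r ==> test_function (pr r \<gamma>)"
proof -
 assume r: "bump r"
 have "C_class k (pr r \<gamma>)" for k
  by (induction k arbitrary: \<gamma>) (auto simp: pr_continuous[OF r] pr_partial_deriv[OF r] intro: differentiableI[OF pr_has_derivative[OF r]])
 moreover obtain R where "!!y \<gamma>. R < norm y ==> pr r \<gamma> y = 0" by (rule pr_support[OF r]) (rule that)
 hence "\<forall>y. y \<notin> cball 0 R --> pr r \<gamma> y = 0" by auto
 ultimately show ?thesis unfolding test_function_def using compact_cball by blast
qed

lemma pr_shift:
 fixes r :: "'e::euclidean_space => real => real"
 assumes r: "bump r"
 shows "bump (%b x. r b (x - s \<bullet> b))" and "pr (%b x. r b (x - s \<bullet> b)) \<gamma> y = pr r \<gamma> (y - s)"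
proof -
 let ?A = "%b x. r b (x - s \<bullet> b)"
 show "bump (%b x. ?A b x)"
  unfolding bump_def
 proof (intro ballI conjI)
  fix b :: 'e assume b: "b \<in> Basis"
  show "(%x. ?A b x) \<in> smooth1"
   using smooth1_shift[of "r b" "- (s \<bullet> b)"] r b by (simp add: bump_def)
  from r b have "\<exists>B. \<forall>x. B < \<bar>x\<bar> --> r b x = 0" by (simp add: bump_def)
  then obtain B where B: "\<forall>x. B < \<bar>x\<bar> --> r b x = 0" ..
  show "\<exists>B. \<forall>x. B < \<bar>x\<bar> --> ?A b x = 0"
   by (rule exI[of _ "B + \<bar>s \<bullet> b\<bar>"]) (simp add: B)
 qed
 have "(deriv ^^ n) (%x. ?A b x) x = (deriv ^^ n) (r b) (x - s \<bullet> b)" if "b \<in> Basis" for b n x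
  using funpow_deriv_shift[of "r b" n "- (s \<bullet> b)"] r that by (simp add: bump_def)
 thus "pr (%b x. ?A b x) \<gamma> y = pr r \<gamma> (y - s)" by (simp add: pr_def inner_diff_left)
qed

section \<open>The fundamental lemma for product test functions\<close>

definition loc_bounded :: "('e::real_normed_vector => complex) => bool" where
 "loc_bounded h \<longleftrightarrow> h \<in> BM & (\<forall>R. \<exists>B. \<forall>y. norm y <= R --> cmod (h y) <= B)"

lemma loc_bounded_integrable:
 assumes h: "loc_bounded h" and 0: "!!y. R < norm y ==> h y = 0"
 shows "intg h"
proof -
 have [measurable]: "h \<in> BM" using h by (simp add: loc_bounded_def)
 obtain B where B: "!!y. norm y <= R ==> cmod (h y) <= B" using h unfolding loc_bounded_def by blast
 have "intg (%y. indicator (cball 0 R) y *\<^sub>R B)" by (rule integrable_indicator) (use emeasure_lborel_cball_finite[of 0 R] in simp_all)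
 thus ?thesis
 proof (rule int_bound)
  show "AEL y. cmod (h y) <= norm (indicator (cball 0 R) y *\<^sub>R B)"
   using B 0 by (auto simp: indicator_def not_le intro!: AE_I2 order_trans[OF _ abs_ge_self])
 qed simp
qed

lemma loc_bounded_mult: "loc_bounded f ==> loc_bounded g ==> loc_bounded (%y. f y*g y)"
 unfolding loc_bounded_def
proof (intro conjI allI)
 fix R assume a: "f \<in> BM & (\<forall>R. \<exists>B. \<forall>y. norm y <= R --> cmod (f y) <= B)" "g \<in> BM & (\<forall>R. \<exists>B. \<forall>y. norm y <= R --> cmod (g y) <= B)"
 then obtain A B where "!!y. norm y <= R ==> cmod (f y) <= A" "!!y. norm y <= R ==> cmod (g y) <= B" by metis
 hence "norm y <= R ==> cmod (f y*g y) <= A*B" for y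
  unfolding norm_mult by (intro mult_mono) (auto intro: order_trans[OF norm_ge_zero])
 thus "\<exists>B. \<forall>y. norm y <= R --> cmod (f y*g y) <= B" by blast
qed auto

lemma loc_bounded_continuous: "continuous_on UNIV h ==> loc_bounded (h :: 'e::euclidean_space => complex)"
 unfolding loc_bounded_def
proof (intro conjI allI BM_contI)
 fix R assume "continuous_on UNIV h"
 hence "compact (h ` cball 0 R)" by (intro compact_continuous_image compact_cball) (auto intro: continuous_on_subset)
 then obtain B where "\<forall>x\<in>h ` cball 0 R. norm x <= B" using bounded_iff compact_imp_bounded by blast
 thus "\<exists>B. \<forall>y. norm y <= R --> cmod (h y) <= B" by (intro exI[of _ B]) auto
qed

lemma integrable_pr:
 assumes h: "loc_bounded h" and r: "bump r"
 shows "intg (%y. h y*pr r \<gamma> y)"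
proof -
 obtain R where R: "!!y \<gamma>. R < norm y ==> pr r \<gamma> y = 0" by (rule pr_support[OF r]) (rule that)
 show ?thesis
  by (rule loc_bounded_integrable[OF loc_bounded_mult[OF h loc_bounded_continuous[OF pr_continuous[OF r]]], of R]) (simp add: R)
qed

text \<open>Boxes form an intersection-stable generator of the Borel sets. After restriction to a
  bounded cube the function is integrable with integral 0, so the sets of vanishing integral are
  closed under complements and disjoint unions.\<close>

lemma AE_zero_if_box_integrals_0:
 fixes h :: "'e::euclidean_space => complex"
 assumes i: "!!A B. set_integrable lborel (box A B) h" and 0: "!!A B. set_lebesgue_integral lborel (box A B) h = 0"
 shows "AEL y. h y = 0"
proof -
 let ?A = "%n. box (- (real n *\<^sub>R One)) (real n *\<^sub>R One)"
 have "AEL y. indicator (?A n) y *\<^sub>R h y = 0" for n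
 proof (rule sigma_finite_measure.density_zero[OF sigma_finite_lborel])
  define C :: "'e set" where "C = ?A n"
  let ?h = "%y. indicator C y *\<^sub>R h y"
  show hi: "intg (%y. indicator (?A n) y *\<^sub>R h y)" using i by (simp add: set_integrable_def)
  have hi: "intg ?h" using i by (simp add: set_integrable_def C_def)
  have si: "set_integrable lborel A ?h" if "A \<in> sets borel" for A unfolding set_integrable_def by (rule integrable_mult_indicator[OF _ hi]) (use that in simp)
  have tot: "(LBINT y. ?h y) = 0" using 0 by (simp add: set_lebesgue_integral_def C_def)
  fix A :: "'e set" assume "A \<in> sets lborel"
  hence A: "A \<in> sigma_sets UNIV (range (%(a, b). box a b))" by (simp add: borel_eq_box)
  have "Int_stable (range (%(a, b). box a b :: 'e set))" by (auto simp: Int_stable_def box_Int_box)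
  moreover have "range (%(a, b). box a b :: 'e set) \<subseteq> Pow UNIV" by simp
  ultimately show "set_lebesgue_integral lborel A (%y. indicator (?A n) y *\<^sub>R h y) = 0"
   using A unfolding C_def[symmetric]
  proof (induction rule: sigma_sets_induct_disjoint)
   case (basic A)
   then obtain a b where A: "A = box a b" by auto
   have "(%y. indicator A y *\<^sub>R ?h y) = (%y. indicator (A \<inter> C) y *\<^sub>R h y)" by (auto simp: indicator_def fun_eq_iff)
   thus ?case using 0 by (simp add: set_lebesgue_integral_def A C_def box_Int_box)
  next
   case (compl A)
   hence A: "A \<in> sets borel" by (simp add: borel_eq_box)
   have "(%y. indicator (UNIV - A) y *\<^sub>R ?h y) = (%y. ?h y - indicator A y *\<^sub>R ?h y)" by (auto simp: indicator_def fun_eq_iff)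
   thus ?case using si[OF A] hi tot compl.IH by (simp add: set_lebesgue_integral_def set_integrable_def)
  next
   case (union A)
   have "A i \<in> sets lborel" for i using subsetD[OF union.hyps(2) rangeI[of A i]] by (simp add: borel_eq_box)
   hence "set_lebesgue_integral lborel (\<Union>i. A i) ?h = (\<Sum>i. set_lebesgue_integral lborel (A i) ?h)"
    by (intro lebesgue_integral_countable_add si) (use union.hyps in \<open>auto simp: disjoint_family_on_def\<close>)
   thus ?case using union.IH by simp
  qed (auto simp: set_lebesgue_integral_def)
 qed
 hence "AEL y. \<forall>n. indicator (?A n) y *\<^sub>R h y = 0" unfolding AE_all_countable by (rule allI)
 thus ?thesis
 proof (rule AE_mp, intro AE_I2 impI)
  fix y :: 'e assume y: "\<forall>n. indicator (?A n) y *\<^sub>R h y = 0"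
  have "y \<in> (\<Union>n. ?A n)" unfolding UN_box_eq_UNIV by simp
  thus "h y = 0" using y by (auto simp: indicator_def)
 qed
qed

text \<open>Product bumps increase to the indicator of a box, which reduces the claim to vanishing
  box integrals.\<close>

theorem fundamental_lemma:
 fixes h :: "'e::euclidean_space => complex"
 assumes [measurable]: "h \<in> BM" and i: "!!A B. set_integrable lborel (box A B) h"
  and 0: "!!r. bump r ==> (LBINT y. h y*pr r (%_. 0) y) = 0"
 shows "AEL y. h y = 0"
proof (rule AE_zero_if_box_integrals_0[OF i])
 fix A B :: 'e
 \<comment> \<open>Each factor vanishes outside the open side of the box and lies between 0 and 1;
   inside, flat 1 (n d) = exp(-1/(n d)) tends to 1 for d > 0.\<close>
 define r where "r n b x = flat 1 (real (Suc n)*x + - real (Suc n)*(A \<bullet> b))*flat 1 (- real (Suc n)*x + real (Suc n)*(B \<bullet> b))" for n b x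
 have r0: "r n b x = 0" if "\<not> (A \<bullet> b < x & x < B \<bullet> b)" for n b x
 proof -
  have "r n b x = flat 1 (real (Suc n)*(x - A \<bullet> b))*flat 1 (real (Suc n)*(B \<bullet> b - x))"
   by (simp add: r_def right_diff_distrib del: of_nat_Suc)
  thus ?thesis using that by (auto simp: flat_def zero_less_mult_iff simp del: of_nat_Suc)
 qed
 have r: "bump (r n)" for n
  unfolding bump_def
 proof (intro ballI conjI exI allI impI)
  fix b x assume "\<bar>A \<bullet> b\<bar> + \<bar>B \<bullet> b\<bar> < \<bar>x\<bar>"
  hence "x < A \<bullet> b \<or> B \<bullet> b < x" by linarith
  thus "r n b x = 0" by (intro r0) auto
 qed (unfold r_def[abs_def], intro smooth1.intros)
 let ?A = "%n y. \<Prod>b\<in>Basis. r n b (y \<bullet> b)"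
 let ?B = "%n. pr (r n) (%_. 0)"
 have pr: "?B n y = of_real (?A n y)" for n y by (simp add: pr_def)
 have r1: "0 <= r n b x" "r n b x <= 1" for n b x
 proof -
  have "0 <= flat 1 s" "flat 1 s <= 1" for s by (auto simp: flat_def)
  thus "0 <= r n b x" "r n b x <= 1" by (auto simp: r_def intro!: mult_le_one)
 qed
 let ?C = "indicator (box A B)"
 let ?D = "%y. norm (?C y *\<^sub>R h y)"
 let ?E = "%y. (%n. h y*?B n y) ---> ?C y *\<^sub>R h y"
 have "(%n. (LBINT y. h y*?B n y)) ---> (LBINT y. ?C y *\<^sub>R h y)"
 proof (rule integral_dominated_convergence[where w="%y. ?D y"])
  show "(%y. h y*?B n y) \<in> borel_measurable lborel" for n
   using BM_contI[OF pr_continuous[OF r, of _ n]] by simp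
  show "intg (%y. ?D y)" using i[of A B] by (intro integrable_norm) (simp add: set_integrable_def)
  show "AEL y. norm (h y*?B n y) <= ?D y" for n
  proof (rule AE_I2)
   fix y
   show "norm (h y*?B n y) <= ?D y"
   proof (cases "y \<in> box A B")
    case True
    have "0 <= ?A n y" "(?A n y) <= 1" using r1 by (auto intro: prod_nonneg prod_le_1)
    hence "norm (?B n y) <= 1" unfolding pr by (simp only: norm_of_real abs_of_nonneg)
    from mult_left_mono[OF this, of "cmod (h y)"] show ?thesis using True by (simp add: norm_mult)
   next
    case False
    then obtain b where "b \<in> Basis" "r n b (y \<bullet> b) = 0" using r0 by (force simp: mem_box)
    hence "(?A n y) = 0" by auto
    thus ?thesis by (simp add: pr del: prod_zero_iff)
   qed
  qed
  show "AEL y. ?E y"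
  proof (rule AE_I2)
   fix y
   have fl: "(%n. flat 1 (real (Suc n)*d)) ---> 1" if "0 < d" for d
   proof -
    have "(%n. exp (- (1/d)*(1/real (Suc n)))) ---> exp (- (1/d)*0)"
     by (intro tendsto_intros LIMSEQ_Suc[OF lim_1_over_n])
    thus ?thesis using that by (simp add: flat_def mult.commute del: of_nat_Suc)
   qed
   show "?E y"
   proof (cases "y \<in> box A B")
    case True
    have "(%n. r n b (y \<bullet> b)) ---> 1*1" if "b \<in> Basis" for b
    proof -
     have "(%n. flat 1 (real (Suc n)*(y \<bullet> b - A \<bullet> b))*flat 1 (real (Suc n)*(B \<bullet> b - y \<bullet> b))) ---> 1*1"
      by (intro tendsto_mult fl) (use True that in \<open>auto simp: mem_box\<close>)
     thus ?thesis by (simp add: r_def right_diff_distrib del: of_nat_Suc)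
    qed
    hence "(%n. h y * of_real (?A n y)) ---> h y * of_real (\<Prod>b\<in>(Basis :: 'e set). 1*1)"
     by (intro tendsto_intros)
    thus ?thesis using True by (simp add: pr)
   next
    case False
    then obtain b where "b \<in> Basis" "!!n. r n b (y \<bullet> b) = 0" using r0 by (force simp: mem_box)
    hence "(?A n y) = 0" for n by auto
    thus ?thesis using False by (simp add: pr del: prod_zero_iff)
   qed
  qed
 qed simp
 thus "set_lebesgue_integral lborel (box A B) h = 0"
  unfolding set_lebesgue_integral_def using 0[OF r] by (simp add: LIMSEQ_const_iff)
qed

section \<open>Taylor's formula for test functions and for distributional derivatives\<close>

definition mis :: "nat => ('e::euclidean_space => nat) set" where
 "mis k = {\<alpha>. multi_index \<alpha> & mi_deg \<alpha> = k}"

lemma finite_mis: "finite (mis k :: ('e::euclidean_space => nat) set)"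
proof -
 have "mis k \<subseteq> {\<beta> :: 'e => nat. \<forall>b. (b \<in> Basis --> \<beta> b \<in> {..k}) & (b \<notin> Basis --> \<beta> b = 0)}"
  by (auto simp: mis_def multi_index_def mi_deg_def intro: member_le_sum)
 thus ?thesis by (rule finite_subset) (rule finite_set_of_finite_funs, auto)
qed

lemma mis_0: "mis 0 = {%_. 0 :: nat}"
 by (auto simp: mis_def multi_index_def mi_deg_def fun_eq_iff)

lemma inc_Basis:
 assumes b: "b \<in> Basis"
 shows "monomial (inc b \<alpha>) u = (u \<bullet> b)*monomial \<alpha> u" and "mi_fact (inc b \<alpha>) = Suc (\<alpha> b)*mi_fact \<alpha>"
  and "mi_deg (inc b \<alpha>) = Suc (mi_deg \<alpha>)"
proof -
 let ?A = "inc b \<alpha>"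
 have *: "(\<Prod>c\<in>Basis - {b}. (u \<bullet> c)^?A c) = (\<Prod>c\<in>Basis - {b}. (u \<bullet> c)^\<alpha> c)"
  "(\<Prod>c\<in>Basis - {b}. fact (?A c) :: nat) = (\<Prod>c\<in>Basis - {b}. fact (\<alpha> c))"
  "(\<Sum>c\<in>Basis - {b}. ?A c) = (\<Sum>c\<in>Basis - {b}. \<alpha> c)"
  by (auto simp: inc_def intro!: prod.cong sum.cong)
 have "?A b = Suc (\<alpha> b)" by (simp add: inc_def)
 thus "monomial ?A u = (u \<bullet> b)*monomial \<alpha> u" "mi_fact ?A = Suc (\<alpha> b)*mi_fact \<alpha>" "mi_deg ?A = Suc (mi_deg \<alpha>)"
  using b unfolding monomial_def mi_fact_def mi_deg_def
  by (simp_all add: prod.remove[of Basis b] sum.remove[of Basis b] * algebra_simps)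
qed

text \<open>The numbers k!/\<alpha>! are the coefficients in the expansion of the k-th power of the
  derivative along u. One more derivative shifts \<alpha> by a basis vector, and (k+1)!/\<alpha>! is
  the sum over b of k! \<alpha>(b)/\<alpha>! when |\<alpha>| = k + 1.\<close>

lemma multinomial_step:
 fixes G :: "('e::euclidean_space => nat) => complex"
 shows "(\<Sum>\<alpha>\<in>mis k. of_real (fact k/mi_fact \<alpha>*monomial \<alpha> u)*(\<Sum>b\<in>Basis. of_real (u \<bullet> b)*G (inc b \<alpha>)))
   = (\<Sum>\<alpha>\<in>mis (Suc k). of_real (fact (Suc k)/mi_fact \<alpha>*monomial \<alpha> u)*G \<alpha>)"
proof -
 have f0: "mi_fact \<alpha> ~= 0" for \<alpha> :: "'e => nat" by (simp add: mi_fact_def)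
 let ?A = "%k \<alpha> b. of_real (fact k*real (\<alpha> b)/mi_fact \<alpha>*monomial \<alpha> u)"
 let ?B = "%k \<alpha>. of_real (fact k/mi_fact \<alpha>*monomial \<alpha> u)"
 let ?C = "%b \<alpha>. inc b (\<alpha>(b := \<alpha> b - 1))"
 let ?F = "%b. of_real (u \<bullet> b)"
 let ?D = "%b. \<Sum>\<alpha>\<in>mis k. ?B k \<alpha>*(?F b*G (inc b \<alpha>))"
 let ?E = "%k b \<alpha>. of_real (fact k*real (inc b \<alpha> b)/mi_fact (inc b \<alpha>)*monomial (inc b \<alpha>) u)"
 have "(\<Sum>\<alpha>\<in>mis (Suc k). of_real (fact (Suc k)/mi_fact \<alpha>*monomial \<alpha> u)*G \<alpha>)
   = (\<Sum>\<alpha>\<in>mis (Suc k). \<Sum>b\<in>Basis. ?A k \<alpha> b*G \<alpha>)"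
 proof (intro sum.cong refl)
  fix \<alpha> :: "'e => nat" assume "\<alpha> \<in> mis (Suc k)"
  hence "Suc k = (\<Sum>b\<in>Basis. \<alpha> b)" by (simp add: mis_def mi_deg_def)
  hence "fact (Suc k) = (\<Sum>b\<in>Basis. fact k*real (\<alpha> b))" unfolding fact_Suc by (simp add: sum_distrib_left mult.commute)
  thus "of_real (fact (Suc k)/mi_fact \<alpha>*monomial \<alpha> u)*G \<alpha> = (\<Sum>b\<in>Basis. ?A k \<alpha> b*G \<alpha>)"
   by (simp only: sum_distrib_right sum_divide_distrib of_real_sum)
 qed
 also have "... = (\<Sum>b\<in>Basis. \<Sum>\<alpha>\<in>mis (Suc k). ?A k \<alpha> b*G \<alpha>)"
  by (rule sum.swap)
 also have "... = (\<Sum>b\<in>Basis. \<Sum>\<alpha>\<in>mis k. ?B k \<alpha>*(?F b*G (inc b \<alpha>)))"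
 proof (rule sum.cong[OF refl])
  fix b :: 'e assume b: "b \<in> Basis"
  have "(\<Sum>\<alpha>\<in>mis (Suc k). ?A k \<alpha> b*G \<alpha>)
    = (\<Sum>\<alpha>\<in>{\<alpha>\<in>mis (Suc k). 0 < \<alpha> b}. ?A k \<alpha> b*G \<alpha>)"
   by (rule sum.mono_neutral_right) (auto simp: finite_mis)
  also have "... = (\<Sum>\<alpha>\<in>mis k. ?E k b \<alpha>*G (inc b \<alpha>))"
  proof (rule sum.reindex_bij_witness[where i="inc b" and j="%\<alpha>. \<alpha>(b := \<alpha> b - 1)"])
   fix \<alpha> :: "'e => nat" assume a: "\<alpha> \<in> {\<alpha> \<in> mis (Suc k). 0 < \<alpha> b}"
   thus e: "?C b \<alpha> = \<alpha>" by (auto simp: inc_def)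
   have "mi_deg \<alpha> = Suc (mi_deg (\<alpha>(b := \<alpha> b - 1)))"
    using inc_Basis(3)[OF b, of "\<alpha>(b := \<alpha> b - 1)"] unfolding e .
   with a show "\<alpha>(b := \<alpha> b - 1) \<in> mis k" by (auto simp: mis_def multi_index_def)
   show "of_real (fact k*real (?C b \<alpha> b)/mi_fact (?C b \<alpha>)*monomial (?C b \<alpha>) u)*G (?C b \<alpha>) = ?A k \<alpha> b*G \<alpha>"
    unfolding e ..
  next
   fix \<alpha> :: "'e => nat" assume "\<alpha> \<in> mis k"
   thus "inc b \<alpha> \<in> {\<alpha> \<in> mis (Suc k). 0 < \<alpha> b}" "(inc b \<alpha>)(b := inc b \<alpha> b - 1) = \<alpha>"
    using b by (auto simp: mis_def inc_Basis(3)[OF b]) (auto simp: inc_def multi_index_def)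
  qed
  also have "... = ?D b"
  proof (intro sum.cong refl)
   fix \<alpha> :: "'e => nat"
   have "fact k*real (inc b \<alpha> b)/mi_fact (inc b \<alpha>)*monomial (inc b \<alpha>) u = fact k/mi_fact \<alpha>*monomial \<alpha> u*(u \<bullet> b)"
   proof -
    have "inc b \<alpha> b = Suc (\<alpha> b)" by (simp add: inc_def)
    thus ?thesis using f0[of \<alpha>] unfolding inc_Basis[OF b] of_nat_mult by (simp del: of_nat_Suc)
   qed
   thus "?E k b \<alpha>*G (inc b \<alpha>) = ?B k \<alpha>*(?F b*G (inc b \<alpha>))"
    by (simp only: of_real_mult mult.assoc)
  qed
  finally show "(\<Sum>\<alpha>\<in>mis (Suc k). ?A k \<alpha> b*G \<alpha>) = ?D b" .
 qed
 also have "... = (\<Sum>\<alpha>\<in>mis k. ?B k \<alpha>*(\<Sum>b\<in>Basis. ?F b*G (inc b \<alpha>)))"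
  by (subst sum.swap) (simp add: sum_distrib_left)
 finally show ?thesis by simp
qed

text \<open>The one-variable formula with integral remainder for t -> pr(y - t u), taken from t = 0
  to t = 1; the signs stem from the direction -u.\<close>

lemma pr_Taylor:
 assumes r: "bump r" and N: "0 < N"
 shows "pr r (%_. 0) (y - u) = (\<Sum>k<N. \<Sum>\<alpha>\<in>mis k. of_real ((- 1)^k*monomial \<alpha> u/mi_fact \<alpha>)*pr r \<alpha> y)
   + of_nat N*(\<Sum>\<alpha>\<in>mis N. of_real ((- 1)^N*monomial \<alpha> u/mi_fact \<alpha>)*(LBINT t. indicator {0..1} t *\<^sub>R (of_real ((1 - t)^(N - 1))*pr r \<alpha> (y - t *\<^sub>R u))))"
proof -
 let ?C = "%t R. y - t *\<^sub>R u"
 \<comment> \<open>\<open>H k\<close> is the k-th derivative along the segment, written out by the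
   multinomial expansion.\<close>
 define H where "H k t = (- 1)^k*(\<Sum>\<alpha>\<in>mis k. of_real (fact k/mi_fact \<alpha>*monomial \<alpha> u)*pr r \<alpha> (?C t R))" for k and t :: real
 have H: "(H k has_vector_derivative H (Suc k) t) (at t within S)" for k t S
 proof -
  have "((%t. pr r \<alpha> (?C t R)) has_derivative (%s. \<Sum>b\<in>Basis. of_real (- (s *\<^sub>R u) \<bullet> b)*pr r (inc b \<alpha>) (?C t R))) (at t within S)" for \<alpha>
   by (rule has_derivative_compose[OF _ pr_has_derivative[OF r]]) (auto intro!: derivative_eq_intros)
  hence "((%t. pr r \<alpha> (?C t R)) has_vector_derivative - (\<Sum>b\<in>Basis. of_real (u \<bullet> b)*pr r (inc b \<alpha>) (?C t R))) (at t within S)" for \<alpha>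
   by (simp add: has_vector_derivative_def scaleR_conv_of_real sum_distrib_left sum_negf mult.assoc)
  hence "(H k has_vector_derivative (- 1)^k*(\<Sum>\<alpha>\<in>mis k. of_real (fact k/mi_fact \<alpha>*monomial \<alpha> u)*- (\<Sum>b\<in>Basis. of_real (u \<bullet> b)*pr r (inc b \<alpha>) (?C t R)))) (at t within S)"
   unfolding H_def[abs_def] by (intro has_vector_derivative_mult_right has_vector_derivative_sum)
  thus ?thesis
   using multinomial_step[of k u "%\<alpha>. pr r \<alpha> (?C t R)"] by (simp only: H_def power_Suc mult_minus_left mult_minus_right sum_negf mult_1)
 qed
 let ?R = "%t. ((1 - t)^(N - 1)/fact (N - 1)) *\<^sub>R H N t"
 let ?D = "%k \<alpha>. (- 1)^k*monomial \<alpha> u/mi_fact \<alpha>"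
 have "(?R has_integral H 0 1 - (\<Sum>k<N. ((1 - 0)^k/fact k) *\<^sub>R H k 0)) {0..1}"
  by (rule Taylor_has_integral[OF N refl]) (auto intro: H)
 moreover have "integral {0..1} ?R = (LBINT t. indicator {0..1} t *\<^sub>R ?R t)"
 proof -
  have "continuous_on {0..1} ?R"
   unfolding H_def by (intro continuous_intros continuous_on_compose2[OF pr_continuous[OF r]]) auto
  hence "set_integrable lborel {0..1} ?R" by (rule borel_integrable_atLeastAtMost')
  from set_borel_integral_eq_integral(2)[OF this] show ?thesis by (simp add: set_lebesgue_integral_def)
 qed
 ultimately have "H 0 1 = (\<Sum>k<N. (1/fact k) *\<^sub>R H k 0) + (LBINT t. indicator {0..1} t *\<^sub>R ?R t)"
  by (simp add: integral_unique algebra_simps)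
 moreover have "H 0 1 = pr r (%_. 0) (y - u)" by (simp add: H_def mis_0 mi_fact_def monomial_def)
 moreover have "(1/fact k) *\<^sub>R H k 0 = (\<Sum>\<alpha>\<in>mis k. of_real (?D k \<alpha>)*pr r \<alpha> y)" for k
  by (simp add: H_def scaleR_conv_of_real sum_distrib_left mult.assoc)
 moreover have "(LBINT t. indicator {0..1} t *\<^sub>R ?R t) = of_nat N*(\<Sum>\<alpha>\<in>mis N. of_real (?D N \<alpha>)*(LBINT t. indicator {0..1} t *\<^sub>R (of_real ((1 - t)^(N - 1))*pr r \<alpha> (?C t R))))"
 proof -
  define I where "I \<alpha> t = indicator {0..1} t *\<^sub>R (of_real ((1 - t)^(N - 1))*pr r \<alpha> (?C t R))" for \<alpha> and t :: real
  define c where "c \<alpha> = complex_of_real (?D N \<alpha>)" for \<alpha>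
  have i: "intg (I \<alpha>)" for \<alpha>
   unfolding I_def
   by (rule borel_integrable_atLeastAtMost'[unfolded set_integrable_def])
     (auto intro!: continuous_intros continuous_on_compose2[OF pr_continuous[OF r]])
  have fN: "fact N/fact (N - 1) = real N" using N by (simp add: fact_reduce)
  have "indicator {0..1} t *\<^sub>R ?R t = of_nat N*(\<Sum>\<alpha>\<in>mis N. c \<alpha>*I \<alpha> t)" for t
  proof -
   have "indicator {0..1} t *\<^sub>R ?R t = (\<Sum>\<alpha>\<in>mis N. of_real (fact N/fact (N - 1))*(c \<alpha>*I \<alpha> t))"
    by (simp add: H_def I_def c_def scaleR_conv_of_real sum_distrib_left mult_ac)
   thus ?thesis unfolding fN by (simp add: sum_distrib_left)
  qed
  moreover have "(LBINT t. of_nat N*(\<Sum>\<alpha>\<in>mis N. c \<alpha>*I \<alpha> t)) = of_nat N*(\<Sum>\<alpha>\<in>mis N. c \<alpha>*(LBINT t. I \<alpha> t))"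
   using i by (simp add: Bochner_Integration.integral_sum)
  ultimately show ?thesis by (simp only: I_def c_def)
 qed
 ultimately show ?thesis by simp
qed

text \<open>Tested with a bump, translating the function by u means translating the bump by -u,
  where the smooth formula applies; \<open>dd\<close> carries every derivative back, with a sign
  that cancels the one in \<open>pr_Taylor\<close>. The null set in the conclusion depends on
  u.\<close>

lemma weak_Taylor:
 fixes D :: "('e::euclidean_space => nat) => 'e => complex"
 assumes N: "0 < N" and D: "!!\<alpha>. loc_bounded (D \<alpha>)"
  and dd: "!!r \<alpha>. bump r ==> multi_index \<alpha> ==> mi_deg \<alpha> <= N ==>
   (LBINT y. D \<alpha> y*pr r (%_. 0) y) = (- 1)^mi_deg \<alpha>*(LBINT y. D (%_. 0) y*pr r \<alpha> y)"
 shows "AEL y. D (%_. 0) (y + u) = (\<Sum>k<N. \<Sum>\<alpha>\<in>mis k. of_real (monomial \<alpha> u/mi_fact \<alpha>)*D \<alpha> y)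
   + of_nat N*(\<Sum>\<alpha>\<in>mis N. of_real (monomial \<alpha> u/mi_fact \<alpha>)*(LBINT t. indicator {0..1} t *\<^sub>R (of_real ((1 - t)^(N - 1))*D \<alpha> (y + t *\<^sub>R u))))"
proof -
 define D0 where "D0 = D (%_. 0)"
 define c where "c \<alpha> = complex_of_real (monomial \<alpha> u/mi_fact \<alpha>)" for \<alpha>
 have [measurable]: "D \<alpha> \<in> BM" for \<alpha> using D by (simp add: loc_bounded_def)
 have lb0: "loc_bounded (%y. D \<alpha> (y + s))" for \<alpha> s
 proof -
  have "\<exists>B. \<forall>y. norm y <= R --> cmod (D \<alpha> (y + s)) <= B" for R
  proof -
   obtain B where B: "!!y. norm y <= R + norm s ==> cmod (D \<alpha> y) <= B" using D[of \<alpha>] unfolding loc_bounded_def by blast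
   show ?thesis by (rule exI[of _ B]) (auto intro!: B order_trans[OF norm_triangle_ineq])
  qed
  thus ?thesis by (simp add: loc_bounded_def)
 qed
 let ?E = "%t N. of_real ((1 - t)^(N - 1))"
 define J where "J \<alpha> y = (LBINT t. indicator {0..1} t *\<^sub>R (?E t N*D \<alpha> (y + t *\<^sub>R u)))" for \<alpha> y
 \<comment> \<open>The counterpart of \<open>J\<close> on the side of the test function: the segment
   average against the function equals the opposite segment average against the bump.\<close>
 define P where "P r \<alpha> y = (LBINT t. indicator {0..1} t *\<^sub>R (?E t N*pr r \<alpha> (y - t *\<^sub>R u)))" for r \<alpha> y
 have tu: "norm (t *\<^sub>R u) <= norm u" if "t \<in> {0..1}" for t using that by (simp add: mult_left_le_one_le)
 have pw: "cmod (?E t N*x) <= cmod x" if "t \<in> {0..1}" for t :: real and x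
  unfolding norm_mult norm_of_real using that by (intro mult_left_le_one_le) (auto simp: power_abs intro: power_le_one)
 have J: "loc_bounded (J \<alpha>)" for \<alpha>
  unfolding loc_bounded_def
 proof (intro conjI allI)
  show "J \<alpha> \<in> BM" unfolding J_def[abs_def] by measurable
  fix R
  obtain B where B: "!!y. norm y <= R + norm u ==> cmod (D \<alpha> y) <= B" using D[of \<alpha>] unfolding loc_bounded_def by blast
  have "cmod (J \<alpha> y) <= (LBINT t. indicator {0..1} (t :: real) *\<^sub>R \<bar>B\<bar>)" if y: "norm y <= R" for y
  proof -
   have le: "norm (indicator {0..1} t *\<^sub>R (?E t N*D \<alpha> (y + t *\<^sub>R u))) <= indicator {0..1} t *\<^sub>R \<bar>B\<bar>" for t :: real
   proof (cases "t \<in> {0..1}")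
    case True
    have "cmod (D \<alpha> (y + t *\<^sub>R u)) <= B" using tu[OF True] y by (intro B norm_triangle_le) simp
    thus ?thesis using True order_trans[OF pw[OF True]] by (auto intro: order_trans[OF _ abs_ge_self])
   qed simp
   show ?thesis unfolding J_def
  proof (rule order_trans[OF integral_norm_bound], rule Bochner_Integration.integral_mono)
   show i: "intg (%t :: real. indicator {0..1} t *\<^sub>R \<bar>B\<bar>)" by (rule integrable_indicator) simp_all
   show "intg (%t. norm (indicator {0..1} t *\<^sub>R (?E t N*D \<alpha> (y + t *\<^sub>R u))))"
    by (rule int_dom[OF i], measurable) (simp only: real_norm_def abs_norm_cancel le)
  qed (rule le)
  qed
  thus "\<exists>B. \<forall>y. norm y <= R --> cmod (J \<alpha> y) <= B" by blast
 qed
 define h where "h y = D0 (y + u) - ((\<Sum>k<N. \<Sum>\<alpha>\<in>mis k. c \<alpha>*D \<alpha> y) + of_nat N*(\<Sum>\<alpha>\<in>mis N. c \<alpha>*J \<alpha> y))" for y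
 have D0u: "loc_bounded (%y. D0 (y + u))" unfolding D0_def by (rule lb0)
 have [measurable]: "J \<alpha> \<in> BM" "D0 \<in> BM" for \<alpha>
  using J by (simp_all add: D0_def loc_bounded_def)
 have [measurable]: "h \<in> BM" unfolding h_def[abs_def] by measurable
 let ?A = "%r. pr r (%_. 0)"
 let ?B = "%p s' R. fst p - (s' * snd p) *\<^sub>R u"
 let ?C = "%p s R. fst p + (s * snd p) *\<^sub>R u"
 let ?D = "%A B. indicator (box A B)"
 have "AEL y. h y = 0"
 proof (rule fundamental_lemma)
  show "set_integrable lborel (box A B) h" for A B
  proof -
   have "bounded (box A B)" by simp
   then obtain R where R: "!!y. y \<in> box A B ==> norm y <= R" by (auto simp: bounded_iff)
   have i: "intg (%y. ?D A B y *\<^sub>R g y)" if "loc_bounded g" for g :: "'e => complex"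
   proof -
    have "loc_bounded (%y. ?D A B y*g y)"
    proof (rule loc_bounded_mult[OF _ that])
     show "loc_bounded (?D A B :: 'e => complex)" by (auto simp: loc_bounded_def indicator_def intro!: exI[of _ 1])
    qed
    hence "intg (%y. ?D A B y*g y)"
     by (rule loc_bounded_integrable[where R=R]) (use R in \<open>force simp: indicator_def\<close>)
    also have "(%y. ?D A B y*g y) = (%y. ?D A B y *\<^sub>R g y)" by (auto simp: indicator_def)
    finally show ?thesis .
   qed
   have eq: "(%y. ?D A B y *\<^sub>R h y) = (%y. ?D A B y *\<^sub>R D0 (y + u) - ((\<Sum>k<N. \<Sum>\<alpha>\<in>mis k. c \<alpha>*(?D A B y *\<^sub>R D \<alpha> y)) + of_nat N*(\<Sum>\<alpha>\<in>mis N. c \<alpha>*(?D A B y *\<^sub>R J \<alpha> y))))"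
    by (auto simp: h_def indicator_def fun_eq_iff)
   show ?thesis unfolding set_integrable_def eq
    by (intro Bochner_Integration.integrable_diff Bochner_Integration.integrable_add Bochner_Integration.integrable_sum integrable_mult_right i[OF D0u] i[OF D] i[OF J])
  qed
  fix r :: "'e => real => real" assume r: "bump r"
  obtain R where R: "0 < R" "!!y \<gamma>. R < norm y ==> pr r \<gamma> y = 0" by (rule pr_support[OF r]) (rule that)
  have prm [measurable]: "pr r \<gamma> \<in> BM" for \<gamma> by (intro BM_contI pr_continuous r)
  have shift: "(LBINT y. D \<alpha> (y + s)*pr r \<gamma> y) = (LBINT y. D \<alpha> y*pr r \<gamma> (y - s))" for \<alpha> \<gamma> s
   using integral_lborel_shift[of "%y. D \<alpha> y*pr r \<gamma> (y - s)" s] by (simp add: add.commute)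
  have dds: "(LBINT y. D \<alpha> (y + s)*?A r y) = (- 1)^mi_deg \<alpha>*(LBINT y. D0 y*pr r \<alpha> (y - s))"
   if "multi_index \<alpha>" "mi_deg \<alpha> <= N" for \<alpha> s
   using dd[OF pr_shift(1)[OF r] that, of s] by (simp add: shift pr_shift(2)[OF r] D0_def)
  have JP: "(LBINT y. J \<alpha> y*?A r y) = (- 1)^N*(LBINT y. D0 y*P r \<alpha> y)" (is ?JP)
   and PI: "intg (%y. D0 y*P r \<alpha> y)" (is ?PI) if \<alpha>: "\<alpha> \<in> mis N" for \<alpha>
  proof -
   define \<kappa> where "\<kappa> t = indicator {0..1} t*complex_of_real ((1 - t)^(N - 1))" for t :: real
   have [measurable]: "\<kappa> \<in> BM" unfolding \<kappa>_def[abs_def] by measurable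
   have b: "cmod (\<kappa> t*x) <= cmod x" for t x using pw[of t x] by (simp add: indicator_def \<kappa>_def)
   \<comment> \<open>The parameters s and s' cover both positions of the translation, on the
     function (s = 1, s' = 0) and on the bump (s = 0, s' = 1), with one integrability proof.\<close>
   have I: "intg (%p. \<kappa> (snd p)*(D \<beta> (?C p s R)*pr r \<gamma> (?B p s' R)))" if "\<bar>s\<bar> <= 1" "\<bar>s'\<bar> <= 1" for \<beta> \<gamma> s s'
   proof (rule loc_bounded_integrable[where R="R + norm u + 1"])
    have sm: "norm ((s*t) *\<^sub>R u) <= norm u" if "t \<in> {0..1}" "\<bar>s\<bar> <= 1" for s t
     using that mult_left_le_one_le[of "norm u" "\<bar>s\<bar>*t"] mult_le_one[of "\<bar>s\<bar>" t] by (simp add: abs_mult)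
    have ind: "\<kappa> t = 0" if "t \<notin> {0..1}" for t using that by (simp add: \<kappa>_def)
    show "\<kappa> (snd p)*(D \<beta> (?C p s R)*pr r \<gamma> (?B p s' R)) = 0" if "R + norm u + 1 < norm p" for p
    proof (cases "snd p \<in> {0..1}")
     case True
     have "norm p <= norm (fst p) + norm (snd p)" using norm_Pair_le[of "fst p" "snd p"] by simp
     moreover have "norm (fst p) <= norm (?B p s' R) + norm u"
      using norm_triangle_ineq[of "fst p - (s' * snd p) *\<^sub>R u" "(s' * snd p) *\<^sub>R u"] sm[OF True \<open>\<bar>s'\<bar> <= 1\<close>] by simp
     ultimately have "R < norm (?B p s' R)" using True that by simp
     thus ?thesis by (simp add: R(2))
    qed (simp add: ind)
    show "loc_bounded (%p. \<kappa> (snd p)*(D \<beta> (?C p s R)*pr r \<gamma> (?B p s' R)))"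
     unfolding loc_bounded_def
    proof (intro conjI allI)
     have [measurable]: "(%p :: 'e \<times> real. fst p + (s * snd p) *\<^sub>R u) \<in> BM" "(%p :: 'e \<times> real. fst p - (s' * snd p) *\<^sub>R u) \<in> BM" by measurable
     have [measurable]: "(%p :: 'e \<times> real. \<kappa> (snd p)) \<in> BM" by (rule measurable_compose[of snd borel borel \<kappa>]) measurable
     have [measurable]: "(%p :: 'e \<times> real. D \<beta> (?C p s R)) \<in> BM"
      by (rule measurable_compose[of _ borel borel "D \<beta>"]) measurable
     have [measurable]: "(%p :: 'e \<times> real. pr r \<gamma> (?B p s' R)) \<in> BM"
      by (rule measurable_compose[of _ borel borel "pr r \<gamma>"]) measurable
     show "(%p. \<kappa> (snd p)*(D \<beta> (?C p s R)*pr r \<gamma> (?B p s' R))) \<in> BM" by measurable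
     fix R'
     obtain B where B: "!!y. norm y <= R' + norm u ==> cmod (D \<beta> y) <= B" using D[of \<beta>] unfolding loc_bounded_def by blast
     obtain B' where B': "!!y. norm y <= R' + norm u ==> cmod (pr r \<gamma> y) <= B'"
      using loc_bounded_continuous[OF pr_continuous[OF r, of _ \<gamma>]] unfolding loc_bounded_def by blast
     have "cmod (\<kappa> (snd p)*(D \<beta> (?C p s R)*pr r \<gamma> (?B p s' R))) <= \<bar>B\<bar>*\<bar>B'\<bar>" if p: "norm p <= R'" for p
     proof (cases "snd p \<in> {0..1}")
      case True
      have "norm (fst p) <= R'" using norm_fst_le[of "fst p" "snd p"] p by simp
      hence "cmod (D \<beta> (?C p s R)) <= B" "cmod (pr r \<gamma> (?B p s' R)) <= B'"
       using sm[OF True \<open>\<bar>s\<bar> <= 1\<close>] sm[OF True \<open>\<bar>s'\<bar> <= 1\<close>] by (auto intro!: B B' norm_triangle_le norm_triangle_le_diff)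
      hence "cmod (D \<beta> (?C p s R)*pr r \<gamma> (?B p s' R)) <= \<bar>B\<bar>*\<bar>B'\<bar>"
       unfolding norm_mult by (intro mult_mono) auto
      thus ?thesis using order_trans[OF b] by simp
     qed (simp add: ind)
     thus "\<exists>B. \<forall>p. norm p <= R' --> cmod (\<kappa> (snd p)*(D \<beta> (?C p s R)*pr r \<gamma> (?B p s' R))) <= B" by blast
    qed
   qed
   have e: "indicator {0..1} t *\<^sub>R (?E t N*x) = \<kappa> t*x" for t :: real and x :: complex by (simp add: indicator_def \<kappa>_def)
   note IJ = I[of 1 0 \<alpha> "%_. 0", simplified] and IP = I[of 0 1 "%_. 0" \<alpha>, simplified, folded D0_def]
   have DP: "(LBINT t. \<kappa> t*(D0 y*pr r \<alpha> (y - t *\<^sub>R u))) = D0 y*P r \<alpha> y" for y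
    unfolding P_def e by (simp add: mult.left_commute[of _ "D0 y"])
   show ?PI using Fubini_lborel(5)[OF IP] by (simp add: DP)
   have "(LBINT y. J \<alpha> y*?A r y) = (LBINT y. (LBINT t. \<kappa> t*(D \<alpha> (y + t *\<^sub>R u)*?A r y)))"
    unfolding J_def e by (simp flip: integral_mult_left_zero mult.assoc)
   also have "... = (LBINT t. (LBINT y. \<kappa> t*(D \<alpha> (y + t *\<^sub>R u)*?A r y)))"
    using Fubini_swap_lborel[OF IJ] by simp
   also have "... = (LBINT t. (- 1)^N*(LBINT y. \<kappa> t*(D0 y*pr r \<alpha> (y - t *\<^sub>R u))))"
    using \<alpha> by (simp add: dds mis_def mult.left_commute[of _ "(- 1)^N"])
   also have "... = (- 1)^N*(LBINT y. (LBINT t. \<kappa> t*(D0 y*pr r \<alpha> (y - t *\<^sub>R u))))"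
    using Fubini_swap_lborel[OF IP] by simp
   also have "... = (- 1)^N*(LBINT y. D0 y*P r \<alpha> y)"
    by (simp add: DP)
   finally show ?JP .
  qed
  note i = integrable_pr[OF D0u r] integrable_pr[OF D r] integrable_pr[OF J r]
  have D0: "loc_bounded D0" unfolding D0_def by (rule D)
  have "(LBINT y. h y*?A r y) = (LBINT y. D0 (y + u)*?A r y - ((\<Sum>k<N. \<Sum>\<alpha>\<in>mis k. c \<alpha>*(D \<alpha> y*?A r y)) + of_nat N*(\<Sum>\<alpha>\<in>mis N. c \<alpha>*(J \<alpha> y*?A r y))))"
   by (simp add: h_def left_diff_distrib distrib_right sum_distrib_right mult.assoc)
  also have "... = (LBINT y. D0 (y + u)*?A r y) - ((\<Sum>k<N. \<Sum>\<alpha>\<in>mis k. c \<alpha>*(LBINT y. D \<alpha> y*?A r y)) + of_nat N*(\<Sum>\<alpha>\<in>mis N. c \<alpha>*(LBINT y. J \<alpha> y*?A r y)))"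
   using i by (simp add: Bochner_Integration.integral_sum)
  also have "... = (LBINT y. D0 y*?A r (y - u)) - ((\<Sum>k<N. \<Sum>\<alpha>\<in>mis k. c \<alpha>*((- 1)^k*(LBINT y. D0 y*pr r \<alpha> y))) + of_nat N*(\<Sum>\<alpha>\<in>mis N. c \<alpha>*((- 1)^N*(LBINT y. D0 y*P r \<alpha> y))))"
   using shift[of "%_. 0" u] dd[OF r] by (simp add: JP mis_def D0_def)
  also have "... = (LBINT y. D0 y*?A r (y - u) - ((\<Sum>k<N. \<Sum>\<alpha>\<in>mis k. c \<alpha>*((- 1)^k*(D0 y*pr r \<alpha> y))) + of_nat N*(\<Sum>\<alpha>\<in>mis N. c \<alpha>*((- 1)^N*(D0 y*P r \<alpha> y)))))"
   using integrable_pr[OF D0 r] PI integrable_pr[OF D0 pr_shift(1)[OF r], of u] by (simp add: Bochner_Integration.integral_sum pr_shift(2)[OF r])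
  also have "... = (LBINT (y :: 'e). 0)"
   by (intro Bochner_Integration.integral_cong refl)
     (simp add: pr_Taylor[OF r N] P_def c_def sum_distrib_left distrib_left mult_ac)
  finally show "(LBINT y. h y*?A r y) = 0" by simp
 qed measurable
 thus ?thesis by (simp add: h_def D0_def c_def J_def)
qed

text \<open>The bridge from the Lebesgue integrals in the definitions to \<open>lborel\<close>
  integrals of Borel representatives.\<close>

lemma integral_lebesgue_AE:
 fixes f g :: "'e::euclidean_space => 'b::{banach, second_countable_topology}"
 assumes g: "g \<in> BM" and eq: "AEL x. f x = g x"
 shows "(LINT x|lebesgue. f x) = (LBINT x. g x)"
proof -
 have "(LINT x|lebesgue. f x) = (LINT x|lebesgue. g x)"
 proof (rule integral_cong_AE)
  show "f \<in> borel_measurable lebesgue" by (rule borel_measurable_AE[OF g eq])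
  show "g \<in> borel_measurable lebesgue" by (rule measurable_completion) (use g in simp)
  show "AE x in lebesgue. f x = g x" using eq by (rule AE_completion)
 qed
 also have "... = (LBINT x. g x)" by (rule integral_completion) (use g in simp)
 finally show ?thesis .
qed

section \<open>Expansion of the product\<close>

text \<open>The density in the relative variable u = z - y; the conjugated transform is the bracket
  of the (y + u)-shifted \<phi>4 with the y-shifted \<phi>1.\<close>

definition Qk :: "('a::euclidean_space => complex) => ('a => complex) => ('a => complex) => ('a*'a => 'a*'a => complex) => 'a functional => 'a*'a => complex" where
 "Qk \<phi>1 \<phi>3 \<phi>4 \<sigma> f y = (LBINT u. \<sigma> y u*(cnj (STFT \<phi>4 (tf_shift y \<phi>1) (y + u)) * stft \<phi>3 f (y + u)))"

text \<open>The convolution of the kernel majorant with the price of changing the window of f from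
  \<phi>3 to the Gaussian.\<close>

definition Hk :: "('a::euclidean_space => complex) => ('a => complex) => ('a => complex) => ('a*'a => real) => 'a*'a => ennreal" where
 "Hk \<phi>1 \<phi>3 \<phi>4 S r = (NNINT u. en (S u*cmod (STFT \<phi>4 \<phi>1 u))*en (cg TYPE('a)*cmod (VG \<phi>3 (r - u))))"

context modulation
begin

text \<open>First the window change bounds the transform of f at y + u by a correlation; then
  Tonelli merges the two successive correlations into the single kernel \<open>Hk\<close>.\<close>

lemma Qk_bound:
 assumes f: "f \<in> M1_antidual w" and \<phi>3: "MM w \<phi>3"
  and [measurable]: "\<phi>1 \<in> BM" "\<phi>4 \<in> BM" "S \<in> BM"
  and S: "!!u. cmod (\<sigma> y u) <= S u"
 shows "(NNINT u. en (norm (\<sigma> y u*(cnj (STFT \<phi>4 (tf_shift y \<phi>1) (y + u)) * stft \<phi>3 f (y + u))))) <= corr (Hk \<phi>1 \<phi>3 \<phi>4 S) (absF f) y"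
  and "en (cmod (Qk \<phi>1 \<phi>3 \<phi>4 \<sigma> f y)) <= corr (Hk \<phi>1 \<phi>3 \<phi>4 S) (absF f) y"
proof -
 note [measurable] = absF_meas[OF f] stft_rep(2)[OF w f \<phi>3] MM_measurable[OF \<phi>3]
 define k where "k u = en (S u*cmod (STFT \<phi>4 \<phi>1 u))" for u
 define h where "h x = en (cg TYPE('a)*cmod (VG \<phi>3 x))" for x
 have [measurable]: "k \<in> BM" "h \<in> BM" unfolding k_def h_def by measurable
 have S0: "0 <= S u" for u using S order_trans[OF norm_ge_zero] by blast
 let ?A = "%u. en (norm (\<sigma> y u*(cnj (STFT \<phi>4 (tf_shift y \<phi>1) (y + u)) * stft \<phi>3 f (y + u))))"
 let ?B = "%S. corr (Hk \<phi>1 \<phi>3 \<phi>4 S) (absF f) y"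
 let ?C = "%u. corr h (absF f) (y + u)"
 have "(NNINT u. ?A u)
  <= (NNINT u. k u*?C u)"
 proof (rule nn_integral_mono)
  fix u
  have "?A u <= k u*en (cmod (stft \<phi>3 f (y + u)))"
   using mult_right_mono[OF S[of u], of "cmod (STFT \<phi>4 \<phi>1 u)*cmod (stft \<phi>3 f (y + u))"] S0[of u]
   by (simp add: k_def norm_mult norm_STFT_tf_shift mult.assoc flip: ennreal_mult)
  also have "... <= k u*?C u"
   unfolding h_def by (intro mult_left_mono stft_rep(3)[OF w f \<phi>3]) simp
  finally show "?A u <= k u*?C u" .
 qed
 also have "... = (NNINT u. (NNINT r. k u*(h (r - u)*absF f (y + r))))"
 proof (rule nn_integral_cong)
  fix u
  have "?C u = (NNINT r. h (r - u)*absF f (y + r))"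
   using nn_integral_lborel_shift[of "%r. h (r - u)*absF f (y + r)" u] by (simp add: corr_def add.assoc)
  thus "k u*?C u = (NNINT r. k u*(h (r - u)*absF f (y + r)))"
   by (simp add: nn_integral_cmult)
 qed
 also have "... = (NNINT r. (NNINT u. k u*(h (r - u)*absF f (y + r))))"
 proof -
  have [measurable]: "(%p :: ('a*'a) \<times> ('a*'a). k (fst p)) \<in> BM" by (rule measurable_compose[of fst borel borel k]) measurable
  have [measurable]: "(%p :: ('a*'a) \<times> ('a*'a). h (snd p - fst p)) \<in> BM" by (rule measurable_compose[of _ borel borel h]) measurable
  have [measurable]: "(%p :: ('a*'a) \<times> ('a*'a). absF f (y + snd p)) \<in> BM" by (rule measurable_compose[of _ borel borel "absF f"]) measurable
  have "(%p. k (fst p)*(h (snd p - fst p)*absF f (y + snd p))) \<in> BM" by measurable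
  from nn_integral_fst_lborel[OF this] nn_integral_snd_lborel[OF this] show ?thesis by simp
 qed
 also have "... = ?B S"
  unfolding corr_def Hk_def k_def[symmetric] h_def[symmetric]
  by (simp add: nn_integral_multc flip: mult.assoc)
 finally show "(NNINT u. ?A u) <= ?B S" .
 thus "en (cmod (Qk \<phi>1 \<phi>3 \<phi>4 \<sigma> f y)) <= ?B S"
  unfolding Qk_def by (rule order_trans[OF integral_norm_le_nn])
qed

lemma Hk_measurable:
 assumes [measurable]: "\<phi>1 \<in> BM" "\<phi>3 \<in> BM" "\<phi>4 \<in> BM" "S \<in> BM"
 shows "Hk \<phi>1 \<phi>3 \<phi>4 S \<in> BM"
 unfolding Hk_def by measurable

text \<open>The constant does not depend on S, which matters for compactness, where S runs through a
  sequence of shrinking majorants.\<close>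

lemma Hk_wint:
 assumes \<phi>3: "MM w \<phi>3" and [measurable]: "\<phi>1 \<in> BM" "\<phi>4 \<in> BM"
 obtains c where "0 <= c" "!!S. S \<in> BM ==> wint (Hk \<phi>1 \<phi>3 \<phi>4 S) <= en c*(NNINT u. en (S u*cmod (STFT \<phi>4 \<phi>1 u)*w u))"
proof -
 note [measurable] = MM_measurable[OF \<phi>3]
 obtain C where C: "1 <= C" "!!z1 z2. w (z1 + z2) <= C*w z1*w z2" using tame_const[OF w] by blast
 define d where "d = cg TYPE('a)*(LBINT z. cmod (VG \<phi>3 z)*w z)"
 have d: "(NNINT x. en (cg TYPE('a)*cmod (VG \<phi>3 x))*en (w x)) = en d"
  using nn_integral_eq_integral[OF integrable_mult_right[OF MM_D(3)[OF \<phi>3], of "cg TYPE('a)"]] w_nonneg less_imp_le[OF cg_pos[where 'a='a]]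
  by (simp add: d_def ennreal_mult mult.assoc)
 have d0: "0 <= d" unfolding d_def using w_nonneg less_imp_le[OF cg_pos[where 'a='a]] by (intro mult_nonneg_nonneg Bochner_Integration.integral_nonneg) auto
 have C0: "0 <= C" using C by simp
 let ?A = "%u. cmod (STFT \<phi>4 \<phi>1 u)"
 have "wint (Hk \<phi>1 \<phi>3 \<phi>4 S) <= en (C*d)*(NNINT u. en (S u*?A u*w u))" if [measurable]: "S \<in> BM" for S
 proof -
  have "wint (Hk \<phi>1 \<phi>3 \<phi>4 S) <= en C*(NNINT z. en (S z*?A z)*en (w z))*en d"
   unfolding Hk_def d[symmetric] by (rule conv_weight[OF _ _ w_meas C(2) w_nonneg C0]) measurable
  also have "(NNINT z. en (S z*?A z)*en (w z)) = (NNINT u. en (S u*?A u*w u))"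
   by (intro nn_integral_cong) (simp add: ennreal_mult'' w_nonneg)
  finally show ?thesis using C0 d0 by (simp add: ennreal_mult mult_ac)
 qed
 with C0 d0 show ?thesis by (intro that[of "C*d"]) auto
qed

lemma kernel_op_Qk:
 assumes \<phi>2: "MM w \<phi>2" and \<phi>3: "MM w \<phi>3" and m [measurable]: "\<phi>1 \<in> BM" "\<phi>4 \<in> BM" "S \<in> BM"
  and \<sigma>: "(%p. \<sigma> (fst p) (snd p)) \<in> BM" and S: "!!y u. cmod (\<sigma> y u) <= S u"
  and fin: "(NNINT u. en (S u*cmod (STFT \<phi>4 \<phi>1 u)*w u)) < \<infinity>"
  and T: "!!f g. f \<in> M1_antidual w ==> MM w g ==> T f g = (LBINT y. Qk \<phi>1 \<phi>3 \<phi>4 \<sigma> f y*cnj (STFT \<phi>2 g y))"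
 shows "kernel_op \<phi>2 (Qk \<phi>1 \<phi>3 \<phi>4 \<sigma>) (Hk \<phi>1 \<phi>3 \<phi>4 S) T"
  and "f \<in> M1_antidual w ==> intg (%u. \<sigma> y u*(cnj (STFT \<phi>4 (tf_shift y \<phi>1) (y + u)) * stft \<phi>3 f (y + u)))"
proof -
 note [measurable] = MM_measurable[OF \<phi>3] \<sigma>
 let ?C = "Hk \<phi>1 \<phi>3 \<phi>4"
 let ?E = "STFT \<phi>4 \<phi>1"
 obtain c where c: "0 <= c" "!!S. S \<in> BM ==> wint (?C S) <= en c*(NNINT u. en (S u*cmod (?E u)*w u))"
  by (rule Hk_wint[OF \<phi>3 m(1,2)]) (rule that)
 have Hfin: "wint (?C S) < \<infinity>"
  by (rule le_less_trans[OF c(2)]) (use fin in \<open>auto simp: ennreal_mult_less_top\<close>)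
 have Hm [measurable]: "?C S \<in> BM" by (rule Hk_measurable) measurable
 let ?D = "%p. STFT \<phi>4 (tf_shift (fst p) \<phi>1) (fst p + snd p)"
 have meas: "(%p. \<sigma> (fst p) (snd p)*(cnj (?D p) * stft \<phi>3 f (fst p + snd p))) \<in> BM"
  if f: "f \<in> M1_antidual w" for f
 proof -
  note [measurable] = stft_rep(2)[OF w f \<phi>3]
  have [measurable]: "(%p :: ('a*'a) \<times> ('a*'a). stft \<phi>3 f (fst p + snd p)) \<in> BM" by (rule measurable_compose[of _ borel borel "stft \<phi>3 f"]) measurable
  have [measurable]: "(%p :: ('a*'a) \<times> ('a*'a). ?E (snd p)) \<in> BM" by (rule measurable_compose[of _ borel borel "?E"]) measurable
  have "(%p :: ('a*'a) \<times> ('a*'a). ?D p) = (%p. ph ((snd (fst p) - snd (fst p + snd p)) \<bullet> fst (fst p))*?E (snd p))"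
   by (simp add: STFT_tf_shift fun_eq_iff)
  also have "... \<in> BM" by measurable
  finally have [measurable]: "(%p :: ('a*'a) \<times> ('a*'a). ?D p) \<in> BM" .
  show ?thesis by measurable
 qed
 let ?A = "%y u f. cnj (STFT \<phi>4 (tf_shift y \<phi>1) (y + u)) * stft \<phi>3 f (y + u)"
 show int: "intg (%u. \<sigma> y u*(?A y u f))" if f: "f \<in> M1_antidual w" for f y
 proof -
  obtain k where k: "0 <= k" "!!z. absF f z <= en (k*w z)" by (rule absF_bound[OF f]) (rule that)
  obtain C where C: "1 <= C" "!!z1 z2. w (z1 + z2) <= C*w z1*w z2" using tame_const[OF w] by blast
  have C0: "0 <= C" using C by simp
  have m: "(%u. \<sigma> y u*(?A y u f)) \<in> BM"
   using measurable_compose[OF _ meas[OF f], of "%u. (y, u)" borel] by simp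
  have "(NNINT u. en (norm (\<sigma> y u*(?A y u f)))) <= corr (?C S) (absF f) y"
   by (rule Qk_bound(1)[OF f \<phi>3 _ _ _ S]) measurable
  also have "... <= en (k*C)*wint (?C S)*en (w y)"
   by (rule corr_weight_bound[OF w C0 C(2) k(1) Hm k(2)])
  also have "... < \<infinity>" using Hfin by (simp add: ennreal_mult_less_top)
  finally show ?thesis using m by (simp add: integrable_iff_bounded)
 qed
 let ?B = "Qk \<phi>1 \<phi>3 \<phi>4 \<sigma>"
 show "kernel_op \<phi>2 ?B (?C S) T"
  unfolding kernel_op_def
 proof (intro conjI ballI allI impI)
  fix f assume f: "f \<in> M1_antidual w"
  have "(%x. (LBINT u. case_prod (%y u. \<sigma> y u*(?A y u f)) (x, u))) \<in> borel_measurable lborel"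
   by (rule lborel.borel_measurable_lebesgue_integral) (subst measurable_cong_sets[OF sets_lborel_pair refl], use meas[OF f] in \<open>simp add: case_prod_unfold\<close>)
  thus "?B f \<in> BM" by (simp add: Qk_def[abs_def])
  show "en (cmod (?B f y)) <= corr (?C S) (absF f) y" for y
   by (rule Qk_bound(2)[OF f \<phi>3 _ _ _ S]) measurable
  show "T f g = (LBINT y. ?B f y*cnj (STFT \<phi>2 g y))" if "MM w g" for g by (rule T[OF f that])
  fix g c y assume g: "g \<in> M1_antidual w"
  have "?B (%k. c*f k + g k) y = (LBINT u. c*(\<sigma> y u*(?A y u f)) + \<sigma> y u*(?A y u g))"
   unfolding Qk_def stft_def by (simp add: algebra_simps)
  thus "?B (%k. c*f k + g k) y = c*?B f y + ?B g y"
   unfolding Qk_def using int[OF f, of y] int[OF g, of y] by simp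
 qed (fact \<phi>2 Hm Hfin)+
qed

end

lemma abs_monomial_le:
 fixes u :: "'a::euclidean_space \<times> 'a"
 assumes "mi_deg \<alpha> <= N"
 shows "\<bar>monomial \<alpha> u\<bar> <= xj N u"
proof -
 have *: "\<bar>\<Prod>b\<in>Basis. (x \<bullet> b)^\<gamma> b\<bar> <= jbracket x^N" if "mi_deg \<gamma> <= N" for \<gamma> and x :: 'a
 proof -
  have "\<bar>\<Prod>b\<in>Basis. (x \<bullet> b)^\<gamma> b\<bar> = (\<Prod>b\<in>Basis. \<bar>x \<bullet> b\<bar>^\<gamma> b)" by (simp add: abs_prod power_abs)
  also have "... <= (\<Prod>b\<in>Basis. jbracket x^\<gamma> b)"
   by (intro prod_mono conjI power_mono) (auto intro: order_trans[OF Basis_le_norm norm_le_jbracket])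
  also have "... = jbracket x^mi_deg \<gamma>" by (simp add: mi_deg_def power_sum)
  also have "... <= jbracket x^N" using that by (intro power_increasing jbracket_ge_1)
  finally show ?thesis .
 qed
 have "\<bar>monomial \<alpha> u\<bar> = \<bar>\<Prod>b\<in>Basis. (fst u \<bullet> b)^mi_fst \<alpha> b\<bar>*\<bar>\<Prod>b\<in>Basis. (snd u \<bullet> b)^mi_snd \<alpha> b\<bar>"
  by (simp add: monomial_def prod_Basis_prod mi_fst_def mi_snd_def inner_prod_def abs_mult)
 also have "... <= xj N u" unfolding xj_def using assms mi_deg_fst_snd[of \<alpha>] by (intro mult_mono *) auto
 finally show ?thesis .
qed

lemma mi_fact_ge_1: "1 <= mi_fact \<alpha>"
 unfolding mi_fact_def by (intro prod_ge_1) simp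

lemma N1_tf_shift:
 assumes w: "tame w" and C: "0 <= C" "!!z1 z2. w (z1 + z2) <= C*w z1*w z2" and g: "MM w g"
 shows "N1 w (tf_shift y g) <= C*w y*N1 w g"
proof -
 note [measurable] = MM_measurable[OF g] tame_measurable[OF w]
 have i: "intg (%z. cmod (VG (tf_shift y g) z)*w z)" by (rule MM_D(3)[OF MM_tf_shift[OF w g]])
 have "N1 w (tf_shift y g) = (LBINT z. cmod (VG g z)*w (y + z))"
  using integral_lborel_shift[of "%z. cmod (VG (tf_shift y g) z)*w z" y] by (simp add: N1_def norm_STFT_tf_shift)
 also have "... <= (LBINT z. C*w y*(cmod (VG g z)*w z))"
 proof (rule Bochner_Integration.integral_mono)
  show "intg (%z. cmod (VG g z)*w (y + z))"
   using integrable_lborel_shift[OF i, of y] by (simp add: norm_STFT_tf_shift)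
  show "intg (%z. C*w y*(cmod (VG g z)*w z))" by (rule integrable_mult_right[OF MM_D(3)[OF g]])
  show "cmod (VG g z)*w (y + z) <= C*w y*(cmod (VG g z)*w z)" for z
   using mult_left_mono[OF C(2)[of y z], of "cmod (VG g z)"] by (simp add: mult_ac)
 qed
 also have "... = C*w y*N1 w g" by (simp add: N1_def)
 finally show ?thesis .
qed

lemma antidual_tf_shift:
 assumes w: "tame w" and f: "f \<in> M1_antidual w"
 shows "(%g. f (tf_shift y g)) \<in> M1_antidual w"
proof -
 obtain C where C: "1 <= C" "!!z1 z2. w (z1 + z2) <= C*w z1*w z2" using tame_const[OF w] by blast
 have C0: "0 <= C" using C by simp
 obtain B where B: "0 <= B" "!!g. MM w g ==> cmod (f g) <= B*N1 w g" using antidualD(6)[OF w f] by blast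
 show ?thesis
 proof (rule antidualI[OF w])
  show "f (tf_shift y (%t. c*g t + h t)) = cnj c*f (tf_shift y g) + f (tf_shift y h)" if "MM w g" "MM w h" for g h c
   unfolding tf_shift_add_fun tf_shift_scale by (rule antidualD(1)[OF w f]) (intro MM_tf_shift w that)+
  show "0 <= B*(C*w y)" using B(1) C0 tameD(4)[OF w] by simp
  show "cmod (f (tf_shift y g)) <= B*(C*w y)*N1 w g" if g: "MM w g" for g
   using order_trans[OF B(2)[OF MM_tf_shift[OF w g]] mult_left_mono[OF N1_tf_shift[OF w C0 C(2) g] B(1)]] by (simp add: mult.assoc)
 qed
qed

text \<open>\<open>A\<close> and \<open>D\<close> stand for Borel representatives of a and of the
  derivatives of b. One constant B serves all of them, and the bounds hold at every point rather
  than almost everywhere, so kernel estimates need no exceptional sets.\<close>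

locale expansion = modulation w \<mu> \<mu>' K p q
 for w \<mu> \<mu>' :: "'a::euclidean_space \<times> 'a => real" and K p q +
 fixes v m' :: "'a*'a => real" and K' B Cv :: real and N :: nat and \<phi>1 \<phi>2 \<phi>3 \<phi>4 :: "'a => complex"
  and A :: "'a*'a => complex" and D :: "('a*'a => nat) => 'a*'a => complex"
 assumes v: "tame v" and Cv: "0 <= Cv" and vint: "!!u. (LBINT t. indicator {0..1} t * v (t *\<^sub>R u)) <= Cv * v u"
  and m'_meas [measurable]: "m' \<in> BM" and m'_pos: "!!z. 0 < m' z" and K': "1 <= K'"
  and m'_mod: "!!z1 z2. m' (z1 + z2) <= K' * v z1*m' z2" and N: "1 <= N"
  and \<phi>1: "MM (%z. v z*w z*xj N z) \<phi>1" and \<phi>4: "MM (%z. v z*w z*xj N z) \<phi>4" and \<phi>2: "MM w \<phi>2" and \<phi>3: "MM w \<phi>3"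
  and A_meas [measurable]: "A \<in> BM" and D_meas [measurable]: "!!\<alpha>. D \<alpha> \<in> BM"
  and B: "0 <= B" and A: "!!z. cmod (A z) <= B*m' z" and D: "!!\<alpha> z. cmod (D \<alpha> z) <= B/m' z"
begin

definition J :: "('a*'a => nat) => 'a*'a => 'a*'a => complex" where
 "J \<alpha> y u = (LBINT t. indicator {0..1} t *\<^sub>R (of_real ((1 - t)^(N - 1))*D \<alpha> (y + t *\<^sub>R u)))"

definition tk :: "'a*'a => 'a*'a => complex" where
 "tk y u = of_nat N*(\<Sum>\<alpha>\<in>mis N. of_real (monomial \<alpha> u/mi_fact \<alpha>)*J \<alpha> y u)"

text \<open>The kernels of the composition, of a single localization term (here) below, and of the
  remainder; they differ only in how the symbol b enters.\<close>

definition \<sigma>c where "\<sigma>c y u = A y*D (%_. 0) (y + u)"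
definition \<sigma>l where "\<sigma>l \<alpha> y u = A y*D \<alpha> y * of_real (monomial \<alpha> u)"
definition \<sigma>r where "\<sigma>r y u = A y*tk y u"
text \<open>Large enough for all three kernels: the summand 1 covers the composition and the single
  terms, the other one the remainder, where N and the number of top multi-indices count summands and
  Cv pays for averaging v over a segment.\<close>

definition c0 where "c0 = B*B*K'*(1 + real N*card (mis N :: ('a*'a => nat) set)*Cv)"
definition S where "S u = c0*(v u*xj N u)"

lemma c0_nonneg: "0 <= c0" unfolding c0_def using B K' Cv by simp

lemma c0_ge: "B*B*K' <= c0"
 unfolding c0_def using mult_left_mono[of 1 "1 + real N*card (mis N :: ('a*'a => nat) set)*Cv" "B*B*K'"] B K' Cv by simp

lemma v_nonneg: "0 <= v z" by (rule tameD(4)[OF v])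

lemma xj_ge_1: "1 <= xj N z" by (rule tameD(2)[OF tame_xj])

text \<open>The ratio m' y / m' (y + s) is at most K'*v s by moderation. The factor \<open>e\<close>
  is carried along for use where the derivative is known to be small.\<close>

lemma AD:
 assumes D': "cmod (D \<alpha> (y + s)) <= e*(B/m' (y + s))" and e: "0 <= e"
 shows "cmod (A y*D \<alpha> (y + s)) <= e*(B*B*K' * v s)"
proof -
 have "m' (- s + (y + s)) <= K' * v (- s)*m' (y + s)" by (rule m'_mod)
 hence "m' y/m' (y + s) <= K' * v s" using m'_pos[of "y + s"] by (simp add: tameD(5)[OF v] divide_le_eq)
 hence "(B*(e*B))*(m' y/m' (y + s)) <= (B*(e*B))*(K' * v s)" using B e by (intro mult_left_mono) auto
 moreover have "cmod (A y)*cmod (D \<alpha> (y + s)) <= (B*m' y)*(e*(B/m' (y + s)))"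
  by (intro mult_mono A D') (use B less_imp_le[OF m'_pos] in auto)
 ultimately show ?thesis by (simp add: norm_mult mult_ac)
qed

lemma v_line: "intg (%t. indicator {0..1} t * v (t *\<^sub>R u))"
proof -
 have "continuous_on {0..1} (%t. v (t *\<^sub>R u))"
  by (rule continuous_on_compose2[OF tameD(1)[OF v]]) (auto intro!: continuous_intros)
 from borel_integrable_atLeastAtMost'[OF this] show ?thesis by (simp add: set_integrable_def)
qed

text \<open>Here the integral condition on v enters: along the segment the kernel is bounded by v (t
  u), and its average over t is at most a multiple of v u. Smallness \<open>e\<close> of the
  derivatives on the segment passes to the whole kernel.\<close>

lemma \<sigma>r_bound:
 assumes D': "!!\<alpha> t. \<alpha> \<in> mis N ==> t \<in> {0..1} ==> cmod (D \<alpha> (y + t *\<^sub>R u)) <= e*(B/m' (y + t *\<^sub>R u))" and e: "0 <= e"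
 shows "cmod (\<sigma>r y u) <= e*S u"
proof -
 define c where "c = B*B*K'*Cv"
 have c: "0 <= c" unfolding c_def using B K' Cv by simp
 have AJ: "cmod (A y*J \<alpha> y u) <= e*c * v u" if \<alpha>: "\<alpha> \<in> mis N" for \<alpha>
 proof -
  have "A y*J \<alpha> y u = (LBINT t. indicator {0..1} t *\<^sub>R (of_real ((1 - t)^(N - 1))*(A y*D \<alpha> (y + t *\<^sub>R u))))"
   unfolding J_def by (simp add: mult.left_commute[of "A y"] flip: integral_mult_right_zero)
  hence "cmod (A y*J \<alpha> y u) <= (LBINT t. norm (indicator {0..1} t *\<^sub>R (of_real ((1 - t)^(N - 1))*(A y*D \<alpha> (y + t *\<^sub>R u)))))"
   by (simp only: integral_norm_bound)
  also have "... <= (LBINT t. e*(B*B*K')*(indicator {0..1} t * v (t *\<^sub>R u)))"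
  proof (rule Bochner_Integration.integral_mono')
   show "norm (indicator {0..1} t *\<^sub>R (of_real ((1 - t)^(N - 1))*(A y*D \<alpha> (y + t *\<^sub>R u)))) <= e*(B*B*K')*(indicator {0..1} t * v (t *\<^sub>R u))" for t :: real
   proof (cases "t \<in> {0..1}")
    case True
    have "\<bar>(1 - t)^(N - 1)\<bar> <= 1" using True by (simp add: power_abs power_le_one)
    hence "\<bar>(1 - t)^(N - 1)\<bar>*cmod (A y*D \<alpha> (y + t *\<^sub>R u)) <= 1*(e*(B*B*K' * v (t *\<^sub>R u)))"
     by (intro mult_mono AD D' \<alpha> True e) auto
    thus ?thesis using True by (simp only: norm_mult norm_scaleR norm_of_real) (simp add: mult_ac)
   qed simp
  qed (use v_line B K' e v_nonneg in auto)
  also have "... <= e*(B*B*K')*(Cv * v u)" using mult_left_mono[OF vint[of u], of "e*(B*B*K')"] B K' e by simp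
  finally show ?thesis by (simp add: c_def mult_ac)
 qed
 have mon: "\<bar>monomial \<alpha> u/mi_fact \<alpha>\<bar> <= xj N u" if "\<alpha> \<in> mis N" for \<alpha>
 proof -
  have "\<bar>monomial \<alpha> u\<bar>/real (mi_fact \<alpha>) <= \<bar>monomial \<alpha> u\<bar>/1"
   using mi_fact_ge_1[of \<alpha>] by (intro divide_left_mono) auto
  also have "... <= xj N u" using abs_monomial_le[of \<alpha> N u] that by (simp add: mis_def)
  finally show ?thesis by simp
 qed
 let ?A = "\<Sum>\<alpha>\<in>mis N. of_real (monomial \<alpha> u/mi_fact \<alpha>)*(A y*J \<alpha> y u)"
 have "\<sigma>r y u = of_nat N*?A"
  by (simp add: \<sigma>r_def tk_def sum_distrib_left mult_ac)
 hence "cmod (\<sigma>r y u) = real N*cmod ?A" by (simp add: norm_mult)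
 also have "... <= real N*(\<Sum>\<alpha>\<in>(mis N :: ('a*'a => nat) set). xj N u*(e*c * v u))"
  unfolding norm_of_real by (intro mult_left_mono sum_norm_le) (auto simp only: norm_mult norm_of_real intro!: mult_mono mon AJ[unfolded norm_mult] order_trans[OF zero_le_one xj_ge_1] mult_nonneg_nonneg norm_ge_zero)
 also have "... = e*(B*B*K'*(real N*card (mis N :: ('a*'a => nat) set)*Cv))*(v u*xj N u)" by (simp add: c_def mult_ac)
 also have "... <= e*S u"
  unfolding S_def mult.assoc[of e] c0_def using B K' e v_nonneg[of u] xj_ge_1[of u]
  by (intro mult_left_mono mult_right_mono) auto
 finally show ?thesis .
qed

lemma S_bounds: "cmod (\<sigma>c y u) <= S u" "\<alpha> \<in> mis k ==> k <= N ==> cmod (\<sigma>l \<alpha> y u) <= S u" "cmod (\<sigma>r y u) <= S u"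
proof -
 have "cmod (\<sigma>c y u) <= 1*(B*B*K' * v u)" unfolding \<sigma>c_def by (rule AD) (use D in auto)
 also have "... <= c0 * v u*1" using c0_ge v_nonneg[of u] by (simp add: mult_right_mono)
 also have "... <= c0 * v u*xj N u" by (intro mult_left_mono xj_ge_1 mult_nonneg_nonneg c0_nonneg v_nonneg)
 finally show "cmod (\<sigma>c y u) <= S u" by (simp add: S_def mult.assoc)
 show "cmod (\<sigma>r y u) <= S u" using \<sigma>r_bound[of y u 1] D by simp
 assume a: "\<alpha> \<in> mis k" "k <= N"
 have "cmod (A y*D \<alpha> y) <= (B*m' y)*(B/m' y)" unfolding norm_mult by (intro mult_mono A D) (use B less_imp_le[OF m'_pos] in auto)
 also have "... = B*B*1" using m'_pos[of y] by simp
 also have "... <= B*B*K'" using B K' by (intro mult_left_mono) auto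
 also have "... <= c0*1" using c0_ge by simp
 also have "... <= c0 * v u" using c0_nonneg tameD(2)[OF v] by (intro mult_left_mono)
 finally have "cmod (A y*D \<alpha> y)*\<bar>monomial \<alpha> u\<bar> <= (c0 * v u)*xj N u"
  using a abs_monomial_le[of \<alpha> N u] c0_nonneg v_nonneg by (intro mult_mono) (auto simp: mis_def)
 thus "cmod (\<sigma>l \<alpha> y u) <= S u" by (simp add: \<sigma>l_def S_def norm_mult mult.assoc)
qed

lemma window_measurable [measurable]: "\<phi>1 \<in> BM" "\<phi>2 \<in> BM" "\<phi>3 \<in> BM" "\<phi>4 \<in> BM"
 by (rule MM_measurable[OF \<phi>1] MM_measurable[OF \<phi>2] MM_measurable[OF \<phi>3] MM_measurable[OF \<phi>4])+

lemma S_measurable [measurable]: "S \<in> BM"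
 unfolding S_def[abs_def] using tame_measurable[OF v] tame_measurable[OF tame_xj[of N]] by measurable

text \<open>The place where the stronger hypothesis on \<phi>1 and \<phi>4 is used: v and the
  polynomial in the majorant, together with w, make up exactly their weight.\<close>

lemma S_integrable: "intg (%u. S u*cmod (STFT \<phi>4 \<phi>1 u)*w u)"
proof -
 have t: "tame (%z. v z*w z*xj N z)" by (intro tame_mult v w tame_xj)
 have "intg (%z. cmod (STFT \<phi>4 \<phi>1 z)*(v z*w z*xj N z))"
  by (rule STFT_windows_weighted[OF t]) (use \<phi>1 \<phi>4 in blast)
 hence "intg (%z. c0*(cmod (STFT \<phi>4 \<phi>1 z)*(v z*w z*xj N z)))" by (rule integrable_mult_right)
 thus ?thesis by (simp add: S_def mult_ac)
qed

lemma S_nonneg: "0 <= S u" using S_bounds(1) order_trans[OF norm_ge_zero] by blast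

lemma S_finite: "(NNINT u. en (S u*cmod (STFT \<phi>4 \<phi>1 u)*w u)) < \<infinity>"
 using integrable_nn_less_top[OF S_integrable] S_nonneg w_nonneg by simp

lemma monomial_measurable [measurable]: "(%u. monomial \<alpha> (u :: 'a*'a)) \<in> BM"
 unfolding monomial_def by measurable

lemma pair_measurable:
 fixes h :: "'a*'a => 'b::topological_space"
 assumes h: "h \<in> BM" and g: "continuous_on UNIV (g :: ('a*'a) \<times> ('a*'a) => 'a*'a)"
 shows "(%p. h (g p)) \<in> BM"
 using BM_contI[OF g] h by (rule measurable_compose)

lemma \<sigma>_measurable:
 "(%p. \<sigma>c (fst p) (snd p)) \<in> BM" "(%p. \<sigma>l \<alpha> (fst p) (snd p)) \<in> BM" "(%p. \<sigma>r (fst p) (snd p)) \<in> BM"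
proof -
 have cf: "continuous_on UNIV (%p :: ('a*'a) \<times> ('a*'a). fst p)" "continuous_on UNIV (%p :: ('a*'a) \<times> ('a*'a). snd p)" "continuous_on UNIV (%p :: ('a*'a) \<times> ('a*'a). fst p + snd p)"
  by (intro continuous_intros)+
 note [measurable] = pair_measurable[OF A_meas cf(1)] pair_measurable[OF D_meas cf(3)] pair_measurable[OF D_meas cf(1)]
  pair_measurable[OF monomial_measurable cf(2)]
 show "(%p. \<sigma>c (fst p) (snd p)) \<in> BM" "(%p. \<sigma>l \<alpha> (fst p) (snd p)) \<in> BM"
  unfolding \<sigma>c_def \<sigma>l_def by measurable
 have [measurable]: "(%p. J \<alpha> (fst p) (snd p)) \<in> BM" for \<alpha>
 proof -
  have "(%(p, t). indicator {0..1} t *\<^sub>R (of_real ((1 - t)^(N - 1))*D \<alpha> (fst p + t *\<^sub>R snd p))) \<in> borel_measurable (borel \<Otimes>\<^sub>M lborel)"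
   by measurable
  thus ?thesis unfolding J_def by (rule lborel.borel_measurable_lebesgue_integral)
 qed
 show "(%p. \<sigma>r (fst p) (snd p)) \<in> BM"
  unfolding \<sigma>r_def tk_def by measurable
qed

abbreviation "QK \<equiv> Qk \<phi>1 \<phi>3 \<phi>4"

lemma kernel_ops:
 assumes T: "!!f g. f \<in> M1_antidual w ==> MM w g ==> T f g = (LBINT y. QK \<sigma> f y*cnj (STFT \<phi>2 g y))"
  and \<sigma>: "\<sigma> = \<sigma>c \<or> \<sigma> = \<sigma>r \<or> (\<exists>k\<le>N. \<exists>\<alpha>\<in>mis k. \<sigma> = \<sigma>l \<alpha>)"
 shows "kernel_op \<phi>2 (QK \<sigma>) (Hk \<phi>1 \<phi>3 \<phi>4 S) T"
  and "f \<in> M1_antidual w ==> intg (%u. \<sigma> y u*(cnj (STFT \<phi>4 (tf_shift y \<phi>1) (y + u)) * stft \<phi>3 f (y + u)))"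
proof -
 have 1: "(%p. \<sigma> (fst p) (snd p)) \<in> BM" using \<sigma> \<sigma>_measurable by auto
 have 2: "cmod (\<sigma> y u) <= S u" for y u using \<sigma> by (elim disjE bexE exE conjE) (simp_all add: S_bounds)
 show "kernel_op \<phi>2 (QK \<sigma>) (Hk \<phi>1 \<phi>3 \<phi>4 S) T"
  by (rule kernel_op_Qk(1)[OF \<phi>2 \<phi>3 _ _ _ 1 2 S_finite T]) measurable
 show "f \<in> M1_antidual w ==> intg (%u. \<sigma> y u*(cnj (STFT \<phi>4 (tf_shift y \<phi>1) (y + u)) * stft \<phi>3 f (y + u)))"
  by (rule kernel_op_Qk(2)[OF \<phi>2 \<phi>3 _ _ _ 1 2 S_finite T]) measurable
qed

lemma MM_w_xj: "MM (%z. w z*xj N z) \<phi>1" "MM (%z. w z*xj N z) \<phi>4"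
proof -
 have le: "w z*xj N z <= 1*(v z*w z*xj N z)" for z
  using mult_right_mono[OF tameD(2)[OF v, of z], of "w z*xj N z"] w_nonneg xj_ge_1[of z] by (simp add: mult.assoc)
 let ?A = "(%z. w z*xj N z)"
 have t: "tame ?A" "tame (%z. v z*w z*xj N z)" by (intro tame_mult v w tame_xj)+
 show "MM ?A \<phi>1" "MM ?A \<phi>4"
  by (rule MM_mono[OF t le \<phi>1] MM_mono[OF t le \<phi>4])+
qed

text \<open>The phases of \<open>\<pi>(y + u) = c \<pi>(y) \<pi>(u)\<close> in the two factors cancel.\<close>

lemma QK_\<sigma>l:
 assumes f: "f \<in> M1_antidual w" and \<alpha>: "\<alpha> \<in> mis k" "k <= N"
 shows "QK (\<sigma>l \<alpha>) f y = (- 1)^k*(A y*D \<alpha> y * stft (Phi \<phi>1 \<phi>3 \<phi>4 \<alpha>) f y)"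
proof -
 define fy where "fy g = f (tf_shift y g)" for g
 have fy: "fy \<in> M1_antidual w" unfolding fy_def by (rule antidual_tf_shift[OF w f])
 have "cnj (STFT \<phi>4 (tf_shift y \<phi>1) (y + u)) * stft \<phi>3 f (y + u) = cnj (STFT \<phi>4 \<phi>1 u) * stft \<phi>3 fy u" for u
 proof -
  have "stft \<phi>3 f (y + u) = ph (- (snd u \<bullet> fst y)) * stft \<phi>3 fy u"
   unfolding stft_def fy_def tf_shift_add using antidualD(3)[OF w f MM_tf_shift[OF w MM_tf_shift[OF w \<phi>3]]] by simp
  moreover have "cnj (STFT \<phi>4 (tf_shift y \<phi>1) (y + u)) = ph (snd u \<bullet> fst y)*cnj (STFT \<phi>4 \<phi>1 u)"
   by (simp add: STFT_tf_shift)
  moreover have "ph (snd u \<bullet> fst y)*ph (- (snd u \<bullet> fst y)) = 1" by (simp flip: ph_add)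
  ultimately show ?thesis by (simp add: mult_ac)
 qed
 hence "QK (\<sigma>l \<alpha>) f y = (LBINT u. A y*D \<alpha> y*(of_real (monomial \<alpha> u)*cnj (STFT \<phi>4 \<phi>1 u) * stft \<phi>3 fy u))"
  by (simp add: Qk_def \<sigma>l_def mult.assoc)
 also have "... = A y*D \<alpha> y*((- 1)^k*fy (Phi \<phi>1 \<phi>3 \<phi>4 \<alpha>))"
  using Phi_integral[OF w fy MM_w_xj \<phi>3, of \<alpha>] \<alpha> by (simp add: mis_def)
 finally show ?thesis by (simp add: fy_def stft_def mult_ac)
qed

lemma loc_op_eq:
 assumes f: "f \<in> M1_antidual w" and g: "MM w g" and \<alpha>: "\<alpha> \<in> mis k" "k <= N"
  and a: "AEL z. a z = A z" and d: "AEL z. d z = D \<alpha> z"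
 shows "loc_op (%z. a z*d z) (Phi \<phi>1 \<phi>3 \<phi>4 \<alpha>) \<phi>2 f g = (- 1)^k*(LBINT y. QK (\<sigma>l \<alpha>) f y*cnj (STFT \<phi>2 g y))"
proof -
 note [measurable] = g
 let ?A = "Phi \<phi>1 \<phi>3 \<phi>4 \<alpha>"
 have [measurable]: "stft ?A f \<in> BM"
  by (rule stft_rep(2)[OF w f Phi_MM[OF w MM_w_xj(1)]]) (use \<alpha> in \<open>auto simp: mis_def\<close>)
 have "loc_op (%z. a z*d z) ?A \<phi>2 f g = (LBINT z. A z*D \<alpha> z * stft ?A f z*cnj (STFT \<phi>2 g z))"
  unfolding loc_op_def stft_bracket
  by (rule integral_lebesgue_AE) (measurable, use a d in eventually_elim, simp)
 also have "... = (LBINT y. (- 1)^k*(QK (\<sigma>l \<alpha>) f y*cnj (STFT \<phi>2 g y)))"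
  by (intro Bochner_Integration.integral_cong refl) (simp add: QK_\<sigma>l[OF f \<alpha>] mult.assoc flip: power_mult_distrib mult.assoc[of "(- 1)^k" "(- 1)^k"])
 finally show ?thesis by simp
qed

end

lemma integral_sum_AE:
 fixes F :: "'e::euclidean_space => complex"
 assumes eq: "AEL x. F x = (\<Sum>i\<in>I. c i*G i x) + H x" and F: "F \<in> BM"
  and G: "!!i. i \<in> I ==> intg (G i)" and H: "intg H"
 shows "(LBINT x. F x) = (\<Sum>i\<in>I. c i*(LBINT x. G i x)) + (LBINT x. H x)"
proof -
 have G': "intg (%x. c i*G i x)" if "i \<in> I" for i by (rule integrable_mult_right[OF G[OF that]])
 have S: "intg (%x. \<Sum>i\<in>I. c i*G i x)" by (rule Bochner_Integration.integrable_sum[OF G'])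
 let ?A = "LBINT x. (\<Sum>i\<in>I. c i*G i x)"
 have "(LBINT x. F x) = (LBINT x. (\<Sum>i\<in>I. c i*G i x) + H x)"
  by (rule integral_cong_AE[OF _ _ eq]) (use F borel_measurable_integrable[OF S] borel_measurable_integrable[OF H] in simp_all)
 also have "... = ?A + (LBINT x. H x)" by (rule Bochner_Integration.integral_add[OF S H])
 also have "?A = (\<Sum>i\<in>I. c i*(LBINT x. G i x))"
  by (subst Bochner_Integration.integral_sum[OF G']) simp_all
 finally show ?thesis .
qed

lemma sum_mis_less: "(\<Sum>k<N. \<Sum>\<alpha>\<in>mis k. F \<alpha>) = (\<Sum>\<alpha> | multi_index \<alpha> & mi_deg \<alpha> < N. F \<alpha>)"
 for F :: "('e::euclidean_space => nat) => complex"
proof -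
 have U: "{\<alpha> :: 'e => nat. multi_index \<alpha> & mi_deg \<alpha> < N} = (\<Union>k<N. mis k)" by (auto simp: mis_def)
 have "(\<Sum>\<alpha>\<in>(\<Union>k<N. mis k). F \<alpha>) = (\<Sum>k<N. \<Sum>\<alpha>\<in>mis k. F \<alpha>)"
 proof (rule sum.UNION_disjoint)
  show "\<forall>i\<in>{..<N}. \<forall>j\<in>{..<N}. i ~= j --> mis i \<inter> mis j = ({} :: ('e => nat) set)" by (auto simp: mis_def)
 qed (simp_all add: finite_mis)
 thus ?thesis unfolding U by simp
qed

context expansion
begin

lemma QK_measurable:
 assumes "\<sigma> = \<sigma>c \<or> \<sigma> = \<sigma>r \<or> (\<exists>k\<le>N. \<exists>\<alpha>\<in>mis k. \<sigma> = \<sigma>l \<alpha>)" and f: "f \<in> M1_antidual w"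
 shows "QK \<sigma> f \<in> BM" and "MM w g ==> intg (%y. QK \<sigma> f y*cnj (STFT \<phi>2 g y))"
 by (rule kernel_opD(4)[OF kernel_ops(1)[OF _ assms(1)] f] kernel_op_integrable(1)[OF kernel_ops(1)[OF _ assms(1)] f], rule refl, assumption?)+

text \<open>The second operator applied to the y-shifted \<phi>1 is an integral over z; the
  translation z = y + u turns it into the density with kernel \<open>\<sigma>c\<close>.\<close>

lemma comp_op_eq:
 assumes f: "f \<in> M1_antidual w" and g: "MM w g"
  and a: "AEL z. a z = A z" and b: "AEL z. b z = D (%_. 0) z"
 shows "(loc_op a \<phi>1 \<phi>2 \<circ> loc_op b \<phi>3 \<phi>4) f g = (LBINT y. QK \<sigma>c f y*cnj (STFT \<phi>2 g y))"
proof -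
 note [measurable] = g
 note [measurable] = stft_rep(2)[OF w f \<phi>3] QK_measurable(1)[of \<sigma>c, OF _ f, simplified]
 let ?A = "%y. STFT \<phi>4 (tf_shift y \<phi>1)"
 let ?B = "stft \<phi>1 (loc_op b \<phi>3 \<phi>4 f)"
 have inner: "A y*?B y = QK \<sigma>c f y" for y
 proof -
  have "?B y = (LBINT z. D (%_. 0) z * stft \<phi>3 f z*cnj (?A y z))"
   unfolding stft_def[of \<phi>1] loc_op_def stft_bracket
   by (rule integral_lebesgue_AE) (measurable, use b in eventually_elim, simp)
  also have "... = (LBINT u. D (%_. 0) (y + u) * stft \<phi>3 f (y + u)*cnj (?A y (y + u)))"
   using integral_lborel_shift[of "%z. D (%_. 0) z * stft \<phi>3 f z*cnj (?A y z)" y] by simp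
  finally show ?thesis by (simp add: Qk_def \<sigma>c_def mult_ac flip: integral_mult_right_zero)
 qed
 show ?thesis
  unfolding o_def loc_op_def[of a] stft_bracket
  by (rule integral_lebesgue_AE) (measurable, use a in eventually_elim, simp add: inner)
qed

text \<open>Changing a symbol on a null set must not affect segment integrals. For t different from
  0 the map u -> y + t u pulls null sets back to null sets, and Tonelli exchanges the order of u and
  t.\<close>

lemma AE_segment:
 fixes f g :: "'a*'a => complex"
 assumes eq: "AEL x. f x = g x"
 shows "AEL u. AEL t. f (y + t *\<^sub>R u) = g (y + t *\<^sub>R u)"
proof -
 obtain M where M: "M \<in> null_sets lborel" "{x. f x ~= g x} \<subseteq> M" using eq unfolding eventually_ae_filter by auto
 hence [measurable]: "M \<in> sets borel" by auto
 let ?B = "%p. indicator M (y + snd p *\<^sub>R fst p)"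
 have [measurable]: "(%p :: ('a*'a) \<times> real. ?B p :: ennreal) \<in> BM"
  by (rule measurable_compose[of _ borel borel "indicator M"]) measurable
 let ?A = "%t u. indicator M (y + t *\<^sub>R u)"
 have "(NNINT u. ?A t u) = (0 :: ennreal)" if "t ~= 0" for t
 proof -
  have "en (\<bar>t\<bar>^DIM('a*'a))*(NNINT u. ?A t u) = emeasure lborel M"
   using nn_integral_lborel_scale[of "indicator M" t y] that by simp
  thus ?thesis using M(1) that by auto
 qed
 hence "(NNINT t. (NNINT u. ?A t u)) = (NNINT (t :: real). 0)"
  using AE_lborel_singleton[of "0 :: real"] by (intro nn_integral_cong_AE) (auto elim!: eventually_mono)
 hence "(NNINT u. (NNINT t. ?A t u)) = 0"
  using nn_integral_fst_lborel[of "%p :: ('a*'a) \<times> real. ?B p"]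
   nn_integral_snd_lborel[of "%p :: ('a*'a) \<times> real. ?B p"] by simp
 hence "AEL u. (NNINT t. ?A t u) = (0 :: ennreal)"
  by (subst (asm) nn_integral_0_iff_AE) auto
 thus ?thesis
 proof eventually_elim
  case (elim u)
  have "AEL t. ?A t u = (0 :: ennreal)" using elim by (subst (asm) nn_integral_0_iff_AE) auto
  thus ?case by eventually_elim (use M(2) in \<open>auto simp: indicator_def split: if_splits\<close>)
 qed
qed

text \<open>By \<open>AE_segment\<close> the Taylor kernel built from the given derivatives agrees
  for almost every z with the one built from the Borel representatives; the rest is the translation
  z = y + u.\<close>

lemma remainder_op_eq:
 assumes f: "f \<in> M1_antidual w" and g: "MM w g"
  and a: "AEL z. a z = A z" and d: "!!\<alpha>. \<alpha> \<in> mis N ==> AEL z. Db \<alpha> z = D \<alpha> z"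
 shows "remainder_op N a Db \<phi>1 \<phi>2 \<phi>3 \<phi>4 f g = (LBINT y. QK \<sigma>r f y*cnj (STFT \<phi>2 g y))"
proof -
 note [measurable] = g
 note [measurable] = stft_rep(2)[OF w f \<phi>3] QK_measurable(1)[of \<sigma>r, OF _ f, simplified]
 let ?C = "%y z. \<sigma>r y (z - y)"
 have tkm: "(%z. ?C y z) \<in> BM" for y
  using measurable_compose[OF _ \<sigma>_measurable(3), of "%z. (y, z - y)" borel] by simp
 let ?E = "%N. taylor_kernel N Db"
 have tke: "AEL z. ?E N y z = tk y (z - y)" for y
 proof -
  have "AEL u. \<forall>\<alpha>\<in>mis N. AEL t. Db \<alpha> (y + t *\<^sub>R u) = D \<alpha> (y + t *\<^sub>R u)"
   by (rule AE_finite_allI[OF finite_mis]) (rule AE_segment[OF d])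
  hence "AEL u. ?E N y (y + u) = tk y u"
  proof eventually_elim
   case (elim u)
   have "(LINT t:{0..1}|lebesgue. of_real ((1 - t)^(N - 1))*Db \<alpha> (y + t *\<^sub>R u)) = J \<alpha> y u" if "\<alpha> \<in> mis N" for \<alpha>
    unfolding J_def set_lebesgue_integral_def
   proof (rule integral_lebesgue_AE)
    show "AEL t. indicator {0..1} t *\<^sub>R (of_real ((1 - t)^(N - 1))*Db \<alpha> (y + t *\<^sub>R u)) = indicator {0..1} t *\<^sub>R (of_real ((1 - t)^(N - 1))*D \<alpha> (y + t *\<^sub>R u))"
     using elim[rule_format, OF that] by eventually_elim simp
   qed measurable
   thus ?case by (simp add: taylor_kernel_def tk_def mis_def[symmetric] mult.commute)
  qed
  hence "AE u in distr lborel borel ((+) (- y)). ?E N y (y + u) = tk y u" by (subst lborel_distr_plus)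
  hence "AEL z. ?E N y (y + (- y + z)) = tk y (- y + z)" by (rule AE_distrD[rotated]) measurable
  thus ?thesis by simp
 qed
 let ?A = "%y z. cnj (STFT \<phi>4 (tf_shift y \<phi>1) z) * stft \<phi>3 f z"
 let ?B = "%y N. LINT z|lebesgue. a y*?E N y z * stft \<phi>3 f z*bracket (tf_shift z \<phi>4) (tf_shift y \<phi>1)*bracket (tf_shift y \<phi>2) g"
 let ?D = "%y. cnj (STFT \<phi>2 g y)"
 have inner: "(?B y N) = QK \<sigma>r f y*?D y"
  if ay: "a y = A y" for y
 proof -
  have "(?B y N)
   = (LBINT z. ?C y z*(?A y z)*?D y)"
  proof (rule integral_lebesgue_AE)
   note [measurable] = tkm
   show "(%z. ?C y z*(?A y z)*?D y) \<in> BM" by measurable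
   show "AEL z. a y*?E N y z * stft \<phi>3 f z*bracket (tf_shift z \<phi>4) (tf_shift y \<phi>1)*bracket (tf_shift y \<phi>2) g = ?C y z*(?A y z)*?D y"
    using tke[of y] by eventually_elim (simp add: ay \<sigma>r_def STFT_def bracket_sym)
  qed
  also have "... = (LBINT z. ?C y z*(?A y z))*?D y" by simp
  also have "(LBINT z. ?C y z*(?A y z)) = QK \<sigma>r f y"
  proof -
   note [measurable] = tkm
   show ?thesis
    using integral_lborel_shift[of "%z. ?C y z*(?A y z)" y] by (simp add: Qk_def)
  qed
  finally show ?thesis .
 qed
 show ?thesis
  unfolding remainder_op_def
  by (rule integral_lebesgue_AE) (measurable, use a in eventually_elim, erule inner)
qed

lemma D_loc_bounded: "loc_bounded (D \<alpha>)"
 unfolding loc_bounded_def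
proof (intro conjI allI D_meas)
 fix R :: real
 obtain M where M: "1 <= M" "!!z. norm z <= R ==> v z <= M" by (rule tame_bounded_on_ball[OF v]) (rule that)
 have "cmod (D \<alpha> z) <= B*(K'*M/m' 0)" if "norm z <= R" for z
 proof -
  have "m' (- z + z) <= K' * v (- z)*m' z" by (rule m'_mod)
  also have "... <= K'*M*m' z" unfolding tameD(5)[OF v]
   using M(2)[OF that] K' less_imp_le[OF m'_pos] by (intro mult_left_mono mult_right_mono) auto
  finally have "1/m' z <= K'*M/m' 0" using m'_pos[of z] m'_pos[of 0] by (simp add: field_simps)
  hence "B*(1/m' z) <= B*(K'*M/m' 0)" using B by (rule mult_left_mono)
  thus ?thesis using D[of \<alpha> z] by simp
 qed
 thus "\<exists>B. \<forall>y. norm y <= R --> cmod (D \<alpha> y) <= B" by blast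
qed

text \<open>The kernel identity is linear in the symbol, so once it holds almost everywhere it may
  be integrated first in u and then in y; all terms are separately integrable by the common
  majorant.\<close>

lemma QK_expansion:
 assumes f: "f \<in> M1_antidual w" and g: "MM w g"
  and dd: "!!r \<alpha>. bump r ==> multi_index \<alpha> ==> mi_deg \<alpha> <= N ==>
   (LBINT y. D \<alpha> y*pr r (%_. 0) y) = (- 1)^mi_deg \<alpha>*(LBINT y. D (%_. 0) y*pr r \<alpha> y)"
 shows "(LBINT y. QK \<sigma>c f y*cnj (STFT \<phi>2 g y)) =
  (\<Sum>\<alpha> | multi_index \<alpha> & mi_deg \<alpha> < N. 1 / of_nat (mi_fact \<alpha>)*(LBINT y. QK (\<sigma>l \<alpha>) f y*cnj (STFT \<phi>2 g y))) + (LBINT y. QK \<sigma>r f y*cnj (STFT \<phi>2 g y))"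
proof -
 define I where "I = {\<alpha> :: 'a*'a => nat. multi_index \<alpha> & mi_deg \<alpha> < N}"
 let ?D = "%\<alpha>. \<sigma>l \<alpha>"
 have \<sigma>l: "?D \<alpha> = \<sigma>c \<or> ?D \<alpha> = \<sigma>r \<or> (\<exists>k'\<le>N. \<exists>\<alpha>'\<in>mis k'. ?D \<alpha> = ?D \<alpha>')" if "\<alpha> \<in> I" for \<alpha>
  using that by (intro disjI2 exI[of _ "mi_deg \<alpha>"] conjI bexI[of _ \<alpha>]) (auto simp: I_def mis_def)
 define R where "R y u = (\<Sum>\<alpha>\<in>I. 1 / of_nat (mi_fact \<alpha>)*?D \<alpha> y u) + \<sigma>r y u" for y u
 note [measurable] = \<sigma>_measurable
 let ?A = "%p. en (cmod (\<sigma>c (fst p) (snd p) - R (fst p) (snd p)))"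
 have hm [measurable]: "(%p. ?A p) \<in> BM" unfolding R_def by measurable
 have pw: "AEL y. \<sigma>c y u = R y u" for u
 proof (rule AE_mp[OF weak_Taylor[of N D u]])
  show "(LBINT y. D \<alpha> y*pr r (%_. 0) y) = (- 1)^mi_deg \<alpha>*(LBINT y. D (%_. 0) y*pr r \<alpha> y)" if "bump r" "multi_index \<alpha>" "mi_deg \<alpha> <= N" for r \<alpha>
   by (rule dd[OF that])
 qed (use N in \<open>simp_all add: I_def sum_mis_less D_loc_bounded \<sigma>c_def R_def \<sigma>l_def \<sigma>r_def tk_def J_def sum_distrib_left distrib_left mult_ac\<close>)
 let ?C = "%u. NNINT y. en (cmod (\<sigma>c y u - R y u))"
 have "(NNINT p. ?A p) = (NNINT u. ?C u)"
  using nn_integral_snd_lborel[OF hm] by simp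
 also have "... = (NNINT (u :: 'a*'a). 0)"
 proof (rule nn_integral_cong)
  fix u
  have "(?C u) = (NNINT (y :: 'a*'a). 0)"
   using pw[of u] by (intro nn_integral_cong_AE) (auto elim: eventually_mono)
  thus "(?C u) = 0" by simp
 qed
 finally have "(NNINT p. ?A p) = 0" by simp
 hence "AEL p. ?A p = 0"
  by (subst (asm) nn_integral_0_iff_AE) (use hm in simp_all)
 hence "AEL p. \<sigma>c (fst p) (snd p) = R (fst p) (snd p)" by eventually_elim simp
 \<comment> \<open>The Taylor identity was known for each u and almost every y; the joint
   exceptional set is null, so it now reads for almost every y and almost every u, as the inner
   integration requires.\<close>
 from AE_lborel_pair(1)[OF this] have "AEL y. AEL u. \<sigma>c y u = R y u" by simp
 hence QKe: "AEL y. QK \<sigma>c f y = (\<Sum>\<alpha>\<in>I. 1 / of_nat (mi_fact \<alpha>)*QK (?D \<alpha>) f y) + QK \<sigma>r f y"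
 proof eventually_elim
  case (elim y)
  define X where "X u = cnj (STFT \<phi>4 (tf_shift y \<phi>1) (y + u)) * stft \<phi>3 f (y + u)" for u
  note i = kernel_ops(2)[OF refl _ f, of _ y, folded X_def]
  show ?case
   unfolding Qk_def X_def[symmetric]
  proof (rule integral_sum_AE)
   show "AEL u. \<sigma>c y u*X u = (\<Sum>\<alpha>\<in>I. 1 / of_nat (mi_fact \<alpha>)*(?D \<alpha> y u*X u)) + \<sigma>r y u*X u"
    using elim by eventually_elim (simp add: R_def distrib_right sum_distrib_right)
   show "(%u. \<sigma>c y u*X u) \<in> BM" using borel_measurable_integrable[OF i[of \<sigma>c]] by simp
   show "intg (%u. ?D \<alpha> y u*X u)" if "\<alpha> \<in> I" for \<alpha> by (rule i[OF \<sigma>l[OF that]])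
   show "intg (%u. \<sigma>r y u*X u)" by (rule i) simp
  qed
 qed
 let ?B = "%y. cnj (STFT \<phi>2 g y)"
 show ?thesis
  unfolding I_def[symmetric]
 proof (rule integral_sum_AE)
  show "AEL y. QK \<sigma>c f y*?B y = (\<Sum>\<alpha>\<in>I. 1 / of_nat (mi_fact \<alpha>)*(QK (?D \<alpha>) f y*?B y)) + QK \<sigma>r f y*?B y"
   using QKe by eventually_elim (simp add: distrib_right sum_distrib_right)
  show "(%y. QK \<sigma>c f y*?B y) \<in> BM" using borel_measurable_integrable[OF QK_measurable(2)[OF _ f g, of \<sigma>c]] by simp
  show "intg (%y. QK (?D \<alpha>) f y*?B y)" if "\<alpha> \<in> I" for \<alpha> by (rule QK_measurable(2)[OF \<sigma>l[OF that] f g])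
  show "intg (%y. QK \<sigma>r f y*?B y)" by (rule QK_measurable(2)[OF _ f g]) simp
 qed
qed

text \<open>For |y| > n and |u| <= n/2 the segment from y to y + u stays outside the ball of radius
  n/2, where the top derivatives are small; for longer u the full majorant is kept. Both parts of
  the majorant \<open>SR n\<close> tend to 0 under the integral.\<close>

lemma remainder_compact:
 assumes T: "!!f g. f \<in> M1_antidual w ==> MM w g ==> T f g = (LBINT y. QK \<sigma>r f y*cnj (STFT \<phi>2 g y))" and B0: "0 < B"
  and decay: "!!\<epsilon>. 0 < \<epsilon> ==> \<exists>R. \<forall>\<alpha>\<in>mis N. \<forall>z. R < norm z --> cmod (D \<alpha> z)*m' z <= \<epsilon>"
 shows "compact_on_Mpq w p q \<mu> T"
proof -
 \<comment> \<open>The inserted 0 keeps the set nonempty and makes its supremum nonnegative;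
   division by B normalizes it to at most 1.\<close>
 define X where "X r = insert 0 {cmod (D \<alpha> z)*m' z/B | \<alpha> z. \<alpha> \<in> mis N & r < norm z}" for r :: real
 define e where "e r = Sup (X r)" for r
 have X1: "x <= 1" if "x \<in> X r" for x r
 proof -
  have "cmod (D \<alpha> z)*m' z/B <= 1" for \<alpha> z
   using mult_right_mono[OF D[of \<alpha> z], of "m' z"] m'_pos[of z] B0 by (simp add: divide_le_eq)
  thus ?thesis using that by (auto simp: X_def)
 qed
 have bdd: "bdd_above (X r)" for r using X1 by (auto simp: bdd_above_def)
 have e0: "0 <= e r" for r unfolding e_def by (rule cSup_upper[OF _ bdd]) (simp add: X_def)
 have eD: "cmod (D \<alpha> z) <= e r*(B/m' z)" if "\<alpha> \<in> mis N" "r < norm z" for \<alpha> z r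
 proof -
  have "cmod (D \<alpha> z)*m' z/B <= e r" unfolding e_def by (rule cSup_upper[OF _ bdd]) (use that in \<open>unfold X_def, blast\<close>)
  thus ?thesis using B0 m'_pos[of z] by (simp add: field_simps)
 qed
 have elim: "(%n. e (real n/2)) ---> 0"
 proof (rule LIMSEQ_I)
  fix \<epsilon> :: real assume \<epsilon>: "0 < \<epsilon>"
  obtain R where R: "\<forall>\<alpha>\<in>mis N. \<forall>z. R < norm z --> cmod (D \<alpha> z)*m' z <= \<epsilon>/2*B" using decay[of "\<epsilon>/2*B"] \<epsilon> B0 by auto
  have le: "e r <= \<epsilon>/2" if "R <= r" for r
   unfolding e_def
  proof (rule cSup_least)
   fix x assume "x \<in> X r"
   then consider "x = 0" | \<alpha> z where "x = cmod (D \<alpha> z)*m' z/B" "\<alpha> \<in> mis N" "r < norm z" by (auto simp: X_def)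
   thus "x <= \<epsilon>/2"
   proof cases
    case 2
    hence "cmod (D \<alpha> z)*m' z <= \<epsilon>/2*B" using R[rule_format, of \<alpha> z] that by simp
    thus ?thesis unfolding 2(1) using B0 by (simp add: divide_le_eq)
   qed (use \<epsilon> in simp)
  qed (simp add: X_def)
  obtain n0 :: nat where "2 * R <= real n0" using real_arch_simple by blast
  hence "norm (e (real n/2) - 0) < \<epsilon>" if "n0 <= n" for n
   using le[of "real n/2"] e0[of "real n/2"] that \<epsilon> by auto
  thus "\<exists>n0. \<forall>n\<ge>n0. norm (e (real n/2) - 0) < \<epsilon>" by blast
 qed
 \<comment> \<open>The radius n/2 matches the geometry: it is half the distance of y from the
   origin, leaving n/2 for the segment.\<close>
 define SR where "SR n u = (if norm u <= real n/2 then e (real n/2) else 1)*S u" for n :: nat and u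
 have SRm [measurable]: "SR n \<in> BM" for n unfolding SR_def[abs_def] by measurable
 have SR0: "0 <= SR n u" for n u by (simp add: SR_def e0 S_nonneg)
 have e1: "e r <= 1" for r unfolding e_def by (rule cSup_least) (auto simp: X_def intro: X1[unfolded X_def])
 have SR_le: "SR n u <= S u" for n u unfolding SR_def using mult_right_mono[OF e1 S_nonneg] by simp
 let ?A = "%u. cmod (STFT \<phi>4 \<phi>1 u)"
 define I where "I n = (LBINT u. SR n u*?A u*w u)" for n
 have dom: "norm (SR n u*?A u*w u) <= S u*?A u*w u" for n u
  using SR0[of n u] w_nonneg[of u] by (simp add: abs_mult mult_right_mono SR_le)
 have ii: "intg (%u. SR n u*?A u*w u)" for n
  by (rule int_bound[OF S_integrable], measurable) (intro AE_I2 order_trans[OF dom], unfold real_norm_def, rule abs_ge_self)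
 have "I ---> (LBINT (u :: 'a*'a). 0)"
  unfolding I_def
 proof (rule integral_dominated_convergence[OF _ _ S_integrable])
  show "AEL u. (%n. SR n u*?A u*w u) ---> 0"
  proof (rule AE_I2)
   fix u :: "'a*'a"
   obtain n0 :: nat where n0: "2*norm u <= real n0" using real_arch_simple by blast
   have "(%n. SR n u) ---> 0"
   proof (rule Lim_transform_eventually)
    show "(%n. e (real n/2)*S u) ---> 0" using tendsto_mult_right[OF elim, of "S u"] by simp
    show "\<forall>\<^sub>F n in sequentially. e (real n/2)*S u = SR n u"
     using eventually_ge_at_top[of n0] by eventually_elim (use n0 in \<open>auto simp: SR_def\<close>)
   qed
   hence "(%n. SR n u*?A u*w u) ---> 0*?A u*w u" by (intro tendsto_intros)
   thus "(%n. SR n u*?A u*w u) ---> 0" by simp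
  qed
 qed (use dom in \<open>auto intro!: AE_I2\<close>)
 hence I0: "I ---> 0" by simp
 let ?B = "Hk \<phi>1 \<phi>3 \<phi>4"
 obtain c where c: "0 <= c" "!!S. S \<in> BM ==> wint (?B S) <= en c*(NNINT u. en (S u*?A u*w u))"
  by (rule Hk_wint[OF \<phi>3 window_measurable(1,4)]) (rule that)
 show ?thesis
 proof (rule kernel_op_compact)
  show "kernel_op \<phi>2 (QK \<sigma>r) (?B S) T" by (rule kernel_ops(1)) (rule T, assumption+, simp)
  show "?B (SR n) \<in> BM" for n by (rule Hk_measurable[OF window_measurable(1,3,4) SRm])
  show "(%n. wint (?B (SR n))) ---> 0"
  proof -
   have le: "wint (?B (SR n)) <= en (c*I n)" for n
   proof -
    have "(NNINT u. en (SR n u*?A u*w u)) = en (I n)"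
     unfolding I_def by (rule nn_integral_eq_integral[OF ii]) (simp add: SR0 w_nonneg)
    thus ?thesis using c(2)[OF SRm[of n]] c(1) by (simp add: ennreal_mult')
   qed
   have lim0: "(%n. en (c*I n)) ---> 0"
    using tendsto_ennrealI[OF tendsto_mult_left[OF I0, of c]] by simp
   show ?thesis by (rule tendsto_sandwich[OF _ _ tendsto_const lim0]) (auto simp: le)
  qed
  fix f n and y :: "'a*'a" assume f: "f \<in> M1_antidual w" and y: "real n < norm y"
  have "cmod (\<sigma>r y u) <= SR n u" for u :: "'a*'a"
  proof (cases "norm u <= real n/2")
   case True
   have "cmod (\<sigma>r y u) <= e (real n/2)*S u"
   proof (rule \<sigma>r_bound[OF eD e0])
    fix t :: real assume t: "t \<in> {0..1}"
    have "norm (t *\<^sub>R u) <= norm u" using t by (simp add: mult_left_le_one_le)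
    thus "real n/2 < norm (y + t *\<^sub>R u)" using y True norm_diff_ineq[of y "t *\<^sub>R u"] by linarith
   qed
   thus ?thesis using True by (simp add: SR_def)
  qed (simp add: SR_def S_bounds)
  thus "en (cmod (QK \<sigma>r f y)) <= corr (?B (SR n)) (absF f) y"
   by (rule Qk_bound(2)[OF f \<phi>3 window_measurable(1,4) SRm])
 qed
qed

end

text \<open>The condition on the weight is stated with the gauge integral; continuity converts it
  into a Lebesgue integral, and the absolute value makes the constant nonnegative.\<close>

lemma submult_vint:
 assumes v: "submult_weight v"
 obtains C where "0 <= C" "!!u. (LBINT t. indicator {0..1} t * v (t *\<^sub>R u)) <= C * v u"
proof -
 obtain C where C: "!!u. integral {0..1} (%t. v (t *\<^sub>R u)) <= C * v u" using v unfolding submult_weight_def by blast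
 note t = submult_tame[OF v]
 have "(LBINT t. indicator {0..1} t * v (t *\<^sub>R u)) <= \<bar>C\<bar> * v u" for u
 proof -
  have "continuous_on {0..1} (%t. v (t *\<^sub>R u))"
   by (rule continuous_on_compose2[OF tameD(1)[OF t]]) (auto intro!: continuous_intros)
  from set_borel_integral_eq_integral(2)[OF borel_integrable_atLeastAtMost'[OF this]]
  have "(LBINT t. indicator {0..1} t * v (t *\<^sub>R u)) = integral {0..1} (%t. v (t *\<^sub>R u))" by (simp add: set_lebesgue_integral_def)
  also have "... <= C * v u" by (rule C)
  also have "... <= \<bar>C\<bar> * v u" using tameD(4)[OF t] by (intro mult_right_mono) auto
  finally show ?thesis .
 qed
 thus ?thesis by (intro that[of "\<bar>C\<bar>"]) auto
qed

section \<open>Borel representatives with bounds valid at every point\<close>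

lemma borel_version:
 fixes F :: "'e::euclidean_space => complex"
 assumes F: "F \<in> borel_measurable lebesgue"
 obtains G where "G \<in> BM" "AEL z. F z = G z"
proof -
 have "(%z. Re (F z)) \<in> borel_measurable lebesgue" "(%z. Im (F z)) \<in> borel_measurable lebesgue" using F by measurable
 from this[THEN completion_ex_borel_measurable_real] obtain g h where [measurable]: "g \<in> BM" "h \<in> BM"
  and e: "AEL z. Re (F z) = g z" "AEL z. Im (F z) = h z" by auto
 show ?thesis
 proof
  show "(%z. Complex (g z) (h z)) \<in> BM" unfolding Complex_eq by measurable
  show "AEL z. F z = Complex (g z) (h z)" using e by eventually_elim (simp add: complex_eq_iff)
 qed
qed

lemma bounded_borel_version:
 assumes F: "F \<in> borel_measurable lebesgue" and k [measurable]: "k \<in> BM" "!!z. 0 <= k z" and le: "AEL z. cmod (F z) <= k z"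
 shows "\<exists>G. G \<in> BM & (AEL z. F z = G z) & (\<forall>z. cmod (G z) <= k z)"
proof -
 obtain G where [measurable]: "G \<in> BM" and eq: "AEL z. F z = G z" by (rule borel_version[OF F])
 have "(%z. if cmod (G z) <= k z then G z else 0) \<in> BM" by measurable
 moreover have "AEL z. F z = (if cmod (G z) <= k z then G z else 0)" using eq le by eventually_elim simp
 ultimately show ?thesis using k(2) by (intro exI[of _ "%z. if cmod (G z) <= k z then G z else 0"]) auto
qed

lemma locally_integrable_measurable:
 fixes f :: "'e::euclidean_space => complex"
 assumes f: "locally_integrable f"
 shows "f \<in> borel_measurable lebesgue"
proof (rule borel_measurable_LIMSEQ_metric)
 show "(%x. indicator (cball 0 (real n)) x *\<^sub>R f x) \<in> borel_measurable lebesgue" for n :: nat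
  using f unfolding locally_integrable_def set_integrable_def by (intro borel_measurable_integrable) auto
 fix x :: 'e
 obtain n0 :: nat where n0: "norm x <= real n0" using real_arch_simple by blast
 show "(%n. indicator (cball 0 (real n)) x *\<^sub>R f x) ---> f x"
  by (rule tendsto_eventually) (use n0 in \<open>auto simp: eventually_sequentially intro!: exI[of _ n0]\<close>)
qed

text \<open>The composition involves b itself, whereas the expansion starts with the function
  representing its derivative of order 0; testing with product bumps identifies the two almost
  everywhere.\<close>

lemma distr_deriv_0:
 fixes f h :: "'e::euclidean_space => complex"
 assumes d: "distr_deriv (%_. 0) f h"
 shows "AEL x. f x = h x"
proof -
 have li: "locally_integrable f" "locally_integrable h" using d by (auto simp: distr_deriv_def)
 obtain F where F [measurable]: "F \<in> BM" "AEL x. f x = F x" by (rule borel_version[OF locally_integrable_measurable[OF li(1)]])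
 obtain H where H [measurable]: "H \<in> BM" "AEL x. h x = H x" by (rule borel_version[OF locally_integrable_measurable[OF li(2)]])
 let ?C = "%R. indicator (cball 0 R)"
 let ?A = "%R g. (%x. ?C R x *\<^sub>R g x)"
 have int: "intg (%x. G x*k x)"
  if g: "locally_integrable g" and G: "G \<in> BM" "AEL x. g x = G x" and k [measurable]: "k \<in> BM" "!!x. cmod (k x) <= c" "!!x. R < norm x ==> k x = 0"
  for g G k :: "'e => complex" and c R :: real
 proof -
  note [measurable] = G(1)
  have gi: "integrable lebesgue (?A R g)" using g unfolding locally_integrable_def set_integrable_def by auto
  have "(?A R G) \<in> BM"
   by (intro borel_measurable_scaleR borel_measurable_indicator G(1)) simp
  hence m: "(?A R G) \<in> borel_measurable lborel" by simp
  have "integrable lebesgue (?A R G)"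
  proof (rule integrable_cong_AE_imp[OF gi measurable_completion[OF m]])
   show "AE x in lebesgue. ?C R x *\<^sub>R g x = ?C R x *\<^sub>R G x"
    using AE_completion[OF G(2)] by eventually_elim simp
  qed
  hence "intg (?A R G)" by (simp add: integrable_completion[OF m])
  from integrable_norm[OF integrable_mult_right[OF this, of "of_real c"]]
  show ?thesis
  proof (rule int_bound)
   have "cmod (G x*k x) <= norm (cmod (of_real c*(?C R x *\<^sub>R G x)))" for x
   proof (cases "norm x <= R")
    case True
    have "cmod (k x) <= \<bar>c\<bar>" using k(2)[of x] by simp
    thus ?thesis using True mult_left_mono[of "cmod (k x)" "\<bar>c\<bar>" "cmod (G x)"] by (simp add: norm_mult mult.commute)
   qed (simp add: k(3))
   thus "AEL x. cmod (G x*k x) <= norm (cmod (of_real c*(?C R x *\<^sub>R G x)))" by simp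
  qed measurable
 qed
 let ?B = "%r. pr r (%_. 0)"
 let ?D = "%A B. (%x. F x*indicator (box A B) x - H x*indicator (box A B) x)"
 have "AEL x. F x - H x = 0"
 proof (rule fundamental_lemma)
  show "set_integrable lborel (box A B) (%x. F x - H x)" for A B
  proof -
   have "bounded (box A B)" by simp
   then obtain R where R: "!!y. y \<in> box A B ==> norm y <= R" by (auto simp: bounded_iff)
   have "intg (?D A B)"
    by (intro Bochner_Integration.integrable_diff int[OF li(1) F, of _ 1 R] int[OF li(2) H, of _ 1 R])
      (use R in \<open>auto simp: indicator_def not_le dest: leD\<close>)
   also have "(?D A B) = (%x. indicator (box A B) x *\<^sub>R (F x - H x))" by (auto simp: indicator_def)
   finally show ?thesis by (simp add: set_integrable_def)
  qed
  fix r :: "'e => real => real" assume r: "bump r"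
  have pm [measurable]: "?B r \<in> BM" by (intro BM_contI pr_continuous r)
  obtain R where R: "0 < R" "!!y \<gamma>. R < norm y ==> pr r \<gamma> y = 0" by (rule pr_support[OF r]) (rule that)
  obtain c where c: "!!y. norm y <= R ==> cmod (?B r y) <= c" using loc_bounded_continuous[OF pr_continuous[OF r, of _ "%_. 0"]] unfolding loc_bounded_def by blast
  have c': "cmod (?B r y) <= \<bar>c\<bar>" for y using c[of y] R(2)[of y "%_. 0"] by (cases "norm y <= R") auto
  have "(LINT x|lebesgue. h x*?B r x) = (LINT x|lebesgue. f x*?B r x)"
   using d pr_test_function[OF r, of "%_. 0"] pr_mi_deriv[OF r, of "%_. 0"] by (simp add: distr_deriv_def mi_deg_def multi_index_def)
  also have "(LINT x|lebesgue. f x*?B r x) = (LBINT x. F x*?B r x)"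
   by (rule integral_lebesgue_AE) (measurable, use F(2) in eventually_elim, simp)
  also have "(LINT x|lebesgue. h x*?B r x) = (LBINT x. H x*?B r x)"
   by (rule integral_lebesgue_AE) (measurable, use H(2) in eventually_elim, simp)
  finally show "(LBINT x. (F x - H x)*?B r x) = 0"
   using int[OF li(1) F pm c' R(2)] int[OF li(2) H pm c' R(2)] by (simp add: left_diff_distrib)
 qed measurable
 thus ?thesis using F(2) H(2) by eventually_elim simp
qed

text \<open>Decay at infinity is known for each threshold up to a null set. The thresholds 1/(n+1)
  are countably many, so setting the function to 0 wherever one of them fails changes it on a null
  set only and makes the decay hold everywhere.\<close>

lemma L0_version:
 assumes F [measurable]: "F \<in> BM" and k: "!!z. cmod (F z) <= k z" and eq: "AEL z. d z = F z"
  and m' [measurable]: "m' \<in> BM" and c: "1 <= c" "!!z. 0 < m' z" "!!z. m' z <= c*m z" and L: "(%z. d z * of_real (m z)) \<in> L0"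
 shows "\<exists>G. G \<in> BM & (AEL z. d z = G z) & (\<forall>z. cmod (G z) <= k z) & (\<forall>\<epsilon>>0. \<exists>R. \<forall>z. R < norm z --> cmod (G z)*m' z <= \<epsilon>)"
proof -
 let ?A = "%z. cmod (d z * of_real (m z))"
 have "\<forall>n. \<exists>R. AEL z. norm z > R --> ?A z < 1/real (Suc n)"
 proof
  fix n
  have "0 < 1/real (Suc n)" by simp
  thus "\<exists>R. AEL z. norm z > R --> ?A z < 1/real (Suc n)"
   using L unfolding L0_def AE_completion_iff by blast
 qed
 from choice[OF this] obtain R where R: "!!n. AEL z. norm z > R n --> ?A z < 1/real (Suc n)" by blast
 define P where "P z \<longleftrightarrow> (\<forall>n. norm z > R n --> cmod (F z)*m' z <= c*(1/real (Suc n)))" for z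
 have [measurable]: "Measurable.pred borel P" unfolding P_def by measurable
 have mpos: "0 < m z" for z using c(1) c(2)[of z] c(3)[of z] mult_nonneg_nonpos[of c "m z"] by (cases "0 < m z") auto
 have "AEL z. \<forall>n. norm z > R n --> ?A z < 1/real (Suc n)" using R by (simp add: AE_all_countable)
 hence AP: "AEL z. P z"
  using eq
 proof eventually_elim
  case (elim z)
  show ?case
   unfolding P_def
  proof (intro allI impI)
   fix n assume n: "R n < norm z"
   have "cmod (F z)*m' z <= cmod (F z)*(c*m z)" by (intro mult_left_mono c) simp
   also have "... = c*?A z" using mpos[of z] elim(2) by (simp add: norm_mult)
   also have "... <= c*(1/real (Suc n))" using elim(1) n c(1) by (intro mult_left_mono) (auto simp: less_imp_le)
   finally show "cmod (F z)*m' z <= c*(1/real (Suc n))" .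
  qed
 qed
 define G where "G z = (if P z then F z else 0)" for z
 have "G \<in> BM" unfolding G_def[abs_def] by measurable
 moreover have "AEL z. d z = G z" using eq AP by eventually_elim (simp add: G_def)
 moreover have "cmod (G z) <= k z" for z using k[of z] order_trans[OF norm_ge_zero k[of z]] by (simp add: G_def)
 moreover have "\<exists>R. \<forall>z. R < norm z --> cmod (G z)*m' z <= \<epsilon>" if "0 < \<epsilon>" for \<epsilon>
 proof -
  have "0 < \<epsilon>/c" using that c(1) by simp
  then obtain n where n: "1/real (Suc n) < \<epsilon>/c" by (rule nat_approx_posE)
  hence "c*(1/real (Suc n)) <= \<epsilon>" using c(1) by (simp add: field_simps)
  thus ?thesis using \<open>0 < \<epsilon>\<close> by (intro exI[of _ "R n"]) (auto simp: G_def P_def intro: order_trans)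
 qed
 ultimately show ?thesis by blast
qed

theorem theorem6p1:
  fixes N :: nat
    and v w m \<mu> :: "'a::euclidean_space \<times> 'a \<Rightarrow> real"
    and \<phi>1 \<phi>2 \<phi>3 \<phi>4 :: "'a \<Rightarrow> complex"
    and a b :: "'a \<times> 'a \<Rightarrow> complex"
    and Db :: "('a \<times> 'a \<Rightarrow> nat) \<Rightarrow> 'a \<times> 'a \<Rightarrow> complex"
  assumes N: "1 \<le> N"
    and v: "submult_weight v"
    and w: "submult_weight w"
    and m: "m \<in> moderate_weights v"
    and \<mu>: "\<mu> \<in> moderate_weights w"
    and \<phi>1: "\<phi>1 \<in> M1 (\<lambda>(x, \<omega>). v (x, \<omega>) * w (x, \<omega>) * (jbracket x ^ N * jbracket \<omega> ^ N))"
    and \<phi>4: "\<phi>4 \<in> M1 (\<lambda>(x, \<omega>). v (x, \<omega>) * w (x, \<omega>) * (jbracket x ^ N * jbracket \<omega> ^ N))"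
    and \<phi>2: "\<phi>2 \<in> M1 w"
    and \<phi>3: "\<phi>3 \<in> M1 w"
    and a: "a \<in> Linf (\<lambda>z. 1 / m z)"
    and Db: "\<And>\<alpha>. multi_index \<alpha> \<Longrightarrow> mi_deg \<alpha> \<le> N \<Longrightarrow> distr_deriv \<alpha> b (Db \<alpha>) \<and> Db \<alpha> \<in> Linf m"
  shows
    "(\<forall>\<alpha>. multi_index \<alpha> \<and> mi_deg \<alpha> < N \<longrightarrow> Phi \<phi>1 \<phi>3 \<phi>4 \<alpha> \<in> M1 (\<lambda>z. v z * w z)) \<and>
     (\<forall>p q. 1 \<le> p \<and> 1 \<le> q \<longrightarrow>
        bounded_on_Mpq w p q \<mu> (loc_op a \<phi>1 \<phi>2 \<circ> loc_op b \<phi>3 \<phi>4) \<and>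
        (\<forall>\<alpha>. multi_index \<alpha> \<and> mi_deg \<alpha> < N \<longrightarrow>
           bounded_on_Mpq w p q \<mu> (loc_op (\<lambda>z. a z * Db \<alpha> z) (Phi \<phi>1 \<phi>3 \<phi>4 \<alpha>) \<phi>2)) \<and>
        bounded_on_Mpq w p q \<mu> (remainder_op N a Db \<phi>1 \<phi>2 \<phi>3 \<phi>4) \<and>
        (\<forall>f\<in>Mpq w p q \<mu>. \<forall>g\<in>M1 w.
           (loc_op a \<phi>1 \<phi>2 \<circ> loc_op b \<phi>3 \<phi>4) f g =
           (\<Sum>\<alpha> | multi_index \<alpha> \<and> mi_deg \<alpha> < N.
              (-1) ^ mi_deg \<alpha> / of_nat (mi_fact \<alpha>) *
              loc_op (\<lambda>z. a z * Db \<alpha> z) (Phi \<phi>1 \<phi>3 \<phi>4 \<alpha>) \<phi>2 f g) +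
           remainder_op N a Db \<phi>1 \<phi>2 \<phi>3 \<phi>4 f g)) \<and>
     ((\<forall>\<alpha>. multi_index \<alpha> \<and> mi_deg \<alpha> = N \<longrightarrow> (\<lambda>z. Db \<alpha> z * of_real (m z)) \<in> L0) \<longrightarrow>
        (\<forall>p q. 1 \<le> p \<and> 1 \<le> q \<longrightarrow>
           compact_on_Mpq w p q \<mu> (remainder_op N a Db \<phi>1 \<phi>2 \<phi>3 \<phi>4)))"
proof -
 note tv = submult_tame[OF v] and tw = submult_tame[OF w]
 obtain m' Km where m'_meas [measurable]: "m' \<in> BM" and m'_pos: "!!z. 0 < m' z" and Km: "1 <= Km"
  and m'_le: "!!z. m' z <= Km*m z" and m_le: "!!z. m z <= Km*m' z" and m'_mod: "!!z1 z2. m' (z1 + z2) <= Km * v z1*m' z2"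
  by (rule moderate_borel[OF tv m]) (rule that)
 obtain \<mu>' K where \<mu>'_meas: "\<mu>' \<in> BM" and \<mu>'_pos: "!!z. 0 < \<mu>' z" and K: "1 <= K"
  and \<mu>'_le: "!!z. \<mu>' z <= K*\<mu> z" and \<mu>_le: "!!z. \<mu> z <= K*\<mu>' z" and \<mu>'_mod: "!!z1 z2. \<mu>' (z1 + z2) <= K*w z1*\<mu>' z2"
  by (rule moderate_borel[OF tw \<mu>]) (rule that)
 obtain Cv where Cv: "0 <= Cv" "!!u. (LBINT t. indicator {0..1} t * v (t *\<^sub>R u)) <= Cv * v u" by (rule submult_vint[OF v]) (rule that)
 have mpos: "0 < m z" for z using m unfolding moderate_weights_def by blast
 let ?J = "%v w N. (%z. v z*w z*xj N z)"
 have tx: "tame (?J v w N)" by (intro tame_mult tv tw tame_xj)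
 have "(%(x, \<omega>). v (x, \<omega>)*w (x, \<omega>)*(jbracket x^N*jbracket \<omega>^N)) = ?J v w N" by (auto simp: xj_def fun_eq_iff)
 hence M: "MM (?J v w N) \<phi>1" "MM (?J v w N) \<phi>4" using \<phi>1 \<phi>4 M1_iff[OF tx] by simp_all
 have M2: "MM w \<phi>2" "MM w \<phi>3" using \<phi>2 \<phi>3 M1_iff[OF tw] by simp_all
 let ?C = "%\<alpha>. multi_index \<alpha>"
 let ?E = "%\<alpha>. mi_deg \<alpha>"
 define I where "I = {\<alpha> :: 'a*'a => nat. ?C \<alpha> & ?E \<alpha> <= N}"
 have "I = (\<Union>k\<le>N. mis k)" by (auto simp: I_def mis_def)
 hence fI: "finite I" by (simp add: finite_mis)
 have misI: "\<alpha> \<in> I" if "\<alpha> \<in> mis k" "k <= N" for \<alpha> k using that by (simp add: I_def mis_def)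
 have I0: "(%_. 0) \<in> I" by (simp add: I_def multi_index_def mi_deg_def)
 obtain Ca where Ca: "AEL z. cmod (a z * of_real (1/m z)) <= Ca" using a unfolding Linf_def AE_completion_iff by blast
 have "\<forall>\<alpha>\<in>I. \<exists>C. AEL z. cmod (Db \<alpha> z * of_real (m z)) <= C" using Db unfolding Linf_def AE_completion_iff I_def by blast
 from bchoice[OF this] obtain C where C: "!!\<alpha>. \<alpha> \<in> I ==> AEL z. cmod (Db \<alpha> z * of_real (m z)) <= C \<alpha>" by blast
 let ?A = "\<Sum>\<alpha>\<in>I. \<bar>C \<alpha>\<bar>"
 \<comment> \<open>One constant for a and for all derivatives up to order N; Km exchanges m for m',
   and the summand 1 makes it positive, so that division by it is possible later.\<close>
 define B where "B = 1 + Km*(\<bar>Ca\<bar> + ?A)"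
 have sC: "0 <= ?A" by (intro sum_nonneg) simp
 have Bp: "0 < B" unfolding B_def using Km sC by (intro add_pos_nonneg mult_nonneg_nonneg) auto
 have BC: "Km*\<bar>Ca\<bar> <= B" "\<alpha> \<in> I ==> Km*\<bar>C \<alpha>\<bar> <= B" for \<alpha>
 proof -
  have le: "Km*x <= B" if "x <= \<bar>Ca\<bar> + ?A" for x
  proof -
   have "Km*x <= Km*(\<bar>Ca\<bar> + ?A)" using that Km by (intro mult_left_mono) auto
   thus ?thesis unfolding B_def by linarith
  qed
  show "Km*\<bar>Ca\<bar> <= B" using sC by (intro le) simp
  assume "\<alpha> \<in> I"
  hence "\<bar>C \<alpha>\<bar> <= ?A" by (intro member_le_sum fI) auto
  thus "Km*\<bar>C \<alpha>\<bar> <= B" by (intro le) simp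
 qed
 have "\<exists>A. A \<in> BM & (AEL z. a z = A z) & (\<forall>z. cmod (A z) <= B*m' z)"
 proof (rule bounded_borel_version)
  show "a \<in> borel_measurable lebesgue" using a by (simp add: Linf_def)
  show "AEL z. cmod (a z) <= B*m' z"
   using Ca
  proof eventually_elim
   case (elim z)
   hence "cmod (a z) <= Ca*m z" using mpos[of z] by (simp add: norm_mult norm_divide divide_le_eq)
   also have "... <= \<bar>Ca\<bar>*(Km*m' z)" using m_le mpos[of z] by (intro mult_mono) (auto simp: less_imp_le)
   also have "... <= B*m' z" using mult_right_mono[OF BC(1) less_imp_le[OF m'_pos[of z]]] by (simp add: mult_ac)
   finally show ?case .
  qed
 qed (use Bp less_imp_le[OF m'_pos] in auto)
 then obtain A where Aw: "A \<in> BM" "AEL z. a z = A z" "!!z. cmod (A z) <= B*m' z" by blast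
 let ?G = "%D B m'. \<forall>z. cmod (D z) <= B/m' z"
 let ?L = "%\<alpha> D. AEL z. Db \<alpha> z = D z"
 have "\<forall>\<alpha>\<in>I. \<exists>D. D \<in> BM & (?L \<alpha> D) & (?G D B m')"
 proof
  fix \<alpha> assume \<alpha>: "\<alpha> \<in> I"
  show "\<exists>D. D \<in> BM & (?L \<alpha> D) & (?G D B m')"
  proof (rule bounded_borel_version)
   show "Db \<alpha> \<in> borel_measurable lebesgue" using Db[of \<alpha>] \<alpha> by (simp add: Linf_def I_def)
   show "AEL z. cmod (Db \<alpha> z) <= B/m' z"
    using C[OF \<alpha>]
   proof eventually_elim
    case (elim z)
    have "cmod (Db \<alpha> z)*m' z <= cmod (Db \<alpha> z)*(Km*m z)" by (intro mult_left_mono m'_le) simp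
    also have "... = Km*cmod (Db \<alpha> z * of_real (m z))" using mpos[of z] by (simp add: norm_mult)
    also have "... <= Km*\<bar>C \<alpha>\<bar>" using elim Km by (intro mult_left_mono) auto
    also have "... <= B" by (rule BC(2)[OF \<alpha>])
    finally show ?case using m'_pos[of z] by (simp add: le_divide_eq)
   qed
  qed (use Bp less_imp_le[OF m'_pos] in auto)
 qed
 from bchoice[OF this] obtain D0 where D0: "\<forall>\<alpha>\<in>I. D0 \<alpha> \<in> BM & (AEL z. Db \<alpha> z = D0 \<alpha> z) & (\<forall>z. cmod (D0 \<alpha> z) <= B/m' z)" ..
 \<comment> \<open>Extension by 0 beyond order N: the locale asks for measurability and bounds at
   every \<alpha>, while the hypotheses speak of orders up to N only.\<close>
 let ?H = "%D. (%\<alpha>. if \<alpha> \<in> I then D \<alpha> else (%_. 0))"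
 have ex: "expansion w \<mu> \<mu>' K p q v m' Km B Cv N \<phi>1 \<phi>2 \<phi>3 \<phi>4 A (?H D)"
  if "1 <= p" "1 <= q" "\<forall>\<alpha>\<in>I. D \<alpha> \<in> BM & (\<forall>z. cmod (D \<alpha> z) <= B/m' z)" for p q D
 proof (intro expansion.intro modulation.intro expansion_axioms.intro)
  show "cmod ((if \<alpha> \<in> I then D \<alpha> else (%_. 0)) z) <= B/m' z" for \<alpha> z
   using that(3) Bp m'_pos[of z] by (cases "\<alpha> \<in> I") (simp_all del: split_paired_All)
  show "(if \<alpha> \<in> I then D \<alpha> else (%_. 0)) \<in> BM" for \<alpha> using that(3) by auto
 qed (fact tw \<mu> \<mu>'_meas \<mu>'_pos K \<mu>'_le \<mu>_le \<mu>'_mod that(1,2) tv Cv m'_meas m'_pos Km m'_mod N M M2 Aw(1,3) less_imp_le[OF Bp])+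
 define D where "D = ?H D0"
 have DA: "AEL z. Db \<alpha> z = D \<alpha> z" if "\<alpha> \<in> I" for \<alpha> using D0 that by (simp add: D_def)
 have Dm [measurable]: "D \<alpha> \<in> BM" for \<alpha> using D0 by (simp add: D_def)
 have "AEL z. b z = Db (%_. 0) z"
  using Db[of "%_. 0"] I0 by (intro distr_deriv_0) (simp add: I_def)
 hence bD: "AEL z. b z = D (%_. 0) z" using DA[OF I0] by eventually_elim simp
 \<comment> \<open>The distributional identity is needed on product bumps only, where the derivative
   of the test function is \<open>pr r \<alpha>\<close>.\<close>
 have dd: "(LBINT y. D \<alpha> y*pr r (%_. 0) y) = (- 1)^?E \<alpha>*(LBINT y. D (%_. 0) y*pr r \<alpha> y)"
  if r: "bump r" and \<alpha>: "?C \<alpha>" "?E \<alpha> <= N" for r \<alpha>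
 proof -
  have [measurable]: "pr r \<gamma> \<in> BM" for \<gamma> by (intro BM_contI pr_continuous r)
  have "(LINT x|lebesgue. Db \<alpha> x*pr r (%_. 0) x) = (- 1)^?E \<alpha>*(LINT x|lebesgue. b x*pr r \<alpha> x)"
   using Db[OF \<alpha>] pr_test_function[OF r, of "%_. 0"] pr_mi_deriv[OF r \<alpha>(1)] by (simp add: distr_deriv_def)
  also have "(LINT x|lebesgue. b x*pr r \<alpha> x) = (LBINT x. D (%_. 0) x*pr r \<alpha> x)"
   by (rule integral_lebesgue_AE) (measurable, use bD in eventually_elim, simp)
  also have "(LINT x|lebesgue. Db \<alpha> x*pr r (%_. 0) x) = (LBINT x. D \<alpha> x*pr r (%_. 0) x)"
   by (rule integral_lebesgue_AE) (measurable, use DA[of \<alpha>] \<alpha> in \<open>auto simp: I_def elim: eventually_mono\<close>)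
  finally show ?thesis .
 qed
 have mis: "\<alpha> \<in> mis (?E \<alpha>)" if "?C \<alpha>" for \<alpha> :: "'a*'a => nat" using that by (simp add: mis_def)
 let ?B = "%\<alpha>. (%z. a z*Db \<alpha> z)"
 let ?F = "%\<alpha>. of_nat (mi_fact \<alpha>)"
 let ?I = "%\<phi>2 g y. cnj (STFT \<phi>2 g y)"
 let ?K = "%w p. bounded_on_Mpq w p"
 have part2: "?K w p q \<mu> (loc_op a \<phi>1 \<phi>2 \<circ> loc_op b \<phi>3 \<phi>4) &
   (\<forall>\<alpha>. ?C \<alpha> & ?E \<alpha> < N --> ?K w p q \<mu> (loc_op (?B \<alpha>) (Phi \<phi>1 \<phi>3 \<phi>4 \<alpha>) \<phi>2)) &
   ?K w p q \<mu> (remainder_op N a Db \<phi>1 \<phi>2 \<phi>3 \<phi>4) &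
   (\<forall>f\<in>Mpq w p q \<mu>. \<forall>g\<in>M1 w. (loc_op a \<phi>1 \<phi>2 \<circ> loc_op b \<phi>3 \<phi>4) f g =
     (\<Sum>\<alpha> | ?C \<alpha> & ?E \<alpha> < N. (-1)^?E \<alpha>/?F \<alpha>*loc_op (?B \<alpha>) (Phi \<phi>1 \<phi>3 \<phi>4 \<alpha>) \<phi>2 f g) +
     remainder_op N a Db \<phi>1 \<phi>2 \<phi>3 \<phi>4 f g)"
  if pq: "1 <= p" "1 <= q" for p q
 proof -
  interpret expansion w \<mu> \<mu>' K p q v m' Km B Cv N \<phi>1 \<phi>2 \<phi>3 \<phi>4 A D
   unfolding D_def by (rule ex[OF pq]) (use D0 in \<open>simp del: split_paired_All\<close>)
  have rem: "remainder_op N a Db \<phi>1 \<phi>2 \<phi>3 \<phi>4 f g = (LBINT y. QK \<sigma>r f y*?I \<phi>2 g y)"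
   if "f \<in> M1_antidual w" "MM w g" for f g
   by (rule remainder_op_eq[OF that Aw(2)]) (rule DA, rule misI, assumption, simp)
  have comp: "(loc_op a \<phi>1 \<phi>2 \<circ> loc_op b \<phi>3 \<phi>4) f g = (LBINT y. QK \<sigma>c f y*?I \<phi>2 g y)"
   if "f \<in> M1_antidual w" "MM w g" for f g by (rule comp_op_eq[OF that Aw(2) bD])
  have loc: "loc_op (?B \<alpha>) (Phi \<phi>1 \<phi>3 \<phi>4 \<alpha>) \<phi>2 f g = (- 1)^?E \<alpha>*(LBINT y. QK (\<sigma>l \<alpha>) f y*?I \<phi>2 g y)"
   if "f \<in> M1_antidual w" "MM w g" "?C \<alpha>" "?E \<alpha> < N" for f g \<alpha>
   using that by (intro loc_op_eq Aw(2) DA mis) (auto simp: I_def)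
  have "?K w p q \<mu> (loc_op (?B \<alpha>) (Phi \<phi>1 \<phi>3 \<phi>4 \<alpha>) \<phi>2)" if \<alpha>: "?C \<alpha>" "?E \<alpha> < N" for \<alpha>
  proof -
   \<comment> \<open>The sign is moved into the kernel, so that the localization operator itself has
     the required form; the majorant is unaffected.\<close>
   let ?s = "%y u. (- 1)^?E \<alpha>*\<sigma>l \<alpha> y u"
   have "cmod (?s y u) <= S u" for y u using S_bounds(2)[OF mis[OF \<alpha>(1)], of y u] \<alpha>(2) by (simp add: norm_mult norm_power)
   moreover have "(%z. ?s (fst z) (snd z)) \<in> BM" using \<sigma>_measurable(2)[of \<alpha>] by measurable
   moreover have "loc_op (?B \<alpha>) (Phi \<phi>1 \<phi>3 \<phi>4 \<alpha>) \<phi>2 f g = (LBINT y. QK ?s f y*?I \<phi>2 g y)"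
    if "f \<in> M1_antidual w" "MM w g" for f g
    using loc[OF that \<alpha>] by (simp add: Qk_def mult.assoc)
   ultimately have "kernel_op \<phi>2 (QK ?s) (Hk \<phi>1 \<phi>3 \<phi>4 S) (loc_op (?B \<alpha>) (Phi \<phi>1 \<phi>3 \<phi>4 \<alpha>) \<phi>2)"
    by (intro kernel_op_Qk(1)[OF M2 window_measurable(1,4) S_measurable _ _ S_finite])
   thus ?thesis by (rule kernel_op_bounded)
  qed
  moreover have "?K w p q \<mu> (loc_op a \<phi>1 \<phi>2 \<circ> loc_op b \<phi>3 \<phi>4)" by (rule kernel_op_bounded[OF kernel_ops(1)]) (rule comp, assumption+, simp)
  moreover have "?K w p q \<mu> (remainder_op N a Db \<phi>1 \<phi>2 \<phi>3 \<phi>4)" by (rule kernel_op_bounded[OF kernel_ops(1)]) (rule rem, assumption+, simp)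
  moreover have "(loc_op a \<phi>1 \<phi>2 \<circ> loc_op b \<phi>3 \<phi>4) f g =
     (\<Sum>\<alpha> | ?C \<alpha> & ?E \<alpha> < N. (-1)^?E \<alpha>/?F \<alpha>*loc_op (?B \<alpha>) (Phi \<phi>1 \<phi>3 \<phi>4 \<alpha>) \<phi>2 f g) +
     remainder_op N a Db \<phi>1 \<phi>2 \<phi>3 \<phi>4 f g" if "f \<in> Mpq w p q \<mu>" "g \<in> M1 w" for f g
  proof -
   have f: "f \<in> M1_antidual w" and g: "MM w g" using that M1_iff[OF tw] by (auto simp: Mpq_def)
   \<comment> \<open>The sign in the expansion and the one produced by \<open>Phi\<close> cancel,
     which leaves the plain Taylor coefficients.\<close>
   have t: "(-1)^?E \<alpha>/?F \<alpha>*loc_op (?B \<alpha>) (Phi \<phi>1 \<phi>3 \<phi>4 \<alpha>) \<phi>2 f g = 1/?F \<alpha>*(LBINT y. QK (\<sigma>l \<alpha>) f y*?I \<phi>2 g y)"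
    if "?C \<alpha>" "?E \<alpha> < N" for \<alpha>
    unfolding loc[OF f g that] by (simp flip: mult.assoc power_add mult_2 power_mult_distrib)
   have "(LBINT y. QK \<sigma>c f y*?I \<phi>2 g y) = (\<Sum>\<alpha> | ?C \<alpha> & ?E \<alpha> < N. 1/?F \<alpha>*(LBINT y. QK (\<sigma>l \<alpha>) f y*?I \<phi>2 g y)) + (LBINT y. QK \<sigma>r f y*?I \<phi>2 g y)"
    by (rule QK_expansion[OF f g]) (rule dd)
   also have "(\<Sum>\<alpha> | ?C \<alpha> & ?E \<alpha> < N. 1/?F \<alpha>*(LBINT y. QK (\<sigma>l \<alpha>) f y*?I \<phi>2 g y))
     = (\<Sum>\<alpha> | ?C \<alpha> & ?E \<alpha> < N. (-1)^?E \<alpha>/?F \<alpha>*loc_op (?B \<alpha>) (Phi \<phi>1 \<phi>3 \<phi>4 \<alpha>) \<phi>2 f g)"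
    by (intro sum.cong refl t[symmetric]) auto
   finally show ?thesis unfolding comp[OF f g] rem[OF f g] .
  qed
  ultimately show ?thesis by blast
 qed
 let ?D = "%G m'. \<forall>\<epsilon>>0. \<exists>R. \<forall>z. R < norm z --> cmod (G z)*m' z <= \<epsilon>"
 have part3: "compact_on_Mpq w p q \<mu> (remainder_op N a Db \<phi>1 \<phi>2 \<phi>3 \<phi>4)"
  if L: "\<forall>\<alpha>. ?C \<alpha> & ?E \<alpha> = N --> (%z. Db \<alpha> z * of_real (m z)) \<in> L0" and pq: "1 <= p" "1 <= q" for p q
 proof -
  have "\<forall>\<alpha>\<in>mis N. \<exists>G. G \<in> BM & (?L \<alpha> G) & (?G G B m') & (?D G m')"
  proof
   fix \<alpha> :: "'a*'a => nat" assume \<alpha>: "\<alpha> \<in> mis N"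
   have \<alpha>I: "\<alpha> \<in> I" by (rule misI[OF \<alpha>]) simp
   show "\<exists>G. G \<in> BM & (?L \<alpha> G) & (?G G B m') & (?D G m')"
   proof (rule L0_version[OF Dm _ DA[OF \<alpha>I] m'_meas Km m'_pos m'_le])
    show "cmod (D \<alpha> z) <= B/m' z" for z using D0 \<alpha>I by (simp add: D_def del: split_paired_All)
    show "(%z. Db \<alpha> z * of_real (m z)) \<in> L0" using L \<alpha> by (simp add: mis_def)
   qed
  qed
  from bchoice[OF this] obtain G where G: "\<forall>\<alpha>\<in>mis N. G \<alpha> \<in> BM & (AEL z. Db \<alpha> z = G \<alpha> z) & (\<forall>z. cmod (G \<alpha> z) <= B/m' z) & (\<forall>\<epsilon>>0. \<exists>R. \<forall>z. R < norm z --> cmod (G \<alpha> z)*m' z <= \<epsilon>)" ..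
  \<comment> \<open>Top-order derivatives get the decaying representatives and lower orders keep the
    earlier ones; the remainder depends on the top order only.\<close>
  define D1 where "D1 = (%\<alpha>. if \<alpha> \<in> I then (if \<alpha> \<in> mis N then G \<alpha> else D0 \<alpha>) else (%_. 0))"
  have D1: "D1 \<alpha> = G \<alpha>" if "\<alpha> \<in> mis N" for \<alpha> using that misI[OF that] by (simp add: D1_def)
  interpret expansion w \<mu> \<mu>' K p q v m' Km B Cv N \<phi>1 \<phi>2 \<phi>3 \<phi>4 A D1
   unfolding D1_def by (rule ex[OF pq]) (use D0 G in \<open>simp del: split_paired_All\<close>)
  show ?thesis
  proof (rule remainder_compact[OF _ Bp])
   show "remainder_op N a Db \<phi>1 \<phi>2 \<phi>3 \<phi>4 f g = (LBINT y. QK \<sigma>r f y*?I \<phi>2 g y)"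
    if "f \<in> M1_antidual w" "MM w g" for f g
    by (rule remainder_op_eq[OF that Aw(2)]) (use G D1 in simp)
   fix \<epsilon> :: real assume "0 < \<epsilon>"
   hence "\<forall>\<alpha>\<in>mis N. \<exists>R. \<forall>z. R < norm z --> cmod (D1 \<alpha> z)*m' z <= \<epsilon>" using G D1 by (simp del: split_paired_All)
   from bchoice[OF this] obtain R where R: "\<forall>\<alpha>\<in>mis N. \<forall>z. R \<alpha> < norm z --> cmod (D1 \<alpha> z)*m' z <= \<epsilon>" ..
   \<comment> \<open>The sum of the absolute values of the finitely many radii dominates each of
     them.\<close>
   have "cmod (D1 \<alpha> z)*m' z <= \<epsilon>" if "\<alpha> \<in> mis N" "(\<Sum>\<alpha>\<in>mis N. \<bar>R \<alpha>\<bar>) < norm z" for \<alpha> z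
   proof -
    have "\<bar>R \<alpha>\<bar> <= (\<Sum>\<alpha>\<in>mis N. \<bar>R \<alpha>\<bar>)" by (intro member_le_sum finite_mis that) auto
    thus ?thesis using R[rule_format, OF that(1), of z] that(2) by simp
   qed
   thus "\<exists>R. \<forall>\<alpha>\<in>mis N. \<forall>z. R < norm z --> cmod (D1 \<alpha> z)*m' z <= \<epsilon>" by blast
  qed
 qed
 have part1: "Phi \<phi>1 \<phi>3 \<phi>4 \<alpha> \<in> M1 (%z. v z*w z)" if "?C \<alpha>" "?E \<alpha> < N" for \<alpha>
  unfolding M1_iff[OF tame_mult[OF tv tw]] by (rule Phi_MM[OF tame_mult[OF tv tw] M(1) that(1)]) (use that(2) in simp)
 show ?thesis
  by (rule conjI[OF _ conjI]; intro allI impI; elim conjE; rule part1 part2 part3; assumption)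
qed

end
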